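(* Let $n\ge 3$ and let $\Omega\subset\mathbb{R}^n$ be a rotationally invariant, bounded domain. Suppose that $\Omega$ admits a rotationally invariant Cheeger set $C$ generated by a closed, convex curve $\gamma:[a,b]\to\mathbb{R}\times\mathbb{R}^+$ of class $\mathcal{C}^{1,1}$. Then each connected component of $\partial C\cap\Omega$ is a part of a nodoid.
   Context: Here $\mathbb{R}^+=[0,+\infty)$. Cheeger problem. For a bounded domain (open connected set) $\Omega\subset\mathbb{R}^n$, the Cheeger constant is $h(\Omega)=\inf_{E\subset\Omega}\frac{P(E)}{|E|}$, where the infimum is over measurable $E\subset\Omega$ with $|E|>0$, $P(E)=P(E;\mathbb{R}^n)$ is the distributional perimeter of $E$ in $\mathbb{R}^n$ and $|E|$ is its Lebesgue measure. Any minimizer $C$ is called a Cheeger set of $\Omega$. Sets of finite perimeter are considered up to Lebesgue null sets, and $\partial C$ is the topological boundary of a representative for which $0<|C\cap B_r(p)|<|B_r(p)|$ for every $p\in\partial C$ and $r>0$. The set $\partial C\cap\Omega$ is called the free boundary of $C$. Rotational invariance. Write points of $\mathbb{R}^n$ as $(x,z)\in\mathbb{R}\times\mathbb{R}^{n-1}$. A set is rotationally invariant if it is invariant under the action of $SO(n-1)$ on the $z$-variable (rotations fixing the $x$-axis pointwise). The surface generated by a curve $\gamma(s)=(x(s),y(s))$ with $y\ge 0$ is $\{(x(s),y(s)\,\omega):\ s \text{ in the parameter interval},\ \omega\in\mathbb{S}^{n-2}\}$, where $\mathbb{S}^{n-2}\subset\mathbb{R}^{n-1}$ is the unit sphere.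 Standing assumption on the domain: $\partial\Omega$ is the surface generated by a continuous curve $\Gamma=(\xi,\eta):[\alpha,\beta]\to\mathbb{R}\times\mathbb{R}^+$ without self-intersections, which is either closed or satisfies $\eta(\alpha)=\eta(\beta)=0$. Generating curve of $C$: saying that $C$ is generated by the closed, convex curve $\gamma$ of class $\mathcal{C}^{1,1}$ means that $\gamma$ is a simple closed curve, parametrized by arc length and of class $\mathcal{C}^{1,1}$ as a closed curve, which bounds a convex region $D$ of the half-plane $\mathbb{R}\times\mathbb{R}^+$, and that $C$ is the set obtained by rotating $D$ about the $x$-axis, $C=\{(x,y\omega): (x,y)\in D,\ \omega\in\mathbb{S}^{n-2}\}$, so that its boundary is the surface generated by $\gamma$. Nodoids. For a constant $H>0$ consider arc-length parametrized curves $(x(s),y(s))$, $y(s)>0$, with (continuous, real-valued) tangent angle $\sigma(s)$, solving on a maximal interval $$x'=\cos\sigma,\qquad y'=\sin\sigma,\qquad \sigma'=-(n-1)H+(n-2)\frac{\cos\sigma}{y}.$$ The generated surface then has constant mean curvature $H$ (the average of its principal curvatures, with respect to the normal given by $(\sin\sigma,-\cos\sigma)$ in the $(x,y)$ half-plane), and the quantity $T=y^{n-2}\cos\sigma-Hy^{n-1}$ is constant along the curve. If $T<0$, the generated surface is called a nodoid. "A part of" a surface means a subset of it. *)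

theory Defs
  imports "HOL-Analysis.Analysis"
begin

section \<open>Perimeter and the Cheeger problem\<close>

definition divergence :: "('a::euclidean_space \<Rightarrow> 'a) \<Rightarrow> 'a \<Rightarrow> real" where
  "divergence \<phi> x = (\<Sum>b\<in>Basis. frechet_derivative \<phi> (at x) b \<bullet> b)"

definition test_fields :: "('a::euclidean_space \<Rightarrow> 'a) set" where
  "test_fields = {\<phi>. (\<forall>x. \<phi> differentiable (at x)) \<and>
     (\<forall>b\<in>Basis. continuous_on UNIV (\<lambda>x. frechet_derivative \<phi> (at x) b)) \<and>
     compact (closure {x. \<phi> x \<noteq> 0}) \<and> (\<forall>x. norm (\<phi> x) \<le> 1)}"

definition perimeter :: "'a::euclidean_space set \<Rightarrow> ereal" where
  "perimeter E = (SUP \<phi>\<in>test_fields. ereal (LINT x:E|lebesgue. divergence \<phi> x))"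

definition cheeger_const :: "'a::euclidean_space set \<Rightarrow> ereal" where
  "cheeger_const \<Omega> =
     (INF E\<in>{E. E \<in> lmeasurable \<and> E \<subseteq> \<Omega> \<and> measure lebesgue E > 0}.
        perimeter E / ereal (measure lebesgue E))"

text \<open>
  Sets of finite perimeter are considered up to null sets, so \<open>C \<subseteq> \<Omega>\<close> is only required up to a
  null set. This matters when \<open>C\<close> is a closed representative: a Cheeger set touches the boundary of
  \<open>\<Omega>\<close>, so such a representative is never literally contained in the open set \<open>\<Omega>\<close>.
\<close>

definition cheeger_set :: "'a::euclidean_space set \<Rightarrow> 'a set \<Rightarrow> bool" where
  "cheeger_set \<Omega> C \<longleftrightarrow>
     C \<in> lmeasurable \<and> negligible (C - \<Omega>) \<and> measure lebesgue C > 0 \<and>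
     perimeter C / ereal (measure lebesgue C) = cheeger_const \<Omega>"

text \<open>The representatives whose frontier is taken as the boundary of a set of finite perimeter.\<close>

definition normalized_representative :: "'a::euclidean_space set \<Rightarrow> bool" where
  "normalized_representative C \<longleftrightarrow>
     (\<forall>p\<in>frontier C. \<forall>r>0. 0 < measure lebesgue (C \<inter> ball p r) \<and>
        measure lebesgue (C \<inter> ball p r) < measure lebesgue (ball p r))"


section \<open>Rotational invariance\<close>

text \<open>
  The space \<open>\<real>\<^sup>n = \<real> \<times> \<real>\<^bsup>n-1\<^esup>\<close> is \<open>real \<times> (real ^ 'm)\<close> with \<open>CARD('m) = n - 1\<close>;
  \<open>half_plane\<close> is \<open>\<real> \<times> \<real>\<^sup>+\<close>, where \<open>\<real>\<^sup>+\<close> contains \<open>0\<close>.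
\<close>

definition rotationally_invariant :: "(real \<times> (real ^ 'm)) set \<Rightarrow> bool" where
  "rotationally_invariant S \<longleftrightarrow>
     (\<forall>A :: real ^ 'm ^ 'm. rotation_matrix A \<longrightarrow> (\<lambda>(x, z). (x, A *v z)) ` S = S)"

definition half_plane :: "(real \<times> real) set" where
  "half_plane = {(x, y). 0 \<le> y}"

definition revolve :: "(real \<times> real) set \<Rightarrow> (real \<times> (real ^ 'm)) set" where
  "revolve S = {(x, y *\<^sub>R \<omega>) | x y \<omega>. (x, y) \<in> S \<and> \<omega> \<in> sphere 0 1}"

text \<open>
  Standing assumption on the domain. The parameter interval of the continuous curve is normalized
  to \<open>{0..1}\<close>; \<open>simple_path\<close> excludes self-intersections but allows the curve to be closed.
\<close>

definition curve_generated_boundary :: "(real \<times> (real ^ 'm)) set \<Rightarrow> bool" where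
  "curve_generated_boundary \<Omega> \<longleftrightarrow>
     (\<exists>\<Gamma>. simple_path \<Gamma> \<and> path_image \<Gamma> \<subseteq> half_plane \<and>
        (pathfinish \<Gamma> = pathstart \<Gamma> \<or> snd (pathstart \<Gamma>) = 0 \<and> snd (pathfinish \<Gamma>) = 0) \<and>
        frontier \<Omega> = revolve (path_image \<Gamma>))"

text \<open>
  Arc-length parametrized curves on \<open>[a,b]\<close> that are simple, closed and of class \<open>C\<^bsup>1,1\<^esup>\<close> as closed
  curves: the condition \<open>\<gamma>' a = \<gamma>' b\<close> makes the periodic extension of \<open>\<gamma>\<close> of class \<open>C\<^bsup>1,1\<^esup>\<close>.
\<close>

definition simple_closed_C11 :: "real \<Rightarrow> real \<Rightarrow> (real \<Rightarrow> real \<times> real) \<Rightarrow> bool" where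
  "simple_closed_C11 a b \<gamma> \<longleftrightarrow>
     a < b \<and> \<gamma> a = \<gamma> b \<and> inj_on \<gamma> {a..<b} \<and>
     (\<exists>\<gamma>' L. (\<forall>s\<in>{a..b}. (\<gamma> has_vector_derivative \<gamma>' s) (at s within {a..b}) \<and> norm (\<gamma>' s) = 1) \<and>
        L-lipschitz_on {a..b} \<gamma>' \<and> \<gamma>' a = \<gamma>' b)"

definition closed_region :: "(real \<times> real) set \<Rightarrow> (real \<times> real) set" where
  "closed_region J = inside J \<union> J"

definition generated_by_convex_C11 ::
    "(real \<times> (real ^ 'm)) set \<Rightarrow> real \<Rightarrow> real \<Rightarrow> (real \<Rightarrow> real \<times> real) \<Rightarrow> bool" where
  "generated_by_convex_C11 C a b \<gamma> \<longleftrightarrow>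
     simple_closed_C11 a b \<gamma> \<and> \<gamma> ` {a..b} \<subseteq> half_plane \<and>
     convex (closed_region (\<gamma> ` {a..b})) \<and>
     C = revolve (closed_region (\<gamma> ` {a..b}))"


section \<open>Nodoids\<close>

definition cmc_solution ::
    "nat \<Rightarrow> real \<Rightarrow> real set \<Rightarrow> (real \<Rightarrow> real) \<Rightarrow> (real \<Rightarrow> real) \<Rightarrow> (real \<Rightarrow> real) \<Rightarrow> bool" where
  "cmc_solution n H I x y \<sigma> \<longleftrightarrow>
     is_interval I \<and> open I \<and> I \<noteq> {} \<and>
     (\<forall>s\<in>I. y s > 0 \<and>
        (x has_real_derivative cos (\<sigma> s)) (at s) \<and>
        (y has_real_derivative sin (\<sigma> s)) (at s) \<and>
        (\<sigma> has_real_derivative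
           (- (real n - 1) * H + (real n - 2) * (cos (\<sigma> s) / y s))) (at s))"

definition maximal_cmc_solution ::
    "nat \<Rightarrow> real \<Rightarrow> real set \<Rightarrow> (real \<Rightarrow> real) \<Rightarrow> (real \<Rightarrow> real) \<Rightarrow> (real \<Rightarrow> real) \<Rightarrow> bool" where
  "maximal_cmc_solution n H I x y \<sigma> \<longleftrightarrow>
     cmc_solution n H I x y \<sigma> \<and>
     (\<forall>J u v \<tau>. cmc_solution n H J u v \<tau> \<and> I \<subseteq> J \<and>
        (\<forall>s\<in>I. u s = x s \<and> v s = y s \<and> \<tau> s = \<sigma> s) \<longrightarrow> J = I)"

text \<open>The quantity \<open>T = y\<^bsup>n-2\<^esup> cos \<sigma> - H y\<^bsup>n-1\<^esup>\<close> is constant along solutions.\<close>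

definition nodoid :: "nat \<Rightarrow> (real \<times> (real ^ 'm)) set \<Rightarrow> bool" where
  "nodoid n N \<longleftrightarrow>
     (\<exists>H>0. \<exists>I x y \<sigma>. maximal_cmc_solution n H I x y \<sigma> \<and>
        (\<forall>s\<in>I. y s ^ (n - 2) * cos (\<sigma> s) - H * y s ^ (n - 1) < 0) \<and>
        N = revolve ((\<lambda>s. (x s, y s)) ` I))"

end

theory Submission
  imports Defs
begin

text \<open>
  Perturbing a Cheeger set \<open>C\<close> inside a small box in which it is a rotationally symmetric subgraph,
  and evaluating perimeter and volume by the Gauss--Green formula, yields the first variation of
  \<open>P - h |\<cdot>|\<close>: it vanishes in \<open>\<Omega>\<close>, and it has a sign for inward variations everywhere. In terms of
  the arc-length profile \<open>(X, Y)\<close> with tangent angle \<open>\<sigma>\<close> and \<open>H = h / (n - 1)\<close>, the quantity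
  \<open>T = Y\<^sup>n\<^sup>-\<^sup>2 cos \<sigma> - H Y\<^sup>n\<^sup>-\<^sup>1\<close> is therefore constant on free arcs and monotone elsewhere, with the
  direction given by the sign of \<open>Y'\<close>. On a closed convex profile \<open>T\<close> is negative wherever \<open>cos \<sigma> \<le> 0\<close>, and
  monotonicity propagates this to all points with \<open>Y > 0\<close>. As \<open>T = 0\<close> on the axis, a free arc never
  meets the axis, so a component of the free boundary lies on a single free arc; such an arc solves
  the nodoid equations with \<open>T < 0\<close>, and Zorn's lemma extends it to a maximal solution.
\<close>

text \<open>Two obstacles shape the argument. The perimeter is given only as a supremum over test
  fields, so its change under a perturbation cannot be read off from a boundary measure. Only an
  upper bound for the competitor is proved: a test field is split by a cutoff, and its outer part is
  completed inside the box by an almost exact unit normal of \<open>C\<close>. Secondly,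
  \<open>\<gamma>\<close> has no pointwise curvature to start from, so the Euler-Lagrange equation
  is used in integrated form. Over an interval of the radial axis the density
  \<open>y^(m-1)\<close>, \<open>m = CARD('m) = n - 1\<close>, does not depend on the height of the
  graph, and the weak equation integrates exactly to a statement about \<open>T\<close>; this
  requires \<open>Y' \<noteq> 0\<close>. At a horizontal tangent the profile is a graph over the
  rotation axis instead. A free horizontal segment is excluded because a comparison would give
  \<open>T \<ge> 0\<close> there. Hence free horizontal points are isolated and \<open>T\<close> is
  constant across them by continuity. The angle equation finally comes from solving \<open>T\<close>
  for \<open>cos \<sigma>\<close> and differentiating.\<close>

section \<open>Calculus of continuously differentiable maps\<close>

text \<open>Derivatives are taken \<open>at x\<close>, so the notion is meant for open
  \<open>S\<close>. Continuity is asked one direction at a time, as \<open>test_fields\<close> does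
  for the basis directions.\<close>

definition C1_on :: "'a::real_normed_vector set \<Rightarrow> ('a \<Rightarrow> 'b::real_normed_vector) \<Rightarrow> bool" where
  "C1_on S f \<longleftrightarrow> (\<exists>f'. (\<forall>x\<in>S. (f has_derivative f' x) (at x)) \<and> (\<forall>h. continuous_on S (\<lambda>x. f' x h)))"

lemma C1_onI:
  assumes "\<And>x. x \<in> S \<Longrightarrow> (f has_derivative f' x) (at x)" "\<And>h. continuous_on S (\<lambda>x. f' x h)"
  shows "C1_on S f"
  using assms unfolding C1_on_def by blast

lemma C1_onE:
  assumes "C1_on S f"
  obtains f' where "\<forall>x\<in>S. (f has_derivative f' x) (at x)" "\<forall>h. continuous_on S (\<lambda>x. f' x h)"
  using assms unfolding C1_on_def by blast

text \<open>Replaces the unnamed derivative by \<open>frechet_derivative\<close>, in which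
  \<open>divergence\<close> and \<open>test_fields\<close> are written.\<close>

lemma C1_on_frechet:
  assumes "C1_on S f"
  shows "x \<in> S \<Longrightarrow> (f has_derivative frechet_derivative f (at x)) (at x)"
    and "continuous_on S (\<lambda>x. frechet_derivative f (at x) h)"
proof -
  obtain f' where f': "\<forall>x\<in>S. (f has_derivative f' x) (at x)"
    "\<forall>h. continuous_on S (\<lambda>x. f' x h)"
    by (rule C1_onE[OF assms])
  have eq: "frechet_derivative f (at x) = f' x" if "x \<in> S" for x
    using frechet_derivative_at[OF bspec[OF f'(1) that]] by simp
  show "x \<in> S \<Longrightarrow> (f has_derivative frechet_derivative f (at x)) (at x)"
    using f'(1) eq by simp
  show "continuous_on S (\<lambda>x. frechet_derivative f (at x) h)"
    using f'(2)[rule_format, of h] eq by (simp cong: continuous_on_cong)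
qed

lemma C1_on_imp_continuous_on: "C1_on S f \<Longrightarrow> continuous_on S f"
  unfolding C1_on_def by (meson continuous_at_imp_continuous_on has_derivative_continuous)

lemma C1_on_subset: "C1_on S f \<Longrightarrow> T \<subseteq> S \<Longrightarrow> C1_on T f"
  unfolding C1_on_def by (meson continuous_on_subset subsetD)

lemma C1_on_cong_open:
  assumes "C1_on S f" "open S" "\<And>x. x \<in> S \<Longrightarrow> f x = g x"
  shows "C1_on S g"
proof -
  obtain f' where f': "\<forall>x\<in>S. (f has_derivative f' x) (at x)"
    "\<forall>h. continuous_on S (\<lambda>x. f' x h)"
    by (rule C1_onE[OF assms(1)])
  show ?thesis
    using f' assms(2,3) by (intro C1_onI[of S g f']) (blast intro: has_derivative_transform_within_open)+
qed

lemma C1_on_Un: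
  assumes "open S" "open T" "C1_on S f" "C1_on T f"
  shows "C1_on (S \<union> T) f"
  using assms
  by (intro C1_onI[of _ f "\<lambda>x. frechet_derivative f (at x)"])
    (auto intro: C1_on_frechet continuous_on_open_Un)

lemma C1_on_bounded_linear:
  assumes "bounded_linear f" shows "C1_on S f"
  using assms by (intro C1_onI[of _ f "\<lambda>x. f"]) (auto intro: bounded_linear_imp_has_derivative)

lemma C1_on_const: "C1_on S (\<lambda>x. c)"
  by (rule C1_onI[of _ _ "\<lambda>_ _. 0"]) auto

lemma C1_on_add:
  assumes "C1_on S f" "C1_on S g" shows "C1_on S (\<lambda>x. f x + g x)"
proof -
  obtain f' where "\<forall>x\<in>S. (f has_derivative f' x) (at x)" "\<forall>h. continuous_on S (\<lambda>x. f' x h)"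
    by (rule C1_onE[OF assms(1)])
  moreover obtain g' where "\<forall>x\<in>S. (g has_derivative g' x) (at x)" "\<forall>h. continuous_on S (\<lambda>x. g' x h)"
    by (rule C1_onE[OF assms(2)])
  ultimately show ?thesis
    by (intro C1_onI[of _ _ "\<lambda>x h. f' x h + g' x h"]) (auto intro!: derivative_intros continuous_intros)
qed

lemma C1_on_scaleR:
  fixes f :: "'a::real_normed_vector \<Rightarrow> real"
  assumes "C1_on S f" "C1_on S g" shows "C1_on S (\<lambda>x. f x *\<^sub>R g x)"
proof -
  obtain f' where "\<forall>x\<in>S. (f has_derivative f' x) (at x)" "\<forall>h. continuous_on S (\<lambda>x. f' x h)"
    by (rule C1_onE[OF assms(1)])
  moreover obtain g' where "\<forall>x\<in>S. (g has_derivative g' x) (at x)" "\<forall>h. continuous_on S (\<lambda>x. g' x h)"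
    by (rule C1_onE[OF assms(2)])
  moreover have "continuous_on S f" "continuous_on S g"
    using assms C1_on_imp_continuous_on by blast+
  ultimately show ?thesis
    by (intro C1_onI[of _ _ "\<lambda>x h. f x *\<^sub>R g' x h + f' x h *\<^sub>R g x"])
      (auto intro!: derivative_intros continuous_intros)
qed

lemma C1_on_mult:
  fixes f g :: "'a::real_normed_vector \<Rightarrow> real"
  shows "C1_on S f \<Longrightarrow> C1_on S g \<Longrightarrow> C1_on S (\<lambda>x. f x * g x)"
  using C1_on_scaleR[of S f g] by simp

lemma C1_on_minus: "C1_on S f \<Longrightarrow> C1_on S (\<lambda>x. - f x)"
  using C1_on_scaleR[OF C1_on_const[of S "-1"], of f] by simp

lemma C1_on_diff: "C1_on S f \<Longrightarrow> C1_on S g \<Longrightarrow> C1_on S (\<lambda>x. f x - g x)"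
  using C1_on_add[of S f "\<lambda>x. - g x"] C1_on_minus[of S g] by simp

lemma C1_on_linear_compose:
  assumes "C1_on S f" "bounded_linear l" shows "C1_on S (\<lambda>x. l (f x))"
proof -
  obtain f' where "\<forall>x\<in>S. (f has_derivative f' x) (at x)" "\<forall>h. continuous_on S (\<lambda>x. f' x h)"
    by (rule C1_onE[OF assms(1)])
  then show ?thesis using assms(2)
    by (intro C1_onI[of _ _ "\<lambda>x h. l (f' x h)"])
      (auto intro: bounded_linear.has_derivative bounded_linear.continuous_on)
qed

lemma C1_on_Pair:
  assumes "C1_on S f" "C1_on S g" shows "C1_on S (\<lambda>x. (f x, g x))"
proof -
  obtain f' where "\<forall>x\<in>S. (f has_derivative f' x) (at x)" "\<forall>h. continuous_on S (\<lambda>x. f' x h)"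
    by (rule C1_onE[OF assms(1)])
  moreover obtain g' where "\<forall>x\<in>S. (g has_derivative g' x) (at x)" "\<forall>h. continuous_on S (\<lambda>x. g' x h)"
    by (rule C1_onE[OF assms(2)])
  ultimately show ?thesis
    by (intro C1_onI[of _ _ "\<lambda>x h. (f' x h, g' x h)"]) (auto intro!: derivative_intros continuous_intros)
qed

lemma C1_on_real_compose:
  fixes f :: "'a::real_normed_vector \<Rightarrow> real" and g g' :: "real \<Rightarrow> real"
  assumes f: "C1_on S f" and g: "\<And>y. y \<in> f ` S \<Longrightarrow> (g has_real_derivative g' y) (at y)"
    and g': "continuous_on (f ` S) g'"
  shows "C1_on S (\<lambda>x. g (f x))"
proof -
  obtain f' where f': "\<forall>x\<in>S. (f has_derivative f' x) (at x)" "\<forall>h. continuous_on S (\<lambda>x. f' x h)"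
    by (rule C1_onE[OF f])
  show ?thesis
  proof (rule C1_onI[of _ _ "\<lambda>x h. g' (f x) * f' x h"])
    fix x assume x: "x \<in> S"
    have "(g has_derivative (\<lambda>h. g' (f x) * h)) (at (f x))"
      using g[of "f x"] x by (simp add: has_field_derivative_def)
    from has_derivative_compose[OF bspec[OF f'(1) x] this]
    show "((\<lambda>x. g (f x)) has_derivative (\<lambda>h. g' (f x) * f' x h)) (at x)" .
  next
    fix h
    show "continuous_on S (\<lambda>x. g' (f x) * f' x h)"
      by (intro continuous_on_mult f'(2)[rule_format] continuous_on_compose2[OF g' C1_on_imp_continuous_on[OF f]]) auto
  qed
qed

lemma C1_on_norm_snd: "C1_on {p::'a::real_normed_vector \<times> 'b::real_inner. snd p \<noteq> 0} (\<lambda>p. norm (snd p))"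
proof (rule C1_onI[of _ _ "\<lambda>p h. sgn (snd p) \<bullet> snd h"])
  fix p :: "'a \<times> 'b" assume "p \<in> {p. snd p \<noteq> 0}"
  then have "(norm has_derivative (\<lambda>h. sgn (snd p) \<bullet> h)) (at (snd p))"
    using has_derivative_norm[of "snd p"] by (simp add: inner_commute)
  from has_derivative_compose[OF has_derivative_snd[OF has_derivative_ident] this]
  show "((\<lambda>p. norm (snd p)) has_derivative (\<lambda>h. sgn (snd p) \<bullet> snd h)) (at p)" by simp
next
  show "continuous_on {p::'a \<times> 'b. snd p \<noteq> 0} (\<lambda>p. sgn (snd p) \<bullet> snd h)" for h :: "'a \<times> 'b"
    unfolding sgn_div_norm by (intro continuous_intros) auto
qed

subsection \<open>The divergence theorem for compactly supported fields\<close>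

lemma divergence_eq:
  "(\<phi> has_derivative \<phi>') (at x) \<Longrightarrow> divergence \<phi> x = (\<Sum>b\<in>Basis. \<phi>' b \<bullet> b)"
  unfolding divergence_def by (metis frechet_derivative_at)

lemma divergence_add:
  assumes "C1_on S f" "C1_on S g" "x \<in> S"
  shows "divergence (\<lambda>x. f x + g x) x = divergence f x + divergence g x"
proof -
  have *: "((\<lambda>x. f x + g x) has_derivative
      (\<lambda>h. frechet_derivative f (at x) h + frechet_derivative g (at x) h)) (at x)"
    using C1_on_frechet(1)[OF assms(1,3)] C1_on_frechet(1)[OF assms(2,3)] by (rule has_derivative_add)
  show ?thesis
    unfolding divergence_eq[OF *] by (simp add: divergence_def inner_add_left sum.distrib)
qed

lemma divergence_scaleR:
  fixes \<zeta> :: "'a::euclidean_space \<Rightarrow> real"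
  assumes "(\<zeta> has_derivative \<zeta>') (at x)" "C1_on S \<psi>" "x \<in> S"
  shows "divergence (\<lambda>x. \<zeta> x *\<^sub>R \<psi> x) x = \<zeta> x * divergence \<psi> x + \<zeta>' (\<psi> x)"
proof -
  have *: "((\<lambda>x. \<zeta> x *\<^sub>R \<psi> x) has_derivative
      (\<lambda>h. \<zeta> x *\<^sub>R frechet_derivative \<psi> (at x) h + \<zeta>' h *\<^sub>R \<psi> x)) (at x)"
    using assms(1) C1_on_frechet(1)[OF assms(2,3)] by (rule has_derivative_scaleR)
  have lin: "linear \<zeta>'" using assms(1) has_derivative_linear by blast
  have "\<zeta>' (\<psi> x) = \<zeta>' (\<Sum>b\<in>Basis. (\<psi> x \<bullet> b) *\<^sub>R b)" by (simp add: euclidean_representation)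
  also have "\<dots> = (\<Sum>b\<in>Basis. (\<psi> x \<bullet> b) * \<zeta>' b)"
    using lin by (simp add: linear_sum linear_cmul)
  finally have "\<zeta>' (\<psi> x) = (\<Sum>b\<in>Basis. \<zeta>' b * (\<psi> x \<bullet> b))" by (simp add: mult.commute)
  then show ?thesis
    unfolding divergence_eq[OF *]
    by (simp add: divergence_def inner_add_left sum.distrib sum_distrib_left)
qed

lemma divergence_cong_open:
  assumes "open S" "x \<in> S" "\<And>y. y \<in> S \<Longrightarrow> f y = g y"
  shows "divergence f x = divergence g x"
proof -
  have "(f has_derivative D) (at x) \<longleftrightarrow> (g has_derivative D) (at x)" for D
    using assms has_derivative_transform_within_open[of f D x UNIV S g]
      has_derivative_transform_within_open[of g D x UNIV S f] by auto
  then have "frechet_derivative f (at x) = frechet_derivative g (at x)"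
    unfolding frechet_derivative_def by simp
  then show ?thesis by (simp add: divergence_def)
qed

lemma divergence_zero_open:
  assumes "open S" "x \<in> S" "\<And>y. y \<in> S \<Longrightarrow> f y = 0"
  shows "divergence f x = 0"
  using divergence_cong_open[OF assms(1,2), of f "\<lambda>_. 0"] assms(3)
    divergence_eq[of "\<lambda>_. 0" "\<lambda>_. 0" x] by simp

lemma divergence_continuous: "C1_on S f \<Longrightarrow> continuous_on S (divergence f)"
  unfolding divergence_def by (intro continuous_intros C1_on_frechet)

lemma test_fields_iff:
  "\<phi> \<in> test_fields \<longleftrightarrow>
    C1_on UNIV \<phi> \<and> compact (closure {x. \<phi> x \<noteq> 0}) \<and> (\<forall>x. norm (\<phi> x) \<le> 1)"
proof
  assume t: "\<phi> \<in> test_fields"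
  have "C1_on UNIV \<phi>"
  proof (rule C1_onI)
    fix x show "(\<phi> has_derivative frechet_derivative \<phi> (at x)) (at x)"
      using t frechet_derivative_works unfolding test_fields_def by blast
  next
    fix h
    \<comment> \<open>\<open>test_fields\<close> controls the basis directions only; linearity
      extends continuity to every direction \<open>h\<close>.\<close>
    have "frechet_derivative \<phi> (at x) h = (\<Sum>b\<in>Basis. (h \<bullet> b) *\<^sub>R frechet_derivative \<phi> (at x) b)" for x
    proof -
      have "linear (frechet_derivative \<phi> (at x))"
        using t linear_frechet_derivative unfolding test_fields_def by blast
      then have "frechet_derivative \<phi> (at x) (\<Sum>b\<in>Basis. (h \<bullet> b) *\<^sub>R b)
         = (\<Sum>b\<in>Basis. (h \<bullet> b) *\<^sub>R frechet_derivative \<phi> (at x) b)"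
        by (simp add: linear_sum linear_cmul)
      then show ?thesis by (simp add: euclidean_representation)
    qed
    then show "continuous_on UNIV (\<lambda>x. frechet_derivative \<phi> (at x) h)"
      using t by (auto simp: test_fields_def intro!: continuous_intros)
  qed
  then show "C1_on UNIV \<phi> \<and> compact (closure {x. \<phi> x \<noteq> 0}) \<and> (\<forall>x. norm (\<phi> x) \<le> 1)"
    using t by (simp add: test_fields_def)
next
  assume a: "C1_on UNIV \<phi> \<and> compact (closure {x. \<phi> x \<noteq> 0}) \<and> (\<forall>x. norm (\<phi> x) \<le> 1)"
  then show "\<phi> \<in> test_fields"
    using C1_on_frechet[of UNIV \<phi>] unfolding test_fields_def by (auto simp: differentiable_def)
qed

lemma bounded_of_compact_support:
  fixes f :: "'a::real_normed_vector \<Rightarrow> 'b::real_normed_vector"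
  assumes "continuous_on UNIV f" "compact K" "\<And>x. x \<notin> K \<Longrightarrow> f x = 0"
  obtains M where "M \<ge> 0" "\<And>x. norm (f x) \<le> M"
proof -
  have "bounded (f ` K)"
    using assms(2) by (intro compact_imp_bounded compact_continuous_image continuous_on_subset[OF assms(1)]) auto
  then obtain M where M: "\<And>x. x \<in> K \<Longrightarrow> norm (f x) \<le> M"
    by (auto simp: bounded_iff)
  have "norm (f x) \<le> max 0 M" for x
    using M[of x] assms(3)[of x] by (cases "x \<in> K") auto
  then show ?thesis using that[of "max 0 M"] by auto
qed

lemma integrable_of_compact_support:
  fixes f :: "'a::euclidean_space \<Rightarrow> real"
  assumes "continuous_on UNIV f" "compact K" "\<And>x. x \<notin> K \<Longrightarrow> f x = 0"
  shows "integrable lborel f"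
proof -
  have "integrable lborel (\<lambda>x. indicator K x *\<^sub>R f x)"
    using assms by (intro borel_integrable_compact) (auto intro: continuous_on_subset)
  moreover have "(\<lambda>x. indicator K x *\<^sub>R f x) = f" using assms(3) by (auto simp: indicator_def fun_eq_iff)
  ultimately show ?thesis by simp
qed

text \<open>By the mean value theorem \<open>s k x\<close> is a value of the directional derivative
  at a point within \<open>norm b\<close> of \<open>x\<close>, so a constant on an enlarged ball
  dominates. The set \<open>B\<close> serves two uses: \<open>B = UNIV\<close> gives the divergence
  theorem, a ball gives the finiteness of its perimeter.\<close>

lemma difference_quotient_limit:
  fixes g :: "'a::euclidean_space \<Rightarrow> real" and b :: 'a
  assumes g: "C1_on UNIV g" and K: "compact K"
    and D0: "\<And>x. x \<notin> K \<Longrightarrow> frechet_derivative g (at x) b = 0" and B: "B \<in> sets borel"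
  defines "s \<equiv> \<lambda>k x. (g (x + (1 / real (Suc k)) *\<^sub>R b) - g x) * real (Suc k)"
  shows "(\<lambda>k. integral\<^sup>L lborel (\<lambda>x. indicator B x * s k x))
    \<longlonglongrightarrow> integral\<^sup>L lborel (\<lambda>x. indicator B x * frechet_derivative g (at x) b)"
proof -
  define D where "D x = frechet_derivative g (at x) b" for x
  have Dc: "continuous_on UNIV D" unfolding D_def using C1_on_frechet(2)[OF g] .
  have gc: "continuous_on UNIV g" using g by (rule C1_on_imp_continuous_on)
  obtain M where M: "M \<ge> 0" "\<And>x. norm (D x) \<le> M"
    by (rule bounded_of_compact_support[OF Dc K]) (use D0 D_def in auto)
  obtain R where R: "\<And>x. x \<in> K \<Longrightarrow> norm x \<le> R"
    using compact_imp_bounded[OF K] unfolding bounded_iff by blast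
  have der: "((\<lambda>t. g (x + t *\<^sub>R b)) has_real_derivative D (x + t *\<^sub>R b)) (at t)" for x t
  proof -
    have 1: "((\<lambda>t. x + t *\<^sub>R b) has_derivative (\<lambda>h. h *\<^sub>R b)) (at t)"
      by (auto intro!: derivative_eq_intros)
    have "((\<lambda>t. g (x + t *\<^sub>R b)) has_derivative (\<lambda>h. frechet_derivative g (at (x + t *\<^sub>R b)) (h *\<^sub>R b))) (at t)"
      using has_derivative_compose[OF 1 C1_on_frechet(1)[OF g]] by simp
    moreover have "frechet_derivative g (at (x + t *\<^sub>R b)) (h *\<^sub>R b) = D (x + t *\<^sub>R b) * h" for h
      using C1_on_frechet(1)[OF g UNIV_I, of "x + t *\<^sub>R b", THEN has_derivative_linear]
      by (simp add: D_def linear_cmul)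
    ultimately show ?thesis by (simp add: has_field_derivative_def)
  qed
  have sD: "\<exists>\<xi>. 0 < \<xi> \<and> \<xi> < 1 \<and> s k x = D (x + \<xi> *\<^sub>R b)" for k x
  proof -
    have pos: "0 < 1 / real (Suc k)" by simp
    obtain z where z: "z > 0" "z < 1 / real (Suc k)"
      and gz: "g (x + (1 / real (Suc k)) *\<^sub>R b) - g (x + 0 *\<^sub>R b) = (1 / real (Suc k) - 0) * D (x + z *\<^sub>R b)"
      using MVT2[OF pos, of "\<lambda>t. g (x + t *\<^sub>R b)" "\<lambda>t. D (x + t *\<^sub>R b)"] der by blast
    have "1 / real (Suc k) \<le> 1" by simp
    then have "z < 1" using z by linarith
    moreover have "s k x = D (x + z *\<^sub>R b)"
      using gz unfolding s_def by (simp add: field_simps del: of_nat_Suc)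
    ultimately show ?thesis using z by blast
  qed
  have "(\<lambda>k. integral\<^sup>L lborel (\<lambda>x. indicator B x * s k x)) \<longlonglongrightarrow> integral\<^sup>L lborel (\<lambda>x. indicator B x * D x)"
  proof (rule integral_dominated_convergence[where w="\<lambda>x. M * indicator (cball (0::'a) (R + norm b)) x"])
    show "(\<lambda>x. indicator B x * D x) \<in> borel_measurable lborel"
      using B borel_measurable_continuous_onI[OF Dc] by simp
    have "continuous_on UNIV (s k)" for k unfolding s_def
      by (intro continuous_intros continuous_on_compose2[OF gc]) auto
    then show "(\<lambda>x. indicator B x * s k x) \<in> borel_measurable lborel" for k
      using B borel_measurable_continuous_onI[of "s k"] by simp
    show "integrable lborel (\<lambda>x. M * indicator (cball (0::'a) (R + norm b)) x)"
      by (intro integrable_mult_right integrable_real_indicator)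
        (use emeasure_lborel_cball_finite[of "0::'a" "R + norm b"] in auto)
    show "AE x in lborel. (\<lambda>k. indicator B x * s k x) \<longlonglongrightarrow> indicator B x * D x"
    proof (intro AE_I2 tendsto_mult tendsto_const)
      fix x
      have "((\<lambda>t. (g (x + t *\<^sub>R b) - g x) / t) \<longlongrightarrow> D x) (at 0)"
        using der[of x 0] by (simp add: has_field_derivative_iff)
      moreover have "filterlim (\<lambda>k. 1 / real (Suc k)) (at 0) sequentially"
        by (intro filterlim_atI) (use LIMSEQ_inverse_real_of_nat in \<open>auto simp: inverse_eq_divide\<close>)
      ultimately have "(\<lambda>k. (g (x + (1 / real (Suc k)) *\<^sub>R b) - g x) / (1 / real (Suc k))) \<longlonglongrightarrow> D x"
        by (rule filterlim_compose)
      then show "(\<lambda>k. s k x) \<longlonglongrightarrow> D x" by (simp add: s_def)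
    qed
    show "AE x in lborel. norm (indicator B x * s k x) \<le> M * indicator (cball (0::'a) (R + norm b)) x" for k
    proof (rule AE_I2)
      fix x
      obtain \<xi> where \<xi>: "0 < \<xi>" "\<xi> < 1" "s k x = D (x + \<xi> *\<^sub>R b)" using sD by blast
      have "norm (s k x) \<le> M * indicator (cball (0::'a) (R + norm b)) x"
      proof (cases "x \<in> cball (0::'a) (R + norm b)")
        case True then show ?thesis using M \<xi> by simp
      next
        case False
        have "x + \<xi> *\<^sub>R b \<notin> K"
        proof
          assume "x + \<xi> *\<^sub>R b \<in> K"
          then have "norm (x + \<xi> *\<^sub>R b) \<le> R" using R by blast
          moreover have "norm x \<le> norm (x + \<xi> *\<^sub>R b) + norm (\<xi> *\<^sub>R b)"
            by (metis add_diff_cancel_right' norm_triangle_ineq4)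
          moreover have "norm (\<xi> *\<^sub>R b) \<le> norm b" using \<xi> by (simp add: mult_left_le_one_le)
          ultimately show False using False by simp
        qed
        then show ?thesis using D0 \<xi> False by (simp add: D_def)
      qed
      moreover have "norm (indicator B x * s k x) \<le> norm (s k x)" by (simp add: indicator_def)
      ultimately show "norm (indicator B x * s k x) \<le> M * indicator (cball (0::'a) (R + norm b)) x" by linarith
    qed
  qed
  then show ?thesis by (simp only: D_def)
qed

lemma integral_translate:
  fixes g :: "'a::euclidean_space \<Rightarrow> real"
  assumes "g \<in> borel_measurable borel"
  shows "integral\<^sup>L lborel (\<lambda>x. g (x + c)) = integral\<^sup>L lborel g"
    and "integrable lborel (\<lambda>x. g (x + c)) \<longleftrightarrow> integrable lborel g"
proof -
  have d: "lborel = distr lborel borel ((+) c)" using lborel_distr_plus[of c] by simp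
  show "integral\<^sup>L lborel (\<lambda>x. g (x + c)) = integral\<^sup>L lborel g"
    using assms by (subst (2) d) (simp add: integral_distr add.commute)
  show "integrable lborel (\<lambda>x. g (x + c)) \<longleftrightarrow> integrable lborel g"
    using assms by (subst (2) d) (simp add: integrable_distr_eq add.commute)
qed

text \<open>Translation invariance of Lebesgue measure makes the integral of every difference
  quotient vanish; only the limit remains to be taken.\<close>

lemma integral_directional_derivative_zero:
  fixes g :: "'a::euclidean_space \<Rightarrow> real"
  assumes g: "C1_on UNIV g" and K: "compact K" "\<And>x. x \<notin> K \<Longrightarrow> g x = 0"
    and D0: "\<And>x. x \<notin> K \<Longrightarrow> frechet_derivative g (at x) b = 0"
  shows "integral\<^sup>L lborel (\<lambda>x. frechet_derivative g (at x) b) = 0"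
proof -
  have gc: "continuous_on UNIV g" using g by (rule C1_on_imp_continuous_on)
  have gi: "integrable lborel g" using integrable_of_compact_support[OF gc K] .
  have gm: "g \<in> borel_measurable borel" using gc by (rule borel_measurable_continuous_onI)
  have "integral\<^sup>L lborel (\<lambda>x. indicator UNIV x * ((g (x + (1 / real (Suc k)) *\<^sub>R b) - g x) * real (Suc k))) = 0" for k
    using gi by (simp add: integral_translate[OF gm] del: of_nat_Suc)
  then show ?thesis
    using difference_quotient_limit[OF g K(1) D0, where B=UNIV] by (simp add: LIMSEQ_const_iff)
qed

lemma integral_divergence_zero:
  fixes \<psi> :: "'a::euclidean_space \<Rightarrow> 'a"
  assumes \<psi>: "C1_on UNIV \<psi>" and K: "compact (closure {x. \<psi> x \<noteq> 0})"
  shows "integral\<^sup>L lborel (divergence \<psi>) = 0"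
proof -
  let ?K = "closure {x. \<psi> x \<noteq> 0}"
  have F: "frechet_derivative (\<lambda>x. \<psi> x \<bullet> b) (at x) h = frechet_derivative \<psi> (at x) h \<bullet> b" for x b h
  proof -
    have "((\<lambda>x. \<psi> x \<bullet> b) has_derivative (\<lambda>h. frechet_derivative \<psi> (at x) h \<bullet> b)) (at x)"
      using C1_on_frechet(1)[OF \<psi>] by (intro has_derivative_inner_left) auto
    from frechet_derivative_at[OF this] show ?thesis by (simp add: fun_eq_iff)
  qed
  have Z: "frechet_derivative \<psi> (at x) h = 0" if "x \<notin> ?K" for x h
  proof -
    have "(\<psi> has_derivative (\<lambda>h. 0)) (at x)"
    proof (rule has_derivative_transform_within_open[of "\<lambda>_. 0" _ _ _ "- ?K"])
      show "\<And>y. y \<in> - ?K \<Longrightarrow> 0 = \<psi> y" using closure_subset[of "{x. \<psi> x \<noteq> 0}"] by auto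
    qed (use that in auto)
    from frechet_derivative_at[OF this] show ?thesis by (simp add: fun_eq_iff)
  qed
  have c: "C1_on UNIV (\<lambda>x. \<psi> x \<bullet> b)" for b
    by (rule C1_on_linear_compose[OF \<psi> bounded_linear_inner_left])
  have ck: "continuous_on UNIV (\<lambda>x. frechet_derivative \<psi> (at x) b \<bullet> b)" for b
    by (intro continuous_intros C1_on_frechet \<psi>)
  have i: "integrable lborel (\<lambda>x. frechet_derivative \<psi> (at x) b \<bullet> b)" for b
    by (rule integrable_of_compact_support[OF ck K]) (simp add: Z)
  have "integral\<^sup>L lborel (\<lambda>x. frechet_derivative \<psi> (at x) b \<bullet> b) = 0" for b
  proof -
    have "\<psi> x = 0" if "x \<notin> ?K" for x
      using that closure_subset[of "{x. \<psi> x \<noteq> 0}"] by auto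
    then show ?thesis using integral_directional_derivative_zero[OF c K, of b b] by (simp only: F Z inner_zero_left simp_thms)
  qed
  then show ?thesis unfolding divergence_def by (subst Bochner_Integration.integral_sum) (simp_all only: i sum.neutral_const)
qed

section \<open>Cylindrical coordinates\<close>

text \<open>The pairs are \<open>(cos, sin)\<close> of the four quarter turns. In the coordinates of
  \<open>frame_coords\<close> the first axis points along \<open>(\<alpha>, \<beta>)\<close>, the
  second along the normal to its left; for a clockwise curve this is the outer side, so the region
  is always the subgraph. Turns with \<open>\<alpha> = 0\<close> give graphs over the radial axis,
  those with \<open>\<beta> = 0\<close> graphs over the rotation axis.\<close>

definition frame :: "real \<Rightarrow> real \<Rightarrow> bool" where
  "frame \<alpha> \<beta> \<longleftrightarrow> (\<alpha>, \<beta>) \<in> {(1, 0), (-1, 0), (0, 1), (0, -1)}"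

definition frame_coords :: "real \<Rightarrow> real \<Rightarrow> real \<times> real \<Rightarrow> real \<times> real" where
  "frame_coords \<alpha> \<beta> p = (\<alpha> * fst p + \<beta> * snd p, - \<beta> * fst p + \<alpha> * snd p)"

definition profile :: "real \<times> 'a::real_normed_vector \<Rightarrow> real \<times> real" where
  "profile p = (fst p, norm (snd p))"

lemma frame_sq: "frame \<alpha> \<beta> \<Longrightarrow> \<alpha>\<^sup>2 + \<beta>\<^sup>2 = 1" "frame \<alpha> \<beta> \<Longrightarrow> \<alpha> * \<alpha> + \<beta> * \<beta> = 1"
  by (auto simp: frame_def)

lemma frame_coords_inverse:
  assumes "frame \<alpha> \<beta>"
  shows "frame_coords \<alpha> (-\<beta>) (frame_coords \<alpha> \<beta> p) = p"
    and "frame_coords \<alpha> \<beta> (frame_coords \<alpha> (-\<beta>) p) = p"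
  using assms by (cases p, auto simp: frame_def frame_coords_def)+

lemma continuous_on_frame_coords [continuous_intros]:
  "continuous_on S f \<Longrightarrow> continuous_on S (\<lambda>x. frame_coords \<alpha> \<beta> (f x))"
  unfolding frame_coords_def by (intro continuous_intros)

lemma measurable_frame_coords [measurable]: "frame_coords \<alpha> \<beta> \<in> borel_measurable borel"
  by (intro borel_measurable_continuous_onI continuous_intros)

text \<open>A quarter turn maps boxes to boxes, so Lebesgue measure can be recognised from its
  values on boxes.\<close>

lemma distr_frame_coords:
  assumes "frame \<alpha> \<beta>"
  shows "distr lborel borel (frame_coords \<alpha> \<beta>) = lborel"
proof (rule lborel_eqI[symmetric])
  fix l u :: "real \<times> real"
  assume le: "\<And>b. b \<in> Basis \<Longrightarrow> l \<bullet> b \<le> u \<bullet> b"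
  obtain l1 l2 u1 u2 where lu: "l = (l1, l2)" "u = (u1, u2)" by (cases l, cases u) auto
  have B: "(1, 0) \<in> (Basis :: (real \<times> real) set)" "(0, 1) \<in> (Basis :: (real \<times> real) set)"
    by (simp_all add: Basis_prod_def)
  have "l \<bullet> (1, 0) \<le> u \<bullet> (1, 0)" "l \<bullet> (0, 1) \<le> u \<bullet> (0, 1)"
    by (rule le[OF B(1)], rule le[OF B(2)])
  then have l12: "l1 \<le> u1" "l2 \<le> u2" by (simp_all add: lu)
  have box: "emeasure lborel (box (a1, a2) (b1, b2)) = ennreal ((b1 - a1) * (b2 - a2))"
    if "a1 \<le> b1" "a2 \<le> b2" for a1 a2 b1 b2 :: real
    using that by (subst emeasure_lborel_box)
      (auto simp: Basis_prod_def prod.union_disjoint inner_prod_def)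
  have prd: "(\<Prod>b\<in>Basis. (u - l) \<bullet> b) = (u1 - l1) * (u2 - l2)"
    by (simp add: lu Basis_prod_def)
  have "frame_coords \<alpha> \<beta> -` box l u \<in> {box (l1, l2) (u1, u2), box (-u1, -u2) (-l1, -l2),
      box (-u2, l1) (-l2, u1), box (l2, -u1) (u2, -l1)}"
  proof -
    have bp: "box (a1, a2) (b1, b2) = {q. a1 < fst q \<and> fst q < b1 \<and> a2 < snd q \<and> snd q < b2}"
      for a1 a2 b1 b2 :: real
      by (auto simp: box_def Basis_prod_def)
    consider "\<alpha> = 1 \<and> \<beta> = 0" | "\<alpha> = -1 \<and> \<beta> = 0" | "\<alpha> = 0 \<and> \<beta> = 1" | "\<alpha> = 0 \<and> \<beta> = -1"
      using assms by (auto simp: frame_def)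
    then show ?thesis
    proof cases
      case 1
      then have "frame_coords \<alpha> \<beta> -` box l u = box (l1, l2) (u1, u2)"
        unfolding lu bp by (auto simp: frame_coords_def)
      then show ?thesis by simp
    next
      case 2
      then have "frame_coords \<alpha> \<beta> -` box l u = box (-u1, -u2) (-l1, -l2)"
        unfolding lu bp by (auto simp: frame_coords_def)
      then show ?thesis by simp
    next
      case 3
      then have "frame_coords \<alpha> \<beta> -` box l u = box (-u2, l1) (-l2, u1)"
        unfolding lu bp by (auto simp: frame_coords_def)
      then show ?thesis by simp
    next
      case 4
      then have "frame_coords \<alpha> \<beta> -` box l u = box (l2, -u1) (u2, -l1)"
        unfolding lu bp by (auto simp: frame_coords_def)
      then show ?thesis by simp
    qed
  qed
  then have "emeasure lborel (frame_coords \<alpha> \<beta> -` box l u) = ennreal ((u1 - l1) * (u2 - l2))"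
    using l12 by (auto simp: box algebra_simps)
  then show "emeasure (distr lborel borel (frame_coords \<alpha> \<beta>)) (box l u) = (\<Prod>b\<in>Basis. (u - l) \<bullet> b)"
    by (simp add: emeasure_distr prd)
qed simp

text \<open>The area of the unit sphere of \<open>real ^ 'm\<close>, as dimension times volume of
  the unit ball.\<close>

definition sphere_const :: "'m::finite itself \<Rightarrow> real" where
  "sphere_const _ = real CARD('m) * unit_ball_vol (real CARD('m))"

lemma sphere_const_pos: "sphere_const TYPE('m::finite) > 0"
  by (simp add: sphere_const_def)

text \<open>The cut at 0 makes \<open>sphere_const\<close> times \<open>weight\<close> the density
  of the law of \<open>norm\<close> on the whole line: for \<open>m \<ge> 2\<close> it vanishes at
  negative radii.\<close>

definition weight :: "nat \<Rightarrow> real \<Rightarrow> real" where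
  "weight m y = (max 0 y) ^ (m - 1)"

lemma weight_nonneg: "weight m y \<ge> 0"
  by (simp add: weight_def)

lemma continuous_on_weight [continuous_intros]:
  "continuous_on S f \<Longrightarrow> continuous_on S (\<lambda>x. weight m (f x))"
  unfolding weight_def by (intro continuous_intros)

lemma measurable_weight [measurable]: "weight m \<in> borel_measurable borel"
  unfolding weight_def[abs_def] by measurable

text \<open>Polar coordinates for radial functions. The measures are compared on the half-lines
  \<open>{..a}\<close>, an intersection-stable generator: one side is the volume of a ball, the
  other the integral of the derivative of this volume in the radius.\<close>

lemma distr_norm:
  assumes m: "CARD('m::finite) \<ge> 2"
  shows "distr lborel borel (norm :: real ^ 'm \<Rightarrow> real)
    = density lborel (\<lambda>y. ennreal (sphere_const TYPE('m) * weight CARD('m) y))"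
    (is "?M = density lborel (\<lambda>y. ennreal (?w y))")
proof (rule measure_eqI_generator_eq[where E="range (\<lambda>a::real. {..a})" and \<Omega>=UNIV and A="\<lambda>n. {..real n}"])
  let ?m = "CARD('m)"
  show "Int_stable (range (\<lambda>a::real. {..a}))" by (auto simp: Int_stable_def)
  show "sets ?M = sigma_sets UNIV (range (\<lambda>a::real. {..a}))"
    "sets (density lborel (\<lambda>y. ennreal (?w y))) = sigma_sets UNIV (range (\<lambda>a::real. {..a}))"
    by (simp_all add: borel_eq_atMost)
  have cb: "norm -` {..a} = (cball 0 a :: (real ^ 'm) set)" for a by auto
  have M: "emeasure ?M {..a} = ennreal (if a \<ge> 0 then unit_ball_vol ?m * a ^ ?m else 0)" for a
    by (simp add: emeasure_distr cb emeasure_cball)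
  have D: "emeasure (density lborel (\<lambda>y. ennreal (?w y))) {..a} = ennreal (if a \<ge> 0 then unit_ball_vol ?m * a ^ ?m else 0)" for a
  proof -
    have "emeasure (density lborel (\<lambda>y. ennreal (?w y))) {..a} = (\<integral>\<^sup>+y. ennreal (?w y) * indicator {..a} y \<partial>lborel)"
      by (subst emeasure_density) (auto intro!: measurable_compose[OF measurable_weight])
    also have "\<dots> = (\<integral>\<^sup>+y. ennreal (?w y) * indicator {0..a} y \<partial>lborel)"
      using m by (intro nn_integral_cong) (auto simp: indicator_def weight_def max_def power_0_left split: if_splits)
    also have "\<dots> = ennreal (if a \<ge> 0 then unit_ball_vol ?m * a ^ ?m else 0)"
    proof (cases "a \<ge> 0")
      case True
      have "(\<integral>\<^sup>+y. ennreal (?w y) * indicator {0..a} y \<partial>lborel)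
          = ennreal (unit_ball_vol ?m * a ^ ?m - unit_ball_vol ?m * 0 ^ ?m)"
      proof (rule nn_integral_FTC_Icc)
        fix y :: real assume y: "y \<in> {0..a}"
        show "((\<lambda>y. unit_ball_vol ?m * y ^ ?m) has_real_derivative ?w y) (at y)"
          using y by (auto intro!: derivative_eq_intros simp: sphere_const_def weight_def max_def)
        show "0 \<le> ?w y" using sphere_const_pos[where 'm='m] weight_nonneg[of ?m y] by simp
      next
        show "0 \<le> a" by (rule True)
        show "?w \<in> borel_measurable borel" by measurable
      qed
      then show ?thesis using True m by (simp add: power_0_left)
    qed auto
    finally show ?thesis .
  qed
  show "\<And>X. X \<in> range (\<lambda>a::real. {..a}) \<Longrightarrow> emeasure ?M X = emeasure (density lborel (\<lambda>y. ennreal (?w y))) X"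
    using M D by auto
  show "(\<Union>i. {..real i}) = UNIV" using real_arch_simple by auto
  show "emeasure ?M {..real i} \<noteq> \<infinity>" for i using M by simp
qed auto

lemma measurable_profile [measurable]: "profile \<in> borel_measurable (borel :: (real \<times> (real^'m)) measure)"
  unfolding profile_def[abs_def] by (intro borel_measurable_continuous_onI continuous_intros)

lemma nn_integral_lborel_pair:
  fixes F :: "'a::euclidean_space \<times> 'b::euclidean_space \<Rightarrow> ennreal"
  assumes "F \<in> borel_measurable borel"
  shows "integral\<^sup>N lborel F = (\<integral>\<^sup>+x. \<integral>\<^sup>+y. F (x, y) \<partial>lborel \<partial>lborel)"
proof -
  have "F \<in> borel_measurable (lborel \<Otimes>\<^sub>M (lborel :: 'b measure))"
    using assms by (simp add: lborel_prod)
  from lborel.nn_integral_fst[OF this] show ?thesis by (simp add: lborel_prod)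
qed

text \<open>Fubini in the axial and the transversal variable, with polar coordinates in the inner
  integral.\<close>

lemma distr_profile:
  assumes m: "CARD('m::finite) \<ge> 2"
  shows "distr lborel borel (profile :: real \<times> (real ^ 'm) \<Rightarrow> _)
    = density lborel (\<lambda>q. ennreal (sphere_const TYPE('m) * weight CARD('m) (snd q)))"
    (is "?M = density lborel (\<lambda>q. ennreal (?w (snd q)))")
proof (rule measure_eqI)
  have wm[measurable]: "?w \<in> borel_measurable borel" by measurable
  have dm: "(\<lambda>q. ennreal (?w (snd q))) \<in> borel_measurable (borel :: (real \<times> real) measure)"
    by (intro measurable_compose[OF _ measurable_ennreal] borel_measurable_continuous_onI continuous_intros)
  fix A assume "A \<in> sets ?M"
  then have A: "A \<in> sets borel" by simp
  have Ai: "(indicator A :: _ \<Rightarrow> ennreal) \<in> borel_measurable borel"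
    using A by simp
  have "emeasure ?M A = (\<integral>\<^sup>+p. indicator A (profile p) \<partial>(lborel :: (real \<times> (real ^ 'm)) measure))"
    using nn_integral_distr[of profile "lborel :: (real \<times> (real ^ 'm)) measure" borel "indicator A :: _ \<Rightarrow> ennreal"] Ai A by simp
  also have "\<dots> = (\<integral>\<^sup>+x. \<integral>\<^sup>+z. indicator A (x, norm (z :: real ^ 'm)) \<partial>lborel \<partial>lborel)"
    using measurable_compose[OF measurable_profile[where 'm='m] Ai]
    by (subst nn_integral_lborel_pair) (auto simp: profile_def)
  also have "\<dots> = (\<integral>\<^sup>+x. \<integral>\<^sup>+y. ennreal (?w y) * indicator A (x, y) \<partial>lborel \<partial>lborel)"
  proof (rule nn_integral_cong)
    fix x :: real
    have [measurable]: "(\<lambda>y. indicator A (x, y) :: ennreal) \<in> borel_measurable borel"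
      by (rule measurable_compose[OF _ Ai]) (auto intro!: borel_measurable_continuous_onI continuous_intros)
    have "(\<integral>\<^sup>+z. indicator A (x, norm (z :: real ^ 'm)) \<partial>lborel)
       = integral\<^sup>N (distr lborel borel (norm :: real ^ 'm \<Rightarrow> real)) (\<lambda>y. indicator A (x, y))"
      by (subst nn_integral_distr) auto
    also have "\<dots> = (\<integral>\<^sup>+y. ennreal (?w y) * indicator A (x, y) \<partial>lborel)"
      unfolding distr_norm[OF m] by (subst nn_integral_density) auto
    finally show "(\<integral>\<^sup>+z. indicator A (x, norm (z :: real ^ 'm)) \<partial>lborel)
       = (\<integral>\<^sup>+y. ennreal (?w y) * indicator A (x, y) \<partial>lborel)" .
  qed
  also have "\<dots> = (\<integral>\<^sup>+q. ennreal (?w (snd q)) * indicator A q \<partial>lborel)"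
    by (subst nn_integral_lborel_pair) (auto intro!: borel_measurable_times_ennreal dm Ai)
  also have "\<dots> = emeasure (density lborel (\<lambda>q. ennreal (?w (snd q)))) A"
    using dm A by (subst emeasure_density) auto
  finally show "emeasure ?M A = emeasure (density lborel (\<lambda>q. ennreal (?w (snd q)))) A" .
qed simp

definition cyl_coords :: "real \<Rightarrow> real \<Rightarrow> real \<times> 'a::real_normed_vector \<Rightarrow> real \<times> real" where
  "cyl_coords \<alpha> \<beta> p = frame_coords \<alpha> \<beta> (profile p)"

text \<open>\<open>\<beta> * fst q + \<alpha> * snd q\<close> is the radius recovered from the
  turned coordinates. For \<open>\<alpha> = 0\<close> the weight depends on the abscissa alone,
  which is what makes the first variation over the radial axis exact.\<close>

definition cyl_weight :: "real \<Rightarrow> real \<Rightarrow> 'm::finite itself \<Rightarrow> real \<times> real \<Rightarrow> real" where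
  "cyl_weight \<alpha> \<beta> M q = sphere_const M * weight CARD('m) (\<beta> * fst q + \<alpha> * snd q)"

lemma continuous_on_cyl_weight: "continuous_on S (cyl_weight \<alpha> \<beta> M)"
  unfolding cyl_weight_def[abs_def] by (intro continuous_intros)

lemma cyl_weight_nonneg: "cyl_weight \<alpha> \<beta> M q \<ge> 0"
  unfolding cyl_weight_def sphere_const_def by (simp add: weight_nonneg)

lemma measurable_cyl_coords [measurable]:
  "cyl_coords \<alpha> \<beta> \<in> borel_measurable (borel :: (real \<times> (real^'m)) measure)"
  unfolding cyl_coords_def[abs_def] by measurable

lemma distr_cyl_coords:
  assumes m: "CARD('m::finite) \<ge> 2" and fr: "frame \<alpha> \<beta>"
  shows "distr lborel borel (cyl_coords \<alpha> \<beta> :: real \<times> (real ^ 'm) \<Rightarrow> _)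
    = density lborel (\<lambda>q. ennreal (cyl_weight \<alpha> \<beta> TYPE('m) q))"
proof -
  let ?d = "\<lambda>q. ennreal (sphere_const TYPE('m) * weight CARD('m) (snd q))"
  have fr': "frame \<alpha> (-\<beta>)" using fr by (auto simp: frame_def)
  have [measurable]: "?d \<in> borel_measurable (borel :: (real \<times> real) measure)"
    by (intro measurable_compose[OF _ measurable_ennreal] borel_measurable_continuous_onI continuous_intros)
  have "distr lborel borel (cyl_coords \<alpha> \<beta> :: real \<times> (real ^ 'm) \<Rightarrow> _)
      = distr (distr lborel borel (profile :: real \<times> (real ^ 'm) \<Rightarrow> _)) borel (frame_coords \<alpha> \<beta>)"
    by (subst distr_distr) (auto simp: cyl_coords_def[abs_def] o_def)
  also have "\<dots> = distr (density lborel ?d) borel (frame_coords \<alpha> \<beta>)"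
    by (simp add: distr_profile[OF m])
  \<comment> \<open>\<open>lborel\<close> is rewritten as its image under the inverse turn, so that
    \<open>density_distr\<close> moves the density through it and the two turns cancel.\<close>
  also have "\<dots> = distr (density (distr lborel borel (frame_coords \<alpha> (-\<beta>))) ?d) borel (frame_coords \<alpha> \<beta>)"
    by (simp add: distr_frame_coords[OF fr'])
  also have "density (distr lborel borel (frame_coords \<alpha> (-\<beta>))) ?d
      = distr (density lborel (\<lambda>q. ?d (frame_coords \<alpha> (-\<beta>) q))) borel (frame_coords \<alpha> (-\<beta>))"
    by (rule density_distr) auto
  also have "distr \<dots> borel (frame_coords \<alpha> \<beta>)
     = density lborel (\<lambda>q. ?d (frame_coords \<alpha> (-\<beta>) q))"
    by (subst distr_distr) (auto simp: o_def frame_coords_inverse[OF fr] cong: distr_cong intro!: distr_id2)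
  finally show ?thesis by (simp add: cyl_weight_def frame_coords_def)
qed

lemma integral_cyl_coords:
  fixes F :: "real \<times> real \<Rightarrow> real"
  assumes m: "CARD('m::finite) \<ge> 2" and fr: "frame \<alpha> \<beta>" and [measurable]: "F \<in> borel_measurable borel"
  shows "integral\<^sup>L lborel (\<lambda>p :: real \<times> (real ^ 'm). F (cyl_coords \<alpha> \<beta> p))
    = integral\<^sup>L lborel (\<lambda>q. cyl_weight \<alpha> \<beta> TYPE('m) q * F q)"
proof -
  have [measurable]: "cyl_weight \<alpha> \<beta> TYPE('m) \<in> borel_measurable borel"
    by (intro borel_measurable_continuous_onI continuous_on_cyl_weight)
  have "integral\<^sup>L lborel (\<lambda>p :: real \<times> (real ^ 'm). F (cyl_coords \<alpha> \<beta> p))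
      = integral\<^sup>L (distr lborel borel (cyl_coords \<alpha> \<beta> :: real \<times> (real ^ 'm) \<Rightarrow> _)) F"
    by (subst integral_distr) auto
  also have "\<dots> = integral\<^sup>L lborel (\<lambda>q. cyl_weight \<alpha> \<beta> TYPE('m) q * F q)"
    unfolding distr_cyl_coords[OF m fr]
    by (subst integral_density) (auto simp: cyl_weight_nonneg)
  finally show ?thesis .
qed

section \<open>Smoothing of subgraphs\<close>

text \<open>The squared positive part is a simple \<open>C^1\<close> function vanishing on a
  half-line; \<open>sstep\<close>, \<open>smoothstep\<close> and \<open>tent_step\<close> are all
  built from it.\<close>

lemma DERIV_pos_part_square: "((\<lambda>r::real. (max 0 r)\<^sup>2) has_real_derivative 2 * max 0 r) (at r)"
proof -
  consider "r > 0" | "r < 0" | "r = 0" by linarith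
  then show ?thesis
  proof cases
    case 1
    have "((\<lambda>r::real. r\<^sup>2) has_real_derivative 2 * r) (at r)" by (auto intro!: derivative_eq_intros)
    then show ?thesis
      using 1 has_field_derivative_transform_within_open[of "\<lambda>r::real. r\<^sup>2" "2 * r" r "{0<..}" "\<lambda>r. (max 0 r)\<^sup>2"]
      by (simp add: max_def)
  next
    case 2
    then show ?thesis
      using has_field_derivative_transform_within_open[of "\<lambda>r::real. 0" "0" r "{..<0}" "\<lambda>r. (max 0 r)\<^sup>2"]
      by (simp add: max_def)
  next
    case 3
    have "((\<lambda>h::real. (max 0 h)\<^sup>2 / h) \<longlongrightarrow> 0) (at 0)"
    proof (rule Lim_null_comparison)
      show "\<forall>\<^sub>F h in at 0. norm ((max 0 h)\<^sup>2 / h) \<le> \<bar>h::real\<bar>"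
        by (intro always_eventually allI) (auto simp: max_def power2_eq_square)
      show "((\<lambda>h::real. \<bar>h\<bar>) \<longlongrightarrow> 0) (at 0)" by (intro tendsto_rabs_zero tendsto_ident_at)
    qed
    then show ?thesis using 3 by (simp add: has_field_derivative_iff)
  qed
qed

lemma C1_on_pos_part_square: "C1_on S (\<lambda>r::real. (max 0 r)\<^sup>2)"
  using DERIV_pos_part_square
  by (intro C1_onI[of _ _ "\<lambda>r h. 2 * max 0 r * h"]) (auto simp: has_field_derivative_def intro!: continuous_intros)

text \<open>A \<open>C^1\<close> stand-in for the indicator of \<open>r \<le> 0\<close>. Evaluated
  at \<open>Suc j\<close> times the height above a graph, it tends pointwise to the indicator of the
  closed subgraph. Decay at infinity is enough, since the fields it multiplies have compact
  support.\<close>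

definition sstep :: "real \<Rightarrow> real" where "sstep r = 1 / (1 + (max 0 r)\<^sup>2)"

text \<open>Minus the derivative of \<open>sstep\<close>; a bounded probability density carried by
  the positive half-line.\<close>

definition sker :: "real \<Rightarrow> real" where "sker r = 2 * max 0 r / (1 + (max 0 r)\<^sup>2)\<^sup>2"

lemma denom_pos: "1 + (max 0 (r::real))\<^sup>2 > 0"
  by (simp add: add_pos_nonneg)

lemma denom_nz: "1 + (max 0 (r::real))\<^sup>2 \<noteq> 0"
  using denom_pos[of r] by simp

lemma DERIV_sstep: "(sstep has_real_derivative - sker r) (at r)"
  unfolding sstep_def[abs_def] sker_def
  by (rule DERIV_cong, (rule derivative_intros DERIV_pos_part_square | simp add: denom_nz)+)
    (simp add: denom_nz power2_eq_square)

lemma continuous_sker: "continuous_on S sker"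
  unfolding sker_def[abs_def] by (intro continuous_intros) (use denom_nz in \<open>auto simp: power2_eq_square\<close>)

lemma sker_nonneg: "sker r \<ge> 0" by (simp add: sker_def)

lemma sker_le_1: "sker r \<le> 1"
proof -
  let ?t = "max 0 r"
  have "2 * ?t \<le> 1 + ?t\<^sup>2" using zero_le_power2[of "?t - 1"] by (simp add: power2_diff)
  also have "\<dots> \<le> (1 + ?t\<^sup>2) * (1 + ?t\<^sup>2)" using mult_left_mono[of 1 "1 + ?t\<^sup>2" "1 + ?t\<^sup>2"] by simp
  finally show ?thesis using denom_pos[of r] by (simp add: sker_def power2_eq_square)
qed

lemma sstep_bounds: "0 \<le> sstep r" "sstep r \<le> 1"
  using denom_pos[of r] by (auto simp: sstep_def)

lemma sstep_nonpos: "r \<le> 0 \<Longrightarrow> sstep r = 1" by (simp add: sstep_def max_def)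

lemma sstep_limit:
  assumes "d > 0" shows "(\<lambda>j. sstep (real (Suc j) * d)) \<longlonglongrightarrow> 0"
proof -
  have "filterlim (\<lambda>j. real (Suc j)) at_top sequentially"
    by (rule filterlim_compose[OF filterlim_real_sequentially filterlim_Suc])
  then have 1: "filterlim (\<lambda>j. real (Suc j) * d) at_top sequentially"
    using assms filterlim_at_top_mult_tendsto_pos[OF tendsto_const[of d]] by (simp add: mult.commute)
  have "filterlim (\<lambda>j. (real (Suc j) * d) * (real (Suc j) * d)) at_top sequentially"
    by (rule filterlim_at_top_mult_at_top[OF 1 1])
  then have "filterlim (\<lambda>j. 1 + (real (Suc j) * d) * (real (Suc j) * d)) at_top sequentially"
    by (rule filterlim_tendsto_add_at_top[OF tendsto_const])
  then have "(\<lambda>j. inverse (1 + (real (Suc j) * d) * (real (Suc j) * d))) \<longlonglongrightarrow> 0"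
    by (rule tendsto_inverse_0_at_top)
  moreover have "sstep (real (Suc j) * d) = inverse (1 + (real (Suc j) * d) * (real (Suc j) * d))" for j
    using assms by (simp add: sstep_def max_def power2_eq_square inverse_eq_divide mult_less_0_iff)
  ultimately show ?thesis by simp
qed

lemma sker_integral: "integrable lborel sker" "integral\<^sup>L lborel sker = 1"
proof -
  have "((\<lambda>r. - sstep r) \<longlongrightarrow> 0) at_top"
  proof -
    have "filterlim (\<lambda>r::real. 1 + r * r) at_top at_top"
      by (intro filterlim_tendsto_add_at_top[OF tendsto_const] filterlim_at_top_mult_at_top filterlim_ident)
    then have "((\<lambda>r::real. inverse (1 + r * r)) \<longlongrightarrow> 0) at_top" by (rule tendsto_inverse_0_at_top)
    then have "((\<lambda>r::real. - inverse (1 + r * r)) \<longlongrightarrow> 0) at_top" by (rule tendsto_minus[of _ 0, simplified])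
    moreover have "\<forall>\<^sub>F r in at_top. - inverse (1 + r * r) = - sstep r"
      using eventually_ge_at_top[of 0]
      by eventually_elim (simp add: sstep_def max_def power2_eq_square inverse_eq_divide)
    ultimately show ?thesis using tendsto_cong by fastforce
  qed
  then have "(\<integral>\<^sup>+x. ennreal (sker x) * indicator {0 ..} x \<partial>lborel) = ennreal (0 - (- sstep 0))"
    using DERIV_sstep
    by (intro nn_integral_FTC_atLeast)
      (auto simp: sker_nonneg intro!: borel_measurable_continuous_onI[OF continuous_sker] derivative_eq_intros)
  moreover have "(\<integral>\<^sup>+x. ennreal (sker x) * indicator {0 ..} x \<partial>lborel) = (\<integral>\<^sup>+x. ennreal (sker x) \<partial>lborel)"
    by (intro nn_integral_cong) (auto simp: sker_def indicator_def max_def)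
  ultimately have n: "(\<integral>\<^sup>+x. ennreal (sker x) \<partial>lborel) = 1" by (simp add: sstep_nonpos)
  have m: "sker \<in> borel_measurable borel" by (intro borel_measurable_continuous_onI continuous_sker)
  show "integrable lborel sker"
    using n m by (intro integrableI_nn_integral_finite[of _ _ 1]) (auto simp: sker_nonneg)
  show "integral\<^sup>L lborel sker = 1"
    using n m by (subst integral_eq_nn_integral) (auto simp: sker_nonneg)
qed

text \<open>In the inner integral the substitution \<open>v = g u + r / Suc j\<close> cancels the
  factor \<open>Suc j\<close> and leaves an average of \<open>\<Phi>\<close> under the probability
  density \<open>sker\<close>. Dominated convergence is applied twice, first in \<open>r\<close> and
  then in \<open>u\<close>. Only measurability of \<open>g\<close> matters.\<close>

lemma subgraph_kernel_limit:
  fixes \<Phi> :: "real \<times> real \<Rightarrow> real" and g :: "real \<Rightarrow> real"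
  assumes \<Phi>: "continuous_on UNIV \<Phi>" and K: "compact K" "\<And>q. q \<notin> K \<Longrightarrow> \<Phi> q = 0"
    and g: "g \<in> borel_measurable borel"
  shows "(\<lambda>j. integral\<^sup>L lborel (\<lambda>q. real (Suc j) * sker (real (Suc j) * (snd q - g (fst q))) * \<Phi> q))
    \<longlonglongrightarrow> integral\<^sup>L lborel (\<lambda>u. \<Phi> (u, g u))"
proof -
  note [measurable] = g borel_measurable_continuous_onI[OF \<Phi>] borel_measurable_continuous_onI[OF continuous_sker]
  have [measurable]: "(fst :: real \<times> real \<Rightarrow> real) \<in> borel_measurable borel" "(snd :: real \<times> real \<Rightarrow> real) \<in> borel_measurable borel"
    by (intro borel_measurable_continuous_onI continuous_intros)+
  have pm: "(\<lambda>u. (u, h u)) \<in> borel_measurable borel" if "h \<in> borel_measurable borel" for h :: "real \<Rightarrow> real"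
    using that by (subst borel_prod[symmetric]) measurable
  obtain M where M: "M \<ge> 0" "\<And>q. norm (\<Phi> q) \<le> M"
    by (rule bounded_of_compact_support[OF \<Phi> K(1)]) (use K(2) in auto)
  obtain R where R: "\<And>q. q \<in> K \<Longrightarrow> norm q \<le> R"
    using compact_imp_bounded[OF K(1)] unfolding bounded_iff by blast
  have \<Phi>0: "\<Phi> (u, v) = 0" if "\<bar>u\<bar> > R" for u v
    using that R[of "(u, v)"] K(2)[of "(u,v)"] norm_fst_le[of u v] by fastforce
  define I where "I j u = integral\<^sup>L lborel (\<lambda>r. sker r * \<Phi> (u, g u + r / real (Suc j)))" for j u
  have eq: "integral\<^sup>L lborel (\<lambda>q. real (Suc j) * sker (real (Suc j) * (snd q - g (fst q))) * \<Phi> q)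
     = integral\<^sup>L lborel (I j)" for j
  proof -
    let ?J = "real (Suc j)"
    let ?F = "\<lambda>q. ?J * sker (?J * (snd q - g (fst q))) * \<Phi> q"
    have Fm: "?F \<in> borel_measurable borel" by measurable
    have "integrable lborel ?F"
    proof (rule Bochner_Integration.integrable_bound)
      show "integrable lborel (\<lambda>q. ?J * norm (\<Phi> q))"
        by (intro integrable_mult_right integrable_norm integrable_of_compact_support[OF \<Phi> K])
      show "AE q in lborel. norm (?F q) \<le> norm (?J * norm (\<Phi> q))"
        using sker_nonneg sker_le_1
        by (intro AE_I2) (auto simp: abs_mult mult.assoc intro!: mult_left_mono mult_left_le_one_le)
      show "?F \<in> borel_measurable lborel" using Fm by simp
    qed
    then have i: "integrable (lborel \<Otimes>\<^sub>M lborel) ?F" by (simp add: lborel_prod)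
    have "integral\<^sup>L lborel ?F = integral\<^sup>L (lborel \<Otimes>\<^sub>M lborel) ?F" by (simp add: lborel_prod)
    also have "\<dots> = (\<integral>u. (\<integral>v. ?F (u, v) \<partial>lborel) \<partial>lborel)"
      by (rule lborel_pair.integral_fst'[OF i, symmetric])
    also have "(\<lambda>u. \<integral>v. ?F (u, v) \<partial>lborel) = I j"
    proof (rule ext)
      fix u
      have "(\<integral>v. ?F (u, v) \<partial>lborel) = \<bar>1 / ?J\<bar> *\<^sub>R (\<integral>r. ?F (u, g u + 1 / ?J * r) \<partial>lborel)"
        by (rule lborel_integral_real_affine) simp
      also have "\<dots> = I j u"
        unfolding I_def by (simp add: field_simps del: of_nat_Suc flip: integral_mult_right_zero)
      finally show "(\<integral>v. ?F (u, v) \<partial>lborel) = I j u" .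
    qed
    finally show ?thesis .
  qed
  have bd: "norm (sker r * \<Phi> q) \<le> M * sker r" for r q
    using mult_right_mono[OF M(2)[of q] sker_nonneg[of r]] sker_nonneg[of r]
    by (simp add: abs_mult mult.commute)
  have inner: "(\<lambda>j. I j u) \<longlonglongrightarrow> \<Phi> (u, g u)" for u
  proof -
    have "(\<lambda>j. I j u) \<longlonglongrightarrow> integral\<^sup>L lborel (\<lambda>r. sker r * \<Phi> (u, g u))"
      unfolding I_def
    proof (rule integral_dominated_convergence[where w="\<lambda>r. M * sker r"])
      show "integrable lborel (\<lambda>r. M * sker r)" by (intro integrable_mult_right sker_integral)
      show "AE r in lborel. norm (sker r * \<Phi> (u, g u + r / real (Suc j))) \<le> M * sker r" for j
        using bd by simp
      have "(\<lambda>r. \<Phi> (u, g u + r / real (Suc j))) \<in> borel_measurable borel" for j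
        by (intro borel_measurable_continuous_onI continuous_on_compose2[OF \<Phi>] continuous_intros) auto
      then show "(\<lambda>r. sker r * \<Phi> (u, g u + r / real (Suc j))) \<in> borel_measurable lborel" for j by simp
      show "AE r in lborel. (\<lambda>j. sker r * \<Phi> (u, g u + r / real (Suc j))) \<longlonglongrightarrow> sker r * \<Phi> (u, g u)"
      proof (intro AE_I2 tendsto_mult tendsto_const)
        fix r
        have "(\<lambda>j. r / real (Suc j)) \<longlonglongrightarrow> 0"
          using tendsto_mult[OF tendsto_const[of r] LIMSEQ_inverse_real_of_nat] by (simp add: divide_inverse)
        then have "(\<lambda>j. (u, g u + r / real (Suc j))) \<longlonglongrightarrow> (u, g u + 0)"
          by (intro tendsto_intros)
        then show "(\<lambda>j. \<Phi> (u, g u + r / real (Suc j))) \<longlonglongrightarrow> \<Phi> (u, g u)"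
          using continuous_on_tendsto_compose[OF \<Phi>] by force
      qed
    qed measurable
    then show ?thesis by (simp add: sker_integral)
  qed
  have "(\<lambda>j. integral\<^sup>L lborel (I j)) \<longlonglongrightarrow> integral\<^sup>L lborel (\<lambda>u. \<Phi> (u, g u))"
  proof (rule integral_dominated_convergence[where w="\<lambda>u. M * indicator {-R..R} u"])
    show "(\<lambda>u. \<Phi> (u, g u)) \<in> borel_measurable lborel"
      using measurable_compose[OF pm[OF g] borel_measurable_continuous_onI[OF \<Phi>]] by simp
    show "integrable lborel (\<lambda>u. M * indicator {-R..R} u)"
      by (intro integrable_mult_right integrable_real_indicator) (auto simp: emeasure_lborel_Icc_eq)
    show "AE u in lborel. (\<lambda>j. I j u) \<longlonglongrightarrow> \<Phi> (u, g u)" using inner by simp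
    have "(\<lambda>q. sker (snd q) * \<Phi> (fst q, g (fst q) + snd q / real (Suc j))) \<in> borel_measurable (lborel \<Otimes>\<^sub>M lborel)" for j
    proof -
      have 1: "(\<lambda>q. (fst q, g (fst q) + snd q / real (Suc j))) \<in> borel \<Otimes>\<^sub>M borel \<rightarrow>\<^sub>M borel \<Otimes>\<^sub>M (borel :: real measure)"
        by measurable
      have 2: "\<Phi> \<in> borel_measurable (borel \<Otimes>\<^sub>M borel)"
        using borel_measurable_continuous_onI[OF \<Phi>] by (simp add: borel_prod)
      have "(\<lambda>q. sker (snd q) * \<Phi> (fst q, g (fst q) + snd q / real (Suc j))) \<in> borel_measurable (borel \<Otimes>\<^sub>M borel)"
        using measurable_compose[OF 1 2] by measurable
      then show ?thesis by (simp cong: measurable_cong_sets)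
    qed
    then show "I j \<in> borel_measurable lborel" for j
      unfolding I_def[abs_def]
      by (intro lborel.borel_measurable_lebesgue_integral) (simp add: split_beta')
    show "AE u in lborel. norm (I j u) \<le> M * indicator {-R..R} u" for j
    proof (rule AE_I2)
      fix u
      show "norm (I j u) \<le> M * indicator {-R..R} u"
      proof (cases "\<bar>u\<bar> > R")
        case True
        then show ?thesis using M(1) by (simp add: I_def \<Phi>0)
      next
        case False
        have "norm (I j u) \<le> (\<integral>r. M * sker r \<partial>lborel)"
          unfolding I_def
        proof (rule Bochner_Integration.integral_norm_bound_integral)
          show i: "integrable lborel (\<lambda>r. M * sker r)" by (intro integrable_mult_right sker_integral)
          show bd': "norm (sker r * \<Phi> (u, g u + r / real (Suc j))) \<le> M * sker r" for r by (rule bd)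
          have "(\<lambda>r. sker r * \<Phi> (u, g u + r / real (Suc j))) \<in> borel_measurable borel"
            by (intro borel_measurable_continuous_onI continuous_on_compose2[OF \<Phi>] continuous_intros continuous_sker) auto
          then show "integrable lborel (\<lambda>r. sker r * \<Phi> (u, g u + r / real (Suc j)))"
          proof (intro Bochner_Integration.integrable_bound[OF i] AE_I2)
            fix r
            show "norm (sker r * \<Phi> (u, g u + r / real (Suc j))) \<le> norm (M * sker r)"
              using order_trans[OF bd abs_ge_self] by (simp only: real_norm_def)
          qed simp
        qed
        moreover have "u \<in> {-R..R}" using False by auto
        ultimately show ?thesis by (simp add: sker_integral)
      qed
    qed
  qed
  then show ?thesis by (simp only: eq)
qed

section \<open>Gauss--Green formula for rotationally symmetric subgraphs\<close>

definition cyl_deriv :: "real \<Rightarrow> real \<Rightarrow> real \<times> 'a::real_inner \<Rightarrow> real \<times> 'a \<Rightarrow> real \<times> real" where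
  "cyl_deriv \<alpha> \<beta> p h = frame_coords \<alpha> \<beta> (fst h, sgn (snd p) \<bullet> snd h)"

lemma norm_frame_coords:
  assumes "frame \<alpha> \<beta>" shows "norm (frame_coords \<alpha> \<beta> q) = norm q"
  using assms by (cases q) (auto simp: frame_def frame_coords_def norm_Pair)

lemma bounded_linear_frame_coords: "bounded_linear (frame_coords \<alpha> \<beta>)"
  unfolding frame_coords_def[abs_def]
  by (intro bounded_linear_Pair bounded_linear_add bounded_linear_mult_const
      bounded_linear_const_mult bounded_linear_fst bounded_linear_snd)

text \<open>Projecting a vector to its axial and radial components and turning it does not lengthen
  it, so a test field becomes a planar vector of length at most 1.\<close>

lemma norm_cyl_deriv_le:
  assumes "frame \<alpha> \<beta>" shows "norm (cyl_deriv \<alpha> \<beta> p h) \<le> norm h"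
proof -
  have "\<bar>sgn (snd p) \<bullet> snd h\<bar> \<le> norm (sgn (snd p)) * norm (snd h)" by (rule Cauchy_Schwarz_ineq2)
  also have "\<dots> \<le> norm (snd h)" by (auto simp: norm_sgn)
  finally have "(sgn (snd p) \<bullet> snd h)\<^sup>2 \<le> (norm (snd h))\<^sup>2"
    by (metis abs_ge_zero power2_abs power_mono)
  then show ?thesis
    unfolding cyl_deriv_def norm_frame_coords[OF assms]
    by (cases h) (simp add: norm_Pair)
qed

lemma has_derivative_cyl_coords:
  assumes "snd p \<noteq> 0"
  shows "(cyl_coords \<alpha> \<beta> has_derivative cyl_deriv \<alpha> \<beta> p) (at p)"
proof -
  have "(norm has_derivative (\<lambda>h. sgn (snd p) \<bullet> h)) (at (snd p))"
    using has_derivative_norm[OF assms] by (simp add: inner_commute)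
  from has_derivative_compose[OF has_derivative_snd[OF has_derivative_ident] this]
  have "((\<lambda>p. norm (snd p)) has_derivative (\<lambda>h. sgn (snd p) \<bullet> snd h)) (at p)" by simp
  then have "(profile has_derivative (\<lambda>h. (fst h, sgn (snd p) \<bullet> snd h))) (at p)"
    unfolding profile_def[abs_def] by (intro derivative_intros)
  from bounded_linear.has_derivative[OF bounded_linear_frame_coords this]
  show ?thesis unfolding cyl_coords_def[abs_def] cyl_deriv_def[abs_def] .
qed

lemma continuous_on_profile: "continuous_on S profile"
  unfolding profile_def[abs_def] by (intro continuous_intros)

lemma continuous_on_cyl_coords: "continuous_on S (cyl_coords \<alpha> \<beta>)"
  unfolding cyl_coords_def[abs_def] by (intro continuous_intros continuous_on_profile)

lemma C1_on_cyl_coords: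
  "C1_on {p :: real \<times> 'b::real_inner. snd p \<noteq> 0} (cyl_coords \<alpha> \<beta>)"
  unfolding cyl_coords_def[abs_def] profile_def[abs_def]
  by (intro C1_on_linear_compose[OF _ bounded_linear_frame_coords] C1_on_Pair C1_on_norm_snd
      C1_on_bounded_linear bounded_linear_fst)

lemma norm_cyl_coords:
  fixes p :: "real \<times> 'a::real_normed_vector"
  assumes "frame \<alpha> \<beta>" shows "norm (cyl_coords \<alpha> \<beta> p) = norm p"
  unfolding cyl_coords_def norm_frame_coords[OF assms] by (cases p) (simp add: profile_def norm_Pair)

lemma norm_snd_cyl_coords:
  assumes "frame \<alpha> \<beta>"
  shows "\<beta> * fst (cyl_coords \<alpha> \<beta> p) + \<alpha> * snd (cyl_coords \<alpha> \<beta> p) = norm (snd p)"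
  using assms by (auto simp: frame_def cyl_coords_def frame_coords_def profile_def)

lemma compact_vimage_cyl_coords:
  assumes "frame \<alpha> \<beta>" "compact Q"
  shows "compact (cyl_coords \<alpha> \<beta> -` Q :: (real \<times> (real ^ 'm)) set)"
proof -
  have "closed (cyl_coords \<alpha> \<beta> -` Q :: (real \<times> (real ^ 'm)) set)"
    by (intro closed_vimage compact_imp_closed[OF assms(2)] continuous_on_cyl_coords)
  moreover have "bounded (cyl_coords \<alpha> \<beta> -` Q :: (real \<times> (real ^ 'm)) set)"
    using compact_imp_bounded[OF assms(2)] norm_cyl_coords[OF assms(1)]
    unfolding bounded_iff by (metis vimageE)
  ultimately show ?thesis using compact_eq_bounded_closed by blast
qed

text \<open>The open sets \<open>R\<close> and \<open>- K\<close> cover the space, and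
  \<open>f\<close> is \<open>C^1\<close> on each. In this way fields built in a box off the axis
  become global ones.\<close>

lemma C1_on_zero_extend:
  assumes "open R" "closed K" "K \<subseteq> R" "C1_on R f" "\<And>x. x \<notin> K \<Longrightarrow> f x = 0"
  shows "C1_on UNIV f"
proof -
  have "C1_on (- K) f"
    by (rule C1_on_cong_open[OF C1_on_const[of "- K" 0]]) (use assms in auto)
  then have "C1_on (R \<union> - K) f" using assms by (intro C1_on_Un) auto
  moreover have "R \<union> - K = UNIV" using assms(3) by auto
  ultimately show ?thesis by simp
qed

lemma continuous_on_zero_extend:
  fixes f :: "'a::topological_space \<Rightarrow> 'b::real_normed_vector"
  assumes "open R" "closed K" "K \<subseteq> R" "continuous_on R f" "\<And>x. x \<notin> K \<Longrightarrow> f x = 0"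
  shows "continuous_on UNIV f"
proof -
  have "continuous_on (- K) f"
    using assms(5) by (subst continuous_on_cong[OF refl, of _ _ "\<lambda>_. 0"]) auto
  then have "continuous_on (R \<union> - K) f" using assms by (intro continuous_on_open_Un) auto
  moreover have "R \<union> - K = UNIV" using assms(3) by auto
  ultimately show ?thesis by simp
qed

lemma compact_closure_support:
  fixes f :: "'a::metric_space \<Rightarrow> 'b::zero"
  assumes "compact K" "\<And>x. x \<notin> K \<Longrightarrow> f x = 0"
  shows "compact (closure {x. f x \<noteq> 0})"
proof -
  have "closure {x. f x \<noteq> 0} \<subseteq> K"
    using assms(2) by (intro closure_minimal compact_imp_closed[OF assms(1)]) auto
  then have "K \<inter> closure {x. f x \<noteq> 0} = closure {x. f x \<noteq> 0}" by (rule Int_absorb1)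
  with compact_Int_closed[OF assms(1) closed_closure[of "{x. f x \<noteq> 0}"]] show ?thesis by (simp only:)
qed

definition cyl_box :: "real \<Rightarrow> real \<Rightarrow> real \<Rightarrow> real \<Rightarrow> real \<Rightarrow> real \<Rightarrow> (real \<times> 'a::real_normed_vector) set" where
  "cyl_box \<alpha> \<beta> u1 u2 v1 v2 = {p. cyl_coords \<alpha> \<beta> p \<in> {u1<..<u2} \<times> {v1<..<v2}}"

lemma open_cyl_box: "open (cyl_box \<alpha> \<beta> u1 u2 v1 v2)"
proof -
  have eq: "cyl_box \<alpha> \<beta> u1 u2 v1 v2 = cyl_coords \<alpha> \<beta> -` ({u1<..<u2} \<times> {v1<..<v2})"
    by (auto simp: cyl_box_def)
  show ?thesis
    unfolding eq by (intro open_vimage open_Times open_greaterThanLessThan continuous_on_cyl_coords)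
qed

text \<open>Let \<open>w j\<close> be the smoothed indicator of the subgraph. The field
  \<open>w j \<psi>\<close> has compact support, so its divergence integrates to 0, and the product
  rule turns this into equality of the integrals of \<open>w j * divergence \<psi>\<close> and
  \<open>I j\<close>. As \<open>w j\<close> tends to the indicator of \<open>E\<close> inside the
  box and \<open>\<psi>\<close> vanishes outside, the volume side converges; nothing about
  \<open>E\<close> outside the box enters.\<close>

lemma gauss_green_limit:
  fixes \<psi> :: "real \<times> (real ^ 'm) \<Rightarrow> real \<times> (real ^ 'm)" and g g' :: "real \<Rightarrow> real"
  assumes fr: "frame \<alpha> \<beta>"
    and pos: "\<And>u v. u \<in> {u1<..<u2} \<Longrightarrow> v \<in> {v1<..<v2} \<Longrightarrow> \<beta> * u + \<alpha> * v > 0"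
    and g: "\<And>u. u \<in> {u1<..<u2} \<Longrightarrow> (g has_real_derivative g' u) (at u)"
    and g': "continuous_on {u1<..<u2} g'"
    and \<psi>: "C1_on UNIV \<psi>" and K: "compact K" "K \<subseteq> cyl_box \<alpha> \<beta> u1 u2 v1 v2" "\<And>p. p \<notin> K \<Longrightarrow> \<psi> p = 0"
    and E: "E \<in> sets borel"
    and ER: "\<And>p. p \<in> cyl_box \<alpha> \<beta> u1 u2 v1 v2 \<Longrightarrow>
      p \<in> E \<longleftrightarrow> snd (cyl_coords \<alpha> \<beta> p) \<le> g (fst (cyl_coords \<alpha> \<beta> p))"
  defines "I \<equiv> \<lambda>j p. real (Suc j) * sker (real (Suc j) * (snd (cyl_coords \<alpha> \<beta> p) - g (fst (cyl_coords \<alpha> \<beta> p)))) *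
      (snd (cyl_deriv \<alpha> \<beta> p (\<psi> p)) - g' (fst (cyl_coords \<alpha> \<beta> p)) * fst (cyl_deriv \<alpha> \<beta> p (\<psi> p)))"
  shows "(\<lambda>j. integral\<^sup>L lborel (I j)) \<longlonglongrightarrow> integral\<^sup>L lborel (\<lambda>p. indicator E p * divergence \<psi> p)"
    and "\<And>j. integrable lborel (I j)"
proof -
  let ?R = "cyl_box \<alpha> \<beta> u1 u2 v1 v2 :: (real \<times> (real ^ 'm)) set"
  define U where "U p = fst (cyl_coords \<alpha> \<beta> p)" for p :: "real \<times> (real ^ 'm)"
  define V where "V p = snd (cyl_coords \<alpha> \<beta> p)" for p :: "real \<times> (real ^ 'm)"
  have UR: "U p \<in> {u1<..<u2}" "V p \<in> {v1<..<v2}" if "p \<in> ?R" for p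
    using that by (auto simp: cyl_box_def U_def V_def)
  have nz: "snd p \<noteq> 0" if "p \<in> ?R" for p
  proof -
    have "norm (snd p) > 0"
      using pos[OF UR[OF that]] norm_snd_cyl_coords[OF fr, of p] by (simp add: U_def V_def)
    then show ?thesis by auto
  qed
  have oR: "open ?R" by (rule open_cyl_box)
  have cK: "closed K" using K(1) by (rule compact_imp_closed)
  have dU: "(U has_derivative (\<lambda>h. fst (cyl_deriv \<alpha> \<beta> p h))) (at p)"
    and dV: "(V has_derivative (\<lambda>h. snd (cyl_deriv \<alpha> \<beta> p h))) (at p)" if "p \<in> ?R" for p
    unfolding U_def[abs_def] V_def[abs_def]
    using has_derivative_cyl_coords[OF nz[OF that]] by (auto intro: has_derivative_fst has_derivative_snd)
  have CU: "C1_on ?R U" and CV: "C1_on ?R V"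
    unfolding U_def[abs_def] V_def[abs_def]
    by (rule C1_on_linear_compose[OF C1_on_subset[OF C1_on_cyl_coords] bounded_linear_fst]
             C1_on_linear_compose[OF C1_on_subset[OF C1_on_cyl_coords] bounded_linear_snd], use nz in auto)+
  have Cg: "C1_on ?R (\<lambda>p. g (U p))"
    using g UR by (intro C1_on_real_compose[OF CU, of g g'] continuous_on_subset[OF g']) auto
  define w where "w j p = sstep (real (Suc j) * (V p - g (U p)))" for j p
  have Cw: "C1_on ?R (w j)" for j
    unfolding w_def[abs_def]
    by (rule C1_on_real_compose[of _ _ sstep "\<lambda>r. - sker r"])
      (auto intro!: C1_on_mult C1_on_const C1_on_diff CV Cg DERIV_sstep continuous_intros continuous_sker)
  define w' where "w' j p h = - sker (real (Suc j) * (V p - g (U p))) *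
      (real (Suc j) * (snd (cyl_deriv \<alpha> \<beta> p h) - g' (U p) * fst (cyl_deriv \<alpha> \<beta> p h)))" for j p h
  have dw: "(w j has_derivative w' j p) (at p)" if "p \<in> ?R" for j p
  proof -
    have "(g has_derivative (\<lambda>h. g' (U p) * h)) (at (U p))"
      using g[OF UR(1)[OF that]] by (simp add: has_field_derivative_def)
    from has_derivative_compose[OF dU[OF that] this]
    have 1: "((\<lambda>p. g (U p)) has_derivative (\<lambda>h. g' (U p) * fst (cyl_deriv \<alpha> \<beta> p h))) (at p)" .
    have 2: "((\<lambda>p. real (Suc j) * (V p - g (U p))) has_derivative
       (\<lambda>h. real (Suc j) * (snd (cyl_deriv \<alpha> \<beta> p h) - g' (U p) * fst (cyl_deriv \<alpha> \<beta> p h)))) (at p)"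
      by (intro has_derivative_mult_right has_derivative_diff dV[OF that] 1)
    have 3: "(sstep has_derivative (\<lambda>h. - sker (real (Suc j) * (V p - g (U p))) * h)) (at (real (Suc j) * (V p - g (U p))))"
      using DERIV_sstep[of "real (Suc j) * (V p - g (U p))"] unfolding has_field_derivative_def .
    show ?thesis
      using has_derivative_compose[OF 2 3] unfolding w_def[abs_def] w'_def[abs_def] .
  qed
  \<comment> \<open>\<open>w j\<close> is differentiable only in the box, but the support of
    \<open>\<psi>\<close> lies in a compact part of it.\<close>
  have C\<psi>: "C1_on UNIV (\<lambda>p. w j p *\<^sub>R \<psi> p)" for j
    by (rule C1_on_zero_extend[OF oR cK K(2)])
      (use K(3) in \<open>auto intro!: C1_on_scaleR Cw C1_on_subset[OF \<psi>]\<close>)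
  have cs: "compact (closure {p. w j p *\<^sub>R \<psi> p \<noteq> 0})" for j
    by (rule compact_closure_support[OF K(1)]) (use K(3) in auto)
  have div0: "divergence \<psi> p = 0" if "p \<notin> K" for p
    by (rule divergence_zero_open[of "- K"]) (use that cK K(3) in auto)
  have div0': "divergence (\<lambda>p. w j p *\<^sub>R \<psi> p) p = 0" if "p \<notin> K" for p j
    by (rule divergence_zero_open[of "- K"]) (use that cK K(3) in auto)
  have cd0: "cyl_deriv \<alpha> \<beta> p 0 = 0" for p :: "real \<times> (real ^ 'm)"
    by (simp add: cyl_deriv_def frame_coords_def zero_prod_def)
  have I: "I j p = w j p * divergence \<psi> p - divergence (\<lambda>p. w j p *\<^sub>R \<psi> p) p" for j p
  proof (cases "p \<in> K")
    case True
    then have "p \<in> ?R" using K(2) by auto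
    from divergence_scaleR[OF dw[OF this] \<psi> UNIV_I]
    show ?thesis by (simp add: I_def w'_def U_def V_def)
  next
    case False
    then show ?thesis using div0 div0' K(3) by (simp add: I_def cd0)
  qed
  have ic: "integrable lborel (\<lambda>p. w j p * divergence \<psi> p)" for j
  proof (rule integrable_of_compact_support[OF _ K(1)])
    show "continuous_on UNIV (\<lambda>p. w j p * divergence \<psi> p)"
      by (rule continuous_on_zero_extend[OF oR cK K(2)])
        (auto simp: div0 intro!: continuous_intros C1_on_imp_continuous_on[OF Cw]
          continuous_on_subset[OF divergence_continuous[OF \<psi>]])
  qed (simp add: div0)
  have id: "integrable lborel (divergence (\<lambda>p. w j p *\<^sub>R \<psi> p))" for j
    by (rule integrable_of_compact_support[OF divergence_continuous[OF C\<psi>] K(1)]) (rule div0')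
  have "integral\<^sup>L lborel (I j) = integral\<^sup>L lborel (\<lambda>p. w j p * divergence \<psi> p)" for j
    unfolding I using ic id integral_divergence_zero[OF C\<psi> cs] by simp
  moreover have "(\<lambda>j. integral\<^sup>L lborel (\<lambda>p. w j p * divergence \<psi> p))
      \<longlonglongrightarrow> integral\<^sup>L lborel (\<lambda>p. indicator E p * divergence \<psi> p)"
  proof (rule integral_dominated_convergence[where w="\<lambda>p. norm (divergence \<psi> p)"])
    have dm: "divergence \<psi> \<in> borel_measurable borel"
      by (intro borel_measurable_continuous_onI divergence_continuous \<psi>)
    then show "(\<lambda>p. indicator E p * divergence \<psi> p) \<in> borel_measurable lborel"
      using E by simp
    show "(\<lambda>p. w j p * divergence \<psi> p) \<in> borel_measurable lborel" for j
      using ic by (rule borel_measurable_integrable)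
    show "integrable lborel (\<lambda>p. norm (divergence \<psi> p))"
      by (intro integrable_norm integrable_of_compact_support[OF divergence_continuous[OF \<psi>] K(1)]) (rule div0)
    show "AE p in lborel. norm (w j p * divergence \<psi> p) \<le> norm (divergence \<psi> p)" for j
      using sstep_bounds by (intro AE_I2) (auto simp: w_def abs_mult intro!: mult_left_le_one_le)
    show "AE p in lborel. (\<lambda>j. w j p * divergence \<psi> p) \<longlonglongrightarrow> indicator E p * divergence \<psi> p"
    proof (rule AE_I2)
      fix p
      show "(\<lambda>j. w j p * divergence \<psi> p) \<longlonglongrightarrow> indicator E p * divergence \<psi> p"
      proof (cases "p \<in> ?R")
        case False
        then have "p \<notin> K" using K(2) by auto
        then have "divergence \<psi> p = 0" by (rule div0)
        then show ?thesis by simp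
      next
        case True
        have "(\<lambda>j. w j p) \<longlonglongrightarrow> indicator E p"
        proof (cases "V p \<le> g (U p)")
          case True
          then have "p \<in> E" using ER[OF \<open>p \<in> ?R\<close>] by (simp add: U_def V_def)
          moreover have "w j p = 1" for j
            unfolding w_def using True by (intro sstep_nonpos mult_nonneg_nonpos) auto
          ultimately show ?thesis by simp
        next
          case False
          then have "p \<notin> E" using ER[OF \<open>p \<in> ?R\<close>] by (simp add: U_def V_def)
          then show ?thesis using sstep_limit[of "V p - g (U p)"] False by (simp add: w_def)
        qed
        then show ?thesis by (intro tendsto_intros)
      qed
    qed
  qed
  ultimately show "(\<lambda>j. integral\<^sup>L lborel (I j)) \<longlonglongrightarrow> integral\<^sup>L lborel (\<lambda>p. indicator E p * divergence \<psi> p)"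
    by simp
  show "integrable lborel (I j)" for j
    unfolding I[abs_def] using ic id by (intro Bochner_Integration.integrable_diff) auto
qed

section \<open>Cutoff functions\<close>

lemma C1_on_compose_real:
  fixes g :: "real \<Rightarrow> real"
  assumes "C1_on S f" "C1_on UNIV g"
  shows "C1_on S (\<lambda>x. g (f x))"
proof (rule C1_on_real_compose[OF assms(1), of g "\<lambda>y. frechet_derivative g (at y) 1"])
  fix y
  have d: "(g has_derivative frechet_derivative g (at y)) (at y)"
    by (rule C1_on_frechet(1)[OF assms(2)]) simp
  then have "frechet_derivative g (at y) h = frechet_derivative g (at y) 1 * h" for h
    using linear_cmul[OF has_derivative_linear[OF d], of h 1] by simp
  then have "frechet_derivative g (at y) = (*) (frechet_derivative g (at y) 1)" by (rule ext)
  then show "(g has_real_derivative frechet_derivative g (at y) 1) (at y)"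
    unfolding has_field_derivative_def using d by simp
next
  show "continuous_on (f ` S) (\<lambda>y. frechet_derivative g (at y) 1)"
    by (rule continuous_on_subset[OF C1_on_frechet(2)[OF assms(2)]]) simp
qed

lemma C1_on_real_derivI:
  fixes g :: "real \<Rightarrow> real"
  assumes "\<And>x. x \<in> S \<Longrightarrow> (g has_real_derivative g' x) (at x)" "continuous_on S g'"
  shows "C1_on S g"
  using assms by (intro C1_onI[of _ _ "\<lambda>x h. g' x * h"]) (auto simp: has_field_derivative_def intro!: continuous_intros)

lemma C1_on_inverse:
  fixes f :: "'a::real_normed_vector \<Rightarrow> real"
  assumes "C1_on S f" "\<And>x. x \<in> S \<Longrightarrow> f x \<noteq> 0"
  shows "C1_on S (\<lambda>x. inverse (f x))"
  by (rule C1_on_real_compose[OF assms(1), of inverse "\<lambda>y. - (inverse y * inverse y)"])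
    (use assms(2) in \<open>auto intro!: derivative_eq_intros continuous_intros simp: power2_eq_square\<close>)

lemma C1_on_sqrt:
  fixes f :: "'a::real_normed_vector \<Rightarrow> real"
  assumes "C1_on S f" "\<And>x. x \<in> S \<Longrightarrow> f x > 0"
  shows "C1_on S (\<lambda>x. sqrt (f x))"
proof (rule C1_on_real_compose[OF assms(1), of sqrt "\<lambda>y. inverse (sqrt y) / 2"])
  show "(sqrt has_real_derivative inverse (sqrt y) / 2) (at y)" if "y \<in> f ` S" for y
    using that assms(2) by (auto intro: DERIV_real_sqrt)
  show "continuous_on (f ` S) (\<lambda>y. inverse (sqrt y) / 2)"
  proof -
    have "f x \<noteq> 0" if "x \<in> S" for x using assms(2)[OF that] by simp
    then show ?thesis by (auto intro!: continuous_intros)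
  qed
qed

lemma C1_on_linear_real: "C1_on S (\<lambda>x::real. c * x + d)"
  by (intro C1_on_add C1_on_const C1_on_bounded_linear bounded_linear_mult_right)

text \<open>The denominator has no zero because \<open>r\<close> and \<open>1 - r\<close> are never
  both nonpositive. The spelling \<open>-1 * r + 1\<close> matches
  \<open>C1_on_linear_real\<close>.\<close>

definition smoothstep :: "real \<Rightarrow> real" where
  "smoothstep r = (max 0 r)\<^sup>2 * inverse ((max 0 r)\<^sup>2 + (max 0 (-1 * r + 1))\<^sup>2)"

lemma smoothstep_denom: "(max 0 r)\<^sup>2 + (max 0 (-1 * r + 1))\<^sup>2 > (0::real)"
proof (cases "r > 0")
  case True
  then have "(max 0 r)\<^sup>2 > 0" by (simp add: max_def)
  then show ?thesis by (simp add: add_pos_nonneg)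
next
  case False
  then have "(max 0 (-1 * r + 1))\<^sup>2 > 0" by (simp add: max_def)
  then show ?thesis by (simp add: add_nonneg_pos)
qed

lemma C1_on_smoothstep: "C1_on UNIV smoothstep"
  unfolding smoothstep_def[abs_def]
proof (intro C1_on_mult C1_on_inverse C1_on_add C1_on_pos_part_square)
  show "C1_on UNIV (\<lambda>r::real. (max 0 (-1 * r + 1))\<^sup>2)"
    by (rule C1_on_compose_real[OF C1_on_linear_real C1_on_pos_part_square])
qed (use smoothstep_denom in \<open>auto simp: less_imp_neq[symmetric]\<close>)

lemma smoothstep_props:
  "0 \<le> smoothstep r" "smoothstep r \<le> 1" "r \<le> 0 \<Longrightarrow> smoothstep r = 0" "1 \<le> r \<Longrightarrow> smoothstep r = 1"
  using smoothstep_denom[of r]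
  by (auto simp: smoothstep_def field_simps max_def divide_simps)

lemma cutoff_exists:
  fixes a b c d :: real
  assumes "a < c" "d < b"
  shows "\<exists>k :: real \<Rightarrow> real. C1_on UNIV k \<and> (\<forall>x. 0 \<le> k x) \<and> (\<forall>x. k x \<le> 1) \<and>
    (\<forall>x. x \<notin> {a..b} \<longrightarrow> k x = 0) \<and> (\<forall>x\<in>{c..d}. k x = 1)"
proof -
  let ?l = "\<lambda>x. (1 / (c - a)) * x + (- a / (c - a))" and ?r = "\<lambda>x. (- 1 / (b - d)) * x + b / (b - d)"
  let ?k = "\<lambda>x. smoothstep (?l x) * smoothstep (?r x)"
  have 1: "C1_on UNIV ?k"
    by (intro C1_on_mult C1_on_compose_real[OF _ C1_on_smoothstep] C1_on_linear_real)
  have 2: "0 \<le> ?k x" for x by (simp add: smoothstep_props)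
  have 3: "?k x \<le> 1" for x by (intro mult_le_one smoothstep_props)
  have l: "?l x = (x - a) / (c - a)" and r: "?r x = (b - x) / (b - d)" for x
    by (simp_all add: diff_divide_distrib)
  have 4: "?k x = 0" if "x \<notin> {a..b}" for x
  proof (cases "x < a")
    case True
    then have "smoothstep (?l x) = 0" unfolding l using assms by (intro smoothstep_props) (auto simp: field_simps)
    then show ?thesis by simp
  next
    case False
    then have "smoothstep (?r x) = 0" unfolding r using assms that by (intro smoothstep_props) (auto simp: field_simps)
    then show ?thesis by simp
  qed
  have 5: "?k x = 1" if "x \<in> {c..d}" for x
  proof -
    have "smoothstep (?l x) = 1" "smoothstep (?r x) = 1"
      unfolding l r using assms that by (intro smoothstep_props; auto simp: field_simps)+
    then show ?thesis by simp
  qed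
  show ?thesis
    by (rule exI[of _ ?k]) (use 1 2 3 4 5 in blast)
qed

section \<open>Perimeter under a change of graph\<close>

lemma set_lebesgue_integral_borel:
  fixes f :: "'a::euclidean_space \<Rightarrow> real"
  assumes "E \<in> sets borel" "f \<in> borel_measurable borel"
  shows "(LINT x:E|lebesgue. f x) = integral\<^sup>L lborel (\<lambda>x. indicator E x * f x)"
proof -
  have "(\<lambda>x. indicator E x * f x) \<in> borel_measurable lborel" using assms by simp
  from integral_completion[OF this] show ?thesis by (simp add: set_lebesgue_integral_def)
qed

lemma test_field_lborel:
  assumes "\<phi> \<in> test_fields" "E \<in> sets borel"
  shows "(LINT x:E|lebesgue. divergence \<phi> x) = integral\<^sup>L lborel (\<lambda>x. indicator E x * divergence \<phi> x)"
  using assms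
  by (intro set_lebesgue_integral_borel borel_measurable_continuous_onI divergence_continuous)
    (auto simp: test_fields_iff)

lemma perimeter_ge:
  assumes "\<phi> \<in> test_fields" "E \<in> sets borel"
  shows "ereal (integral\<^sup>L lborel (\<lambda>x. indicator E x * divergence \<phi> x)) \<le> perimeter E"
  unfolding perimeter_def test_field_lborel[OF assms, symmetric] by (rule SUP_upper[OF assms(1)])

lemma perimeter_le:
  assumes "E \<in> sets borel"
    "\<And>\<phi>. \<phi> \<in> test_fields \<Longrightarrow> integral\<^sup>L lborel (\<lambda>x. indicator E x * divergence \<phi> x) \<le> c"
  shows "perimeter E \<le> ereal c"
  unfolding perimeter_def using assms by (intro SUP_least) (simp add: test_field_lborel)

lemma integrable_indicator_divergence:
  fixes \<psi> :: "'a::euclidean_space \<Rightarrow> 'a"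
  assumes "C1_on UNIV \<psi>" "compact K" "\<And>p. p \<notin> K \<Longrightarrow> \<psi> p = 0" "E \<in> sets borel"
  shows "integrable lborel (\<lambda>p. indicator E p * divergence \<psi> p)"
proof -
  have "divergence \<psi> p = 0" if "p \<notin> K" for p
    by (rule divergence_zero_open[of "- K"]) (use that compact_imp_closed[OF assms(2)] assms(3) in auto)
  then have "integrable lborel (divergence \<psi>)"
    by (rule integrable_of_compact_support[OF divergence_continuous[OF assms(1)] assms(2)])
  from integrable_real_mult_indicator[OF _ this, of E] assms(4) show ?thesis by (simp add: mult.commute)
qed

text \<open>The limit of \<open>gauss_green_limit\<close> is evaluated in the meridian half-plane.
  \<open>X\<close> is the normal component of the field times the length element of the graph. The
  inequality serves arbitrary test fields, whose flux depends on the angular position; the equality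
  serves the explicit normal field, whose flux is a function \<open>F\<close> of the planar
  coordinates.\<close>

lemma gauss_green_eval:
  fixes \<psi> :: "real \<times> (real ^ 'm) \<Rightarrow> real \<times> (real ^ 'm)" and g g' :: "real \<Rightarrow> real" and F :: "real \<times> real \<Rightarrow> real"
  assumes m: "CARD('m) \<ge> 2" and fr: "frame \<alpha> \<beta>"
    and pos: "\<And>u v. u \<in> {u1<..<u2} \<Longrightarrow> v \<in> {v1<..<v2} \<Longrightarrow> \<beta> * u + \<alpha> * v > 0"
    and g: "\<And>u. u \<in> {u1<..<u2} \<Longrightarrow> (g has_real_derivative g' u) (at u)"
    and g': "continuous_on {u1<..<u2} g'" and gm: "g \<in> borel_measurable borel"
    and Q: "compact Q" "Q \<subseteq> {u1<..<u2} \<times> {v1<..<v2}"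
    and \<psi>: "C1_on UNIV \<psi>" and \<psi>0: "\<And>p. cyl_coords \<alpha> \<beta> p \<notin> Q \<Longrightarrow> \<psi> p = 0"
    and F: "continuous_on ({u1<..<u2} \<times> {v1<..<v2}) F" "\<And>q. q \<notin> Q \<Longrightarrow> F q = 0"
    and E: "E \<in> sets borel"
    and ER: "\<And>p. p \<in> cyl_box \<alpha> \<beta> u1 u2 v1 v2 \<Longrightarrow>
      p \<in> E \<longleftrightarrow> snd (cyl_coords \<alpha> \<beta> p) \<le> g (fst (cyl_coords \<alpha> \<beta> p))"
  defines "X \<equiv> \<lambda>p. snd (cyl_deriv \<alpha> \<beta> p (\<psi> p)) - g' (fst (cyl_coords \<alpha> \<beta> p)) * fst (cyl_deriv \<alpha> \<beta> p (\<psi> p))"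
  shows "(\<And>p. p \<in> cyl_box \<alpha> \<beta> u1 u2 v1 v2 \<Longrightarrow> X p \<le> F (cyl_coords \<alpha> \<beta> p)) \<Longrightarrow>
      integral\<^sup>L lborel (\<lambda>p. indicator E p * divergence \<psi> p)
        \<le> integral\<^sup>L lborel (\<lambda>u. cyl_weight \<alpha> \<beta> TYPE('m) (u, g u) * F (u, g u))"
    and "(\<And>p. p \<in> cyl_box \<alpha> \<beta> u1 u2 v1 v2 \<Longrightarrow> X p = F (cyl_coords \<alpha> \<beta> p)) \<Longrightarrow>
      integral\<^sup>L lborel (\<lambda>p. indicator E p * divergence \<psi> p)
        = integral\<^sup>L lborel (\<lambda>u. cyl_weight \<alpha> \<beta> TYPE('m) (u, g u) * F (u, g u))"
proof -
  let ?c = "cyl_coords \<alpha> \<beta> :: real \<times> (real ^ 'm) \<Rightarrow> real \<times> real"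
  let ?R = "cyl_box \<alpha> \<beta> u1 u2 v1 v2 :: (real \<times> (real ^ 'm)) set"
  let ?K = "?c -` Q"
  let ?k = "\<lambda>j q. real (Suc j) * sker (real (Suc j) * (snd q - g (fst q)))"
  have K: "compact ?K" "?K \<subseteq> ?R" "\<And>p. p \<notin> ?K \<Longrightarrow> \<psi> p = 0"
    using compact_vimage_cyl_coords[OF fr Q(1)] Q(2) \<psi>0 by (auto simp: cyl_box_def)
  have Fc: "continuous_on UNIV F"
    using Q compact_imp_closed F
    by (intro continuous_on_zero_extend[of "{u1<..<u2} \<times> {v1<..<v2}" Q]) (auto intro: open_Times)
  define I where "I j p = ?k j (?c p) * X p" for j p
  note gl = gauss_green_limit[OF fr pos g g' \<psi> K E ER]
  have lim: "(\<lambda>j. integral\<^sup>L lborel (I j)) \<longlonglongrightarrow> integral\<^sup>L lborel (\<lambda>p. indicator E p * divergence \<psi> p)"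
    and Ii: "integrable lborel (I j)" for j
    using gl unfolding I_def[abs_def] X_def by auto
  define J where "J j p = ?k j (?c p) * F (?c p)" for j p
  have km: "(\<lambda>q. ?k j q * F q) \<in> borel_measurable borel" for j
  proof -
    have [measurable]: "(fst :: real \<times> real \<Rightarrow> real) \<in> borel_measurable borel" "(snd :: real \<times> real \<Rightarrow> real) \<in> borel_measurable borel"
      by (intro borel_measurable_continuous_onI continuous_intros)+
    note [measurable] = gm borel_measurable_continuous_onI[OF continuous_sker] borel_measurable_continuous_onI[OF Fc]
    show ?thesis by measurable
  qed
  have Ji: "integrable lborel (J j)" for j
  proof (rule Bochner_Integration.integrable_bound)
    show "integrable lborel (\<lambda>p. real (Suc j) * norm (F (?c p)))"
    proof (intro integrable_mult_right integrable_norm integrable_of_compact_support[OF _ K(1)])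
      show "continuous_on UNIV (\<lambda>p. F (?c p))"
        by (rule continuous_on_compose2[OF Fc continuous_on_cyl_coords]) simp
    qed (use F(2) in auto)
    show "J j \<in> borel_measurable lborel"
      unfolding J_def[abs_def] using measurable_compose[OF measurable_cyl_coords km] by simp
    show "AE p in lborel. norm (J j p) \<le> norm (real (Suc j) * norm (F (?c p)))"
      using sker_nonneg sker_le_1
      by (intro AE_I2) (auto simp: J_def abs_mult mult.assoc intro!: mult_left_mono mult_left_le_one_le)
  qed
  have Jl: "(\<lambda>j. integral\<^sup>L lborel (J j)) \<longlonglongrightarrow> integral\<^sup>L lborel (\<lambda>u. cyl_weight \<alpha> \<beta> TYPE('m) (u, g u) * F (u, g u))"
  proof -
    have "integral\<^sup>L lborel (J j) = integral\<^sup>L lborel (\<lambda>q. cyl_weight \<alpha> \<beta> TYPE('m) q * (?k j q * F q))" for j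
      unfolding J_def by (rule integral_cyl_coords[OF m fr km])
    also have "(\<lambda>q. cyl_weight \<alpha> \<beta> TYPE('m) q * (?k j q * F q)) = (\<lambda>q. ?k j q * (cyl_weight \<alpha> \<beta> TYPE('m) q * F q))" for j
      by (simp add: fun_eq_iff mult_ac)
    finally have e: "integral\<^sup>L lborel (J j) = integral\<^sup>L lborel (\<lambda>q. ?k j q * (cyl_weight \<alpha> \<beta> TYPE('m) q * F q))" for j .
    show ?thesis
      unfolding e
      by (rule subgraph_kernel_limit[OF _ Q(1) _ gm]) (auto intro!: continuous_intros continuous_on_cyl_weight Fc simp: F(2))
  qed
  have out: "I j p = 0 \<and> J j p = 0" if "p \<notin> ?R" for p j
  proof -
    have "p \<notin> ?K" "?c p \<notin> Q" using that K(2) by auto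
    then show ?thesis
      using K(3)[of p] F(2) by (simp add: I_def J_def X_def cyl_deriv_def frame_coords_def)
  qed
  show "integral\<^sup>L lborel (\<lambda>p. indicator E p * divergence \<psi> p)
        \<le> integral\<^sup>L lborel (\<lambda>u. cyl_weight \<alpha> \<beta> TYPE('m) (u, g u) * F (u, g u))"
    if le: "\<And>p. p \<in> cyl_box \<alpha> \<beta> u1 u2 v1 v2 \<Longrightarrow> X p \<le> F (cyl_coords \<alpha> \<beta> p)"
  proof (rule LIMSEQ_le[OF lim Jl], intro exI allI impI)
    fix j
    have "I j p \<le> J j p" for p
    proof (cases "p \<in> ?R")
      case True
      then show ?thesis
        unfolding I_def J_def using sker_nonneg by (intro mult_left_mono le mult_nonneg_nonneg) auto
    next
      case False then show ?thesis using out by simp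
    qed
    then show "integral\<^sup>L lborel (I j) \<le> integral\<^sup>L lborel (J j)"
      by (intro integral_mono Ii Ji)
  qed
  show "integral\<^sup>L lborel (\<lambda>p. indicator E p * divergence \<psi> p)
        = integral\<^sup>L lborel (\<lambda>u. cyl_weight \<alpha> \<beta> TYPE('m) (u, g u) * F (u, g u))"
    if eq: "\<And>p. p \<in> cyl_box \<alpha> \<beta> u1 u2 v1 v2 \<Longrightarrow> X p = F (cyl_coords \<alpha> \<beta> p)"
  proof -
    have "I j p = J j p" for p j
    proof (cases "p \<in> ?R")
      case True then show ?thesis by (simp add: I_def J_def eq)
    next
      case False then show ?thesis using out by simp
    qed
    then have "I = J" by (intro ext)
    then show ?thesis using LIMSEQ_unique[OF lim] Jl by simp
  qed
qed

text \<open>The upward unit normal \<open>(-t, 1) / sqrt (1 + t * t)\<close> to a graph of slope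
  \<open>t = q u\<close>, turned back from the frame and lifted along the radial direction
  \<open>sgn (snd p)\<close>. The slope function \<open>q\<close> is a parameter because the true
  slope is only continuous, whereas a test field must be \<open>C^1\<close>.\<close>

definition cyl_normal :: "real \<Rightarrow> real \<Rightarrow> (real \<Rightarrow> real) \<Rightarrow> real \<times> 'a::real_inner \<Rightarrow> real \<times> 'a" where
  "cyl_normal \<alpha> \<beta> q p = (let t = q (fst (cyl_coords \<alpha> \<beta> p)); s = inverse (sqrt (1 + t * t))
     in (s * (- \<alpha> * t - \<beta>), (s * (\<alpha> - \<beta> * t)) *\<^sub>R sgn (snd p)))"

lemma one_plus_square_pos: "1 + t * t > (0::real)"
  by (intro add_pos_nonneg) auto

lemma cyl_deriv_normal:
  fixes q :: "real \<Rightarrow> real"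
  assumes "frame \<alpha> \<beta>" "snd p \<noteq> 0"
  defines "t \<equiv> q (fst (cyl_coords \<alpha> \<beta> p))"
  shows "cyl_deriv \<alpha> \<beta> p (cyl_normal \<alpha> \<beta> q p) = (- t / sqrt (1 + t * t), 1 / sqrt (1 + t * t))"
proof -
  have "sgn (snd p) \<bullet> sgn (snd p) = 1"
    using assms(2) by (simp add: dot_square_norm norm_sgn)
  then show ?thesis
    using assms(1) unfolding frame_def
    by (auto simp: cyl_deriv_def cyl_normal_def Let_def frame_coords_def t_def[symmetric] divide_inverse)
qed

lemma norm_cyl_normal_le:
  assumes "frame \<alpha> \<beta>" shows "norm (cyl_normal \<alpha> \<beta> q p) \<le> 1"
proof -
  let ?t = "q (fst (cyl_coords \<alpha> \<beta> p))"
  let ?s = "inverse (sqrt (1 + ?t * ?t))"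
  have sq: "?s * ?s * (1 + ?t * ?t) = 1"
    using one_plus_square_pos[of ?t] by (simp add: field_simps)
  have "(norm (cyl_normal \<alpha> \<beta> q p))\<^sup>2 = (?s * (- \<alpha> * ?t - \<beta>))\<^sup>2 + (norm ((?s * (\<alpha> - \<beta> * ?t)) *\<^sub>R sgn (snd p)))\<^sup>2"
    by (simp add: cyl_normal_def Let_def norm_Pair)
  also have "\<dots> \<le> (?s * (- \<alpha> * ?t - \<beta>))\<^sup>2 + (?s * (\<alpha> - \<beta> * ?t))\<^sup>2"
    by (auto simp: norm_sgn power_mult_distrib)
  also have "\<dots> = ?s * ?s * (1 + ?t * ?t)"
    using assms unfolding frame_def by (auto simp: power2_eq_square algebra_simps)
  finally have "(norm (cyl_normal \<alpha> \<beta> q p))\<^sup>2 \<le> 1\<^sup>2" unfolding sq by simp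
  then show ?thesis using power2_le_imp_le[of _ 1] by simp
qed

lemma C1_on_cyl_normal:
  fixes q :: "real \<Rightarrow> real"
  assumes "C1_on UNIV q"
  shows "C1_on {p :: real \<times> 'a::real_inner. snd p \<noteq> 0} (cyl_normal \<alpha> \<beta> q)"
proof -
  let ?S = "{p :: real \<times> 'a. snd p \<noteq> 0}"
  let ?t = "\<lambda>p :: real \<times> 'a. q (fst (cyl_coords \<alpha> \<beta> p))"
  have t: "C1_on ?S ?t"
    by (intro C1_on_compose_real[OF _ assms] C1_on_linear_compose[OF C1_on_cyl_coords] bounded_linear_fst)
  have s: "C1_on ?S (\<lambda>p. inverse (sqrt (1 + ?t p * ?t p)))"
    using one_plus_square_pos
    by (intro C1_on_inverse C1_on_sqrt C1_on_add C1_on_const C1_on_mult t) (auto simp: less_imp_neq[symmetric])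
  have g: "C1_on ?S (\<lambda>p. sgn (snd p))"
    unfolding sgn_div_norm
    by (intro C1_on_scaleR C1_on_inverse C1_on_norm_snd C1_on_bounded_linear bounded_linear_snd) auto
  show ?thesis
    unfolding cyl_normal_def[abs_def] Let_def
    by (intro C1_on_Pair C1_on_scaleR C1_on_mult C1_on_diff C1_on_const t s g)
qed

lemma tangential_slope_bound:
  fixes a b t x y :: real
  assumes "norm (x, y) \<le> 1" shows "y - t * x \<le> sqrt (1 + t\<^sup>2)"
proof -
  have "y - t * x = (x, y) \<bullet> (- t, 1)" by simp
  also have "\<dots> \<le> norm (x, y) * norm (- t, 1::real)" by (rule norm_cauchy_schwarz)
  also have "\<dots> \<le> 1 * norm (- t, 1::real)" by (intro mult_right_mono assms) simp
  also have "\<dots> = sqrt (1 + t\<^sup>2)" by (simp add: norm_Pair add.commute)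
  finally show ?thesis .
qed

text \<open>The right side is the length element of slope \<open>t\<close> tested with the normal of
  slope \<open>q\<close>. One \<open>e\<close> is lost because \<open>sqrt (1 + t^2)\<close> is
  1-Lipschitz in \<open>t\<close>, the other in the term
  \<open>(t - q) * q / sqrt (1 + q * q)\<close>.\<close>

lemma slope_approx:
  fixes t q e :: real
  assumes "\<bar>t - q\<bar> \<le> e"
  shows "sqrt (1 + t\<^sup>2) - 2 * e \<le> (1 + t * q) / sqrt (1 + q * q)"
proof -
  let ?s = "sqrt (1 + q * q)"
  have s: "?s > 0" "?s * ?s = 1 + q * q" using one_plus_square_pos[of q] by auto
  have qs: "\<bar>q\<bar> \<le> ?s" by (rule real_le_rsqrt[of "\<bar>q\<bar>", simplified power2_eq_square]) (simp add: abs_mult_self_eq)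
  have "norm (1::real, t) \<le> norm (1::real, q) + norm (0::real, t - q)"
    using norm_triangle_ineq[of "(1::real, q)" "(0, t - q)"] by simp
  then have 1: "sqrt (1 + t\<^sup>2) \<le> ?s + \<bar>t - q\<bar>" by (simp add: norm_Pair power2_eq_square)
  have "(1 + t * q) / ?s = ?s + (t - q) * q / ?s"
  proof -
    have "1 + t * q = ?s * ?s + (t - q) * q" unfolding s(2) by (simp add: algebra_simps)
    then show ?thesis using s(1) by (simp add: field_simps)
  qed
  moreover have "\<bar>(t - q) * q / ?s\<bar> \<le> \<bar>t - q\<bar>"
  proof -
    have "\<bar>(t - q) * q / ?s\<bar> = \<bar>t - q\<bar> * (\<bar>q\<bar> / ?s)" using s(1) by (simp add: abs_mult)
    also have "\<dots> \<le> \<bar>t - q\<bar> * 1" using qs s(1) by (intro mult_left_mono) auto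
    finally show ?thesis by simp
  qed
  ultimately show ?thesis using 1 assms by linarith
qed

lemma zero_outside_support: "x \<notin> closure {x. f x \<noteq> 0} \<Longrightarrow> f x = 0"
  using closure_subset[of "{x. f x \<noteq> 0}"] by blast

text \<open>Let \<open>\<phi>\<close> be a test field for \<open>E\<close> and
  \<open>\<kappa>\<close> a cutoff equal to 1 near the region where \<open>E\<close> and
  \<open>C\<close> may differ. The outer part \<open>(1 - \<kappa>) \<phi>\<close> has the same
  integral over \<open>E\<close> and \<open>C\<close>, and the inner part contributes at most the
  weighted length of the graph of \<open>g\<close>. Conversely, \<open>(1 - \<kappa>) \<phi>\<close>
  plus \<open>\<kappa>\<close> times an approximate unit normal is still a test field, being bounded
  by a convex combination. Testing \<open>C\<close> with it bounds the outer part by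
  \<open>Pc\<close> minus the weighted length of the graph of \<open>f\<close>, up to an arbitrarily
  small error.\<close>

lemma perimeter_variation:
  fixes C E :: "(real \<times> (real ^ 'm)) set" and f f' g g' :: "real \<Rightarrow> real"
  assumes m: "CARD('m) \<ge> 2" and fr: "frame \<alpha> \<beta>"
    and pos: "\<And>u v. u \<in> {u1<..<u2} \<Longrightarrow> v \<in> {v1<..<v2} \<Longrightarrow> \<beta> * u + \<alpha> * v > 0"
    and f: "\<And>u. u \<in> {u1<..<u2} \<Longrightarrow> (f has_real_derivative f' u) (at u)"
    and f': "continuous_on {u1<..<u2} f'" and fm: "f \<in> borel_measurable borel"
    and g: "\<And>u. u \<in> {u1<..<u2} \<Longrightarrow> (g has_real_derivative g' u) (at u)"
    and g': "continuous_on {u1<..<u2} g'" and gm: "g \<in> borel_measurable borel"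
    and C: "C \<in> sets borel" and E: "E \<in> sets borel"
    and CR: "\<And>p. p \<in> cyl_box \<alpha> \<beta> u1 u2 v1 v2 \<Longrightarrow>
      p \<in> C \<longleftrightarrow> snd (cyl_coords \<alpha> \<beta> p) \<le> f (fst (cyl_coords \<alpha> \<beta> p))"
    and ER: "\<And>p. p \<in> cyl_box \<alpha> \<beta> u1 u2 v1 v2 \<Longrightarrow>
      p \<in> E \<longleftrightarrow> snd (cyl_coords \<alpha> \<beta> p) \<le> g (fst (cyl_coords \<alpha> \<beta> p))"
    and CE: "\<And>p. p \<notin> cyl_box \<alpha> \<beta> u1 u2 v1 v2 \<Longrightarrow> p \<in> E \<longleftrightarrow> p \<in> C"
    and ab: "u1 < a" "a \<le> b" "b < u2" and cd: "v1 < c" "c \<le> d" "d < v2"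
    and fg: "\<And>u. u \<in> {u1<..<u2} \<Longrightarrow> u \<notin> {a..b} \<Longrightarrow> f u = g u \<and> f' u = g' u"
    and rf: "\<And>u. u \<in> {u1<..<u2} \<Longrightarrow> f u \<in> {c..d}" and rg: "\<And>u. u \<in> {u1<..<u2} \<Longrightarrow> g u \<in> {c..d}"
    and P: "perimeter C = ereal Pc"
  shows "perimeter E \<le> ereal (Pc
    + integral\<^sup>L lborel (\<lambda>u. indicator {a..b} u * (cyl_weight \<alpha> \<beta> TYPE('m) (u, g u) * sqrt (1 + (g' u)\<^sup>2)))
    - integral\<^sup>L lborel (\<lambda>u. indicator {a..b} u * (cyl_weight \<alpha> \<beta> TYPE('m) (u, f u) * sqrt (1 + (f' u)\<^sup>2))))"
proof (rule perimeter_le[OF E])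
  fix \<phi> :: "real \<times> (real ^ 'm) \<Rightarrow> real \<times> (real ^ 'm)"
  assume \<phi>: "\<phi> \<in> test_fields"
  let ?R = "cyl_box \<alpha> \<beta> u1 u2 v1 v2 :: (real \<times> (real ^ 'm)) set"
  let ?B = "{u1<..<u2} \<times> {v1<..<v2}"
  let ?cw = "cyl_weight \<alpha> \<beta> TYPE('m)"
  define U where "U p = fst (cyl_coords \<alpha> \<beta> p)" for p :: "real \<times> (real ^ 'm)"
  define V where "V p = snd (cyl_coords \<alpha> \<beta> p)" for p :: "real \<times> (real ^ 'm)"
  \<comment> \<open>The cutoff is 1 on a neighbourhood of \<open>{a..b}\<close>, not only on it:
    \<open>\<phi>1\<close> has to vanish on an open set for its divergence to vanish there.
    \<open>K2\<close> does the same for the heights.\<close>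
  obtain K1 :: "real \<Rightarrow> real" where K1': "C1_on UNIV K1" "\<forall>x. 0 \<le> K1 x" "\<forall>x. K1 x \<le> 1"
      "\<forall>x. x \<notin> {(u1 + a) / 2..(b + u2) / 2} \<longrightarrow> K1 x = 0"
      "\<forall>x\<in>{(u1 + 3 * a) / 4..(3 * b + u2) / 4}. K1 x = 1"
  proof -
    have "(u1 + a) / 2 < (u1 + 3 * a) / 4" "(3 * b + u2) / 4 < (b + u2) / 2" using ab by auto
    from cutoff_exists[OF this] that show thesis by blast
  qed
  note K1 = K1'(1) K1'(2)[rule_format] K1'(3)[rule_format] K1'(4)[rule_format] K1'(5)[rule_format]
  obtain K2 :: "real \<Rightarrow> real" where K2': "C1_on UNIV K2" "\<forall>x. 0 \<le> K2 x" "\<forall>x. K2 x \<le> 1"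
      "\<forall>x. x \<notin> {(v1 + c) / 2..(d + v2) / 2} \<longrightarrow> K2 x = 0"
      "\<forall>x\<in>{(v1 + 3 * c) / 4..(3 * d + v2) / 4}. K2 x = 1"
  proof -
    have "(v1 + c) / 2 < (v1 + 3 * c) / 4" "(3 * d + v2) / 4 < (d + v2) / 2" using cd by auto
    from cutoff_exists[OF this] that show thesis by blast
  qed
  note K2 = K2'(1) K2'(2)[rule_format] K2'(3)[rule_format] K2'(4)[rule_format] K2'(5)[rule_format]
  let ?Q = "{(u1 + a) / 2..(b + u2) / 2} \<times> {(v1 + c) / 2..(d + v2) / 2}"
  have Q: "compact ?Q" "?Q \<subseteq> ?B" using ab cd by (auto intro: compact_Times)
  define \<kappa> where "\<kappa> p = K1 (U p) * K2 (V p)" for p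
  have \<kappa>0: "\<kappa> p = 0" if "cyl_coords \<alpha> \<beta> p \<notin> ?Q" for p
    using that K1(4)[of "U p"] K2(4)[of "V p"] by (auto simp: \<kappa>_def U_def V_def mem_Times_iff)
  have \<kappa>01: "0 \<le> \<kappa> p" "\<kappa> p \<le> 1" for p
    unfolding \<kappa>_def using K1 K2 by (auto intro!: mult_le_one)
  let ?KQ = "cyl_coords \<alpha> \<beta> -` ?Q :: (real \<times> (real ^ 'm)) set"
  have KQ: "compact ?KQ" "closed ?KQ" "?KQ \<subseteq> ?R"
    using compact_vimage_cyl_coords[OF fr Q(1)] Q(2) by (auto intro: compact_imp_closed simp: cyl_box_def)
  have oR: "open ?R" by (rule open_cyl_box)
  have nz: "snd p \<noteq> 0" if "p \<in> ?R" for p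
  proof -
    have "norm (snd p) > 0"
      using pos[of "U p" "V p"] norm_snd_cyl_coords[OF fr, of p] that by (auto simp: U_def V_def cyl_box_def mem_Times_iff)
    then show ?thesis by auto
  qed
  have sub: "?R \<subseteq> {p. snd p \<noteq> 0}" using nz by auto
  have CUV: "C1_on ?R U" "C1_on ?R V"
    unfolding U_def[abs_def] V_def[abs_def]
    by (rule C1_on_linear_compose[OF C1_on_subset[OF C1_on_cyl_coords sub] bounded_linear_fst])
       (rule C1_on_linear_compose[OF C1_on_subset[OF C1_on_cyl_coords sub] bounded_linear_snd])
  have C\<kappa>R: "C1_on ?R \<kappa>"
    unfolding \<kappa>_def[abs_def] by (rule C1_on_mult[OF C1_on_compose_real[OF CUV(1) K1(1)] C1_on_compose_real[OF CUV(2) K2(1)]])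
  have C\<kappa>: "C1_on UNIV \<kappa>"
    by (rule C1_on_zero_extend[OF oR KQ(2,3) C\<kappa>R]) (rule \<kappa>0, simp)
  define S where "S = closure {x. \<phi> x \<noteq> 0}"
  have \<phi>': "C1_on UNIV \<phi>" "compact S" "\<And>x. norm (\<phi> x) \<le> 1"
    using \<phi> unfolding test_fields_iff S_def by blast+
  define \<phi>1 where "\<phi>1 p = (1 - \<kappa> p) *\<^sub>R \<phi> p" for p
  define \<phi>2 where "\<phi>2 p = \<kappa> p *\<^sub>R \<phi> p" for p
  have C1: "C1_on UNIV \<phi>1" "C1_on UNIV \<phi>2"
    unfolding \<phi>1_def[abs_def] \<phi>2_def[abs_def] by (intro C1_on_scaleR C1_on_diff C1_on_const C\<kappa> \<phi>')+
  have \<phi>s: "\<phi> p = 0" if "p \<notin> S" for p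
    using that unfolding S_def by (rule zero_outside_support)
  have int1: "integrable lborel (\<lambda>p. indicator X p * divergence \<phi>1 p)" if "X \<in> sets borel" for X
    by (rule integrable_indicator_divergence[OF C1(1) \<phi>'(2) _ that]) (simp add: \<phi>1_def \<phi>s)
  have int2: "integrable lborel (\<lambda>p. indicator X p * divergence \<phi>2 p)" if "X \<in> sets borel" for X
    by (rule integrable_indicator_divergence[OF C1(2) \<phi>'(2) _ that]) (simp add: \<phi>2_def \<phi>s)
  have split\<phi>: "integral\<^sup>L lborel (\<lambda>p. indicator E p * divergence \<phi> p) =
      integral\<^sup>L lborel (\<lambda>p. indicator E p * divergence \<phi>1 p) + integral\<^sup>L lborel (\<lambda>p. indicator E p * divergence \<phi>2 p)"
  proof -
    have "\<phi> = (\<lambda>p. \<phi>1 p + \<phi>2 p)" by (simp add: \<phi>1_def \<phi>2_def fun_eq_iff algebra_simps)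
    then have "divergence \<phi> p = divergence \<phi>1 p + divergence \<phi>2 p" for p
      using divergence_add[OF C1, of p] by simp
    then show ?thesis using int1[OF E] int2[OF E] by (simp add: distrib_left)
  qed
  have same: "integral\<^sup>L lborel (\<lambda>p. indicator E p * divergence \<phi>1 p) = integral\<^sup>L lborel (\<lambda>p. indicator C p * divergence \<phi>1 p)"
  proof (rule Bochner_Integration.integral_cong[OF refl])
    fix p :: "real \<times> (real ^ 'm)"
    show "indicator E p * divergence \<phi>1 p = indicator C p * divergence \<phi>1 p"
    proof (cases "p \<in> E \<longleftrightarrow> p \<in> C")
      case True then show ?thesis by (simp add: indicator_def)
    next
      case False
      then have pR: "p \<in> ?R" using CE by blast
      then have UV: "U p \<in> {u1<..<u2}" "V p \<in> {v1<..<v2}" by (auto simp: cyl_box_def U_def V_def)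
      have EC: "(p \<in> E) = (V p \<le> g (U p))" "(p \<in> C) = (V p \<le> f (U p))"
        using CR[OF pR] ER[OF pR] by (auto simp: U_def V_def)
      have "U p \<in> {a..b}"
      proof (rule ccontr)
        assume "U p \<notin> {a..b}"
        from fg[OF UV(1) this] False EC show False by simp
      qed
      moreover have "V p \<in> {c..d}" using False EC rf[OF UV(1)] rg[OF UV(1)] by auto
      ultimately have pO: "p \<in> cyl_box \<alpha> \<beta> ((u1 + 3 * a) / 4) ((3 * b + u2) / 4) ((v1 + 3 * c) / 4) ((3 * d + v2) / 4)"
        using ab cd by (auto simp: cyl_box_def U_def V_def mem_Times_iff)
      have "divergence \<phi>1 p = 0"
      proof (rule divergence_zero_open[OF open_cyl_box pO])
        fix y :: "real \<times> (real ^ 'm)" assume "y \<in> cyl_box \<alpha> \<beta> ((u1 + 3 * a) / 4) ((3 * b + u2) / 4) ((v1 + 3 * c) / 4) ((3 * d + v2) / 4)"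
        then have "K1 (U y) = 1" "K2 (V y) = 1"
          by (auto intro!: K1(5) K2(5) simp: cyl_box_def U_def V_def mem_Times_iff)
        then show "\<phi>1 y = 0" by (simp add: \<phi>1_def \<kappa>_def)
      qed
      then show ?thesis by simp
    qed
  qed
  have cB: "continuous_on ?B (\<lambda>q. h (fst q))" if "continuous_on {u1<..<u2} h" for h :: "real \<Rightarrow> real"
    by (rule continuous_on_compose2[OF that]) (auto intro!: continuous_intros)
  have cK: "continuous_on S K1" "continuous_on S K2" for S
    using C1_on_imp_continuous_on[OF K1(1)] C1_on_imp_continuous_on[OF K2(1)] continuous_on_subset by blast+
  have cK': "continuous_on ?B (\<lambda>q. K1 (fst q) * K2 (snd q))"
    by (intro continuous_intros continuous_on_compose2[OF cK(1)] continuous_on_compose2[OF cK(2)]) auto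
  define Ag where "Ag u = ?cw (u, g u) * (K1 u * sqrt (1 + (g' u)\<^sup>2))" for u
  define Af where "Af u = ?cw (u, f u) * (K1 u * sqrt (1 + (f' u)\<^sup>2))" for u
  \<comment> \<open>Both graphs have heights in \<open>{c..d}\<close>, where \<open>K2\<close> is 1,
    so the vertical cutoff is invisible on the graphs.\<close>
  have K2f: "K1 u * K2 (f u) = K1 u" "K1 u * K2 (g u) = K1 u" for u
  proof -
    have "K1 u = 0" if "u \<notin> {u1<..<u2}" using that ab by (intro K1(4)) auto
    moreover have "K2 (f u) = 1" "K2 (g u) = 1" if "u \<in> {u1<..<u2}"
      using rf[OF that] rg[OF that] cd by (auto intro!: K2(5))
    ultimately show "K1 u * K2 (f u) = K1 u" "K1 u * K2 (g u) = K1 u" by (cases "u \<in> {u1<..<u2}"; auto)+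
  qed
  have intA: "integrable lborel (\<lambda>u. ?cw (u, h u) * (K1 u * k u))"
    if "continuous_on {u1<..<u2} h" "continuous_on {u1<..<u2} k" for h k
  proof (rule integrable_of_compact_support[of _ "{(u1 + a) / 2..(b + u2) / 2}"])
    show "continuous_on UNIV (\<lambda>u. ?cw (u, h u) * (K1 u * k u))"
      by (rule continuous_on_zero_extend[of "{u1<..<u2}" "{(u1 + a) / 2..(b + u2) / 2}"])
        (use ab K1(4) that in \<open>auto intro!: continuous_intros cK continuous_on_compose2[OF continuous_on_cyl_weight[of UNIV]]\<close>)
  qed (use K1(4) in auto)
  have cf: "continuous_on {u1<..<u2} f" "continuous_on {u1<..<u2} g"
    using DERIV_isCont[OF f] DERIV_isCont[OF g] by (simp_all add: continuous_at_imp_continuous_on)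
  have iAf: "integrable lborel Af" and iAg: "integrable lborel Ag"
    unfolding Af_def[abs_def] Ag_def[abs_def] by (intro intA cf continuous_intros f' g')+
  have up: "integral\<^sup>L lborel (\<lambda>p. indicator E p * divergence \<phi>2 p) \<le> integral\<^sup>L lborel Ag"
  proof -
    let ?F = "\<lambda>q. K1 (fst q) * K2 (snd q) * sqrt (1 + (g' (fst q))\<^sup>2)"
    have "integral\<^sup>L lborel (\<lambda>p. indicator E p * divergence \<phi>2 p) \<le>
        integral\<^sup>L lborel (\<lambda>u. ?cw (u, g u) * ?F (u, g u))"
    proof (rule gauss_green_eval(1)[OF m fr pos g g' gm Q C1(2) _ _ _ E ER])
      show "continuous_on ?B ?F" by (intro continuous_intros cK' cB g')
      show "?F q = 0" if "q \<notin> ?Q" for q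
        using that K1(4)[of "fst q"] K2(4)[of "snd q"] by (auto simp: mem_Times_iff)
      show "\<phi>2 p = 0" if "cyl_coords \<alpha> \<beta> p \<notin> ?Q" for p using \<kappa>0[OF that] by (simp add: \<phi>2_def)
      fix p :: "real \<times> (real ^ 'm)"
      let ?D = "cyl_deriv \<alpha> \<beta> p (\<phi> p)"
      have s: "cyl_deriv \<alpha> \<beta> p (\<phi>2 p) = \<kappa> p *\<^sub>R ?D"
        by (simp add: cyl_deriv_def \<phi>2_def frame_coords_def algebra_simps)
      have "norm (fst ?D, snd ?D) \<le> 1"
        using norm_cyl_deriv_le[OF fr, of p "\<phi> p"] \<phi>'(3)[of p] by simp
      from tangential_slope_bound[OF this, of "g' (U p)"]
      have "\<kappa> p * (snd ?D - g' (U p) * fst ?D) \<le> \<kappa> p * sqrt (1 + (g' (U p))\<^sup>2)"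
        using \<kappa>01 by (intro mult_left_mono)
      then show "snd (cyl_deriv \<alpha> \<beta> p (\<phi>2 p)) - g' (fst (cyl_coords \<alpha> \<beta> p)) * fst (cyl_deriv \<alpha> \<beta> p (\<phi>2 p))
          \<le> ?F (cyl_coords \<alpha> \<beta> p)"
        unfolding s by (simp add: U_def V_def \<kappa>_def algebra_simps)
    qed
    also have "(\<lambda>u. ?cw (u, g u) * ?F (u, g u)) = Ag"
      by (simp add: Ag_def fun_eq_iff K2f)
    finally show ?thesis .
  qed
  define M where "M = integral\<^sup>L lborel (\<lambda>u. ?cw (u, f u) * (K1 u * 1))"
  have low: "integral\<^sup>L lborel (\<lambda>p. indicator C p * divergence \<phi>1 p) \<le> Pc - integral\<^sup>L lborel Af + 2 * e * M" if e: "e > 0" for e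
  proof -
    \<comment> \<open>The slope \<open>f'\<close> is merely continuous; a polynomial uniformly close
      to it makes the normal field \<open>C^1\<close>.\<close>
    have "continuous_on {(u1 + a) / 2..(b + u2) / 2} f'"
      by (rule continuous_on_subset[OF f']) (use ab in auto)
    from Stone_Weierstrass_real_polynomial_function[OF compact_Icc this e]
    obtain q where q: "real_polynomial_function q"
      "\<And>u. u \<in> {(u1 + a) / 2..(b + u2) / 2} \<Longrightarrow> \<bar>f' u - q u\<bar> < e" by blast
    obtain q' where q': "real_polynomial_function q'" "\<And>u. (q has_real_derivative q' u) (at u)"
      using has_real_derivative_polynomial_function[OF q(1)] by blast
    have cq: "continuous_on S q" "continuous_on S q'" for S
      using q(1) q'(1) continuous_on_polymonial_function real_polynomial_function_eq by blast+
    have Cq: "C1_on UNIV q" using q' cq by (intro C1_on_real_derivI) auto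
    define N where "N p = \<kappa> p *\<^sub>R cyl_normal \<alpha> \<beta> q p" for p
    have CN: "C1_on UNIV N"
      by (rule C1_on_zero_extend[OF oR KQ(2,3)])
        (auto simp: N_def[abs_def] \<kappa>0 intro!: C1_on_scaleR C\<kappa>R C1_on_subset[OF C1_on_cyl_normal[OF Cq] sub])
    have N0: "N p = 0" if "p \<notin> ?KQ" for p using \<kappa>0[of p] that by (auto simp: N_def)
    let ?T = "\<lambda>p. \<phi>1 p + N p"
    have T: "?T \<in> test_fields"
      unfolding test_fields_iff
    proof (intro conjI allI)
      show "C1_on UNIV ?T" by (intro C1_on_add C1 CN)
      show "compact (closure {x. ?T x \<noteq> 0})"
        by (rule compact_closure_support[of "S \<union> ?KQ"])
          (use \<phi>'(2) KQ(1) \<phi>s N0 in \<open>auto simp: \<phi>1_def\<close>)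
      fix p
      have "norm (?T p) \<le> norm (\<phi>1 p) + norm (N p)" by (rule norm_triangle_ineq)
      also have "\<dots> \<le> (1 - \<kappa> p) * 1 + \<kappa> p * 1"
        unfolding \<phi>1_def N_def norm_scaleR using \<kappa>01[of p] \<phi>'(3)[of p] norm_cyl_normal_le[OF fr, of q p]
        by (intro add_mono mult_mono) auto
      finally show "norm (?T p) \<le> 1" by simp
    qed
    have intN: "integrable lborel (\<lambda>p. indicator C p * divergence N p)"
      by (rule integrable_indicator_divergence[OF CN KQ(1) N0 C])
    have "ereal (integral\<^sup>L lborel (\<lambda>p. indicator C p * divergence ?T p)) \<le> ereal Pc"
      using perimeter_ge[OF T C] P by simp
    moreover have "integral\<^sup>L lborel (\<lambda>p. indicator C p * divergence ?T p) =
       integral\<^sup>L lborel (\<lambda>p. indicator C p * divergence \<phi>1 p) + integral\<^sup>L lborel (\<lambda>p. indicator C p * divergence N p)"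
      using divergence_add[OF C1(1) CN] int1[OF C] intN by (simp add: distrib_left)
    moreover have "integral\<^sup>L lborel (\<lambda>p. indicator C p * divergence N p) \<ge> integral\<^sup>L lborel Af - 2 * e * M"
    proof -
      let ?F = "\<lambda>z. K1 (fst z) * K2 (snd z) * ((1 + f' (fst z) * q (fst z)) / sqrt (1 + q (fst z) * q (fst z)))"
      have sn: "sqrt (1 + t * t) \<noteq> 0" for t :: real using one_plus_square_pos[of t] by simp
      have "integral\<^sup>L lborel (\<lambda>p. indicator C p * divergence N p) =
          integral\<^sup>L lborel (\<lambda>u. ?cw (u, f u) * ?F (u, f u))"
      proof (rule gauss_green_eval(2)[OF m fr pos f f' fm Q CN _ _ _ C CR])
        show "continuous_on ?B ?F" using sn by (intro continuous_intros cK' cB f' cq) auto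
        show "?F q = 0" if "q \<notin> ?Q" for q
          using that K1(4)[of "fst q"] K2(4)[of "snd q"] by (auto simp: mem_Times_iff)
        show "N p = 0" if "cyl_coords \<alpha> \<beta> p \<notin> ?Q" for p using \<kappa>0[OF that] by (simp add: N_def)
        fix p :: "real \<times> (real ^ 'm)" assume pR: "p \<in> ?R"
        have s: "cyl_deriv \<alpha> \<beta> p (N p) = \<kappa> p *\<^sub>R cyl_deriv \<alpha> \<beta> p (cyl_normal \<alpha> \<beta> q p)"
          by (simp add: cyl_deriv_def N_def frame_coords_def algebra_simps)
        show "snd (cyl_deriv \<alpha> \<beta> p (N p)) - f' (fst (cyl_coords \<alpha> \<beta> p)) * fst (cyl_deriv \<alpha> \<beta> p (N p))
            = ?F (cyl_coords \<alpha> \<beta> p)"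
          unfolding s cyl_deriv_normal[OF fr nz[OF pR]]
          by (simp add: U_def V_def \<kappa>_def add_divide_distrib algebra_simps)
      qed
      also have "(\<lambda>u. ?cw (u, f u) * ?F (u, f u)) =
          (\<lambda>u. ?cw (u, f u) * (K1 u * ((1 + f' u * q u) / sqrt (1 + q u * q u))))"
        by (simp only: fst_conv snd_conv K2f)
      also have "integral\<^sup>L lborel \<dots> \<ge> integral\<^sup>L lborel (\<lambda>u. Af u - 2 * e * (?cw (u, f u) * (K1 u * 1)))"
      proof (rule integral_mono)
        show "integrable lborel (\<lambda>u. Af u - 2 * e * (?cw (u, f u) * (K1 u * 1)))"
          by (intro Bochner_Integration.integrable_diff iAf integrable_mult_right intA cf continuous_intros)
        show "integrable lborel (\<lambda>u. ?cw (u, f u) * (K1 u * ((1 + f' u * q u) / sqrt (1 + q u * q u))))"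
          using sn by (intro intA cf continuous_intros f' cq) auto
        fix u
        show "Af u - 2 * e * (?cw (u, f u) * (K1 u * 1)) \<le> ?cw (u, f u) * (K1 u * ((1 + f' u * q u) / sqrt (1 + q u * q u)))"
        proof (cases "u \<in> {(u1 + a) / 2..(b + u2) / 2}")
          case True
          have "sqrt (1 + (f' u)\<^sup>2) - 2 * e \<le> (1 + f' u * q u) / sqrt (1 + q u * q u)"
            using q(2)[OF True] by (intro slope_approx) simp
          then have "?cw (u, f u) * K1 u * (sqrt (1 + (f' u)\<^sup>2) - 2 * e) \<le>
              ?cw (u, f u) * K1 u * ((1 + f' u * q u) / sqrt (1 + q u * q u))"
            using K1(2) cyl_weight_nonneg by (intro mult_left_mono mult_nonneg_nonneg)
          then show ?thesis by (simp add: Af_def algebra_simps)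
        next
          case False
          then show ?thesis using K1(4)[OF False] by (simp add: Af_def)
        qed
      qed
      also have "integral\<^sup>L lborel (\<lambda>u. Af u - 2 * e * (?cw (u, f u) * (K1 u * 1))) = integral\<^sup>L lborel Af - 2 * e * M"
      proof -
        have "integrable lborel (\<lambda>u. 2 * e * (?cw (u, f u) * (K1 u * 1)))"
          by (intro integrable_mult_right intA cf continuous_intros)
        from Bochner_Integration.integral_diff[OF iAf this] show ?thesis
          by (simp only: M_def integral_mult_right_zero)
      qed
      finally show ?thesis .
    qed
    ultimately show ?thesis by simp
  qed
  have low0: "integral\<^sup>L lborel (\<lambda>p. indicator C p * divergence \<phi>1 p) \<le> Pc - integral\<^sup>L lborel Af"
  proof (rule field_le_epsilon)
    fix e :: real assume e: "e > 0"
    have M0: "M \<ge> 0" unfolding M_def by (rule Bochner_Integration.integral_nonneg) (simp add: K1(2) cyl_weight_nonneg)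
    \<comment> \<open>\<open>M + 1\<close> instead of \<open>M\<close>, since \<open>M\<close> may
      be 0.\<close>
    define \<epsilon> where "\<epsilon> = e / (2 * (M + 1))"
    have \<epsilon>: "\<epsilon> > 0" using e M0 by (simp add: \<epsilon>_def)
    have "2 * \<epsilon> * M = e * (M / (M + 1))" using M0 by (simp add: \<epsilon>_def field_simps)
    also have "\<dots> \<le> e * 1" using e M0 by (intro mult_left_mono) auto
    finally show "integral\<^sup>L lborel (\<lambda>p. indicator C p * divergence \<phi>1 p) \<le> Pc - integral\<^sup>L lborel Af + e"
      using low[OF \<epsilon>] by simp
  qed
  define Bg where "Bg u = indicator {a..b} u * (?cw (u, g u) * sqrt (1 + (g' u)\<^sup>2))" for u
  define Bf where "Bf u = indicator {a..b} u * (?cw (u, f u) * sqrt (1 + (f' u)\<^sup>2))" for u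
  \<comment> \<open>On \<open>{a..b}\<close> the cutoff \<open>K1\<close> is 1, and elsewhere the
    two integrands agree; in the difference \<open>K1\<close> can be traded for the indicator of
    \<open>{a..b}\<close>.\<close>
  have diff: "Ag u - Af u = Bg u - Bf u" for u
  proof (cases "u \<in> {a..b}")
    case True
    then have "K1 u = 1" using ab by (intro K1(5)) auto
    then show ?thesis using True by (simp add: Ag_def Af_def Bg_def Bf_def)
  next
    case False
    have "Ag u = Af u"
    proof (cases "u \<in> {u1<..<u2}")
      case True then show ?thesis using fg[OF True False] by (simp add: Ag_def Af_def)
    next
      case out: False
      then have "K1 u = 0" using ab by (intro K1(4)) auto
      then show ?thesis by (simp add: Ag_def Af_def)
    qed
    then show ?thesis using False by (simp add: Bg_def Bf_def)
  qed
  have iB: "integrable lborel (\<lambda>u. indicator {a..b} u * (?cw (u, h u) * k u))"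
    if "continuous_on {u1<..<u2} h" "continuous_on {u1<..<u2} k" for h k
  proof -
    have "integrable lborel (\<lambda>u. indicator {a..b} u *\<^sub>R (?cw (u, h u) * k u))"
      using ab that
      by (intro borel_integrable_compact continuous_intros continuous_on_compose2[OF continuous_on_cyl_weight[of UNIV]])
        (auto intro: continuous_on_subset)
    then show ?thesis by simp
  qed
  have "integral\<^sup>L lborel Ag - integral\<^sup>L lborel Af = integral\<^sup>L lborel Bg - integral\<^sup>L lborel Bf"
  proof -
    have "integrable lborel Bg" "integrable lborel Bf"
      unfolding Bg_def[abs_def] Bf_def[abs_def] by (intro iB cf continuous_intros f' g')+
    then show ?thesis
      using iAf iAg diff by (simp flip: Bochner_Integration.integral_diff)
  qed
  then show "integral\<^sup>L lborel (\<lambda>p. indicator E p * divergence \<phi> p) \<le> Pc +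
    integral\<^sup>L lborel (\<lambda>u. indicator {a..b} u * (?cw (u, g u) * sqrt (1 + (g' u)\<^sup>2))) -
    integral\<^sup>L lborel (\<lambda>u. indicator {a..b} u * (?cw (u, f u) * sqrt (1 + (f' u)\<^sup>2)))"
    using split\<phi> same up low0 unfolding Bg_def[symmetric] Bf_def[symmetric] by linarith
qed

section \<open>The Cheeger constant is finite and positive\<close>

text \<open>A symmetric difference quotient of \<open>r^N\<close>; up to the volume of the unit ball
  it measures the annulus in the next lemma.\<close>

lemma annulus_volume_quotient:
  assumes "(r::real) > 0"
  shows "(\<lambda>k. real (Suc k) * ((r + 1 / real (Suc k)) ^ N - (r - 1 / real (Suc k)) ^ N)) \<longlonglongrightarrow> 2 * (real N * r ^ (N - 1))"
proof -
  have d: "((\<lambda>t. (t::real) ^ N) has_real_derivative real N * r ^ (N - 1)) (at r)"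
    by (auto intro!: derivative_eq_intros)
  have l: "((\<lambda>h. ((r + h) ^ N - r ^ N) / h) \<longlongrightarrow> real N * r ^ (N - 1)) (at 0)"
    using d by (simp add: DERIV_def)
  have f1: "filterlim (\<lambda>k. 1 / real (Suc k)) (at 0) sequentially"
    by (intro filterlim_atI) (use LIMSEQ_inverse_real_of_nat in \<open>auto simp: inverse_eq_divide\<close>)
  have f2: "filterlim (\<lambda>k. - 1 / real (Suc k)) (at 0) sequentially"
    by (intro filterlim_atI) (use tendsto_minus[OF LIMSEQ_inverse_real_of_nat] in \<open>auto simp: inverse_eq_divide\<close>)
  have "(\<lambda>k. ((r + 1 / real (Suc k)) ^ N - r ^ N) / (1 / real (Suc k)) + ((r + - 1 / real (Suc k)) ^ N - r ^ N) / (- 1 / real (Suc k)))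
      \<longlonglongrightarrow> real N * r ^ (N - 1) + real N * r ^ (N - 1)"
    by (intro tendsto_add filterlim_compose[OF l f1] filterlim_compose[OF l f2])
  moreover have "((r + 1 / real (Suc k)) ^ N - r ^ N) / (1 / real (Suc k)) + ((r + - 1 / real (Suc k)) ^ N - r ^ N) / (- 1 / real (Suc k))
     = real (Suc k) * ((r + 1 / real (Suc k)) ^ N - (r - 1 / real (Suc k)) ^ N)" for k
    by (simp add: algebra_simps del: of_nat_Suc)
  ultimately show ?thesis by simp
qed

text \<open>For each coordinate direction \<open>b\<close>, the integrals over the ball of
  \<open>g\<close> and of its translate by \<open>t\<close> in direction \<open>b\<close> differ by
  at most the volume of the annulus between radii \<open>r - t\<close> and \<open>r + t\<close>.
  Divided by \<open>t\<close> this stays bounded. Adding the coordinates gives a crude constant, but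
  finiteness is all that is asked.\<close>

lemma perimeter_ball_finite:
  fixes x :: "'a::euclidean_space"
  assumes r: "r > 0"
  shows "perimeter (ball x r) < \<infinity>"
proof -
  let ?N = "DIM('a)"
  let ?c = "unit_ball_vol (real ?N)"
  define c where "c = ?c * (2 * (real ?N * r ^ (?N - 1)))"
  have "perimeter (ball x r) \<le> ereal (real ?N * c)"
  proof (rule perimeter_le)
    fix \<phi> :: "'a \<Rightarrow> 'a" assume \<phi>: "\<phi> \<in> test_fields"
    define S where "S = closure {x. \<phi> x \<noteq> 0}"
    have \<phi>': "C1_on UNIV \<phi>" "compact S" "\<And>x. norm (\<phi> x) \<le> 1"
      using \<phi> unfolding test_fields_iff S_def by blast+
    have \<phi>0: "\<phi> y = 0" if "y \<notin> S" for y using that unfolding S_def by (rule zero_outside_support)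
    have one: "integrable lborel (\<lambda>y. indicator (ball x r) y * (frechet_derivative \<phi> (at y) b \<bullet> b)) \<and>
      integral\<^sup>L lborel (\<lambda>y. indicator (ball x r) y * (frechet_derivative \<phi> (at y) b \<bullet> b)) \<le> c" if b: "b \<in> Basis" for b
    proof -
      define g where "g y = \<phi> y \<bullet> b" for y
      have g: "C1_on UNIV g" unfolding g_def[abs_def] by (rule C1_on_linear_compose[OF \<phi>'(1) bounded_linear_inner_left])
      have Fg: "frechet_derivative g (at y) = (\<lambda>h. frechet_derivative \<phi> (at y) h \<bullet> b)" for y
        unfolding g_def[abs_def]
        by (rule frechet_derivative_at[symmetric] has_derivative_inner_left C1_on_frechet(1)[OF \<phi>'(1)])+ simp
      have D0: "frechet_derivative g (at y) b = 0" if "y \<notin> S" for y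
      proof -
        have "(g has_derivative (\<lambda>h. 0)) (at y)"
          by (rule has_derivative_transform_within_open[of "\<lambda>_. 0" _ _ _ "- S"])
            (use that compact_imp_closed[OF \<phi>'(2)] \<phi>0 in \<open>auto simp: g_def\<close>)
        from frechet_derivative_at[OF this] show ?thesis by (simp add: fun_eq_iff)
      qed
      have gc: "continuous_on UNIV g" using g by (rule C1_on_imp_continuous_on)
      have g0: "g y = 0" if "y \<notin> S" for y using \<phi>0[OF that] by (simp add: g_def)
      have g1: "\<bar>g y\<bar> \<le> 1" for y
        using Basis_le_norm[OF b, of "\<phi> y"] \<phi>'(3)[of y] by (simp add: g_def)
      have gi: "integrable lborel g" using integrable_of_compact_support[OF gc \<phi>'(2) g0] .
      have gm: "g \<in> borel_measurable borel" using gc by (rule borel_measurable_continuous_onI)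
      let ?B = "ball x r"
      have Bm: "?B \<in> sets borel" by simp
      have "integral\<^sup>L lborel (\<lambda>y. indicator ?B y * ((g (y + (1 / real (Suc k)) *\<^sub>R b) - g y) * real (Suc k)))
          \<le> ?c * (real (Suc k) * ((r + 1 / real (Suc k)) ^ ?N - (r - 1 / real (Suc k)) ^ ?N))"
        if k: "1 / real (Suc k) \<le> r" for k
      proof -
        let ?t = "1 / real (Suc k)"
        have t: "?t > 0" by simp
        \<comment> \<open>After translation the shift acts on the ball instead of on
          \<open>g\<close>, so that two sets are compared under the same integrand.\<close>
        define G where "G z = indicator ?B (z + (- (?t *\<^sub>R b))) * g z" for z
        have Gm: "G \<in> borel_measurable borel"
        proof -
          have "(\<lambda>z. z + (- (?t *\<^sub>R b))) \<in> borel_measurable borel"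
            by (intro borel_measurable_continuous_onI continuous_intros)
          then have "(\<lambda>z. indicator ?B (z + (- (?t *\<^sub>R b))) :: real) \<in> borel_measurable borel"
            by (rule measurable_compose) (rule borel_measurable_indicator[OF Bm])
          then show ?thesis unfolding G_def[abs_def] using gm by simp
        qed
        have iG: "integrable lborel G"
          by (rule Bochner_Integration.integrable_bound[OF gi])
            (use Gm in \<open>auto simp: G_def indicator_def\<close>)
        have iBg: "integrable lborel (\<lambda>y. indicator ?B y * g y)"
          using integrable_real_mult_indicator[OF _ gi, of ?B] by (simp add: mult.commute)
        have shift: "(\<lambda>y. indicator ?B y * g (y + ?t *\<^sub>R b)) = (\<lambda>y. G (y + ?t *\<^sub>R b))"
          by (simp add: G_def fun_eq_iff)
        have iS: "integrable lborel (\<lambda>y. indicator ?B y * g (y + ?t *\<^sub>R b))"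
          unfolding shift using integral_translate(2)[OF Gm] iG by blast
        have "integral\<^sup>L lborel (\<lambda>y. indicator ?B y * ((g (y + ?t *\<^sub>R b) - g y) * real (Suc k)))
          = integral\<^sup>L lborel (\<lambda>y. (indicator ?B y * g (y + ?t *\<^sub>R b) - indicator ?B y * g y) * real (Suc k))"
          by (simp add: algebra_simps del: of_nat_Suc)
        also have "\<dots> = (integral\<^sup>L lborel (\<lambda>y. indicator ?B y * g (y + ?t *\<^sub>R b)) - integral\<^sup>L lborel (\<lambda>y. indicator ?B y * g y)) * real (Suc k)"
          using iS iBg by (simp only: integral_mult_left_zero Bochner_Integration.integral_diff)
        also have "integral\<^sup>L lborel (\<lambda>y. indicator ?B y * g (y + ?t *\<^sub>R b)) = integral\<^sup>L lborel G"
          unfolding shift by (rule integral_translate(1)[OF Gm])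
        also have "integral\<^sup>L lborel G - integral\<^sup>L lborel (\<lambda>y. indicator ?B y * g y)
            = integral\<^sup>L lborel (\<lambda>z. G z - indicator ?B z * g z)"
          using iG iBg by simp
        also have "\<dots> \<le> integral\<^sup>L lborel (\<lambda>z. indicator (ball x (r + ?t)) z - indicator (ball x (r - ?t)) z)"
        proof (rule integral_mono)
          show "integrable lborel (\<lambda>z. G z - indicator ?B z * g z)" using iG iBg by simp
          have "integrable lborel (indicator (ball x s) :: 'a \<Rightarrow> real)" for s
            by (intro integrable_real_indicator) (use emeasure_lborel_ball_finite[of x s] in auto)
          then show "integrable lborel (\<lambda>z. indicator (ball x (r + ?t)) z - indicator (ball x (r - ?t)) z :: real)"
            by (intro Bochner_Integration.integrable_diff)
          fix z
          have nb: "norm (?t *\<^sub>R b) = ?t" using norm_Basis[OF b] t by simp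
          have d1: "dist x (z + - (?t *\<^sub>R b)) \<le> dist x z + ?t" and d2: "dist x z \<le> dist x (z + - (?t *\<^sub>R b)) + ?t"
            using dist_triangle[of x "z + - (?t *\<^sub>R b)" z] dist_triangle[of x z "z + - (?t *\<^sub>R b)"] nb
            by (auto simp: dist_norm norm_minus_commute)
          show "G z - indicator ?B z * g z \<le> indicator (ball x (r + ?t)) z - indicator (ball x (r - ?t)) z"
            using d1 d2 g1[of z] t unfolding G_def by (auto simp: indicator_def)
        qed
        also have "\<dots> = measure lborel (ball x (r + ?t)) - measure lborel (ball x (r - ?t))"
        proof -
          have "integrable lborel (indicator (ball x s) :: 'a \<Rightarrow> real)" for s
            by (intro integrable_real_indicator) (use emeasure_lborel_ball_finite[of x s] in auto)
          then show ?thesis by simp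
        qed
        also have "\<dots> = ?c * (r + ?t) ^ ?N - ?c * (r - ?t) ^ ?N"
          using k r t by (simp add: content_ball)
        finally show ?thesis by (simp add: mult_left_mono mult.commute right_diff_distrib mult.assoc mult.left_commute del: of_nat_Suc)
      qed
      moreover have "\<forall>\<^sub>F k in sequentially. 1 / real (Suc k) \<le> r"
        using order_tendstoD(2)[OF LIMSEQ_inverse_real_of_nat r]
        by eventually_elim (simp add: inverse_eq_divide)
      ultimately have ev: "\<forall>\<^sub>F k in sequentially.
          integral\<^sup>L lborel (\<lambda>y. indicator ?B y * ((g (y + (1 / real (Suc k)) *\<^sub>R b) - g y) * real (Suc k)))
          \<le> ?c * (real (Suc k) * ((r + 1 / real (Suc k)) ^ ?N - (r - 1 / real (Suc k)) ^ ?N))"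
        by (simp add: eventually_mono)
      have le: "integral\<^sup>L lborel (\<lambda>y. indicator ?B y * frechet_derivative g (at y) b) \<le> c"
        unfolding c_def
        by (rule tendsto_le[OF sequentially_bot tendsto_mult[OF tendsto_const annulus_volume_quotient[OF r]]
            difference_quotient_limit[OF g \<phi>'(2) D0 Bm] ev])
      have "integrable lborel (\<lambda>y. frechet_derivative g (at y) b)"
        by (rule integrable_of_compact_support[OF C1_on_frechet(2)[OF g] \<phi>'(2) D0])
      from integrable_real_mult_indicator[OF _ this, of ?B]
      have "integrable lborel (\<lambda>y. indicator ?B y * frechet_derivative g (at y) b)"
        by (simp add: mult.commute)
      then show ?thesis using le by (simp add: Fg)
    qed
    have "integral\<^sup>L lborel (\<lambda>y. indicator (ball x r) y * divergence \<phi> y)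
        = (\<Sum>b\<in>Basis. integral\<^sup>L lborel (\<lambda>y. indicator (ball x r) y * (frechet_derivative \<phi> (at y) b \<bullet> b)))"
      unfolding divergence_def sum_distrib_left
      by (subst Bochner_Integration.integral_sum) (use one in auto)
    also have "\<dots> \<le> (\<Sum>b\<in>(Basis::'a set). c)" using one by (intro sum_mono) auto
    finally show "integral\<^sup>L lborel (\<lambda>y. indicator (ball x r) y * divergence \<phi> y) \<le> real ?N * c" by simp
  qed simp
  then show ?thesis by (rule le_less_trans) simp
qed

lemma perimeter_nonneg:
  assumes "E \<in> sets borel" shows "perimeter E \<ge> 0"
proof -
  have d: "divergence (\<lambda>_::'a::euclidean_space. 0) x = 0" for x
    by (rule divergence_zero_open[of UNIV]) auto
  have "(\<lambda>_. 0) \<in> (test_fields :: ('a \<Rightarrow> 'a) set)"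
    by (simp add: test_fields_iff C1_on_const)
  from perimeter_ge[OF this, of E] show ?thesis using assms by (simp add: d zero_ereal_def)
qed

text \<open>Tested with a cutoff of the radial field \<open>x / (2 * R)\<close>, whose divergence on
  \<open>E\<close> is the positive constant \<open>DIM('a) / (2 * R)\<close>. The factor keeps the
  norm at most 1 on the support, a ball of radius \<open>2 * R\<close>.\<close>

lemma perimeter_pos:
  fixes E :: "'a::euclidean_space set"
  assumes E: "E \<in> sets borel" "bounded E" "measure lborel E > 0"
  shows "perimeter E > 0"
proof -
  obtain R0 where "\<And>x. x \<in> E \<Longrightarrow> norm x \<le> R0" using E(2) unfolding bounded_iff by blast
  then have R: "norm x \<le> max 1 R0" if "x \<in> E" for x using that by fastforce
  define R where "R = max 1 R0"
  have R1: "R \<ge> 1" "R > 0" by (simp_all add: R_def)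
  have "R\<^sup>2 > 0" using R1 by simp
  \<comment> \<open>The cutoff is applied to the squared norm \<open>x \<bullet> x\<close>, which is
    smooth at the origin. The lower thresholds are arbitrary negative numbers; only the upper ones
    are ever reached.\<close>
  then have "-2 < (-1::real)" "2 * R\<^sup>2 < 4 * R\<^sup>2" by simp_all
  from cutoff_exists[OF this] obtain k :: "real \<Rightarrow> real" where k: "C1_on UNIV k" "\<forall>x. 0 \<le> k x" "\<forall>x. k x \<le> 1"
    "\<forall>x. x \<notin> {-2..4 * R\<^sup>2} \<longrightarrow> k x = 0" "\<forall>x\<in>{-1..2 * R\<^sup>2}. k x = 1" by blast
  define \<phi> where "\<phi> x = k (x \<bullet> x) *\<^sub>R ((1 / (2 * R)) *\<^sub>R x)" for x :: 'a
  have C: "C1_on UNIV (\<lambda>x::'a. x \<bullet> x)"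
    by (rule C1_onI[of _ _ "\<lambda>x h. x \<bullet> h + h \<bullet> x"]) (auto intro!: derivative_eq_intros continuous_intros)
  have C\<phi>: "C1_on UNIV \<phi>"
    unfolding \<phi>_def[abs_def]
    by (rule C1_on_scaleR[OF C1_on_compose_real[OF C k(1)] C1_on_bounded_linear[OF bounded_linear_scaleR_right]])
  have nR: "norm x \<le> 2 * R" if "x \<bullet> x \<le> 4 * R\<^sup>2" for x :: 'a
  proof (rule power2_le_imp_le)
    show "(norm x)\<^sup>2 \<le> (2 * R)\<^sup>2" using that by (simp add: dot_square_norm power_mult_distrib)
  qed (use R1 in simp)
  have z: "\<phi> x = 0" if "x \<notin> cball 0 (2 * R)" for x
  proof -
    have "\<not> x \<bullet> x \<le> 4 * R\<^sup>2" using nR[of x] that by auto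
    then show ?thesis using k(4) by (simp add: \<phi>_def)
  qed
  have t: "\<phi> \<in> test_fields"
    unfolding test_fields_iff
  proof (intro conjI allI)
    show "compact (closure {x. \<phi> x \<noteq> 0})"
      by (rule compact_closure_support[OF compact_cball z])
    fix x
    show "norm (\<phi> x) \<le> 1"
    proof (cases "x \<in> cball 0 (2 * R)")
      case True
      have "norm (\<phi> x) = k (x \<bullet> x) * (norm x / (2 * R))" using k(2) R1 by (simp add: \<phi>_def)
      also have "\<dots> \<le> 1" using True R1 k(2,3) by (intro mult_le_one) auto
      finally show ?thesis .
    qed (simp add: z)
  qed (rule C\<phi>)
  have dv: "divergence \<phi> x = real DIM('a) / (2 * R)" if "x \<in> E" for x
  proof -
    let ?O = "{x::'a. x \<bullet> x < 2 * R\<^sup>2}"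
    have o: "open ?O" by (intro open_Collect_less continuous_intros)
    have "norm x \<le> R" using R[OF that] by (simp add: R_def)
    then have "(norm x)\<^sup>2 \<le> R\<^sup>2" by (intro power_mono) auto
    then have "(norm x)\<^sup>2 < 2 * R\<^sup>2" using \<open>R\<^sup>2 > 0\<close> by linarith
    then have x: "x \<in> ?O" by (simp add: dot_square_norm)
    have "divergence \<phi> x = divergence (\<lambda>x. (1 / (2 * R)) *\<^sub>R x) x"
    proof (rule divergence_cong_open[OF o x])
      fix y assume "y \<in> ?O"
      moreover have "-1 \<le> y \<bullet> y" by (rule order_trans[OF _ inner_ge_zero]) simp
      ultimately have "y \<bullet> y \<in> {-1..2 * R\<^sup>2}" by auto
      then show "\<phi> y = (1 / (2 * R)) *\<^sub>R y" using k(5) by (simp add: \<phi>_def)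
    qed
    also have "\<dots> = (\<Sum>b\<in>(Basis::'a set). ((1 / (2 * R)) *\<^sub>R b) \<bullet> b)"
      by (rule divergence_eq) (rule bounded_linear_imp_has_derivative[OF bounded_linear_scaleR_right])
    also have "\<dots> = (\<Sum>b\<in>(Basis::'a set). 1 / (2 * R))" by (intro sum.cong) auto
    finally show ?thesis by simp
  qed
  have "(\<lambda>x. indicator E x * divergence \<phi> x) = (\<lambda>x. indicator E x * (real DIM('a) / (2 * R)))"
    using dv by (auto simp: indicator_def fun_eq_iff)
  then have "integral\<^sup>L lborel (\<lambda>x. indicator E x * divergence \<phi> x) = measure lborel E * (real DIM('a) / (2 * R))"
    by simp
  also have "\<dots> > 0" using E(3) R1 by (intro mult_pos_pos) auto
  finally have "0 < ereal (integral\<^sup>L lborel (\<lambda>x. indicator E x * divergence \<phi> x))" by simp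
  also have "\<dots> \<le> perimeter E" by (rule perimeter_ge[OF t E(1)])
  finally show ?thesis .
qed

text \<open>Turns the extended-real infimum into a real inequality. The constant is finite because
  \<open>\<Omega>\<close> contains a ball, and positive by \<open>perimeter_pos\<close>. A set
  contained in \<open>\<Omega>\<close> up to a null set is replaced by its intersection with
  \<open>\<Omega>\<close>, which has the same volume and perimeter.\<close>

lemma cheeger_set_real:
  fixes C :: "'a::euclidean_space set"
  assumes ch: "cheeger_set \<Omega> C" and C: "C \<in> sets borel" "bounded C" and \<Omega>: "open \<Omega>"
  obtains h where "h > 0" "perimeter C = ereal (h * measure lborel C)"
    "\<forall>E. E \<in> sets borel \<longrightarrow> bounded E \<longrightarrow> negligible (E - \<Omega>) \<longrightarrow> ereal (h * measure lborel E) \<le> perimeter E"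
proof -
  have mC: "measure lebesgue C = measure lborel C" using C(1) by (simp add: measure_completion)
  have C0: "measure lborel C > 0" and Cn: "negligible (C - \<Omega>)"
    and Cq: "perimeter C / ereal (measure lborel C) = cheeger_const \<Omega>"
    using ch by (auto simp: cheeger_set_def mC)
  have inf: "cheeger_const \<Omega> \<le> perimeter E / ereal (measure lborel E)"
    if "E \<in> sets borel" "bounded E" "E \<subseteq> \<Omega>" "measure lborel E > 0" for E
  proof -
    have "E \<in> lmeasurable" using that(1,2) by (intro bounded_set_imp_lmeasurable) auto
    moreover have "measure lebesgue E = measure lborel E" using that(1) by (simp add: measure_completion)
    ultimately show ?thesis
      unfolding cheeger_const_def using that by (intro INF_lower2[of E]) auto
  qed
  have "\<Omega> \<noteq> {}"
  proof
    assume "\<Omega> = {}"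
    then have "negligible C" using Cn by simp
    then have "measure lebesgue C = 0" by (simp add: negligible_iff_measure)
    then show False using C0 mC by simp
  qed
  then obtain x r where xr: "r > 0" "ball x r \<subseteq> \<Omega>" using \<Omega> by (metis all_not_in_conv openE)
  have mb: "measure lborel (ball x r) > 0" using xr(1) by (simp add: content_ball_pos)
  have bf: "perimeter (ball x r) < \<infinity>" by (rule perimeter_ball_finite[OF xr(1)])
  have "cheeger_const \<Omega> \<le> perimeter (ball x r) / ereal (measure lborel (ball x r))"
    by (rule inf) (use xr mb in auto)
  also have "\<dots> < \<infinity>"
    using bf perimeter_nonneg[of "ball x r"] mb by (cases "perimeter (ball x r)") auto
  finally have "perimeter C / ereal (measure lborel C) < \<infinity>" using Cq by simp
  moreover have pp: "perimeter C > 0" using perimeter_pos[OF C C0] .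
  ultimately obtain P where P: "perimeter C = ereal P" "P > 0"
    using C0 by (cases "perimeter C") auto
  define h where "h = P / measure lborel C"
  have h: "cheeger_const \<Omega> = ereal h" using Cq C0 by (simp add: P h_def)
  show thesis
  proof (rule that[of h])
    show "h > 0" using P C0 by (simp add: h_def)
    show "perimeter C = ereal (h * measure lborel C)" using P C0 by (simp add: h_def)
    show "\<forall>E. E \<in> sets borel \<longrightarrow> bounded E \<longrightarrow> negligible (E - \<Omega>) \<longrightarrow> ereal (h * measure lborel E) \<le> perimeter E"
    proof (intro allI impI)
      fix E assume E: "E \<in> sets borel" "bounded E" "negligible (E - \<Omega>)"
      have En: "E - \<Omega> \<in> null_sets lborel"
        using E \<Omega> by (simp add: negligible_iff_null_sets null_sets_completion_iff)
      then have ae: "AE x in lborel. x \<notin> E - \<Omega>" by (rule AE_not_in)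
      let ?E = "E \<inter> \<Omega>"
      have Eb: "?E \<in> sets borel" using E \<Omega> by auto
      have m: "measure lborel ?E = measure lborel E"
        by (rule measure_eq_AE) (use ae E Eb in \<open>auto elim!: eventually_mono\<close>)
      have p: "perimeter ?E = perimeter E"
      proof -
        have "(LINT x:?E|lebesgue. divergence \<phi> x) = (LINT x:E|lebesgue. divergence \<phi> x)" if "\<phi> \<in> test_fields" for \<phi>
        proof -
          have dm: "divergence \<phi> \<in> borel_measurable borel"
            using that by (intro borel_measurable_continuous_onI divergence_continuous) (auto simp: test_fields_iff)
          have mm: "(\<lambda>x. indicator X x * divergence \<phi> x) \<in> borel_measurable lborel" if "X \<in> sets borel" for X
            using borel_measurable_times[OF borel_measurable_indicator[OF that] dm] by simp
          show ?thesis
            unfolding test_field_lborel[OF that E(1)] test_field_lborel[OF that Eb]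
            by (rule integral_cong_AE[OF mm[OF Eb] mm[OF E(1)]])
              (use ae in \<open>auto elim!: eventually_mono simp: indicator_def\<close>)
        qed
        then show ?thesis unfolding perimeter_def by (intro SUP_cong) auto
      qed
      show "ereal (h * measure lborel E) \<le> perimeter E"
      proof (cases "measure lborel E > 0")
        case True
        have "ereal h \<le> perimeter ?E / ereal (measure lborel ?E)"
          unfolding h[symmetric] using True E Eb m by (intro inf) (auto intro: bounded_subset)
        then have "ereal h * ereal (measure lborel E) \<le> perimeter E"
          using True unfolding m p by (subst (asm) ereal_le_divide_pos) (auto simp: mult.commute)
        then show ?thesis by simp
      next
        case False
        then have "measure lborel E = 0" using measure_nonneg[of lborel E] by linarith
        then show ?thesis using perimeter_nonneg[OF E(1)] by (simp add: zero_ereal_def)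
      qed
    qed
  qed
qed

section \<open>First variation of a Cheeger set along a graph\<close>

lemma bounded_on_compact:
  fixes k :: "'a::topological_space \<Rightarrow> real"
  assumes "continuous_on S k" "compact S" shows "\<exists>M. \<forall>x\<in>S. \<bar>k x\<bar> \<le> M"
  using compact_imp_bounded[OF compact_continuous_image[OF assms]] unfolding bounded_iff by simp

text \<open>\<open>W\<close> is a weight independent of the height. \<open>WD\<close> asks it to lie
  below the true density where volume is gained and above it where volume is lost, so the inner
  integral in \<open>v\<close> collapses to \<open>W u * (g u - f u)\<close>. A bound from below is
  the useful one, since volume stands on the smaller side of the Cheeger inequality.\<close>

lemma volume_variation:
  fixes C E :: "(real \<times> (real ^ 'm)) set" and f g W :: "real \<Rightarrow> real"
  assumes m: "CARD('m) \<ge> 2" and fr: "frame \<alpha> \<beta>"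
    and fm: "f \<in> borel_measurable borel" and gm: "g \<in> borel_measurable borel"
    and C: "C \<in> sets borel" "bounded C" and E: "E \<in> sets borel" "bounded E"
    and CR: "\<And>p. p \<in> cyl_box \<alpha> \<beta> u1 u2 v1 v2 \<Longrightarrow>
      p \<in> C \<longleftrightarrow> snd (cyl_coords \<alpha> \<beta> p) \<le> f (fst (cyl_coords \<alpha> \<beta> p))"
    and ER: "\<And>p. p \<in> cyl_box \<alpha> \<beta> u1 u2 v1 v2 \<Longrightarrow>
      p \<in> E \<longleftrightarrow> snd (cyl_coords \<alpha> \<beta> p) \<le> g (fst (cyl_coords \<alpha> \<beta> p))"
    and CE: "\<And>p. p \<notin> cyl_box \<alpha> \<beta> u1 u2 v1 v2 \<Longrightarrow> p \<in> E \<longleftrightarrow> p \<in> C"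
    and ab: "u1 < a" "a \<le> b" "b < u2" and cd: "v1 < c" "c \<le> d" "d < v2"
    and fg: "\<And>u. u \<in> {u1<..<u2} \<Longrightarrow> u \<notin> {a..b} \<Longrightarrow> f u = g u"
    and rf: "\<And>u. u \<in> {u1<..<u2} \<Longrightarrow> f u \<in> {c..d}" and rg: "\<And>u. u \<in> {u1<..<u2} \<Longrightarrow> g u \<in> {c..d}"
    and W: "continuous_on {a..b} W"
    and WD: "\<And>u v. u \<in> {a..b} \<Longrightarrow> v \<in> {v1<..<v2} \<Longrightarrow>
      W u * (indicator {..g u} v - indicator {..f u} v)
        \<le> cyl_weight \<alpha> \<beta> TYPE('m) (u, v) * (indicator {..g u} v - indicator {..f u} v)"
  shows "integral\<^sup>L lborel (\<lambda>u. indicator {a..b} u * (W u * (g u - f u))) \<le> measure lborel E - measure lborel C"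
proof -
  let ?R = "cyl_box \<alpha> \<beta> u1 u2 v1 v2 :: (real \<times> (real ^ 'm)) set"
  let ?cw = "cyl_weight \<alpha> \<beta> TYPE('m)"
  define D :: "real \<times> real \<Rightarrow> real" where "D q = indicator {a..b} (fst q) * (indicator {v1<..<v2} (snd q) *
    (indicator {..g (fst q)} (snd q) - indicator {..f (fst q)} (snd q)))" for q
  have D0: "D q = 0" if "q \<notin> {a..b} \<times> {c..d}" for q
  proof (cases "fst q \<in> {a..b}")
    case True
    then have u: "fst q \<in> {u1<..<u2}" using ab by auto
    have "snd q < c \<or> snd q > d" using that True by (cases q) auto
    then show ?thesis using rf[OF u] rg[OF u] by (auto simp: D_def indicator_def)
  qed (simp add: D_def)
  have D1: "\<bar>D q\<bar> \<le> 1" for q by (auto simp: D_def indicator_def)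
  have [measurable]: "(fst :: real \<times> real \<Rightarrow> real) \<in> borel_measurable borel" "(snd :: real \<times> real \<Rightarrow> real) \<in> borel_measurable borel"
    by (intro borel_measurable_continuous_onI continuous_intros)+
  have lm: "(\<lambda>q. indicator {..h (fst q)} (snd q) :: real) \<in> borel_measurable (borel :: (real \<times> real) measure)"
    if [measurable]: "h \<in> borel_measurable borel" for h :: "real \<Rightarrow> real"
  proof -
    have "{q :: real \<times> real. snd q \<le> h (fst q)} \<in> sets borel" by measurable
    from borel_measurable_indicator[OF this] show ?thesis
      by (rule measurable_cong[THEN iffD1, rotated]) (auto simp: indicator_def)
  qed
  have Dm: "D \<in> borel_measurable borel"
    unfolding D_def[abs_def]
    by (intro borel_measurable_times borel_measurable_diff lm fm gm
        measurable_compose[OF _ borel_measurable_indicator]) measurable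
  have iQ: "integrable lborel (indicator ({a..b} \<times> {c..d}) :: real \<times> real \<Rightarrow> real)"
  proof (rule integrable_real_indicator)
    show "emeasure lborel ({a..b} \<times> {c..d}) < \<infinity>"
      using emeasure_lborel_cbox_finite[of "(a, c)" "(b, d)"] by (simp add: cbox_Pair_eq)
  qed (auto intro: borel_closed closed_Times)
  have bound: "integrable lborel (\<lambda>q. k q * D q)" if km: "k \<in> borel_measurable borel" and kb: "\<And>q. q \<in> {a..b} \<times> {c..d} \<Longrightarrow> \<bar>k q\<bar> \<le> M" for k M
  proof (rule Bochner_Integration.integrable_bound[OF integrable_mult_right[OF iQ, of M]])
    show "(\<lambda>q. k q * D q) \<in> borel_measurable lborel" using km Dm by simp
    show "AE q in lborel. norm (k q * D q) \<le> norm (M * indicator ({a..b} \<times> {c..d}) q)"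
    proof (rule AE_I2)
      fix q :: "real \<times> real"
      show "norm (k q * D q) \<le> norm (M * indicator ({a..b} \<times> {c..d}) q)"
      proof (cases "q \<in> {a..b} \<times> {c..d}")
        case True
        have "\<bar>k q\<bar> * \<bar>D q\<bar> \<le> \<bar>k q\<bar> * 1" by (intro mult_left_mono D1) simp
        then show ?thesis using kb[OF True] True by (simp add: abs_mult)
      qed (simp add: D0)
    qed
  qed
  have "measure lborel E - measure lborel C = integral\<^sup>L lborel (\<lambda>p. indicator E p - indicator C p)"
  proof -
    have "integrable lborel (indicator X :: real \<times> (real ^ 'm) \<Rightarrow> real)" if "X \<in> sets borel" "bounded X" for X
      using that emeasure_bounded_finite[of X] by (intro integrable_real_indicator) auto
    then show ?thesis using C E by simp
  qed
  also have "(\<lambda>p. indicator E p - indicator C p) = (\<lambda>p. D (cyl_coords \<alpha> \<beta> p) :: real)"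
  proof (rule ext)
    fix p :: "real \<times> (real ^ 'm)"
    let ?u = "fst (cyl_coords \<alpha> \<beta> p)" and ?v = "snd (cyl_coords \<alpha> \<beta> p)"
    show "indicator E p - indicator C p = D (cyl_coords \<alpha> \<beta> p)"
    proof (cases "p \<in> ?R")
      case True
      then have uv: "?u \<in> {u1<..<u2}" "?v \<in> {v1<..<v2}" by (auto simp: cyl_box_def)
      show ?thesis
      proof (cases "?u \<in> {a..b}")
        case ins: True
        then show ?thesis using uv CR[OF True] ER[OF True] by (simp add: D_def indicator_def)
      next
        case out: False
        then show ?thesis using fg[OF uv(1) out] CR[OF True] ER[OF True] by (simp add: D_def indicator_def)
      qed
    next
      case False
      then have "cyl_coords \<alpha> \<beta> p \<notin> {a..b} \<times> {c..d}" using ab cd by (auto simp: cyl_box_def mem_Times_iff)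
      then show ?thesis using CE[OF False] by (simp add: D0 indicator_def)
    qed
  qed
  also have "integral\<^sup>L lborel (\<lambda>p :: real \<times> (real ^ 'm). D (cyl_coords \<alpha> \<beta> p)) = integral\<^sup>L lborel (\<lambda>q. ?cw q * D q)"
    by (rule integral_cyl_coords[OF m fr Dm])
  also have "\<dots> \<ge> integral\<^sup>L lborel (\<lambda>q. (indicator {a..b} (fst q) * W (fst q)) * D q)"
  proof (rule integral_mono)
    obtain M where M: "\<forall>u\<in>{a..b}. \<bar>W u\<bar> \<le> M" using bounded_on_compact[OF W compact_Icc] by blast
    have "(\<lambda>u. indicator {a..b} u *\<^sub>R W u) \<in> borel_measurable borel"
      by (rule borel_measurable_continuous_on_indicator[OF _ W]) simp
    then have Wm: "(\<lambda>u. indicator {a..b} u * W u) \<in> borel_measurable borel" by simp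
    show iL: "integrable lborel (\<lambda>q. (indicator {a..b} (fst q) * W (fst q)) * D q)"
      by (rule bound[OF measurable_compose[OF _ Wm]]) (use M in \<open>auto simp: mem_Times_iff\<close>)
    have "continuous_on ({a..b} \<times> {c..d}) ?cw" by (rule continuous_on_cyl_weight)
    from bounded_on_compact[OF this compact_Times[OF compact_Icc compact_Icc]]
    obtain M' where M': "\<forall>q\<in>{a..b} \<times> {c..d}. \<bar>?cw q\<bar> \<le> M'" by blast
    show "integrable lborel (\<lambda>q. ?cw q * D q)"
      by (rule bound[OF borel_measurable_continuous_onI[OF continuous_on_cyl_weight]]) (use M' in blast)
    fix q :: "real \<times> real"
    show "(indicator {a..b} (fst q) * W (fst q)) * D q \<le> ?cw q * D q"
    proof (cases "fst q \<in> {a..b} \<and> snd q \<in> {v1<..<v2}")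
      case True
      then show ?thesis using WD[of "fst q" "snd q"] by (simp add: D_def)
    qed (auto simp: D_def)
  qed
  also have "integral\<^sup>L lborel (\<lambda>q. (indicator {a..b} (fst q) * W (fst q)) * D q) =
     integral\<^sup>L lborel (\<lambda>u. indicator {a..b} u * (W u * (g u - f u)))"
  proof -
    let ?L = "\<lambda>q. (indicator {a..b} (fst q) * W (fst q)) * D q"
    obtain M where M: "\<forall>u\<in>{a..b}. \<bar>W u\<bar> \<le> M" using bounded_on_compact[OF W compact_Icc] by blast
    have "(\<lambda>u. indicator {a..b} u *\<^sub>R W u) \<in> borel_measurable borel"
      by (rule borel_measurable_continuous_on_indicator[OF _ W]) simp
    then have Wm: "(\<lambda>u. indicator {a..b} u * W u) \<in> borel_measurable borel" by simp
    have iL: "integrable lborel ?L"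
      by (rule bound[OF measurable_compose[OF _ Wm]]) (use M in \<open>auto simp: mem_Times_iff\<close>)
    then have i: "integrable (lborel \<Otimes>\<^sub>M lborel) ?L" by (simp add: lborel_prod)
    have "integral\<^sup>L lborel ?L = integral\<^sup>L (lborel \<Otimes>\<^sub>M lborel) ?L" by (simp add: lborel_prod)
    also have "\<dots> = (\<integral>u. (\<integral>v. ?L (u, v) \<partial>lborel) \<partial>lborel)"
      by (rule lborel_pair.integral_fst'[OF i, symmetric])
    also have "(\<lambda>u. \<integral>v. ?L (u, v) \<partial>lborel) = (\<lambda>u. indicator {a..b} u * (W u * (g u - f u)))"
    proof (rule ext)
      fix u
      show "(\<integral>v. ?L (u, v) \<partial>lborel) = indicator {a..b} u * (W u * (g u - f u))"
      proof (cases "u \<in> {a..b}")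
        case True
        then have u: "u \<in> {u1<..<u2}" using ab by auto
        have r: "v1 < g u" "g u < v2" "v1 < f u" "f u < v2" using rf[OF u] rg[OF u] cd by auto
        have e: "?L (u, v) = W u * (indicator {v1<..g u} v - indicator {v1<..f u} v)" for v
          using True r by (auto simp: D_def indicator_def)
        have e2: "integral\<^sup>L lborel (\<lambda>v. W u * (indicator {v1<..g u} v - indicator {v1<..f u} v)) = W u * ((g u - v1) - (f u - v1))"
        proof -
          have i: "integrable lborel (indicator {v1<..t} :: real \<Rightarrow> real)" for t
            by (rule integrable_real_indicator, simp, cases "v1 \<le> t", simp_all)
          have "integral\<^sup>L lborel (\<lambda>v. indicator {v1<..g u} v - indicator {v1<..f u} v) = (g u - v1) - (f u - v1)"
            using r i by (simp add: measure_def)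
          then show ?thesis by simp
        qed
        show ?thesis unfolding e e2 using True by simp
      qed (simp add: D_def)
    qed
    finally show ?thesis .
  qed
  finally show ?thesis .
qed

text \<open>The competitor is \<open>C\<close> with its part in the box replaced by the subgraph of
  \<open>g\<close>. By \<open>adm\<close> the change either goes inward or takes place in a box
  inside \<open>\<Omega>\<close>; in both cases the competitor stays in \<open>\<Omega>\<close> up
  to a null set. Minimality then compares the gain of volume with the gain of perimeter.\<close>

lemma graph_variation:
  fixes C :: "(real \<times> (real ^ 'm)) set" and f f' g g' W :: "real \<Rightarrow> real"
  assumes m: "CARD('m) \<ge> 2" and fr: "frame \<alpha> \<beta>"
    and pos: "\<And>u v. u \<in> {u1<..<u2} \<Longrightarrow> v \<in> {v1<..<v2} \<Longrightarrow> \<beta> * u + \<alpha> * v > 0"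
    and f: "\<And>u. u \<in> {u1<..<u2} \<Longrightarrow> (f has_real_derivative f' u) (at u)"
    and f': "continuous_on {u1<..<u2} f'" and fm: "f \<in> borel_measurable borel"
    and g: "\<And>u. u \<in> {u1<..<u2} \<Longrightarrow> (g has_real_derivative g' u) (at u)"
    and g': "continuous_on {u1<..<u2} g'" and gm: "g \<in> borel_measurable borel"
    and C: "C \<in> sets borel" "bounded C"
    and CR: "\<And>p. p \<in> cyl_box \<alpha> \<beta> u1 u2 v1 v2 \<Longrightarrow>
      p \<in> C \<longleftrightarrow> snd (cyl_coords \<alpha> \<beta> p) \<le> f (fst (cyl_coords \<alpha> \<beta> p))"
    and ab: "u1 < a" "a \<le> b" "b < u2" and cd: "v1 < c" "c \<le> d" "d < v2"
    and fg: "\<And>u. u \<in> {u1<..<u2} \<Longrightarrow> u \<notin> {a..b} \<Longrightarrow> f u = g u \<and> f' u = g' u"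
    and rf: "\<And>u. u \<in> {u1<..<u2} \<Longrightarrow> f u \<in> {c..d}" and rg: "\<And>u. u \<in> {u1<..<u2} \<Longrightarrow> g u \<in> {c..d}"
    and W: "continuous_on {a..b} W"
    and WD: "\<And>u v. u \<in> {a..b} \<Longrightarrow> v \<in> {v1<..<v2} \<Longrightarrow>
      W u * (indicator {..g u} v - indicator {..f u} v)
        \<le> cyl_weight \<alpha> \<beta> TYPE('m) (u, v) * (indicator {..g u} v - indicator {..f u} v)"
    and h: "h \<ge> 0" and P: "perimeter C = ereal (h * measure lborel C)"
    and min: "\<forall>E. E \<in> sets borel \<longrightarrow> bounded E \<longrightarrow> negligible (E - \<Omega>) \<longrightarrow> ereal (h * measure lborel E) \<le> perimeter E"
    and C\<Omega>: "negligible (C - \<Omega>)"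
    and adm: "(\<forall>u\<in>{u1<..<u2}. g u \<le> f u) \<or> cyl_box \<alpha> \<beta> u1 u2 v1 v2 \<subseteq> \<Omega>"
  shows "h * integral {a..b} (\<lambda>u. W u * (g u - f u)) \<le>
    integral {a..b} (\<lambda>u. cyl_weight \<alpha> \<beta> TYPE('m) (u, g u) * sqrt (1 + (g' u)\<^sup>2)
      - cyl_weight \<alpha> \<beta> TYPE('m) (u, f u) * sqrt (1 + (f' u)\<^sup>2))"
proof -
  let ?R = "cyl_box \<alpha> \<beta> u1 u2 v1 v2 :: (real \<times> (real ^ 'm)) set"
  let ?cw = "cyl_weight \<alpha> \<beta> TYPE('m)"
  define E where "E = (C - ?R) \<union> {p \<in> ?R. snd (cyl_coords \<alpha> \<beta> p) \<le> g (fst (cyl_coords \<alpha> \<beta> p))}"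
  have ER: "p \<in> E \<longleftrightarrow> snd (cyl_coords \<alpha> \<beta> p) \<le> g (fst (cyl_coords \<alpha> \<beta> p))" if "p \<in> ?R" for p
    using that by (simp add: E_def)
  have CE: "p \<in> E \<longleftrightarrow> p \<in> C" if "p \<notin> ?R" for p using that by (simp add: E_def)
  have Rm: "?R \<in> sets borel" by (intro borel_open open_cyl_box)
  have Em: "E \<in> sets borel"
  proof -
    have [measurable]: "(\<lambda>p :: real \<times> (real ^ 'm). fst (cyl_coords \<alpha> \<beta> p)) \<in> borel_measurable borel"
      "(\<lambda>p :: real \<times> (real ^ 'm). snd (cyl_coords \<alpha> \<beta> p)) \<in> borel_measurable borel"
      by (intro borel_measurable_continuous_onI continuous_intros continuous_on_cyl_coords)+
    note [measurable] = gm
    have "{p :: real \<times> (real ^ 'm). snd (cyl_coords \<alpha> \<beta> p) \<le> g (fst (cyl_coords \<alpha> \<beta> p))} \<in> sets borel"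
      by measurable
    moreover have "E = (C - ?R) \<union> (?R \<inter> {p. snd (cyl_coords \<alpha> \<beta> p) \<le> g (fst (cyl_coords \<alpha> \<beta> p))})"
      by (auto simp: E_def)
    ultimately show ?thesis using Rm C(1) by simp
  qed
  have bR: "bounded ?R"
  proof -
    have "bounded ({u1..u2} \<times> {v1..v2})" by (intro bounded_Times bounded_closed_interval)
    then obtain M where M: "\<And>q. q \<in> {u1..u2} \<times> {v1..v2} \<Longrightarrow> norm q \<le> M" unfolding bounded_iff by blast
    have "norm p \<le> M" if "p \<in> ?R" for p
    proof -
      have "cyl_coords \<alpha> \<beta> p \<in> {u1..u2} \<times> {v1..v2}" using that by (auto simp: cyl_box_def mem_Times_iff)
      from M[OF this] show ?thesis by (simp add: norm_cyl_coords[OF fr])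
    qed
    then show ?thesis unfolding bounded_iff by blast
  qed
  have bE: "bounded E"
    by (rule bounded_subset[of "C \<union> ?R"]) (use C(2) bR in \<open>auto simp: E_def\<close>)
  have E\<Omega>: "negligible (E - \<Omega>)"
  proof (rule negligible_subset[OF C\<Omega>])
    show "E - \<Omega> \<subseteq> C - \<Omega>"
    proof
      fix p assume p: "p \<in> E - \<Omega>"
      show "p \<in> C - \<Omega>"
      proof (cases "p \<in> ?R")
        case True
        then have "\<forall>u\<in>{u1<..<u2}. g u \<le> f u" using adm p by blast
        moreover have "fst (cyl_coords \<alpha> \<beta> p) \<in> {u1<..<u2}" using True by (auto simp: cyl_box_def)
        ultimately have "g (fst (cyl_coords \<alpha> \<beta> p)) \<le> f (fst (cyl_coords \<alpha> \<beta> p))" by blast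
        then show ?thesis using ER[OF True] CR[OF True] p by auto
      qed (use CE p in auto)
    qed
  qed
  define Bg where "Bg = (\<lambda>u. indicator {a..b} u * (?cw (u, g u) * sqrt (1 + (g' u)\<^sup>2)))"
  define Bf where "Bf = (\<lambda>u. indicator {a..b} u * (?cw (u, f u) * sqrt (1 + (f' u)\<^sup>2)))"
  have p: "perimeter E \<le> ereal (h * measure lborel C + integral\<^sup>L lborel Bg - integral\<^sup>L lborel Bf)"
    unfolding Bg_def Bf_def
    by (rule perimeter_variation[OF m fr pos f f' fm g g' gm C(1) Em CR ER CE ab cd fg rf rg P])
  have fg1: "f u = g u" if "u \<in> {u1<..<u2}" "u \<notin> {a..b}" for u using fg[OF that] by simp
  have v: "integral\<^sup>L lborel (\<lambda>u. indicator {a..b} u * (W u * (g u - f u))) \<le> measure lborel E - measure lborel C"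
    by (rule volume_variation[OF m fr fm gm C Em bE CR ER CE ab cd fg1 rf rg W WD])
  have "ereal (h * measure lborel E) \<le> ereal (h * measure lborel C + integral\<^sup>L lborel Bg - integral\<^sup>L lborel Bf)"
    using min Em bE E\<Omega> p by (meson order_trans)
  then have "h * (measure lborel E - measure lborel C) \<le> integral\<^sup>L lborel Bg - integral\<^sup>L lborel Bf"
    by (simp add: algebra_simps)
  then have main: "h * integral\<^sup>L lborel (\<lambda>u. indicator {a..b} u * (W u * (g u - f u))) \<le> integral\<^sup>L lborel Bg - integral\<^sup>L lborel Bf"
    using mult_left_mono[OF v h] by linarith
  have conv: "integral\<^sup>L lborel (\<lambda>u. indicator {a..b} u * k u) = integral {a..b} k" if "continuous_on {a..b} k" for k :: "real \<Rightarrow> real"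
    using set_borel_integral_eq_integral(2)[OF borel_integrable_atLeastAtMost'[OF that]]
    by (simp add: set_lebesgue_integral_def)
  have sub: "{a..b} \<subseteq> {u1<..<u2}" using ab by auto
  have cf: "continuous_on {a..b} f" "continuous_on {a..b} g"
    using DERIV_isCont[OF f] DERIV_isCont[OF g] sub by (auto intro!: continuous_at_imp_continuous_on)
  have cf': "continuous_on {a..b} f'" "continuous_on {a..b} g'"
    using continuous_on_subset[OF f' sub] continuous_on_subset[OF g' sub] by auto
  have c1: "continuous_on {a..b} (\<lambda>u. ?cw (u, g u) * sqrt (1 + (g' u)\<^sup>2))" "continuous_on {a..b} (\<lambda>u. ?cw (u, f u) * sqrt (1 + (f' u)\<^sup>2))"
    by (intro continuous_intros cf cf' continuous_on_compose2[OF continuous_on_cyl_weight[of UNIV]]; simp)+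
  have c2: "continuous_on {a..b} (\<lambda>u. W u * (g u - f u))" by (intro continuous_intros W cf)
  have "integral {a..b} (\<lambda>u. ?cw (u, g u) * sqrt (1 + (g' u)\<^sup>2) - ?cw (u, f u) * sqrt (1 + (f' u)\<^sup>2))
     = integral\<^sup>L lborel Bg - integral\<^sup>L lborel Bf"
    unfolding Bg_def Bf_def conv[OF c1(1)] conv[OF c1(2)]
    by (intro Henstock_Kurzweil_Integration.integral_diff integrable_continuous_interval c1)
  then show ?thesis using main unfolding conv[OF c2] by simp
qed

text \<open>Second-order upper expansion of the length element, with a remainder uniform in
  \<open>p\<close>. It is the tangent bound \<open>sqrt (S^2 + x) \<le> S + x / (2 * S)\<close> at
  \<open>S = sqrt (1 + p^2)\<close>, with \<open>x = 2 * p * q + q^2\<close> and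
  \<open>S \<ge> 1\<close>.\<close>

lemma sqrt_slope_variation:
  fixes p q :: real
  shows "sqrt (1 + (p + q)\<^sup>2) - sqrt (1 + p\<^sup>2) \<le> q * (p / sqrt (1 + p\<^sup>2)) + q\<^sup>2 / 2"
proof -
  let ?S = "sqrt (1 + p\<^sup>2)"
  have S: "?S \<ge> 1" "?S * ?S = 1 + p\<^sup>2" by (simp_all add: add_pos_nonneg)
  define x where "x = 2 * p * q + q\<^sup>2"
  have "?S\<^sup>2 + x = 1 + (p + q)\<^sup>2" using S(2) by (simp add: x_def power2_eq_square algebra_simps)
  moreover have "0 \<le> (p + q)\<^sup>2" by simp
  ultimately have x: "?S\<^sup>2 + x \<ge> 1" by linarith
  then have "x \<ge> - ?S\<^sup>2" by linarith
  then have "x \<ge> - (?S * ?S)" unfolding power2_eq_square .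
  moreover have "- ?S / 2 * (2 * ?S) = - (?S * ?S)" by simp
  ultimately have "- ?S / 2 * (2 * ?S) \<le> x" by (simp only:)
  moreover have "2 * ?S > 0" using S(1) by linarith
  ultimately have "- ?S / 2 \<le> x / (2 * ?S)" by (simp only: pos_le_divide_eq)
  then have nn: "?S + x / (2 * ?S) \<ge> 0" using S(1) by linarith
  have "2 * ?S * (x / (2 * ?S)) = x" using S(1) by (intro nonzero_mult_div_cancel_left[of "2 * ?S" x, unfolded times_divide_eq_right[symmetric]]) linarith
  then have "(?S + x / (2 * ?S))\<^sup>2 = ?S\<^sup>2 + x + (x / (2 * ?S))\<^sup>2"
    unfolding power2_sum by linarith
  then have "1 + (p + q)\<^sup>2 \<le> (?S + x / (2 * ?S))\<^sup>2"
    using \<open>?S\<^sup>2 + x = 1 + (p + q)\<^sup>2\<close> by (metis le_add_same_cancel1 zero_le_power2)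
  then have "sqrt (1 + (p + q)\<^sup>2) \<le> ?S + x / (2 * ?S)" using nn by (rule real_le_lsqrt[rotated 1, OF _]) 
  also have "x / (2 * ?S) = q * (p / ?S) + q\<^sup>2 / (2 * ?S)"
    using S(1) by (simp add: x_def add_divide_distrib mult.commute)
  also have "q\<^sup>2 / (2 * ?S) \<le> q\<^sup>2 / 2" using S(1) add_pos_nonneg[of 1 "p\<^sup>2"] by (intro divide_left_mono) auto
  finally show ?thesis by simp
qed

section \<open>Test functions for the weak equation\<close>

text \<open>A second difference of truncated parabolas: the \<open>C^1\<close> step from 0 to 1 on
  \<open>[-1, 1]\<close> whose derivative is the hat function \<open>tent\<close>.\<close>

definition tent_step :: "real \<Rightarrow> real" where
  "tent_step r = ((max 0 (r + 1))\<^sup>2 - 2 * (max 0 r)\<^sup>2 + (max 0 (r - 1))\<^sup>2) / 2"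

definition tent :: "real \<Rightarrow> real" where
  "tent r = max 0 (r + 1) - 2 * max 0 r + max 0 (r - 1)"

lemma DERIV_tent_step: "(tent_step has_real_derivative tent r) (at r)"
proof -
  have s: "((\<lambda>r. (max 0 (r + c))\<^sup>2) has_real_derivative 2 * max 0 (r + c)) (at r)" for c :: real
    using DERIV_shift[of "\<lambda>r. (max 0 r)\<^sup>2" "2 * max 0 (r + c)" r c] DERIV_pos_part_square[of "r + c"] by simp
  show ?thesis
    unfolding tent_step_def[abs_def]
    by (rule DERIV_cong[OF DERIV_cdivide[OF DERIV_add[OF DERIV_diff[OF s[of 1] DERIV_cmult[OF DERIV_pos_part_square]]
        s[of "-1", simplified]]]]) (simp add: tent_def)
qed

lemma tent_nonneg: "tent r \<ge> 0" by (auto simp: tent_def max_def)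
lemma tent_zero: "\<bar>r\<bar> \<ge> 1 \<Longrightarrow> tent r = 0" by (auto simp: tent_def max_def)
lemma continuous_on_tent: "continuous_on S tent"
  unfolding tent_def[abs_def] by (intro continuous_intros)

lemma tent_step_low: "r \<le> -1 \<Longrightarrow> tent_step r = 0" by (simp add: tent_step_def max_def)
lemma tent_step_high: "r \<ge> 1 \<Longrightarrow> tent_step r = 1"
  by (simp add: tent_step_def max_def power2_eq_square algebra_simps)

lemma tent_step_mono: "r \<le> s \<Longrightarrow> tent_step r \<le> tent_step s"
  by (rule DERIV_nonneg_imp_nondecreasing) (use DERIV_tent_step tent_nonneg in blast)+

lemma tent_step_bounds: "0 \<le> tent_step r" "tent_step r \<le> 1"
  using tent_step_mono[of "min r (-1)" r] tent_step_mono[of r "max r 1"]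
    tent_step_low[of "min r (-1)"] tent_step_high[of "max r 1"] by auto

text \<open>
  The du Bois-Reymond argument: the test function rises from 0 to 1 near \<open>x\<close> and falls back near \<open>y\<close>.
\<close>

lemma weak_monotone:
  fixes M :: "real \<Rightarrow> real"
  assumes M: "continuous_on {u1<..<u2} M" and xy: "u1 < x" "x < y" "y < u2"
    and weak: "\<And>\<eta> \<eta>' a b. \<lbrakk>u1 < a; a \<le> b; b < u2; \<And>u. (\<eta> has_real_derivative \<eta>' u) (at u); continuous_on UNIV \<eta>';
      \<And>u. 0 \<le> \<eta> u; \<And>u. \<eta> u \<le> 1; \<And>u. u \<notin> {a..b} \<Longrightarrow> \<eta> u = 0; \<And>u. u \<notin> {a..b} \<Longrightarrow> \<eta>' u = 0;
      \<eta> a = 0; \<eta> b = 0\<rbrakk>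
      \<Longrightarrow> integral {a..b} (\<lambda>u. M u * \<eta>' u) \<le> 0"
  shows "M x \<le> M y"
proof (rule ccontr)
  assume "\<not> M x \<le> M y"
  \<comment> \<open>With a third of the drop, \<open>M\<close> stays above \<open>M x - e\<close>
    near \<open>x\<close> and below \<open>M y + e\<close> near \<open>y\<close>. The tested
    integral is then at least \<open>3 * e - 2 * e > 0\<close>, against \<open>weak\<close>.\<close>
  define e where "e = (M x - M y) / 3"
  have e: "e > 0" using \<open>\<not> M x \<le> M y\<close> by (simp add: e_def)
  have loc: "\<exists>d>0. \<forall>u. \<bar>u - z\<bar> < d \<longrightarrow> \<bar>M u - M z\<bar> < e" if "z \<in> {u1<..<u2}" for z
  proof -
    have "isCont M z" using M that continuous_on_eq_continuous_at[OF open_greaterThanLessThan] by blast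
    then show ?thesis using e unfolding continuous_at_eps_delta dist_real_def by simp
  qed
  obtain d1 where d1: "d1 > 0" "\<forall>u. \<bar>u - x\<bar> < d1 \<longrightarrow> \<bar>M u - M x\<bar> < e" using loc[of x] xy by auto
  obtain d2 where d2: "d2 > 0" "\<forall>u. \<bar>u - y\<bar> < d2 \<longrightarrow> \<bar>M u - M y\<bar> < e" using loc[of y] xy by auto
  note d = d1 d2
  \<comment> \<open>A third of the smallest margin keeps the two transition zones disjoint, inside
    \<open>{u1<..<u2}\<close>, and within the continuity neighbourhoods of \<open>x\<close> and
    \<open>y\<close>.\<close>
  define \<delta> where "\<delta> = Min {d1, d2, x - u1, u2 - y, y - x} / 3"
  have \<delta>: "\<delta> > 0" "\<delta> < d1" "\<delta> < d2" "\<delta> < x - u1" "\<delta> < u2 - y" "2 * \<delta> < y - x"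
  proof -
    define q where "q = Min {d1, d2, x - u1, u2 - y, y - x}"
    have "q > 0" "q \<le> d1" "q \<le> d2" "q \<le> x - u1" "q \<le> u2 - y" "q \<le> y - x"
      using d xy by (simp_all add: q_def)
    moreover have "\<delta> = q / 3" by (simp add: \<delta>_def q_def)
    ultimately show "\<delta> > 0" "\<delta> < d1" "\<delta> < d2" "\<delta> < x - u1" "\<delta> < u2 - y" "2 * \<delta> < y - x" by linarith+
  qed
  define \<eta> where "\<eta> u = tent_step ((u - x) / \<delta>) - tent_step ((u - y) / \<delta>)" for u
  define tx where "tx u = tent ((u - x) / \<delta>) / \<delta>" for u
  define ty where "ty u = tent ((u - y) / \<delta>) / \<delta>" for u
  let ?a = "x - \<delta>" and ?b = "y + \<delta>"
  have D1: "((\<lambda>u. tent_step ((u - z) / \<delta>)) has_real_derivative tent ((u - z) / \<delta>) / \<delta>) (at u)" for z u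
  proof -
    have "((\<lambda>u. (u - z) / \<delta>) has_real_derivative 1 / \<delta>) (at u)"
      using \<delta>(1) by (auto intro!: derivative_eq_intros)
    from DERIV_chain2[OF DERIV_tent_step this] show ?thesis by simp
  qed
  have D: "(\<eta> has_real_derivative tx u - ty u) (at u)" for u
    unfolding \<eta>_def[abs_def] tx_def ty_def by (intro DERIV_diff D1)
  have ct: "continuous_on S tx" "continuous_on S ty" for S
    unfolding tx_def[abs_def] ty_def[abs_def]
    using \<delta>(1) by (auto intro!: continuous_intros continuous_on_compose2[OF continuous_on_tent[of UNIV]])
  have tx0: "tx u = 0" if "\<bar>u - x\<bar> \<ge> \<delta>" for u
    unfolding tx_def using that \<delta>(1) by (subst tent_zero) (auto simp: field_simps)
  have ty0: "ty u = 0" if "\<bar>u - y\<bar> \<ge> \<delta>" for u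
    unfolding ty_def using that \<delta>(1) by (subst tent_zero) (auto simp: field_simps)
  have tp: "tx u \<ge> 0" "ty u \<ge> 0" for u using tent_nonneg \<delta>(1) by (simp_all add: tx_def ty_def)
  have lo: "tent_step ((u - z) / \<delta>) = 0" if "u \<le> z - \<delta>" for u z
    using that \<delta>(1) by (intro tent_step_low) (simp add: field_simps)
  have hi: "tent_step ((u - z) / \<delta>) = 1" if "u \<ge> z + \<delta>" for u z
    using that \<delta>(1) by (intro tent_step_high) (simp add: field_simps)
  have out: "\<eta> u = 0" if "u \<le> ?a \<or> u \<ge> ?b" for u
    using that lo[of u x] lo[of u y] hi[of x u] hi[of y u] xy \<delta> by (auto simp: \<eta>_def)
  have "integral {?a..?b} (\<lambda>u. M u * (tx u - ty u)) \<le> 0"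
  proof (rule weak[of ?a ?b \<eta> "\<lambda>u. tx u - ty u"])
    show "u1 < ?a" "?b < u2" "?a \<le> ?b" using xy \<delta> by auto
    show "(\<eta> has_real_derivative tx u - ty u) (at u)" for u by (rule D)
    show "continuous_on UNIV (\<lambda>u. tx u - ty u)" by (intro continuous_intros ct)
    show "0 \<le> \<eta> u" for u
    proof -
      have "(u - y) / \<delta> \<le> (u - x) / \<delta>" using xy \<delta>(1) by (simp add: divide_right_mono)
      from tent_step_mono[OF this] show ?thesis by (simp add: \<eta>_def)
    qed
    show "\<eta> u \<le> 1" for u
      unfolding \<eta>_def using tent_step_bounds(2)[of "(u - x) / \<delta>"] tent_step_bounds(1)[of "(u - y) / \<delta>"] by linarith
    show "\<eta> u = 0" if "u \<notin> {?a..?b}" for u using that by (intro out) auto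
    show "tx u - ty u = 0" if "u \<notin> {?a..?b}" for u
    proof -
      have "\<bar>u - x\<bar> \<ge> \<delta>" "\<bar>u - y\<bar> \<ge> \<delta>" using that xy \<delta> by auto
      then show ?thesis by (simp add: tx0 ty0)
    qed
    show "\<eta> ?a = 0" "\<eta> ?b = 0" by (intro out; simp)+
  qed
  moreover have "((\<lambda>u. (M x - e) * tx u - (M y + e) * ty u) has_integral (M x - e) - (M y + e)) {?a..?b}"
  proof -
    let ?A = "\<lambda>u. (M x - e) * tent_step ((u - x) / \<delta>) - (M y + e) * tent_step ((u - y) / \<delta>)"
    have "((\<lambda>u. (M x - e) * tx u - (M y + e) * ty u) has_integral ?A ?b - ?A ?a) {?a..?b}"
    proof (rule fundamental_theorem_of_calculus)
      show "?a \<le> ?b" using xy \<delta> by simp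
      fix u assume "u \<in> {?a..?b}"
      have "(?A has_real_derivative (M x - e) * tx u - (M y + e) * ty u) (at u)"
        unfolding tx_def ty_def by (intro DERIV_diff DERIV_cmult D1)
      then show "(?A has_vector_derivative (M x - e) * tx u - (M y + e) * ty u) (at u within {?a..?b})"
        by (simp add: has_real_derivative_iff_has_vector_derivative has_vector_derivative_at_within)
    qed
    moreover have "?A ?b = (M x - e) - (M y + e)" "?A ?a = 0"
      using lo[of ?a x] lo[of ?a y] hi[of x ?b] hi[of y ?b] xy \<delta> by simp_all
    ultimately show ?thesis by simp
  qed
  moreover have "integral {?a..?b} (\<lambda>u. (M x - e) * tx u - (M y + e) * ty u) \<le> integral {?a..?b} (\<lambda>u. M u * (tx u - ty u))"
  proof (rule integral_le)
    have sub: "{?a..?b} \<subseteq> {u1<..<u2}" using xy \<delta> by auto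
    show "(\<lambda>u. (M x - e) * tx u - (M y + e) * ty u) integrable_on {?a..?b}"
      by (intro integrable_continuous_interval continuous_intros ct)
    show "(\<lambda>u. M u * (tx u - ty u)) integrable_on {?a..?b}"
      by (intro integrable_continuous_interval continuous_intros ct continuous_on_subset[OF M sub])
    fix u
    have "(M x - e) * tx u \<le> M u * tx u"
    proof (cases "\<bar>u - x\<bar> < \<delta>")
      case True
      then have "\<bar>M u - M x\<bar> < e" using d(2) \<delta>(2) by auto
      then show ?thesis using tp by (intro mult_right_mono) auto
    qed (simp add: tx0)
    moreover have "M u * ty u \<le> (M y + e) * ty u"
    proof (cases "\<bar>u - y\<bar> < \<delta>")
      case True
      then have "\<bar>M u - M y\<bar> < e" using d(4) \<delta>(3) by auto
      then show ?thesis using tp by (intro mult_right_mono) auto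
    qed (simp add: ty0)
    ultimately show "(M x - e) * tx u - (M y + e) * ty u \<le> M u * (tx u - ty u)"
      by (simp add: right_diff_distrib)
  qed
  ultimately have "(M x - e) - (M y + e) \<le> 0" by (simp only: integral_unique)
  then show False using e by (simp add: e_def field_simps)
qed

section \<open>First variation over the radial axis and over the rotation axis\<close>

text \<open>In the frame \<open>(0, \<beta>)\<close> the radius is \<open>\<beta> * u\<close>, so
  the weight depends on \<open>u\<close> alone and the change of volume is exactly linear in the
  perturbation. The competitor is \<open>f - \<epsilon> * t * \<eta>\<close>: for
  \<open>\<epsilon> = 1\<close> it lies inside \<open>C\<close> and is always admissible, for
  \<open>\<epsilon> = -1\<close> it needs the box inside \<open>\<Omega>\<close>. The first-order
  inequality in \<open>t\<close> is the hypothesis of \<open>weak_monotone\<close> for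
  \<open>\<epsilon> * M\<close>.\<close>

lemma vertical_graph_monotone:
  fixes C :: "(real \<times> (real ^ 'm)) set" and f f' :: "real \<Rightarrow> real"
  assumes m: "CARD('m) \<ge> 2" and \<beta>: "\<beta> = 1 \<or> \<beta> = -1"
    and pos: "\<And>u. u \<in> {u1<..<u2} \<Longrightarrow> \<beta> * u > 0"
    and f: "\<And>u. u \<in> {u1<..<u2} \<Longrightarrow> (f has_real_derivative f' u) (at u)"
    and f': "continuous_on {u1<..<u2} f'" and fm: "f \<in> borel_measurable borel"
    and C: "C \<in> sets borel" "bounded C"
    and CR: "\<And>p. p \<in> cyl_box 0 \<beta> u1 u2 v1 v2 \<Longrightarrow>
      p \<in> C \<longleftrightarrow> snd (cyl_coords 0 \<beta> p) \<le> f (fst (cyl_coords 0 \<beta> p))"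
    and cd: "v1 < c" "c \<le> d" "d < v2" and rf: "\<And>u. u \<in> {u1<..<u2} \<Longrightarrow> f u \<in> {c..d}"
    and h: "h \<ge> 0" and P: "perimeter C = ereal (h * measure lborel C)"
    and min: "\<forall>E. E \<in> sets borel \<longrightarrow> bounded E \<longrightarrow> negligible (E - \<Omega>) \<longrightarrow> ereal (h * measure lborel E) \<le> perimeter E"
    and C\<Omega>: "negligible (C - \<Omega>)"
    and eps: "\<epsilon> = 1 \<or> \<epsilon> = -1 \<and> cyl_box 0 \<beta> u1 u2 v1 v2 \<subseteq> \<Omega>"
    and xy: "u1 < x" "x < y" "y < u2"
  defines "M \<equiv> \<lambda>u. (\<beta> * u) ^ (CARD('m) - 1) * (f' u / sqrt (1 + (f' u)\<^sup>2)) + h / CARD('m) * \<beta> * (\<beta> * u) ^ CARD('m)"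
  shows "\<epsilon> * M x \<le> \<epsilon> * M y"
proof (rule weak_monotone[OF _ xy, of "\<lambda>u. \<epsilon> * M u"])
  let ?m = "CARD('m)"
  have sq: "sqrt (1 + t\<^sup>2) \<noteq> 0" for t :: real by (smt (verit) real_sqrt_eq_0_iff zero_le_power2)
  show "continuous_on {u1<..<u2} (\<lambda>u. \<epsilon> * M u)"
    unfolding M_def using sq by (intro continuous_intros f') auto
  have fr: "frame 0 \<beta>" using \<beta> by (auto simp: frame_def)
  fix \<eta> \<eta>' a b
  assume ab: "u1 < a" "a \<le> b" "b < u2" and \<eta>: "\<And>u. (\<eta> has_real_derivative \<eta>' u) (at u)"
    and \<eta>'c: "continuous_on UNIV \<eta>'" and \<eta>01: "\<And>u. 0 \<le> \<eta> u" "\<And>u. \<eta> u \<le> 1"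
    and \<eta>0: "\<And>u. u \<notin> {a..b} \<Longrightarrow> \<eta> u = 0" and \<eta>'0: "\<And>u. u \<notin> {a..b} \<Longrightarrow> \<eta>' u = 0"
    and \<eta>ab: "\<eta> a = 0" "\<eta> b = 0"
  have \<eta>c: "continuous_on S \<eta>" for S
    by (rule continuous_at_imp_continuous_on) (use \<eta> DERIV_isCont in blast)
  have sub: "{a..b} \<subseteq> {u1<..<u2}" using ab by auto
  define s where "s = sphere_const TYPE('m)"
  have s: "s > 0" unfolding s_def by (rule sphere_const_pos)
  define w where "w u = s * weight ?m (\<beta> * u)" for u
  have cw: "cyl_weight 0 \<beta> TYPE('m) (u, v) = w u" for u v by (simp add: cyl_weight_def w_def s_def)
  have wc: "continuous_on S w" for S unfolding w_def[abs_def] by (intro continuous_intros)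
  have w0: "w u \<ge> 0" for u using s by (simp add: w_def weight_nonneg)
  have wu: "w u = s * (\<beta> * u) ^ (?m - 1)" if "u \<in> {u1<..<u2}" for u
    using pos[OF that] by (simp add: w_def weight_def max_def)
  define F where "F u = f' u / sqrt (1 + (f' u)\<^sup>2)" for u
  have Fc: "continuous_on {a..b} F"
    unfolding F_def using sq by (intro continuous_intros continuous_on_subset[OF f' sub]) auto
  have \<eta>'cab: "continuous_on {a..b} \<eta>'" by (rule continuous_on_subset[OF \<eta>'c]) simp
  define A where "A = integral {a..b} (\<lambda>u. w u * F u * \<eta>' u)"
  define V where "V = integral {a..b} (\<lambda>u. w u * \<eta> u)"
  define B where "B = integral {a..b} (\<lambda>u. w u * (\<eta>' u)\<^sup>2 / 2)"
  \<comment> \<open>Half the gap between the range \<open>{c..d}\<close> and the ends of the box, so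
    that the moved graph still keeps a positive distance from top and bottom.\<close>
  define t0 where "t0 = min ((c - v1) / 2) ((v2 - d) / 2)"
  have t0: "t0 > 0" using cd by (simp add: t0_def)
  have step: "\<epsilon> * A \<le> \<epsilon> * h * V + t * B" if t: "0 < t" "t < t0" for t
  proof -
    define g where "g u = f u - \<epsilon> * t * \<eta> u" for u
    define g' where "g' u = f' u - \<epsilon> * t * \<eta>' u" for u
    have e1: "\<bar>\<epsilon>\<bar> = 1" "\<epsilon> * \<epsilon> = 1" using eps by auto
    have small: "\<bar>\<epsilon> * t * \<eta> u\<bar> \<le> t" for u
      using e1 t \<eta>01[of u] by (simp add: abs_mult mult_left_le)
    have "h * integral {a..b} (\<lambda>u. w u * (g u - f u)) \<le>
      integral {a..b} (\<lambda>u. cyl_weight 0 \<beta> TYPE('m) (u, g u) * sqrt (1 + (g' u)\<^sup>2)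
        - cyl_weight 0 \<beta> TYPE('m) (u, f u) * sqrt (1 + (f' u)\<^sup>2))"
    proof (rule graph_variation[OF m fr _ f f' fm _ _ _ C CR ab, where c = "(v1 + c) / 2" and d = "(d + v2) / 2"])
      show "(g has_real_derivative g' u) (at u)" if "u \<in> {u1<..<u2}" for u
        unfolding g_def[abs_def] g'_def by (intro DERIV_diff DERIV_cmult f \<eta> that)
      show "continuous_on {u1<..<u2} g'"
        unfolding g'_def[abs_def] by (intro continuous_intros f' continuous_on_subset[OF \<eta>'c]) auto
      show "g \<in> borel_measurable borel"
        unfolding g_def[abs_def] using fm borel_measurable_continuous_onI[OF \<eta>c] by measurable
      show "\<beta> * u + 0 * v > 0" if "u \<in> {u1<..<u2}" "v \<in> {v1<..<v2}" for u v using pos[OF that(1)] by simp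
      show "v1 < (v1 + c) / 2" "(v1 + c) / 2 \<le> (d + v2) / 2" "(d + v2) / 2 < v2" using cd by auto
      show "f u = g u \<and> f' u = g' u" if "u \<in> {u1<..<u2}" "u \<notin> {a..b}" for u
        using \<eta>0[OF that(2)] \<eta>'0[OF that(2)] by (simp add: g_def g'_def)
      show "f u \<in> {(v1 + c) / 2..(d + v2) / 2}" if "u \<in> {u1<..<u2}" for u
        using rf[OF that] cd by auto
      show "g u \<in> {(v1 + c) / 2..(d + v2) / 2}" if "u \<in> {u1<..<u2}" for u
      proof -
        have "t < (c - v1) / 2" "t < (v2 - d) / 2" using t by (simp_all add: t0_def)
        moreover obtain z where z: "z = \<epsilon> * t * \<eta> u" by simp
        moreover have "z \<le> t" "- z \<le> t" using small[of u] unfolding z abs_le_iff by blast+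
        moreover have "c \<le> f u" "f u \<le> d" using rf[OF that] by simp_all
        ultimately have "(v1 + c) / 2 \<le> f u - z" "f u - z \<le> (d + v2) / 2"
          by (simp_all add: field_simps)
        then show ?thesis by (simp add: g_def z)
      qed
      show "continuous_on {a..b} w" by (rule wc)
      show "w u * (indicator {..g u} v - indicator {..f u} v) \<le>
        cyl_weight 0 \<beta> TYPE('m) (u, v) * (indicator {..g u} v - indicator {..f u} v)" for u v by (simp add: cw)
      show "(\<forall>u\<in>{u1<..<u2}. g u \<le> f u) \<or> cyl_box 0 \<beta> u1 u2 v1 v2 \<subseteq> \<Omega>"
        using eps t \<eta>01 by (auto simp: g_def)
    qed (use h P min C\<Omega> in auto)
    also have "\<dots> \<le> integral {a..b} (\<lambda>u. - \<epsilon> * t * (w u * F u * \<eta>' u) + t * t * (w u * (\<eta>' u)\<^sup>2 / 2))"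
    proof (rule integral_le)
      have cc: "continuous_on {a..b} f'" by (rule continuous_on_subset[OF f' sub])
      show "(\<lambda>u. cyl_weight 0 \<beta> TYPE('m) (u, g u) * sqrt (1 + (g' u)\<^sup>2)
        - cyl_weight 0 \<beta> TYPE('m) (u, f u) * sqrt (1 + (f' u)\<^sup>2)) integrable_on {a..b}"
        unfolding cw g'_def by (intro integrable_continuous_interval continuous_intros wc cc \<eta>'cab)
      show "(\<lambda>u. - \<epsilon> * t * (w u * F u * \<eta>' u) + t * t * (w u * (\<eta>' u)\<^sup>2 / 2)) integrable_on {a..b}"
        by (intro integrable_continuous_interval continuous_intros wc Fc \<eta>'cab) auto
      fix u
      have "sqrt (1 + (g' u)\<^sup>2) - sqrt (1 + (f' u)\<^sup>2) \<le> - (\<epsilon> * t * \<eta>' u) * F u + (\<epsilon> * t * \<eta>' u)\<^sup>2 / 2"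
        using sqrt_slope_variation[of "f' u" "- (\<epsilon> * t * \<eta>' u)"] by (simp add: g'_def F_def)
      also have "(\<epsilon> * t * \<eta>' u)\<^sup>2 = t * t * (\<eta>' u)\<^sup>2" using e1(2) by (simp add: power2_eq_square)
      finally have "w u * (sqrt (1 + (g' u)\<^sup>2) - sqrt (1 + (f' u)\<^sup>2)) \<le> w u * (- (\<epsilon> * t * \<eta>' u) * F u + t * t * (\<eta>' u)\<^sup>2 / 2)"
        using w0 by (rule mult_left_mono)
      then show "cyl_weight 0 \<beta> TYPE('m) (u, g u) * sqrt (1 + (g' u)\<^sup>2)
        - cyl_weight 0 \<beta> TYPE('m) (u, f u) * sqrt (1 + (f' u)\<^sup>2)
        \<le> - \<epsilon> * t * (w u * F u * \<eta>' u) + t * t * (w u * (\<eta>' u)\<^sup>2 / 2)"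
        unfolding cw by (simp add: algebra_simps)
    qed
    also have "\<dots> = - \<epsilon> * t * A + t * t * B"
      unfolding A_def B_def
      by (subst Henstock_Kurzweil_Integration.integral_add)
        (auto intro!: integrable_continuous_interval continuous_intros wc Fc \<eta>'cab)
    also have "integral {a..b} (\<lambda>u. w u * (g u - f u)) = - \<epsilon> * t * V"
      unfolding V_def by (simp add: g_def mult.left_commute flip: integral_mult_right)
    finally have "t * (\<epsilon> * A) \<le> t * (\<epsilon> * h * V + t * B)" by (simp add: algebra_simps)
    then show ?thesis using t(1) by simp
  qed
  \<comment> \<open>The inequality was divided by \<open>t\<close>; as \<open>t\<close> tends to 0
    the quadratic remainder disappears.\<close>
  have AV: "\<epsilon> * A \<le> \<epsilon> * h * V"
  proof (rule tendsto_lowerbound)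
    show "((\<lambda>t. \<epsilon> * h * V + t * B) \<longlongrightarrow> \<epsilon> * h * V) (at_right 0)"
      by (auto intro!: tendsto_eq_intros)
    show "\<forall>\<^sub>F t in at_right 0. \<epsilon> * A \<le> \<epsilon> * h * V + t * B"
      unfolding eventually_at_right_field using t0 step by blast
  qed simp
  \<comment> \<open>A primitive of the weight. Integration by parts puts \<open>\<eta>'\<close> on
    the volume term as well, and the two terms combine into \<open>M\<close>.\<close>
  define Wi where "Wi u = s / ?m * \<beta> * (\<beta> * u) ^ ?m" for u
  have Wi: "(Wi has_real_derivative w u) (at u)" if "u \<in> {a..b}" for u
  proof -
    have b2: "\<beta> * \<beta> = 1" using \<beta> by auto
    have "(Wi has_real_derivative s / ?m * \<beta> * (?m * (\<beta> * u) ^ (?m - 1) * \<beta>)) (at u)"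
      unfolding Wi_def[abs_def] by (auto intro!: derivative_eq_intros)
    moreover have "s / ?m * \<beta> * (?m * (\<beta> * u) ^ (?m - 1) * \<beta>) = (\<beta> * \<beta>) * (s * (\<beta> * u) ^ (?m - 1))"
      using m by (simp add: field_simps)
    moreover have "u \<in> {u1<..<u2}" using that sub by blast
    ultimately show ?thesis unfolding b2 wu[OF \<open>u \<in> {u1<..<u2}\<close>] by (simp only: mult_1_left)
  qed
  have Wic: "continuous_on {a..b} Wi" unfolding Wi_def[abs_def] by (intro continuous_intros)
  have parts: "V = - integral {a..b} (\<lambda>u. Wi u * \<eta>' u)"
  proof -
    have "((\<lambda>u. w u * \<eta> u + Wi u * \<eta>' u) has_integral Wi b * \<eta> b - Wi a * \<eta> a) {a..b}"
    proof (rule fundamental_theorem_of_calculus[OF ab(2)])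
      fix u assume "u \<in> {a..b}"
      from DERIV_mult[OF Wi[OF this] \<eta>]
      have "((\<lambda>u. Wi u * \<eta> u) has_real_derivative w u * \<eta> u + Wi u * \<eta>' u) (at u)" by (simp add: mult.commute)
      then show "((\<lambda>u. Wi u * \<eta> u) has_vector_derivative w u * \<eta> u + Wi u * \<eta>' u) (at u within {a..b})"
        by (simp add: has_real_derivative_iff_has_vector_derivative has_vector_derivative_at_within)
    qed
    then have "integral {a..b} (\<lambda>u. w u * \<eta> u + Wi u * \<eta>' u) = 0"
      using \<eta>ab by (simp add: integral_unique)
    moreover have "integral {a..b} (\<lambda>u. w u * \<eta> u + Wi u * \<eta>' u) = V + integral {a..b} (\<lambda>u. Wi u * \<eta>' u)"
      unfolding V_def
      by (intro Henstock_Kurzweil_Integration.integral_add integrable_continuous_interval continuous_intros wc \<eta>c Wic \<eta>'cab)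
    ultimately show ?thesis by simp
  qed
  have "s * integral {a..b} (\<lambda>u. \<epsilon> * M u * \<eta>' u) = integral {a..b} (\<lambda>u. \<epsilon> * (w u * F u * \<eta>' u) + \<epsilon> * h * (Wi u * \<eta>' u))"
  proof -
    have "s * (\<epsilon> * M u * \<eta>' u) = \<epsilon> * (w u * F u * \<eta>' u) + \<epsilon> * h * (Wi u * \<eta>' u)" if "u \<in> {a..b}" for u
      using wu[of u] that sub by (auto simp: M_def F_def Wi_def algebra_simps)
    then have "integral {a..b} (\<lambda>u. s * (\<epsilon> * M u * \<eta>' u)) = integral {a..b} (\<lambda>u. \<epsilon> * (w u * F u * \<eta>' u) + \<epsilon> * h * (Wi u * \<eta>' u))"
      by (intro integral_cong)
    then show ?thesis by simp
  qed
  also have "\<dots> = \<epsilon> * A + \<epsilon> * h * integral {a..b} (\<lambda>u. Wi u * \<eta>' u)"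
    unfolding A_def
    by (subst Henstock_Kurzweil_Integration.integral_add)
      (auto intro!: integrable_continuous_interval continuous_intros wc Fc \<eta>'cab Wic)
  also have "\<dots> \<le> 0" using AV parts by simp
  finally show "integral {a..b} (\<lambda>u. \<epsilon> * M u * \<eta>' u) \<le> 0" using s by (simp add: mult_le_0_iff)
qed

lemma sqrt_one_plus_le: "sqrt (1 + x\<^sup>2) \<le> 1 + x\<^sup>2 / (2::real)"
proof (rule real_le_lsqrt)
  show "1 + x\<^sup>2 \<le> (1 + x\<^sup>2 / 2)\<^sup>2" by (simp add: power2_sum power_divide)
qed auto

text \<open>An outward bump on a free horizontal segment. For \<open>\<alpha> = -1\<close> the set
  lies above the segment, and the bump approaches the axis: it gains volume while the area drops at
  first order, which is impossible. For \<open>\<alpha> = 1\<close> the first-order comparison reads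
  \<open>h * v0^k \<le> k * v0^(k-1)\<close> with \<open>k = CARD('m) - 1\<close>.\<close>

lemma horizontal_graph_bound:
  fixes C :: "(real \<times> (real ^ 'm)) set" and v0 :: real
  assumes m: "CARD('m) \<ge> 2" and \<alpha>: "\<alpha> = 1 \<or> \<alpha> = -1"
    and pos: "\<And>v. v \<in> {v1<..<v2} \<Longrightarrow> \<alpha> * v > 0" and v0: "v1 < v0" "v0 < v2" and u12: "u1 < u2"
    and C: "C \<in> sets borel" "bounded C"
    and CR: "\<And>p. p \<in> cyl_box \<alpha> 0 u1 u2 v1 v2 \<Longrightarrow> p \<in> C \<longleftrightarrow> snd (cyl_coords \<alpha> 0 p) \<le> v0"
    and h: "h \<ge> 0" and P: "perimeter C = ereal (h * measure lborel C)"
    and min: "\<forall>E. E \<in> sets borel \<longrightarrow> bounded E \<longrightarrow> negligible (E - \<Omega>) \<longrightarrow> ereal (h * measure lborel E) \<le> perimeter E"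
    and C\<Omega>: "negligible (C - \<Omega>)" and R\<Omega>: "cyl_box \<alpha> 0 u1 u2 v1 v2 \<subseteq> \<Omega>"
  shows "\<alpha> = 1 \<and> h * v0 \<le> real CARD('m) - 1"
proof -
  let ?k = "CARD('m) - 1"
  have k1: "?k \<ge> 1" using m by simp
  have fr: "frame \<alpha> 0" using \<alpha> by (auto simp: frame_def)
  define s where "s = sphere_const TYPE('m)"
  have s: "s > 0" unfolding s_def by (rule sphere_const_pos)
  have cw: "cyl_weight \<alpha> 0 TYPE('m) (u, v) = s * (\<alpha> * v) ^ ?k" if "v \<in> {v1<..<v2}" for u v
    using pos[OF that] by (simp add: cyl_weight_def weight_def s_def max_def)
  \<comment> \<open>Division into fifths gives a bump supported in the open interval with a plateau
    of positive length, whence \<open>J > 0\<close>.\<close>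
  define a where "a = u1 + (u2 - u1) / 5" define b where "b = u2 - (u2 - u1) / 5"
  define a' where "a' = u1 + 2 * (u2 - u1) / 5" define b' where "b' = u2 - 2 * (u2 - u1) / 5"
  have ab: "u1 < a" "a \<le> b" "b < u2" "a < a'" "a' < b'" "b' < b"
    unfolding a_def b_def a'_def b'_def using u12 by (auto simp: field_simps)
  obtain \<eta> :: "real \<Rightarrow> real" where \<eta>: "C1_on UNIV \<eta>" "\<forall>x. 0 \<le> \<eta> x" "\<forall>x. \<eta> x \<le> 1"
    "\<forall>x. x \<notin> {a..b} \<longrightarrow> \<eta> x = 0" "\<forall>x\<in>{a'..b'}. \<eta> x = 1"
    using cutoff_exists[OF ab(4,6)] by blast
  define \<eta>' where "\<eta>' u = frechet_derivative \<eta> (at u) 1" for u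
  have \<eta>'c: "continuous_on S \<eta>'" for S
    unfolding \<eta>'_def[abs_def] by (rule continuous_on_subset[OF C1_on_frechet(2)[OF \<eta>(1)]]) simp
  have \<eta>c: "continuous_on S \<eta>" for S
    by (rule continuous_on_subset[OF C1_on_imp_continuous_on[OF \<eta>(1)]]) simp
  have d\<eta>: "(\<eta> has_real_derivative \<eta>' u) (at u)" for u
  proof -
    have d: "(\<eta> has_derivative frechet_derivative \<eta> (at u)) (at u)" by (rule C1_on_frechet(1)[OF \<eta>(1)]) simp
    then have "frechet_derivative \<eta> (at u) h = \<eta>' u * h" for h
      using linear_cmul[OF has_derivative_linear[OF d], of h 1] by (simp add: \<eta>'_def)
    then have "frechet_derivative \<eta> (at u) = (*) (\<eta>' u)" by (rule ext)
    then show ?thesis unfolding has_field_derivative_def using d by simp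
  qed
  have \<eta>'0: "\<eta>' u = 0" if "u \<notin> {a..b}" for u
  proof -
    have "(\<eta> has_real_derivative 0) (at u)"
      by (rule has_field_derivative_transform_within_open[of "\<lambda>_. 0" 0 u "- {a..b}"]) (use that \<eta>(4) in auto)
    then show ?thesis using d\<eta> DERIV_unique by blast
  qed
  define J where "J = integral {a..b} \<eta>"
  define B where "B = integral {a..b} (\<lambda>u. (\<eta>' u)\<^sup>2 / 2)"
  have J: "J > 0"
  proof -
    have "integral {a'..b'} (\<lambda>u. 1 :: real) \<le> integral {a'..b'} \<eta>"
      using \<eta>(5) by (intro integral_le integrable_continuous_interval \<eta>c) auto
    also have "\<dots> \<le> J" unfolding J_def
      using ab \<eta>(2) by (intro integral_subset_le integrable_continuous_interval \<eta>c) auto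
    finally show ?thesis using ab by simp
  qed
  define t0 where "t0 = min 1 ((v2 - v0) / 2)"
  have t0: "t0 > 0" "t0 \<le> 1" using v0 by (auto simp: t0_def)
  \<comment> \<open>\<open>W\<close> is any constant below the weight for heights above
    \<open>v0\<close>: 0 in the first case below, the weight at \<open>v0\<close> itself in the
    second.\<close>
  have var: "h * integral {a..b} (\<lambda>u. W * (t * \<eta> u)) \<le>
      integral {a..b} (\<lambda>u. s * (\<alpha> * (v0 + t * \<eta> u)) ^ ?k * sqrt (1 + (t * \<eta>' u)\<^sup>2) - s * (\<alpha> * v0) ^ ?k)"
    if t: "0 < t" "t < t0" and W: "\<And>v. v0 \<le> v \<Longrightarrow> v < v2 \<Longrightarrow> W \<le> s * (\<alpha> * v) ^ ?k" for t W
  proof -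
    have tv: "v0 + t * \<eta> u \<in> {v0..v0 + t}" for u
      using t \<eta>(2,3) by (auto simp: mult_left_le)
    have in2: "v0 + t * \<eta> u \<in> {v1<..<v2}" "v0 \<in> {v1<..<v2}" for u
    proof -
      have "t < (v2 - v0) / 2" using t by (simp add: t0_def)
      moreover obtain z where z: "z = v0 + t * \<eta> u" by simp
      moreover have "v0 \<le> z" "z \<le> v0 + t" using tv[of u] unfolding z atLeastAtMost_iff by blast+
      moreover note v0
      ultimately have "z < v2" "v1 < z" by (simp_all add: field_simps)
      then show "v0 + t * \<eta> u \<in> {v1<..<v2}" "v0 \<in> {v1<..<v2}" using v0 unfolding z by simp_all
    qed
    have "h * integral {a..b} (\<lambda>u. W * ((v0 + t * \<eta> u) - v0)) \<le>
      integral {a..b} (\<lambda>u. cyl_weight \<alpha> 0 TYPE('m) (u, v0 + t * \<eta> u) * sqrt (1 + (t * \<eta>' u)\<^sup>2)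
        - cyl_weight \<alpha> 0 TYPE('m) (u, v0) * sqrt (1 + 0\<^sup>2))"
    proof (rule graph_variation[OF m fr _ _ _ _ _ _ _ C CR ab(1,2,3), where c = v0 and d = "v0 + t" and W = "\<lambda>_. W" and \<Omega> = \<Omega>])
      show "((\<lambda>u. v0 + t * \<eta> u) has_real_derivative t * \<eta>' u) (at u)" for u
        by (rule DERIV_cong[OF DERIV_add[OF DERIV_const DERIV_cmult[OF d\<eta>]]]) simp
      show "continuous_on {u1<..<u2} (\<lambda>u. t * \<eta>' u)" by (intro continuous_intros \<eta>'c)
      show "(\<lambda>u. v0 + t * \<eta> u) \<in> borel_measurable borel"
        by (intro borel_measurable_continuous_onI continuous_intros \<eta>c)
      show "0 * u + \<alpha> * v > 0" if "u \<in> {u1<..<u2}" "v \<in> {v1<..<v2}" for u v using pos[OF that(2)] by simp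
      show "v0 = v0 + t * \<eta> u \<and> 0 = t * \<eta>' u" if "u \<in> {u1<..<u2}" "u \<notin> {a..b}" for u
        using that \<eta>(4) \<eta>'0 by auto
      show "v0 + t < v2" using t v0 by (auto simp: t0_def)
      show "v0 + t * \<eta> u \<in> {v0..v0 + t}" for u by (rule tv)
      show "W * (indicator {..v0 + t * \<eta> u} v - indicator {..v0} v)
          \<le> cyl_weight \<alpha> 0 TYPE('m) (u, v) * (indicator {..v0 + t * \<eta> u} v - indicator {..v0} v)"
        if "v \<in> {v1<..<v2}" for u v
        using W[of v] tv[of u] that cw[OF that] by (auto simp: indicator_def)
    qed (use h P min C\<Omega> R\<Omega> v0 t in auto)
    then show ?thesis using cw[OF in2(1)] cw[OF in2(2)] by simp
  qed
  have int\<eta>: "integral {a..b} (\<lambda>u. r * \<eta> u) = r * J" for r unfolding J_def by simp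
  show ?thesis
  proof (cases "\<alpha> = 1")
    case False
    then have \<alpha>1: "\<alpha> = -1" using \<alpha> by simp
    define y0 where "y0 = - v0"
    have y0: "y0 > 0" using pos[of v0] v0 by (simp add: y0_def \<alpha>1)
    \<comment> \<open>The perimeter change is at most \<open>- t * J\<close> plus a term quadratic
      in \<open>t\<close>, up to a positive factor. Letting \<open>t\<close> tend to 0 contradicts
      \<open>J > 0\<close>.\<close>
    have "J \<le> t * (y0 * B)" if t: "0 < t" "t < t0" for t
    proof -
      have "0 \<le> integral {a..b} (\<lambda>u. s * (\<alpha> * (v0 + t * \<eta> u)) ^ ?k * sqrt (1 + (t * \<eta>' u)\<^sup>2) - s * (\<alpha> * v0) ^ ?k)"
      proof -
        have W0: "0 \<le> s * (\<alpha> * v) ^ ?k" if "v0 \<le> v" "v < v2" for v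
        proof -
          have "0 < \<alpha> * v" using that v0 by (intro pos) simp
          then have "0 < (\<alpha> * v) ^ ?k" by (rule zero_less_power)
          then show ?thesis using s by (intro less_imp_le mult_pos_pos)
        qed
        show ?thesis using var[OF t W0] by simp
      qed
      also have "\<dots> \<le> integral {a..b} (\<lambda>u. s * y0 ^ (?k - 1) * (- t * \<eta> u + t * t * y0 * ((\<eta>' u)\<^sup>2 / 2)))"
      proof (rule integral_le)
        show "(\<lambda>u. s * (\<alpha> * (v0 + t * \<eta> u)) ^ ?k * sqrt (1 + (t * \<eta>' u)\<^sup>2) - s * (\<alpha> * v0) ^ ?k) integrable_on {a..b}"
          by (intro integrable_continuous_interval continuous_intros \<eta>c \<eta>'c)
        show "(\<lambda>u. s * y0 ^ (?k - 1) * (- t * \<eta> u + t * t * y0 * ((\<eta>' u)\<^sup>2 / 2))) integrable_on {a..b}"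
          by (intro integrable_continuous_interval continuous_intros \<eta>c \<eta>'c) auto
        fix u
        define z where "z = t * \<eta> u"
        have z: "0 \<le> z" "z \<le> t" using t \<eta>(2,3) by (auto simp: z_def mult_left_le)
        have "v0 + z \<in> {v1<..<v2}" using z t v0 by (auto simp: t0_def)
        then have yz: "y0 - z > 0" using pos[of "v0 + z"] by (simp add: \<alpha>1 y0_def)
        have kk: "x ^ ?k = x ^ (?k - 1) * x" for x :: real using k1 by (metis Suc_diff_1 less_eq_Suc_le One_nat_def power_Suc2)
        \<comment> \<open>A single factor \<open>y0 - z\<close> is kept: it already carries a
          first-order loss.\<close>
        have "(y0 - z) ^ ?k \<le> y0 ^ (?k - 1) * (y0 - z)"
          unfolding kk using yz z y0 by (intro mult_right_mono power_mono) auto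
        then have "(y0 - z) ^ ?k * sqrt (1 + (t * \<eta>' u)\<^sup>2) \<le> y0 ^ (?k - 1) * (y0 - z) * (1 + (t * \<eta>' u)\<^sup>2 / 2)"
          using yz y0 by (intro mult_mono sqrt_one_plus_le) auto
        also have "\<dots> \<le> y0 ^ (?k - 1) * (y0 - z + y0 * ((t * \<eta>' u)\<^sup>2 / 2))"
        proof -
          have "(y0 - z) * ((t * \<eta>' u)\<^sup>2 / 2) \<le> y0 * ((t * \<eta>' u)\<^sup>2 / 2)" using z by (intro mult_right_mono) auto
          then have "(y0 - z) * (1 + (t * \<eta>' u)\<^sup>2 / 2) \<le> y0 - z + y0 * ((t * \<eta>' u)\<^sup>2 / 2)"
            by (simp only: distrib_left mult_1_right)
          then have "y0 ^ (?k - 1) * ((y0 - z) * (1 + (t * \<eta>' u)\<^sup>2 / 2)) \<le> y0 ^ (?k - 1) * (y0 - z + y0 * ((t * \<eta>' u)\<^sup>2 / 2))"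
            using y0 by (intro mult_left_mono) auto
          then show ?thesis by (simp only: mult.assoc)
        qed
        finally have "(y0 - z) ^ ?k * sqrt (1 + (t * \<eta>' u)\<^sup>2) - y0 ^ ?k \<le> y0 ^ (?k - 1) * (- z + y0 * ((t * \<eta>' u)\<^sup>2 / 2))"
          unfolding kk[of y0] by (simp add: algebra_simps)
        then have "s * ((y0 - z) ^ ?k * sqrt (1 + (t * \<eta>' u)\<^sup>2) - y0 ^ ?k) \<le> s * (y0 ^ (?k - 1) * (- z + y0 * ((t * \<eta>' u)\<^sup>2 / 2)))"
          using s by (intro mult_left_mono) auto
        then show "s * (\<alpha> * (v0 + t * \<eta> u)) ^ ?k * sqrt (1 + (t * \<eta>' u)\<^sup>2) - s * (\<alpha> * v0) ^ ?k
            \<le> s * y0 ^ (?k - 1) * (- t * \<eta> u + t * t * y0 * ((\<eta>' u)\<^sup>2 / 2))"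
          by (simp add: \<alpha>1 y0_def z_def power_mult_distrib power2_eq_square algebra_simps)
      qed
      also have "\<dots> = s * y0 ^ (?k - 1) * (- t * J + t * t * y0 * B)"
        unfolding J_def B_def
        by (simp only: integral_mult_right, subst Henstock_Kurzweil_Integration.integral_add)
          (auto intro!: integrable_continuous_interval continuous_intros \<eta>c \<eta>'c)
      finally have "s * y0 ^ (?k - 1) * 0 \<le> s * y0 ^ (?k - 1) * (- t * J + t * t * y0 * B)" by simp
      moreover have "s * y0 ^ (?k - 1) > 0" using s y0 by simp
      ultimately have "0 \<le> - t * J + t * t * y0 * B" by (rule mult_left_le_imp_le)
      then have "t * J \<le> t * (t * (y0 * B))" by (simp add: algebra_simps)
      then show ?thesis using t(1) by simp
    qed
    moreover have "((\<lambda>t. t * (y0 * B)) \<longlongrightarrow> 0) (at_right 0)" by (auto intro!: tendsto_eq_intros)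
    ultimately have "J \<le> 0"
      by (intro tendsto_lowerbound[of "\<lambda>t. t * (y0 * B)" 0 "at_right 0" J])
        (auto simp: eventually_at_right_field intro!: exI[of _ t0] t0)
    then show ?thesis using J by simp
  next
    case True
    have y0: "v0 > 0" using pos[of v0] v0 by (simp add: True)
    have "h * v0 ^ ?k * J \<le> real ?k * (v0 + t) ^ (?k - 1) * J + t * ((v0 + 1) ^ ?k * B)" if t: "0 < t" "t < t0" for t
    proof -
      have W: "s * v0 ^ ?k \<le> s * (\<alpha> * v) ^ ?k" if "v0 \<le> v" "v < v2" for v
        using s y0 that by (intro mult_left_mono power_mono) (auto simp: True)
      have "h * integral {a..b} (\<lambda>u. s * v0 ^ ?k * (t * \<eta> u)) \<le>
        integral {a..b} (\<lambda>u. s * (\<alpha> * (v0 + t * \<eta> u)) ^ ?k * sqrt (1 + (t * \<eta>' u)\<^sup>2) - s * (\<alpha> * v0) ^ ?k)"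
        by (rule var[OF t W])
      also have "\<dots> \<le> integral {a..b} (\<lambda>u. s * (real ?k * (v0 + t) ^ (?k - 1) * (t * \<eta> u) + (v0 + 1) ^ ?k * t * t * ((\<eta>' u)\<^sup>2 / 2)))"
      proof (rule integral_le)
        show "(\<lambda>u. s * (\<alpha> * (v0 + t * \<eta> u)) ^ ?k * sqrt (1 + (t * \<eta>' u)\<^sup>2) - s * (\<alpha> * v0) ^ ?k) integrable_on {a..b}"
          by (intro integrable_continuous_interval continuous_intros \<eta>c \<eta>'c)
        show "(\<lambda>u. s * (real ?k * (v0 + t) ^ (?k - 1) * (t * \<eta> u) + (v0 + 1) ^ ?k * t * t * ((\<eta>' u)\<^sup>2 / 2))) integrable_on {a..b}"
          by (intro integrable_continuous_interval continuous_intros \<eta>c \<eta>'c) auto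
        fix u
        define z where "z = t * \<eta> u"
        have z: "0 \<le> z" "z \<le> t" using t \<eta>(2,3) by (auto simp: z_def mult_left_le)
        have kk: "x ^ ?k = x ^ (?k - 1) * x" for x :: real using k1 by (metis Suc_diff_1 less_eq_Suc_le One_nat_def power_Suc2)
        have yz: "v0 + z > 0" using y0 z by simp
        \<comment> \<open>Bernoulli's inequality for \<open>v0 / (v0 + z)\<close> is the tangent
          bound for the power taken at the right end point, where the slope is
          \<open>k * (v0 + z)^(k-1)\<close>.\<close>
        have q: "- (z / (v0 + z)) \<ge> -1" using y0 z by (simp add: field_simps)
        have "(v0 + z) * (1 + - (z / (v0 + z))) = v0" using yz by (simp add: field_simps)
        then have "v0 ^ ?k = (v0 + z) ^ ?k * (1 + - (z / (v0 + z))) ^ ?k" by (metis power_mult_distrib)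
        also have "\<dots> \<ge> (v0 + z) ^ ?k * (1 + real ?k * - (z / (v0 + z)))"
          using yz by (intro mult_left_mono Bernoulli_inequality[OF q]) auto
        also have "(v0 + z) ^ ?k * (1 + real ?k * - (z / (v0 + z))) = (v0 + z) ^ ?k - real ?k * (v0 + z) ^ (?k - 1) * z"
          unfolding kk[of "v0 + z"] using yz by (simp add: field_simps)
        finally have 1: "(v0 + z) ^ ?k \<le> v0 ^ ?k + real ?k * (v0 + z) ^ (?k - 1) * z" by simp
        have "real ?k * (v0 + z) ^ (?k - 1) * z \<le> real ?k * (v0 + t) ^ (?k - 1) * z"
          using z yz by (intro mult_right_mono mult_left_mono power_mono) auto
        with 1 have 2: "(v0 + z) ^ ?k - v0 ^ ?k \<le> real ?k * (v0 + t) ^ (?k - 1) * z" by linarith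
        have "(v0 + z) ^ ?k * sqrt (1 + (t * \<eta>' u)\<^sup>2) \<le> (v0 + z) ^ ?k * (1 + (t * \<eta>' u)\<^sup>2 / 2)"
          using yz by (intro mult_left_mono sqrt_one_plus_le) auto
        also have "\<dots> = (v0 + z) ^ ?k + (v0 + z) ^ ?k * ((t * \<eta>' u)\<^sup>2 / 2)" by (simp only: distrib_left mult_1_right)
        also have "(v0 + z) ^ ?k * ((t * \<eta>' u)\<^sup>2 / 2) \<le> (v0 + 1) ^ ?k * ((t * \<eta>' u)\<^sup>2 / 2)"
          using z t t0 yz by (intro mult_right_mono power_mono) auto
        finally have "(v0 + z) ^ ?k * sqrt (1 + (t * \<eta>' u)\<^sup>2) - v0 ^ ?k
            \<le> real ?k * (v0 + t) ^ (?k - 1) * z + (v0 + 1) ^ ?k * ((t * \<eta>' u)\<^sup>2 / 2)"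
          using 2 by linarith
        then have "s * ((v0 + z) ^ ?k * sqrt (1 + (t * \<eta>' u)\<^sup>2) - v0 ^ ?k)
            \<le> s * (real ?k * (v0 + t) ^ (?k - 1) * z + (v0 + 1) ^ ?k * ((t * \<eta>' u)\<^sup>2 / 2))"
          using s by (intro mult_left_mono) auto
        then show "s * (\<alpha> * (v0 + t * \<eta> u)) ^ ?k * sqrt (1 + (t * \<eta>' u)\<^sup>2) - s * (\<alpha> * v0) ^ ?k
            \<le> s * (real ?k * (v0 + t) ^ (?k - 1) * (t * \<eta> u) + (v0 + 1) ^ ?k * t * t * ((\<eta>' u)\<^sup>2 / 2))"
          by (simp add: True z_def power_mult_distrib power2_eq_square algebra_simps)
      qed
      also have "\<dots> = s * (real ?k * (v0 + t) ^ (?k - 1) * (t * J) + (v0 + 1) ^ ?k * t * t * B)"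
        unfolding J_def B_def
        by (simp only: integral_mult_right, subst Henstock_Kurzweil_Integration.integral_add)
          (auto intro!: integrable_continuous_interval continuous_intros \<eta>c \<eta>'c)
      also have "integral {a..b} (\<lambda>u. s * v0 ^ ?k * (t * \<eta> u)) = s * v0 ^ ?k * (t * J)"
        unfolding J_def by (simp only: integral_mult_right)
      finally have "(s * t) * (h * v0 ^ ?k * J) \<le> (s * t) * (real ?k * (v0 + t) ^ (?k - 1) * J + t * ((v0 + 1) ^ ?k * B))"
        by (simp add: algebra_simps)
      then show ?thesis using s t(1) by simp
    qed
    moreover have "((\<lambda>t. real ?k * (v0 + t) ^ (?k - 1) * J + t * ((v0 + 1) ^ ?k * B)) \<longlongrightarrow> real ?k * v0 ^ (?k - 1) * J) (at_right 0)"
      by (auto intro!: tendsto_eq_intros)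
    ultimately have "h * v0 ^ ?k * J \<le> real ?k * v0 ^ (?k - 1) * J"
      by (intro tendsto_lowerbound[of "\<lambda>t. real ?k * (v0 + t) ^ (?k - 1) * J + t * ((v0 + 1) ^ ?k * B)" _ "at_right 0"])
        (auto simp: eventually_at_right_field intro!: exI[of _ t0] t0)
    then have "h * v0 ^ ?k \<le> real ?k * v0 ^ (?k - 1)" using J by simp
    moreover have "v0 ^ ?k = v0 ^ (?k - 1) * v0" using k1 by (metis Suc_diff_1 less_eq_Suc_le One_nat_def power_Suc2)
    ultimately have "v0 ^ (?k - 1) * (h * v0) \<le> v0 ^ (?k - 1) * real ?k" by (simp add: mult_ac)
    then have "h * v0 \<le> real ?k" using y0 by simp
    then show ?thesis using m True by (simp add: of_nat_diff)
  qed
qed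

section \<open>Closed convex profile curves\<close>

text \<open>The Jordan curve theorem \<open>Jordan_inside_outside\<close> speaks about curves in
  \<open>complex\<close>; this isometry carries components, boundedness and hence
  \<open>inside\<close> back to \<open>real \<times> real\<close>.\<close>

definition to_complex :: "real \<times> real \<Rightarrow> complex" where "to_complex q = Complex (fst q) (snd q)"
definition from_complex :: "complex \<Rightarrow> real \<times> real" where "from_complex z = (Re z, Im z)"

lemma to_from_complex [simp]: "to_complex (from_complex z) = z" "from_complex (to_complex q) = q"
  by (auto simp: to_complex_def from_complex_def)

lemma norm_to_complex: "norm (to_complex q) = norm q"
  by (cases q) (simp add: to_complex_def cmod_def norm_Pair)

lemma continuous_on_to_complex: "continuous_on S to_complex"
  unfolding to_complex_def[abs_def] Complex_eq by (intro continuous_intros)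

lemma continuous_on_from_complex: "continuous_on S from_complex"
  unfolding from_complex_def[abs_def] by (intro continuous_intros)

lemma inj_to_complex: "inj to_complex"
  by (metis injI to_from_complex(2))

lemma to_complex_image: "to_complex ` S = from_complex -` S"
proof (intro set_eqI iffI)
  fix z assume "z \<in> from_complex -` S"
  then show "z \<in> to_complex ` S" by (intro image_eqI[of _ _ "from_complex z"]) simp_all
qed auto

lemma open_to_complex_image: "open (to_complex ` S) \<longleftrightarrow> open S"
proof
  assume "open (to_complex ` S)"
  then have "open (to_complex -` (to_complex ` S))" by (intro open_vimage continuous_on_to_complex)
  then show "open S" by (simp add: inj_vimage_image_eq inj_to_complex)
next
  assume "open S" then show "open (to_complex ` S)"
    unfolding to_complex_image by (intro open_vimage continuous_on_from_complex)
qed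

lemma bounded_to_complex_image: "bounded (to_complex ` S) \<longleftrightarrow> bounded S"
  unfolding bounded_iff by (simp add: norm_to_complex)

lemma compl_to_complex_image: "to_complex ` (- S) = - (to_complex ` S)"
  unfolding to_complex_image by (simp add: vimage_Compl)

lemma connected_component_to_complex:
  "connected_component_set (to_complex ` S) (to_complex x) = to_complex ` connected_component_set S x"
proof (intro set_eqI iffI)
  fix z assume "z \<in> connected_component_set (to_complex ` S) (to_complex x)"
  then obtain t where t: "connected t" "t \<subseteq> to_complex ` S" "to_complex x \<in> t" "z \<in> t"
    unfolding connected_component_def by auto
  have "connected (from_complex ` t)" by (intro connected_continuous_image continuous_on_from_complex t)
  moreover have "from_complex ` t \<subseteq> S" using t(2) by (auto simp: to_complex_image)
  moreover have "x \<in> from_complex ` t" by (rule image_eqI[OF _ t(3)]) simp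
  moreover have "from_complex z \<in> from_complex ` t" using t(4) by simp
  ultimately have "connected_component S x (from_complex z)" unfolding connected_component_def by blast
  then show "z \<in> to_complex ` connected_component_set S x" by (simp add: to_complex_image)
next
  fix z assume "z \<in> to_complex ` connected_component_set S x"
  then obtain y where y: "z = to_complex y" "connected_component S x y" by auto
  then obtain t where t: "connected t" "t \<subseteq> S" "x \<in> t" "y \<in> t" unfolding connected_component_def by auto
  have "connected (to_complex ` t)" by (intro connected_continuous_image continuous_on_to_complex t)
  then show "z \<in> connected_component_set (to_complex ` S) (to_complex x)"
    unfolding mem_Collect_eq connected_component_def using t y by blast
qed

lemma inside_to_complex: "inside (to_complex ` S) = to_complex ` inside S"
proof (rule set_eqI)
  fix z
  define q where "q = from_complex z"
  have z: "z = to_complex q" by (simp add: q_def)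
  have "z \<in> inside (to_complex ` S) \<longleftrightarrow> q \<notin> S \<and> bounded (connected_component_set (to_complex ` (- S)) (to_complex q))"
    unfolding inside_def compl_to_complex_image z using inj_to_complex by (auto simp: inj_image_mem_iff)
  also have "\<dots> \<longleftrightarrow> q \<in> inside S"
    unfolding connected_component_to_complex bounded_to_complex_image inside_def by auto
  finally show "z \<in> inside (to_complex ` S) \<longleftrightarrow> z \<in> to_complex ` inside S"
    unfolding z using inj_to_complex by (simp add: inj_image_mem_iff)
qed

text \<open>The closed region is the complement of \<open>outside\<close>, hence closed, with
  frontier inside the curve. Conversely, by the Jordan theorem every point of the curve is a limit
  of outside points and so cannot be interior.\<close>

lemma frontier_closed_region:
  fixes c :: "real \<Rightarrow> real \<times> real"
  assumes c: "simple_path c" "pathfinish c = pathstart c"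
  shows "compact (closed_region (path_image c))" "interior (closed_region (path_image c)) \<noteq> {}"
    "frontier (closed_region (path_image c)) = path_image c"
proof -
  let ?J = "path_image c" and ?c = "to_complex \<circ> c"
  have sc: "simple_path ?c"
  proof -
    have "path ?c" unfolding path_def
      using simple_path_imp_path[OF c(1)] unfolding path_def
      by (intro continuous_on_compose continuous_on_to_complex)
    moreover have "loop_free ?c"
      using c(1) inj_to_complex unfolding simple_path_def loop_free_def by (simp add: inj_eq)
    ultimately show ?thesis by (simp add: simple_path_def)
  qed
  have pc: "pathfinish ?c = pathstart ?c" using c(2) by (simp add: pathfinish_compose pathstart_compose)
  have im: "path_image ?c = to_complex ` ?J" by (simp add: path_image_compose)
  note J = Jordan_inside_outside[OF sc pc, unfolded im]
  have cJ: "compact ?J" using c(1) by (rule compact_simple_path_image)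
  have oi: "open (inside ?J)" using J unfolding inside_to_complex open_to_complex_image by blast
  have ni: "inside ?J \<noteq> {}" using J unfolding inside_to_complex by blast
  have bi: "bounded (inside ?J)" using J unfolding inside_to_complex bounded_to_complex_image by blast
  have comp: "closed_region ?J = - outside ?J"
    using inside_Un_outside[of ?J] inside_Int_outside[of ?J] outside_no_overlap[of ?J]
    unfolding closed_region_def by blast
  have oo: "open (outside ?J)" by (rule open_outside[OF compact_imp_closed[OF cJ]])
  have cl: "closed (closed_region ?J)" unfolding comp using oo by (simp add: closed_Compl)
  have bd: "bounded (closed_region ?J)" unfolding closed_region_def using bi compact_imp_bounded[OF cJ] by simp
  show "compact (closed_region ?J)" using cl bd by (simp add: compact_eq_bounded_closed)
  show "interior (closed_region ?J) \<noteq> {}"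
    using interior_maximal[OF _ oi, of "closed_region ?J"] ni by (auto simp: closed_region_def)
  show "frontier (closed_region ?J) = ?J"
  proof
    show "frontier (closed_region ?J) \<subseteq> ?J"
      unfolding comp frontier_complement by (rule frontier_outside_subset[OF compact_imp_closed[OF cJ]])
    show "?J \<subseteq> frontier (closed_region ?J)"
    proof
      fix x assume x: "x \<in> ?J"
      have "x \<notin> interior (closed_region ?J)"
      proof
        assume "x \<in> interior (closed_region ?J)"
        then obtain T where T: "open T" "x \<in> T" "T \<subseteq> closed_region ?J" by (rule interiorE)
        have oT: "open (to_complex ` T)" using T(1) by (simp add: open_to_complex_image)
        have xT: "to_complex x \<in> to_complex ` T" using T(2) by simp
        have "frontier (outside (to_complex ` ?J)) = to_complex ` ?J" using J by blast
        then have "to_complex x \<in> frontier (outside (to_complex ` ?J))" using x by simp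
        then have "to_complex x \<in> closure (outside (to_complex ` ?J))" by (simp add: frontier_def)
        then have "to_complex ` T \<inter> outside (to_complex ` ?J) \<noteq> {}"
          using xT open_Int_closure_eq_empty[OF oT] by blast
        moreover have "to_complex ` T \<subseteq> inside (to_complex ` ?J) \<union> to_complex ` ?J"
          unfolding inside_to_complex using T(3) unfolding closed_region_def by blast
        ultimately show False
          using inside_Int_outside[of "to_complex ` ?J"] outside_no_overlap[of "to_complex ` ?J"] by blast
      qed
      moreover have "x \<in> closed_region ?J" using x by (simp add: closed_region_def)
      ultimately show "x \<in> frontier (closed_region ?J)" using cl by (simp add: frontier_def)
    qed
  qed
qed

subsection \<open>Periodic extension\<close>

definition wrap :: "real \<Rightarrow> real \<Rightarrow> real \<Rightarrow> real" where
  "wrap a b s = s - (b - a) * of_int \<lfloor>(s - a) / (b - a)\<rfloor>"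

lemma wrap_bounds:
  assumes "a < b" shows "a \<le> wrap a b s" "wrap a b s < b"
proof -
  define z where "z = (s - a) / (b - a)"
  have sz: "s - a = (b - a) * z" using assms by (simp add: z_def)
  have "(b - a) * of_int \<lfloor>z\<rfloor> \<le> (b - a) * z" using assms by (intro mult_left_mono) auto
  then show "a \<le> wrap a b s" using sz unfolding wrap_def z_def[symmetric] by linarith
  have "z < of_int \<lfloor>z\<rfloor> + 1" by linarith
  then have "(b - a) * z < (b - a) * (of_int \<lfloor>z\<rfloor> + 1)" using assms by (intro mult_strict_left_mono) auto
  also have "\<dots> = (b - a) * of_int \<lfloor>z\<rfloor> + (b - a)" by (simp add: distrib_left)
  finally show "wrap a b s < b" using sz unfolding wrap_def z_def[symmetric] by linarith
qed

lemma wrap_eqI: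
  assumes "a < b" "a \<le> t" "t < b" "s = t + (b - a) * of_int k"
  shows "wrap a b s = t"
proof -
  have "(s - a) / (b - a) = (t - a) / (b - a) + of_int k"
    using assms by (simp add: field_simps)
  moreover have "0 \<le> (t - a) / (b - a)" "(t - a) / (b - a) < 1" using assms by (simp_all add: field_simps)
  ultimately have "\<lfloor>(s - a) / (b - a)\<rfloor> = k" by (intro floor_unique) auto
  then show ?thesis using assms(4) by (simp add: wrap_def)
qed

lemma wrap_idem: "a < b \<Longrightarrow> a \<le> t \<Longrightarrow> t < b \<Longrightarrow> wrap a b t = t"
  by (rule wrap_eqI[of _ _ _ _ 0]) auto

lemma wrap_exists: "\<exists>k::int. s = wrap a b s + (b - a) * of_int k"
  by (rule exI[of _ "\<lfloor>(s - a) / (b - a)\<rfloor>"]) (simp add: wrap_def)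

lemma wrap_periodic: "a < b \<Longrightarrow> wrap a b (s + (b - a)) = wrap a b s"
proof -
  assume ab: "a < b"
  obtain k :: int where k: "s = wrap a b s + (b - a) * of_int k" using wrap_exists by blast
  show ?thesis
    by (rule wrap_eqI[of _ _ _ _ "k + 1"]) (use ab wrap_bounds[OF ab, of s] k in \<open>auto simp: algebra_simps\<close>)
qed

lemma wrap_right:
  assumes ab: "a < b" shows "\<forall>\<^sub>F t in at_right s. wrap a b t = t + (wrap a b s - s)"
proof -
  obtain k :: int where k: "s = wrap a b s + (b - a) * of_int k" using wrap_exists by blast
  have "wrap a b t = t + (wrap a b s - s)" if "s < t" "t < s + (b - wrap a b s)" for t
    by (rule wrap_eqI[OF ab, of _ _ k]) (use that wrap_bounds[OF ab, of s] k in linarith)+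
  then show ?thesis
    unfolding eventually_at_right_field using wrap_bounds(2)[OF ab, of s]
    by (intro exI[of _ "s + (b - wrap a b s)"]) auto
qed

text \<open>The representative in \<open>(a, b]\<close>. It describes \<open>wrap\<close> on the
  left of a point, where \<open>wrap\<close> itself jumps if the point is congruent to
  \<open>a\<close>.\<close>

definition lwrap :: "real \<Rightarrow> real \<Rightarrow> real \<Rightarrow> real" where
  "lwrap a b s = (if wrap a b s = a then b else wrap a b s)"

lemma wrap_left:
  assumes ab: "a < b" shows "\<forall>\<^sub>F t in at_left s. wrap a b t = t + (lwrap a b s - s)"
proof -
  obtain k :: int where k: "s = wrap a b s + (b - a) * of_int k" using wrap_exists by blast
  obtain j :: int where j: "s = lwrap a b s + (b - a) * of_int j"
  proof (cases "wrap a b s = a")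
    case True
    then have "s = lwrap a b s + (b - a) * of_int (k - 1)" using k by (simp add: lwrap_def algebra_simps)
    then show thesis by (rule that)
  qed (use k that in \<open>auto simp: lwrap_def\<close>)
  have lb: "a < lwrap a b s" "lwrap a b s \<le> b" using wrap_bounds[OF ab, of s] ab by (auto simp: lwrap_def)
  have "wrap a b t = t + (lwrap a b s - s)" if "s - (lwrap a b s - a) < t" "t < s" for t
    by (rule wrap_eqI[OF ab, of _ _ j]) (use that lb j in linarith)+
  then show ?thesis
    unfolding eventually_at_left_field using lb
    by (intro exI[of _ "s - (lwrap a b s - a)"]) auto
qed

lemma at_right_within_Icc:
  fixes c :: real assumes "a \<le> c" "c < b" shows "at_right c \<le> at c within {a..b}"
proof -
  have "at c within {c..b} \<le> at c within {a..b}" using assms by (intro at_le) auto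
  then show ?thesis using assms by (simp add: at_within_Icc_at_right)
qed

lemma at_left_within_Icc:
  fixes c :: real assumes "a < c" "c \<le> b" shows "at_left c \<le> at c within {a..b}"
proof -
  have "at c within {a..c} \<le> at c within {a..b}" using assms by (intro at_le) auto
  then show ?thesis using assms by (simp add: at_within_Icc_at_left)
qed

lemma shift_at_right: "filterlim (\<lambda>t::real. t + (c - s)) (at_right c) (at_right s)"
  unfolding filterlim_at
proof
  show "\<forall>\<^sub>F t in at_right s. t + (c - s) \<in> {c<..} \<and> t + (c - s) \<noteq> c"
    unfolding eventually_at_right_field by (intro exI[of _ "s + 1"]) auto
  show "((\<lambda>t. t + (c - s)) \<longlongrightarrow> c) (at_right s)" by (auto intro!: tendsto_eq_intros)
qed

lemma shift_at_left: "filterlim (\<lambda>t::real. t + (c - s)) (at_left c) (at_left s)"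
  unfolding filterlim_at
proof
  show "\<forall>\<^sub>F t in at_left s. t + (c - s) \<in> {..<c} \<and> t + (c - s) \<noteq> c"
    unfolding eventually_at_left_field by (intro exI[of _ "s - 1"]) auto
  show "((\<lambda>t. t + (c - s)) \<longlongrightarrow> c) (at_left s)" by (auto intro!: tendsto_eq_intros)
qed

text \<open>Near \<open>s\<close> the map \<open>wrap\<close> is a translation on each side,
  possibly by different amounts. The one-sided limits are computed at \<open>wrap a b s\<close> and
  \<open>lwrap a b s\<close>, and the end point condition identifies them;
  \<open>periodic_derivative\<close> repeats this for difference quotients.\<close>

lemma periodic_continuous:
  fixes \<phi> :: "real \<Rightarrow> real"
  assumes ab: "a < b" and \<phi>: "continuous_on {a..b} \<phi>" "\<phi> a = \<phi> b"
  shows "isCont (\<lambda>t. \<phi> (wrap a b t)) s"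
proof -
  have wb: "a \<le> wrap a b s" "wrap a b s < b" by (rule wrap_bounds[OF ab])+
  have lb: "a < lwrap a b s" "lwrap a b s \<le> b" "\<phi> (lwrap a b s) = \<phi> (wrap a b s)" using wb ab \<phi>(2) by (auto simp: lwrap_def)
  have lim: "(\<phi> \<longlongrightarrow> \<phi> c) (at c within {a..b})" if "c \<in> {a..b}" for c
    using \<phi>(1) that by (simp add: continuous_on_def)
  have "((\<lambda>t. \<phi> (t + (wrap a b s - s))) \<longlongrightarrow> \<phi> (wrap a b s)) (at_right s)"
    by (rule filterlim_compose[OF tendsto_mono[OF at_right_within_Icc[OF wb] lim] shift_at_right]) (use wb in auto)
  then have 1: "((\<lambda>t. \<phi> (wrap a b t)) \<longlongrightarrow> \<phi> (wrap a b s)) (at_right s)"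
    by (rule Lim_transform_eventually) (use wrap_right[OF ab, of s] in \<open>eventually_elim, simp\<close>)
  have "((\<lambda>t. \<phi> (t + (lwrap a b s - s))) \<longlongrightarrow> \<phi> (lwrap a b s)) (at_left s)"
    by (rule filterlim_compose[OF tendsto_mono[OF at_left_within_Icc[OF lb(1,2)] lim] shift_at_left]) (use lb in auto)
  then have 2: "((\<lambda>t. \<phi> (wrap a b t)) \<longlongrightarrow> \<phi> (wrap a b s)) (at_left s)"
    unfolding lb(3) by (rule Lim_transform_eventually) (use wrap_left[OF ab, of s] in \<open>eventually_elim, simp\<close>)
  show ?thesis unfolding isCont_def using filterlim_split_at[OF 2 1] .
qed

lemma periodic_derivative:
  fixes \<phi> \<phi>' :: "real \<Rightarrow> real"
  assumes ab: "a < b" and \<phi>: "\<And>s. s \<in> {a..b} \<Longrightarrow> (\<phi> has_real_derivative \<phi>' s) (at s within {a..b})"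
    and eq: "\<phi> a = \<phi> b" "\<phi>' a = \<phi>' b"
  shows "((\<lambda>t. \<phi> (wrap a b t)) has_real_derivative \<phi>' (wrap a b s)) (at s)"
proof -
  have wb: "a \<le> wrap a b s" "wrap a b s < b" by (rule wrap_bounds[OF ab])+
  have lb: "a < lwrap a b s" "lwrap a b s \<le> b" "\<phi> (lwrap a b s) = \<phi> (wrap a b s)" "\<phi>' (lwrap a b s) = \<phi>' (wrap a b s)"
    using wb ab eq by (auto simp: lwrap_def)
  have lim: "((\<lambda>y. (\<phi> y - \<phi> c) / (y - c)) \<longlongrightarrow> \<phi>' c) (at c within {a..b})" if "c \<in> {a..b}" for c
    using \<phi>[OF that] by (simp add: has_field_derivative_iff)
  have "((\<lambda>t. (\<phi> (t + (wrap a b s - s)) - \<phi> (wrap a b s)) / (t + (wrap a b s - s) - wrap a b s)) \<longlongrightarrow> \<phi>' (wrap a b s)) (at_right s)"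
    by (rule filterlim_compose[OF tendsto_mono[OF at_right_within_Icc[OF wb] lim] shift_at_right]) (use wb in auto)
  then have 1: "((\<lambda>t. (\<phi> (wrap a b t) - \<phi> (wrap a b s)) / (t - s)) \<longlongrightarrow> \<phi>' (wrap a b s)) (at_right s)"
    by (rule Lim_transform_eventually) (use wrap_right[OF ab, of s] in \<open>eventually_elim, simp\<close>)
  have "((\<lambda>t. (\<phi> (t + (lwrap a b s - s)) - \<phi> (lwrap a b s)) / (t + (lwrap a b s - s) - lwrap a b s)) \<longlongrightarrow> \<phi>' (lwrap a b s)) (at_left s)"
    by (rule filterlim_compose[OF tendsto_mono[OF at_left_within_Icc[OF lb(1,2)] lim] shift_at_left]) (use lb in auto)
  then have 2: "((\<lambda>t. (\<phi> (wrap a b t) - \<phi> (wrap a b s)) / (t - s)) \<longlongrightarrow> \<phi>' (wrap a b s)) (at_left s)"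
    unfolding lb(3,4) by (rule Lim_transform_eventually) (use wrap_left[OF ab, of s] in \<open>eventually_elim, simp\<close>)
  show ?thesis unfolding has_field_derivative_iff using filterlim_split_at[OF 2 1] .
qed

text \<open>
  The curve \<open>(X, Y)\<close> is traversed clockwise, so \<open>(-Q, P)\<close> is the outer normal of the region \<open>D\<close>.
\<close>

locale convex_profile =
  fixes D :: "(real \<times> real) set" and X Y P Q :: "real \<Rightarrow> real" and L :: real
  assumes L_pos: "L > 0"
    and deriv_X: "(X has_real_derivative P s) (at s)" and deriv_Y: "(Y has_real_derivative Q s) (at s)"
    and unit_speed: "P s * P s + Q s * Q s = 1"
    and cont_P: "isCont P s" and cont_Q: "isCont Q s"
    and period: "X (s + L) = X s" "Y (s + L) = Y s"
    and inj_mod: "X s = X t \<Longrightarrow> Y s = Y t \<Longrightarrow> \<exists>k::int. t = s + of_int k * L"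
    and compact_D: "compact D" and convex_D: "convex D"
    and frontier_D: "frontier D = range (\<lambda>s. (X s, Y s))" and interior_D: "interior D \<noteq> {}"
    and nonneg_D: "(x, y) \<in> D \<Longrightarrow> 0 \<le> y"
    and support: "(x, y) \<in> D \<Longrightarrow> - Q s * (x - X s) + P s * (y - Y s) \<le> 0"

text \<open>At each curve point a supporting functional attains its minimum along the curve, so it
  annihilates the tangent and is a multiple of the normal form \<open>N s\<close>. Hence
  \<open>N s d0\<close> never vanishes for an interior point \<open>d0\<close>, and by continuity it
  has one sign for all \<open>s\<close>. That sign is the orientation; if it is the wrong one, the
  parameter is reversed.\<close>

lemma convex_profile_exists:
  assumes sc: "simple_closed_C11 a b \<gamma>" and hp: "\<gamma> ` {a..b} \<subseteq> half_plane"
    and cv: "convex (closed_region (\<gamma> ` {a..b}))"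
  shows "\<exists>X Y P Q L. convex_profile (closed_region (\<gamma> ` {a..b})) X Y P Q L"
proof -
  let ?J = "\<gamma> ` {a..b}" let ?D = "closed_region ?J"
  obtain \<gamma>' M where ab: "a < b" and \<gamma>ab: "\<gamma> a = \<gamma> b" and inj: "inj_on \<gamma> {a..<b}"
    and \<gamma>': "\<forall>s\<in>{a..b}. (\<gamma> has_vector_derivative \<gamma>' s) (at s within {a..b}) \<and> norm (\<gamma>' s) = 1"
    and lip: "M-lipschitz_on {a..b} \<gamma>'" and \<gamma>'ab: "\<gamma>' a = \<gamma>' b"
    using sc unfolding simple_closed_C11_def by blast
  have \<gamma>c: "continuous_on {a..b} \<gamma>"
    using \<gamma>' by (meson continuous_on_eq_continuous_within has_vector_derivative_continuous)
  define c where "c t = \<gamma> (a + (b - a) * t)" for t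
  have arg: "a + (b - a) * t \<in> {a..b}" if "t \<in> {0..1}" for t
  proof -
    have "0 \<le> (b - a) * t" "(b - a) * t \<le> (b - a) * 1" using that ab by (auto intro!: mult_left_mono)
    then show ?thesis by simp
  qed
  have pathc: "path c"
    unfolding path_def c_def[abs_def]
    by (rule continuous_on_compose2[OF \<gamma>c]) (use arg in \<open>auto intro!: continuous_intros\<close>)
  have injab: "s = t \<or> s = a \<and> t = b \<or> s = b \<and> t = a" if "\<gamma> s = \<gamma> t" "s \<in> {a..b}" "t \<in> {a..b}" for s t
  proof (cases "s = b")
    case True
    show ?thesis
    proof (cases "t = b")
      case False
      then have "a = t" using inj_onD[OF inj, of a t] that True \<gamma>ab ab by auto
      then show ?thesis using True by simp
    qed (use True in simp)
  next
    case sb: False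
    show ?thesis
    proof (cases "t = b")
      case True
      then have "s = a" using inj_onD[OF inj, of s a] that \<gamma>ab ab sb by auto
      then show ?thesis using True by simp
    next
      case False
      then have "s = t" using inj_onD[OF inj, of s t] that sb by auto
      then show ?thesis by simp
    qed
  qed
  have spc: "simple_path c"
    unfolding simple_path_def loop_free_def
  proof (intro conjI pathc ballI impI)
    fix s t :: real assume st: "s \<in> {0..1}" "t \<in> {0..1}" "c s = c t"
    have "a + (b - a) * s = a + (b - a) * t \<or> a + (b - a) * s = a \<and> a + (b - a) * t = b \<or>
        a + (b - a) * s = b \<and> a + (b - a) * t = a"
      by (rule injab) (use st arg in \<open>simp_all add: c_def\<close>)
    moreover have "a + (b - a) * r = b \<Longrightarrow> r = 1" for r
    proof -
      assume "a + (b - a) * r = b"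
      then have "(b - a) * (r - 1) = 0" by (simp add: algebra_simps)
      then show "r = 1" using ab by simp
    qed
    ultimately show "s = t \<or> s = 0 \<and> t = 1 \<or> s = 1 \<and> t = 0" using ab by auto
  qed
  have endc: "pathfinish c = pathstart c" using \<gamma>ab by (simp add: pathfinish_def pathstart_def c_def)
  have imc: "path_image c = ?J"
  proof
    show "path_image c \<subseteq> ?J" using arg by (auto simp: path_image_def c_def)
    show "?J \<subseteq> path_image c"
    proof
      fix z assume "z \<in> ?J"
      then obtain s where s: "z = \<gamma> s" "a \<le> s" "s \<le> b" by auto
      show "z \<in> path_image c"
        unfolding path_image_def by (rule image_eqI[of _ _ "(s - a) / (b - a)"]) (use s ab in \<open>auto simp: c_def\<close>)
    qed
  qed
  note fcr = frontier_closed_region[OF spc endc, unfolded imc]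
  \<comment> \<open>The lowest point of the region is not interior, so it lies on the curve, which
    stays in the half-plane.\<close>
  have nn: "0 \<le> y" if "(x, y) \<in> ?D" for x y
  proof -
    have "?D \<noteq> {}" using that by blast
    from continuous_attains_inf[OF fcr(1) this continuous_on_snd[OF continuous_on_id]]
    obtain q where q: "q \<in> ?D" "\<And>r. r \<in> ?D \<Longrightarrow> snd q \<le> snd r" by blast
    have "q \<notin> interior ?D"
    proof
      assume "q \<in> interior ?D"
      then obtain e where e: "e > 0" "ball q e \<subseteq> ?D" unfolding mem_interior by blast
      have "(fst q, snd q - e / 2) \<in> ball q e" using e(1) by (cases q) (simp add: dist_Pair_Pair dist_real_def)
      then have "snd q \<le> snd (fst q, snd q - e / 2)" using q(2) e(2) by blast
      then show False using e(1) by simp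
    qed
    then have "q \<in> frontier ?D" using q(1) closure_subset unfolding frontier_def by blast
    then have "snd q \<ge> 0" using hp unfolding fcr(3) half_plane_def by auto
    then show ?thesis using q(2)[OF that] by simp
  qed
  define x where "x s = fst (\<gamma> s)" for s define y where "y s = snd (\<gamma> s)" for s
  define p where "p s = fst (\<gamma>' s)" for s define q where "q s = snd (\<gamma>' s)" for s
  have dx: "(x has_real_derivative p s) (at s within {a..b})" and dy: "(y has_real_derivative q s) (at s within {a..b})"
    if "s \<in> {a..b}" for s
    unfolding has_real_derivative_iff_has_vector_derivative x_def[abs_def] y_def[abs_def] p_def q_def
    using bounded_linear.has_vector_derivative[OF bounded_linear_fst] bounded_linear.has_vector_derivative[OF bounded_linear_snd] \<gamma>' that
    by blast+
  have \<gamma>'c: "continuous_on {a..b} \<gamma>'" using lip by (rule lipschitz_on_continuous_on)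
  have pc: "continuous_on {a..b} p" "continuous_on {a..b} q"
    unfolding p_def[abs_def] q_def[abs_def] by (intro continuous_intros \<gamma>'c)+
  have eqs: "x a = x b" "y a = y b" "p a = p b" "q a = q b" using \<gamma>ab \<gamma>'ab by (simp_all add: x_def y_def p_def q_def)
  let ?L = "b - a"
  define X0 where "X0 s = x (wrap a b s)" for s define Y0 where "Y0 s = y (wrap a b s)" for s
  define P0 where "P0 s = p (wrap a b s)" for s define Q0 where "Q0 s = q (wrap a b s)" for s
  have wm: "wrap a b s \<in> {a..b}" "wrap a b s \<in> {a..<b}" for s using wrap_bounds[OF ab, of s] by auto
  have dX0: "(X0 has_real_derivative P0 s) (at s)" and dY0: "(Y0 has_real_derivative Q0 s) (at s)" for s
    unfolding X0_def[abs_def] P0_def Y0_def[abs_def] Q0_def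
    using periodic_derivative[OF ab dx eqs(1,3)] periodic_derivative[OF ab dy eqs(2,4)] by blast+
  have cP0: "isCont P0 s" and cQ0: "isCont Q0 s" for s
    unfolding P0_def[abs_def] Q0_def[abs_def]
    using periodic_continuous[OF ab pc(1) eqs(3)] periodic_continuous[OF ab pc(2) eqs(4)] by blast+
  have unit: "P0 s * P0 s + Q0 s * Q0 s = 1" for s
  proof -
    have "norm (\<gamma>' (wrap a b s)) = 1" using \<gamma>' wm by blast
    then show ?thesis
      by (cases "\<gamma>' (wrap a b s)") (simp add: P0_def Q0_def p_def q_def norm_Pair power2_eq_square)
  qed
  have per: "X0 (s + ?L) = X0 s" "Y0 (s + ?L) = Y0 s" for s
    using wrap_periodic[OF ab] by (simp_all add: X0_def Y0_def)
  have G0: "(X0 s, Y0 s) = \<gamma> (wrap a b s)" for s by (simp add: X0_def Y0_def x_def y_def)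
  have rng: "range (\<lambda>s. (X0 s, Y0 s)) = ?J"
  proof
    show "range (\<lambda>s. (X0 s, Y0 s)) \<subseteq> ?J" using wm by (auto simp: G0)
    show "?J \<subseteq> range (\<lambda>s. (X0 s, Y0 s))"
    proof
      fix z assume "z \<in> ?J"
      then obtain s where s: "z = \<gamma> s" "a \<le> s" "s \<le> b" by auto
      have "\<exists>t. a \<le> t \<and> t < b \<and> z = \<gamma> t"
      proof (cases "s = b")
        case True then show ?thesis using s \<gamma>ab ab by (intro exI[of _ a]) auto
      qed (use s in \<open>intro exI[of _ s], auto\<close>)
      then obtain t where "a \<le> t" "t < b" "z = \<gamma> t" by blast
      then have "z = (X0 t, Y0 t)" using wrap_idem[OF ab, of t] by (simp only: G0)
      then show "z \<in> range (\<lambda>s. (X0 s, Y0 s))" by blast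
    qed
  qed
  have injm: "\<exists>k::int. t = s + of_int k * ?L" if "X0 s = X0 t" "Y0 s = Y0 t" for s t
  proof -
    have "\<gamma> (wrap a b s) = \<gamma> (wrap a b t)" using that G0[of s] G0[of t] by simp
    then have w: "wrap a b s = wrap a b t" using inj_onD[OF inj] wm by blast
    obtain k :: int where "s = wrap a b s + ?L * of_int k" using wrap_exists by blast
    moreover obtain j :: int where "t = wrap a b t + ?L * of_int j" using wrap_exists by blast
    ultimately have "t = s + of_int (j - k) * ?L" using w by (simp add: algebra_simps)
    then show ?thesis by blast
  qed
  obtain d0 where d0: "d0 \<in> interior ?D" using fcr(2) by blast
  define N where "N s z = - Q0 s * (fst z - X0 s) + P0 s * (snd z - Y0 s)" for s z
  have supp: "\<exists>l. l * N s d0 > 0 \<and> (\<forall>z\<in>?D. l * N s z \<ge> 0)" for s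
  proof -
    let ?g = "(X0 s, Y0 s)"
    have gf: "?g \<in> frontier ?D" unfolding fcr(3) using rng by blast
    then have gD: "?g \<in> ?D" using fcr(1) by (simp add: frontier_def compact_imp_closed closure_closed)
    have ri: "rel_interior ?D = interior ?D" by (rule rel_interior_nonempty_interior[OF fcr(2)])
    have "?g \<notin> rel_interior ?D" using gf unfolding ri frontier_def by blast
    from supporting_hyperplane_rel_boundary[OF cv gD this]
    obtain n where n: "n \<noteq> 0" "\<forall>z\<in>?D. n \<bullet> ?g \<le> n \<bullet> z" "\<forall>z\<in>interior ?D. n \<bullet> ?g < n \<bullet> z"
      unfolding ri by metis
    obtain n1 n2 where n12: "n = (n1, n2)" by (cases n)
    define w where "w t = n1 * X0 t + n2 * Y0 t" for t
    have "(w has_real_derivative n1 * P0 s + n2 * Q0 s) (at s)"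
      unfolding w_def[abs_def] by (intro DERIV_add DERIV_cmult dX0 dY0)
    moreover have "w s \<le> w t" for t
    proof -
      have "(X0 t, Y0 t) \<in> frontier ?D" unfolding fcr(3) using rng by blast
      then have "(X0 t, Y0 t) \<in> ?D" using fcr(1) by (simp add: frontier_def compact_imp_closed closure_closed)
      from bspec[OF n(2) this] show ?thesis by (simp add: n12 w_def)
    qed
    ultimately have z: "n1 * P0 s + n2 * Q0 s = 0"
      using DERIV_local_min[of w _ s 1] by simp
    \<comment> \<open>\<open>n\<close> is orthogonal to the unit tangent, so it equals
      \<open>l\<close> times the normal \<open>(- Q0 s, P0 s)\<close>.\<close>
    define l where "l = - n1 * Q0 s + n2 * P0 s"
    have "l * (- Q0 s) = n1 * (Q0 s * Q0 s) - n2 * Q0 s * P0 s" by (simp add: l_def algebra_simps)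
    also have "n2 * Q0 s = - n1 * P0 s" using z by simp
    also have "n1 * (Q0 s * Q0 s) - - n1 * P0 s * P0 s = n1 * (P0 s * P0 s + Q0 s * Q0 s)" by (simp add: algebra_simps)
    finally have l1: "l * (- Q0 s) = n1" by (simp add: unit)
    have "l * P0 s = n2 * (P0 s * P0 s) - n1 * P0 s * Q0 s" by (simp add: l_def algebra_simps)
    also have "n1 * P0 s = - n2 * Q0 s" using z by simp
    also have "n2 * (P0 s * P0 s) - - n2 * Q0 s * Q0 s = n2 * (P0 s * P0 s + Q0 s * Q0 s)" by (simp add: algebra_simps)
    finally have l2: "l * P0 s = n2" by (simp add: unit)
    have lN: "l * N s z = n \<bullet> z - n \<bullet> ?g" for z
    proof -
      have "l * N s z = (l * (- Q0 s)) * (fst z - X0 s) + (l * P0 s) * (snd z - Y0 s)"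
        by (simp add: N_def algebra_simps)
      also have "\<dots> = n \<bullet> z - n \<bullet> ?g" unfolding l1 l2 by (cases z) (simp add: n12 algebra_simps)
      finally show ?thesis .
    qed
    show ?thesis by (rule exI[of _ l]) (use n d0 in \<open>simp add: lN\<close>)
  qed
  have Nnz: "N s d0 \<noteq> 0" for s using supp[of s] by auto
  have Nc: "continuous_on UNIV (\<lambda>s. N s d0)"
    unfolding N_def using cP0 cQ0 DERIV_isCont[OF dX0] DERIV_isCont[OF dY0]
    by (intro continuous_at_imp_continuous_on ballI continuous_intros) auto
  have "connected (range (\<lambda>s. N s d0))" by (intro connected_continuous_image Nc) simp
  then have "(\<forall>s. N s d0 > 0) \<or> (\<forall>s. N s d0 < 0)"
  proof -
    assume c: "connected (range (\<lambda>s. N s d0))"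
    have False if "N s d0 > 0" "N t d0 < 0" for s t
    proof -
      have "0 \<in> range (\<lambda>s. N s d0)"
        by (rule connectedD_interval[OF c, of "N t d0" "N s d0" 0]) (use that in auto)
      then show False using Nnz by (metis rangeE)
    qed
    then show ?thesis using Nnz by (metis linorder_neqE_linordered_idom)
  qed
  then show ?thesis
  proof
    assume neg: "\<forall>s. N s d0 < 0"
    have "convex_profile ?D X0 Y0 P0 Q0 ?L"
    proof
      fix u v s assume uv: "(u, v) \<in> ?D"
      obtain l where l: "l * N s d0 > 0" "\<forall>z\<in>?D. l * N s z \<ge> 0" using supp[of s] by blast
      have "l < 0" using l(1) neg by (metis linorder_neqE_linordered_idom mult_pos_neg mult_zero_left not_less_iff_gr_or_eq)
      moreover have "l * N s (u, v) \<ge> 0" using l(2) uv by blast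
      ultimately have "N s (u, v) \<le> 0" by (simp add: zero_le_mult_iff)
      then show "- Q0 s * (u - X0 s) + P0 s * (v - Y0 s) \<le> 0" by (simp add: N_def)
    qed (use ab dX0 dY0 unit cP0 cQ0 per injm fcr cv rng nn in auto)
    then show ?thesis by blast
  next
    \<comment> \<open>Counterclockwise traversal: \<open>s\<close> is replaced by
      \<open>- s\<close>, which reverses the tangent and keeps the point set.\<close>
    assume pos: "\<forall>s. N s d0 > 0"
    define Xr where "Xr s = X0 (- s)" for s define Yr where "Yr s = Y0 (- s)" for s
    define Pr where "Pr s = - P0 (- s)" for s define Qr where "Qr s = - Q0 (- s)" for s
    have "convex_profile ?D Xr Yr Pr Qr ?L"
    proof
      show "(Xr has_real_derivative Pr s) (at s)" for s
        unfolding Xr_def[abs_def] Pr_def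
        using DERIV_chain2[OF dX0[of "- s"] DERIV_minus[OF DERIV_ident]] by simp
      show "(Yr has_real_derivative Qr s) (at s)" for s
        unfolding Yr_def[abs_def] Qr_def
        using DERIV_chain2[OF dY0[of "- s"] DERIV_minus[OF DERIV_ident]] by simp
      show "Pr s * Pr s + Qr s * Qr s = 1" for s using unit[of "- s"] by (simp add: Pr_def Qr_def)
      show "isCont Pr s" "isCont Qr s" for s
        unfolding Pr_def[abs_def] Qr_def[abs_def]
        using isCont_o2[OF continuous_minus[OF continuous_ident] cP0] isCont_o2[OF continuous_minus[OF continuous_ident] cQ0]
        by (intro continuous_minus; blast)+
      show "Xr (s + ?L) = Xr s" "Yr (s + ?L) = Yr s" for s
      proof -
        have e: "- (s + ?L) = - s - ?L" by simp
        show "Xr (s + ?L) = Xr s" "Yr (s + ?L) = Yr s"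
          using per[of "- s - ?L"] unfolding Xr_def Yr_def e diff_add_cancel by (simp_all only:)
      qed
      show "\<exists>k::int. t = s + of_int k * ?L" if "Xr s = Xr t" "Yr s = Yr t" for s t
      proof -
        have "\<exists>k::int. - t = - s + of_int k * ?L" using that unfolding Xr_def Yr_def by (rule injm)
        then obtain k :: int where "- t = - s + of_int k * ?L" by blast
        then have "t = s + of_int (- k) * ?L" by simp
        then show ?thesis by blast
      qed
      have "range (\<lambda>s. (Xr s, Yr s)) = range (\<lambda>s. (X0 s, Y0 s))"
      proof
        show "range (\<lambda>s. (X0 s, Y0 s)) \<subseteq> range (\<lambda>s. (Xr s, Yr s))"
        proof
          fix z assume "z \<in> range (\<lambda>s. (X0 s, Y0 s))"
          then obtain s where "z = (X0 s, Y0 s)" by blast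
          then have "z = (Xr (- s), Yr (- s))" by (simp add: Xr_def Yr_def)
          then show "z \<in> range (\<lambda>s. (Xr s, Yr s))" by blast
        qed
      qed (auto simp: Xr_def Yr_def)
      then show "frontier ?D = range (\<lambda>s. (Xr s, Yr s))" using fcr(3) rng by simp
      fix u v s assume uv: "(u, v) \<in> ?D"
      obtain l where l: "l * N (- s) d0 > 0" "\<forall>z\<in>?D. l * N (- s) z \<ge> 0" using supp[of "- s"] by blast
      have "l > 0" using l(1) pos by (metis zero_less_mult_pos2)
      moreover have "l * N (- s) (u, v) \<ge> 0" using l(2) uv by blast
      ultimately have "N (- s) (u, v) \<ge> 0" by (simp add: zero_le_mult_iff)
      then show "- Qr s * (u - Xr s) + Pr s * (v - Yr s) \<le> 0" by (simp add: N_def Qr_def Pr_def Xr_def Yr_def)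
    qed (use ab fcr cv nn in auto)
    then show ?thesis by blast
  qed
qed

section \<open>The convex region as a local subgraph\<close>

lemma Int_nonemptyI: "x \<in> A \<Longrightarrow> x \<in> B \<Longrightarrow> A \<inter> B \<noteq> {}"
  by blast

context convex_profile
begin

lemma curve_in_D: "(X s, Y s) \<in> D"
proof -
  have "(X s, Y s) \<in> frontier D" unfolding frontier_D by blast
  then show ?thesis using compact_imp_closed[OF compact_D] by (simp add: frontier_def closure_closed)
qed

lemma Y_nonneg: "Y s \<ge> 0" using nonneg_D curve_in_D by blast

lemma isCont_XY: "isCont X s" "isCont Y s" using DERIV_isCont deriv_X deriv_Y by blast+

lemma continuous_on_XYPQ:
  "continuous_on S X" "continuous_on S Y" "continuous_on S P" "continuous_on S Q"
  using isCont_XY cont_P cont_Q by (auto intro: continuous_at_imp_continuous_on)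

lemma period_int: "X (s + of_int k * L) = X s \<and> Y (s + of_int k * L) = Y s"
proof -
  have n: "X (s + of_nat n * L) = X s \<and> Y (s + of_nat n * L) = Y s" for n s
  proof (induction n)
    case (Suc n)
    then show ?case using period[of "s + of_nat n * L"] by (simp add: algebra_simps)
  qed simp
  show ?thesis
  proof (cases "k \<ge> 0")
    case True
    then show ?thesis using n[of s "nat k"] by simp
  next
    case False
    then show ?thesis using n[of "s + of_int k * L" "nat (- k)"] by simp
  qed
qed

lemma curve_representative: "\<exists>t. s0 \<le> t \<and> t < s0 + L \<and> X t = X s \<and> Y t = Y s"
proof -
  have ab: "s0 < s0 + L" using L_pos by simp
  obtain k :: int where k: "s = wrap s0 (s0 + L) s + (s0 + L - s0) * of_int k" using wrap_exists by blast
  have e: "s + of_int (- k) * L = wrap s0 (s0 + L) s" using k by (simp add: algebra_simps)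
  show ?thesis
    using wrap_bounds[OF ab, of s] period_int[of s "- k"] unfolding e by blast
qed

text \<open>Where the tangent has a positive component along the frame, the curve is a graph in a
  box inside the prescribed open set \<open>Op\<close>. Points of \<open>D\<close> in the box lie
  below the graph by the support inequality at the curve point of equal abscissa. Conversely, the
  part of the box strictly below the graph is connected, misses \<open>frontier D\<close> and meets
  \<open>D\<close>, so it is contained in \<open>D\<close>.\<close>

lemma local_graph:
  assumes fr: "frame \<alpha> \<beta>" and p0: "\<alpha> * P s0 + \<beta> * Q s0 > 0"
    and Op: "open Op" "(X s0, Y s0) \<in> Op"
  obtains \<delta> f u1 u2 v1 v2 c d where "\<delta> > 0" "v1 < c" "c \<le> d" "d < v2" "u1 < u2" "f \<in> borel_measurable borel"
    "\<forall>s. \<bar>s - s0\<bar> < \<delta> \<longrightarrow> \<alpha> * P s + \<beta> * Q s > 0"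
    "\<forall>s. \<bar>s - s0\<bar> < \<delta> \<longrightarrow> \<alpha> * X s + \<beta> * Y s \<in> {u1<..<u2} \<and> f (\<alpha> * X s + \<beta> * Y s) = - \<beta> * X s + \<alpha> * Y s"
    "\<forall>u\<in>{u1<..<u2}. \<exists>s. \<bar>s - s0\<bar> < \<delta> \<and> u = \<alpha> * X s + \<beta> * Y s"
    "\<forall>u\<in>{u1<..<u2}. f u \<in> {c..d}"
    "\<forall>s t. \<bar>s - s0\<bar> < \<delta> \<longrightarrow> \<bar>t - s0\<bar> < \<delta> \<longrightarrow> s < t \<longrightarrow> \<alpha> * X s + \<beta> * Y s < \<alpha> * X t + \<beta> * Y t"
    "\<forall>s. \<bar>s - s0\<bar> < \<delta> \<longrightarrow> (f has_real_derivative (- \<beta> * P s + \<alpha> * Q s) / (\<alpha> * P s + \<beta> * Q s)) (at (\<alpha> * X s + \<beta> * Y s))"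
    "\<exists>g. continuous_on {u1<..<u2} g \<and> (\<forall>s. \<bar>s - s0\<bar> < \<delta> \<longrightarrow> g (\<alpha> * X s + \<beta> * Y s) = (- \<beta> * P s + \<alpha> * Q s) / (\<alpha> * P s + \<beta> * Q s))"
    "\<forall>q. frame_coords \<alpha> \<beta> q \<in> {u1<..<u2} \<times> {v1<..<v2} \<longrightarrow> q \<in> Op \<and> (q \<in> D \<longleftrightarrow> snd (frame_coords \<alpha> \<beta> q) \<le> f (fst (frame_coords \<alpha> \<beta> q)))"
proof -
  define u where "u s = \<alpha> * X s + \<beta> * Y s" for s
  define v where "v s = - \<beta> * X s + \<alpha> * Y s" for s
  define p where "p s = \<alpha> * P s + \<beta> * Q s" for s
  define q where "q s = - \<beta> * P s + \<alpha> * Q s" for s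
  have ab1: "\<alpha> * \<alpha> + \<beta> * \<beta> = 1" using frame_sq(2)[OF fr] .
  have fc: "frame_coords \<alpha> \<beta> (X s, Y s) = (u s, v s)" for s by (simp add: frame_coords_def u_def v_def)
  have du: "(u has_real_derivative p s) (at s)" and dv: "(v has_real_derivative q s) (at s)" for s
    unfolding u_def[abs_def] v_def[abs_def] p_def q_def by (intro DERIV_add DERIV_cmult deriv_X deriv_Y)+
  have cu: "continuous_on S u" and cv: "continuous_on S v" and cp: "continuous_on S p" and cq: "continuous_on S q" for S
    unfolding u_def[abs_def] v_def[abs_def] p_def[abs_def] q_def[abs_def]
    by (intro continuous_intros continuous_on_XYPQ)+
  have "isCont p s0" using cp[of UNIV] by (simp add: continuous_on_eq_continuous_at)
  then obtain d0 where d0: "d0 > 0" "\<forall>s. dist s s0 < d0 \<longrightarrow> dist (p s) (p s0) < p s0"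
    unfolding continuous_at_eps_delta using p0 unfolding p_def by blast
  \<comment> \<open>\<open>L / 4\<close> keeps the parameter window around \<open>s0\<close> shorter
    than one period.\<close>
  define \<delta>1 where "\<delta>1 = min (d0 / 2) (L / 4)"
  have \<delta>1: "\<delta>1 > 0" "\<delta>1 < d0" "2 * \<delta>1 < L" using d0(1) L_pos by (auto simp: \<delta>1_def min_def)
  have p1: "p s > 0" if "\<bar>s - s0\<bar> \<le> \<delta>1" for s
  proof -
    have "dist (p s) (p s0) < p s0" using d0(2) that \<delta>1(2) by (simp add: dist_real_def)
    then show ?thesis unfolding dist_real_def by linarith
  qed
  have mono: "u s < u t" if "\<bar>s - s0\<bar> \<le> \<delta>1" "\<bar>t - s0\<bar> \<le> \<delta>1" "s < t" for s t
  proof (rule DERIV_pos_imp_increasing[OF that(3)])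
    fix r assume "s \<le> r" "r \<le> t"
    then have "\<bar>r - s0\<bar> \<le> \<delta>1" using that by linarith
    then show "\<exists>y. (u has_real_derivative y) (at r) \<and> 0 < y" using du p1 by blast
  qed
  let ?G = "\<lambda>s. (X s, Y s)"
  \<comment> \<open>The rest of the curve: compact, and by injectivity modulo \<open>L\<close>
    without the point at \<open>s0\<close>. A small ball around that point therefore meets the curve
    only in the arc of the window.\<close>
  let ?F = "?G ` {s0 + \<delta>1..s0 + L - \<delta>1}"
  have cF: "closed ?F"
    by (intro compact_imp_closed compact_continuous_image continuous_intros continuous_on_XYPQ) simp
  have nF: "?G s0 \<notin> ?F"
  proof
    assume "?G s0 \<in> ?F"
    then obtain t where t: "s0 + \<delta>1 \<le> t" "t \<le> s0 + L - \<delta>1" "X s0 = X t" "Y s0 = Y t" by auto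
    then obtain k :: int where "t = s0 + of_int k * L" using inj_mod by blast
    then have k: "0 < of_int k * L" "of_int k * L < L" using t(1,2) \<delta>1 by linarith+
    have "(0::real) < of_int k" using k(1) L_pos by (simp add: zero_less_mult_iff)
    then have "1 \<le> (of_int k :: real)" by simp
    then have "1 * L \<le> of_int k * L" using L_pos by (intro mult_right_mono) auto
    then show False using k(2) by simp
  qed
  have "open (Op - ?F)" using Op(1) cF by (rule open_Diff)
  moreover have "?G s0 \<in> Op - ?F" using Op(2) nF by blast
  ultimately obtain r where r: "r > 0" "ball (?G s0) r \<subseteq> Op - ?F" by (rule openE)
  have nearJ: "\<exists>s. \<bar>s - s0\<bar> < \<delta>1 \<and> z = ?G s" if "z \<in> frontier D" "z \<in> ball (?G s0) r" for z
  proof -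
    have "z \<in> range ?G" using that(1) by (simp only: frontier_D)
    then obtain s' where "z = ?G s'" by blast
    moreover obtain s where s: "s0 - \<delta>1 \<le> s" "s < s0 - \<delta>1 + L" "X s = X s'" "Y s = Y s'"
      using curve_representative by blast
    ultimately have z: "z = ?G s" by simp
    have "z \<notin> ?F" using r(2) that(2) by blast
    then have "\<not> (s0 + \<delta>1 \<le> s \<and> s \<le> s0 + L - \<delta>1)" using z by auto
    then have "s < s0 + \<delta>1" using s(2) by auto
    have "s \<noteq> s0 - \<delta>1"
    proof
      assume "s = s0 - \<delta>1"
      then have e: "s0 + L - \<delta>1 = s + L" by simp
      have "z = ?G (s0 + L - \<delta>1)" using period[of s] unfolding z e by simp
      then have "z \<in> ?F" using \<delta>1(3) by (intro image_eqI[of _ _ "s0 + L - \<delta>1"]) auto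
      then show False using \<open>z \<notin> ?F\<close> by simp
    qed
    then have "\<bar>s - s0\<bar> < \<delta>1" using s(1) \<open>s < s0 + \<delta>1\<close> by linarith
    then show ?thesis using z by blast
  qed
  \<comment> \<open>Offsets below \<open>r / 2\<close> in both coordinates place the box inside the
    ball. The heights of the graph are kept within \<open>\<rho> / 2\<close>, which leaves a margin
    to the top and bottom of the box.\<close>
  define \<rho> where "\<rho> = r / 2"
  have \<rho>: "\<rho> > 0" using r(1) by (simp add: \<rho>_def)
  have "isCont u s0" "isCont v s0" using du dv DERIV_isCont by blast+
  then have uvc: "\<forall>e>0. \<exists>d>0. \<forall>s. dist s s0 < d \<longrightarrow> dist (u s) (u s0) < e"
    "\<forall>e>0. \<exists>d>0. \<forall>s. dist s s0 < d \<longrightarrow> dist (v s) (v s0) < e"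
    unfolding continuous_at_eps_delta by simp_all
  obtain d1 where d1: "d1 > 0" "\<forall>s. dist s s0 < d1 \<longrightarrow> dist (u s) (u s0) < \<rho>"
    using uvc(1)[rule_format, OF \<rho>] by blast
  obtain d2 where d2: "d2 > 0" "\<forall>s. dist s s0 < d2 \<longrightarrow> dist (v s) (v s0) < \<rho> / 2"
    using uvc(2)[rule_format, OF half_gt_zero[OF \<rho>]] by blast
  define \<delta> where "\<delta> = min \<delta>1 (min d1 d2) / 2"
  have \<delta>: "\<delta> > 0" "\<delta> < \<delta>1" "\<delta> < d1" "\<delta> < d2" using \<delta>1 d1 d2 by (auto simp: \<delta>_def min_def)
  have un: "\<bar>u s - u s0\<bar> < \<rho>" and vn: "\<bar>v s - v s0\<bar> < \<rho> / 2" if "\<bar>s - s0\<bar> \<le> \<delta>" for s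
    using d1(2) d2(2) that \<delta> by (simp_all add: dist_real_def)
  define u1 where "u1 = u (s0 - \<delta>)" define u2 where "u2 = u (s0 + \<delta>)"
  define v1 where "v1 = v s0 - \<rho>" define v2 where "v2 = v s0 + \<rho>"
  define c where "c = v s0 - \<rho> / 2" define d where "d = v s0 + \<rho> / 2"
  let ?I = "{s0 - \<delta>..s0 + \<delta>}"
  have I: "s \<in> ?I \<longleftrightarrow> \<bar>s - s0\<bar> \<le> \<delta>" for s by auto
  have injI: "inj_on u ?I"
  proof (rule inj_onI)
    fix s t assume st: "s \<in> ?I" "t \<in> ?I" "u s = u t"
    have "\<bar>s - s0\<bar> \<le> \<delta>1" "\<bar>t - s0\<bar> \<le> \<delta>1" using st I \<delta> by auto
    then show "s = t" using mono[of s t] mono[of t s] st(3) by linarith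
  qed
  define si where "si = the_inv_into ?I u"
  have si: "si (u s) = s" if "\<bar>s - s0\<bar> \<le> \<delta>" for s
    unfolding si_def using the_inv_into_f_f[OF injI] that I by blast
  have cov: "\<exists>s. \<bar>s - s0\<bar> \<le> \<delta> \<and> u s = w" if "u1 \<le> w" "w \<le> u2" for w
  proof -
    have "\<exists>s. s0 - \<delta> \<le> s \<and> s \<le> s0 + \<delta> \<and> u s = w"
      using that \<delta>(1) cu[of "{s0 - \<delta>..s0 + \<delta>}"] by (intro IVT') (auto simp: u1_def u2_def)
    then show ?thesis by (auto simp: abs_le_iff) (metis abs_le_iff add.commute diff_le_eq le_diff_eq minus_diff_eq)
  qed
  have inside_u: "u s \<in> {u1<..<u2}" if "\<bar>s - s0\<bar> < \<delta>" for s
    using mono[of "s0 - \<delta>" s] mono[of s "s0 + \<delta>"] that \<delta> by (simp add: u1_def u2_def abs_less_iff)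
  have cov': "\<exists>s. \<bar>s - s0\<bar> < \<delta> \<and> w = u s" if "w \<in> {u1<..<u2}" for w
  proof -
    obtain s where s: "\<bar>s - s0\<bar> \<le> \<delta>" "u s = w" using cov[of w] \<open>w \<in> {u1<..<u2}\<close> by auto
    have "s \<noteq> s0 - \<delta>" "s \<noteq> s0 + \<delta>" using that s(2) by (auto simp: u1_def u2_def)
    then have "\<bar>s - s0\<bar> < \<delta>" using s(1) by linarith
    then show ?thesis using s(2) by blast
  qed
  have imI: "u ` ?I = {u1..u2}"
  proof
    show "u ` ?I \<subseteq> {u1..u2}"
    proof
      fix w assume "w \<in> u ` ?I"
      then obtain s where s: "s \<in> ?I" "w = u s" by blast
      have "\<bar>s - s0\<bar> \<le> \<delta>1" "\<bar>s0 - \<delta> - s0\<bar> \<le> \<delta>1" "\<bar>s0 + \<delta> - s0\<bar> \<le> \<delta>1" using s(1) I \<delta> by auto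
      then have "u1 \<le> w" "w \<le> u2"
        using mono[of "s0 - \<delta>" s] mono[of s "s0 + \<delta>"] s
        by (cases "s = s0 - \<delta>"; cases "s = s0 + \<delta>"; simp add: u1_def u2_def)+
      then show "w \<in> {u1..u2}" by simp
    qed
    show "{u1..u2} \<subseteq> u ` ?I"
    proof
      fix w assume "w \<in> {u1..u2}"
      then obtain s where "\<bar>s - s0\<bar> \<le> \<delta>" "u s = w" using cov by auto
      then show "w \<in> u ` ?I" using I by blast
    qed
  qed
  have csi: "continuous_on {u1..u2} si"
    using continuous_on_inv[OF cu compact_Icc, of "s0 - \<delta>" "s0 + \<delta>" si] si I unfolding imI by blast
  \<comment> \<open>The value 0 outside \<open>{u1..u2}\<close> makes \<open>f\<close> Borel
    measurable on the whole line, as the integral formulas require.\<close>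
  define f where "f w = (if w \<in> {u1..u2} then v (si w) else 0)" for w
  have fu: "f (u s) = v s" if "\<bar>s - s0\<bar> \<le> \<delta>" for s
  proof -
    have "u s \<in> {u1..u2}" using imI that I by blast
    then show ?thesis using si[OF that] by (simp add: f_def)
  qed
  have fm: "f \<in> borel_measurable borel"
    unfolding f_def[abs_def]
    by (rule borel_measurable_continuous_on_if)
      (auto intro!: continuous_on_compose2[OF cv csi])
  have df: "(f has_real_derivative q s / p s) (at (u s))" if s: "\<bar>s - s0\<bar> < \<delta>" for s
  proof -
    have us: "u s \<in> {u1<..<u2}" by (rule inside_u[OF s])
    have sis: "si (u s) = s" using s by (intro si) simp
    have pos: "p s > 0" using s \<delta> by (intro p1) simp
    have "continuous_on {u1<..<u2} si" by (rule continuous_on_subset[OF csi]) auto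
    then have ic: "isCont si (u s)" using us continuous_on_eq_continuous_at[OF open_greaterThanLessThan] by blast
    have "(si has_real_derivative inverse (p s)) (at (u s))"
    proof (rule DERIV_inverse_function[where f=u and a=u1 and b=u2])
      show "(u has_real_derivative p s) (at (si (u s)))" unfolding sis by (rule du)
      show "p s \<noteq> 0" using pos by simp
      show "u1 < u s" "u s < u2" using us by auto
      show "u (si y) = y" if "u1 < y" "y < u2" for y
      proof -
        obtain t where "\<bar>t - s0\<bar> \<le> \<delta>" "u t = y" using cov[of y] \<open>u1 < y\<close> \<open>y < u2\<close> by auto
        then show ?thesis using si by auto
      qed
      show "isCont si (u s)" by (rule ic)
    qed
    then have "((\<lambda>w. v (si w)) has_real_derivative q s * inverse (p s)) (at (u s))"
      using DERIV_chain2[of v "q s" si "u s" "inverse (p s)"] dv[of s] sis by simp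
    then have "(f has_real_derivative q s * inverse (p s)) (at (u s))"
      by (rule has_field_derivative_transform_within_open[where S="{u1<..<u2}"]) (use us in \<open>auto simp: f_def\<close>)
    then show ?thesis by (simp add: divide_inverse)
  qed
  have cg: "\<exists>g. continuous_on {u1<..<u2} g \<and> (\<forall>s. \<bar>s - s0\<bar> < \<delta> \<longrightarrow> g (u s) = q s / p s)"
  proof (intro exI[of _ "\<lambda>w. q (si w) / p (si w)"] conjI allI impI)
    have c1: "continuous_on {u1<..<u2} si" by (rule continuous_on_subset[OF csi]) auto
    have "p (si w) \<noteq> 0" if w: "w \<in> {u1<..<u2}" for w
    proof -
      obtain t where t: "\<bar>t - s0\<bar> < \<delta>" "w = u t" using cov'[OF w] by blast
      then have "si w = t" using si[of t] by simp
      then show ?thesis using p1[of t] t \<delta> by simp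
    qed
    then show "continuous_on {u1<..<u2} (\<lambda>w. q (si w) / p (si w))"
      by (intro continuous_on_divide continuous_on_compose2[OF cq[of UNIV] c1] continuous_on_compose2[OF cp[of UNIV] c1]) auto
    show "q (si (u s)) / p (si (u s)) = q s / p s" if "\<bar>s - s0\<bar> < \<delta>" for s using si[of s] that by simp
  qed
  have frange: "f w \<in> {c..d}" if wI: "w \<in> {u1<..<u2}" for w
  proof -
    obtain t where t: "\<bar>t - s0\<bar> < \<delta>" "w = u t" using cov'[OF wI] by blast
    have "f w = v t" using fu[of t] t by simp
    moreover have "\<bar>v t - v s0\<bar> < \<rho> / 2" using t(1) by (intro vn) simp
    ultimately have "c \<le> f w" "f w \<le> d" unfolding c_def d_def by linarith+
    then show ?thesis by simp
  qed
  let ?B = "{u1<..<u2} \<times> {v1<..<v2}"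
  have boxball: "z \<in> ball (?G s0) r" if "frame_coords \<alpha> \<beta> z \<in> ?B" for z
  proof -
    have lin: "frame_coords \<alpha> \<beta> (z - ?G s0) = frame_coords \<alpha> \<beta> z - (u s0, v s0)"
      by (cases z) (simp add: frame_coords_def u_def v_def algebra_simps)
    obtain w where w: "w = frame_coords \<alpha> \<beta> z" by simp
    have "u1 < fst w" "fst w < u2" "v1 < snd w" "snd w < v2" using that unfolding w[symmetric] by (auto simp: mem_Times_iff)
    moreover have "\<bar>u (s0 - \<delta>) - u s0\<bar> < \<rho>" "\<bar>u (s0 + \<delta>) - u s0\<bar> < \<rho>" using \<delta>(1) by (intro un; simp)+
    ultimately have b: "\<bar>fst w - u s0\<bar> < \<rho>" "\<bar>snd w - v s0\<bar> < \<rho>"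
      unfolding u1_def u2_def v1_def v2_def by linarith+
    have "norm (z - ?G s0) = norm (w - (u s0, v s0))" using norm_frame_coords[OF fr, of "z - ?G s0"] lin w by simp
    also have "\<dots> \<le> norm (fst w - u s0) + norm (snd w - v s0)"
      using norm_Pair_le[of "fst w - u s0" "snd w - v s0"] by (cases w) simp
    also have "\<dots> < r" using b by (simp add: \<rho>_def)
    finally show ?thesis by (simp add: dist_norm norm_minus_commute)
  qed
  have below: "snd (frame_coords \<alpha> \<beta> z) \<le> f (fst (frame_coords \<alpha> \<beta> z))" if zB: "frame_coords \<alpha> \<beta> z \<in> ?B" and zD: "z \<in> D" for z
  proof -
    obtain w1 w2 where w: "frame_coords \<alpha> \<beta> z = (w1, w2)" by (cases "frame_coords \<alpha> \<beta> z")
    have w1B: "w1 \<in> {u1<..<u2}" using zB w by simp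
    then obtain s where s: "\<bar>s - s0\<bar> < \<delta>" "w1 = u s" using cov' by blast
    obtain x y where z: "z = (x, y)" by (cases z)
    have "- Q s * (x - X s) + P s * (y - Y s) \<le> 0" using support zD z by blast
    moreover have "- q s * (w1 - u s) + p s * (w2 - v s) = (\<alpha> * \<alpha> + \<beta> * \<beta>) * (- Q s * (x - X s) + P s * (y - Y s))"
    proof -
      have w12: "w1 = \<alpha> * x + \<beta> * y" "w2 = - \<beta> * x + \<alpha> * y" using w by (auto simp: z frame_coords_def)
      show ?thesis unfolding w12 q_def p_def u_def v_def by (simp add: algebra_simps)
    qed
    ultimately have "p s * (w2 - v s) \<le> 0" using s(2) ab1 by simp
    moreover have "p s > 0" using s(1) \<delta> by (intro p1) simp
    ultimately have "w2 \<le> v s" by (simp add: mult_le_0_iff)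
    then show ?thesis using w fu[of s] s by simp
  qed
  have oB: "open {z. frame_coords \<alpha> \<beta> z \<in> ?B}"
  proof -
    have "open (frame_coords \<alpha> \<beta> -` ?B)"
      by (intro open_vimage open_Times open_greaterThanLessThan continuous_intros)
    then show ?thesis by (simp add: vimage_def)
  qed
  have uv0: "frame_coords \<alpha> \<beta> (?G s0) \<in> ?B"
    using inside_u[of s0] \<delta>(1) \<rho> unfolding fc by (simp add: v1_def v2_def)
  have onJ: "snd (frame_coords \<alpha> \<beta> z) = f (fst (frame_coords \<alpha> \<beta> z))"
    if zB: "frame_coords \<alpha> \<beta> z \<in> ?B" and zJ: "z \<in> frontier D" for z
  proof -
    obtain s where s: "\<bar>s - s0\<bar> < \<delta>1" "z = ?G s" using nearJ[OF zJ boxball[OF zB]] by blast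
    have us: "u s \<in> {u1<..<u2}" using zB unfolding s(2) fc by simp
    have "\<bar>s - s0\<bar> \<le> \<delta>"
    proof (rule ccontr)
      assume "\<not> \<bar>s - s0\<bar> \<le> \<delta>"
      then consider "s > s0 + \<delta>" | "s < s0 - \<delta>" by linarith
      then show False
      proof cases
        case 1
        then have "u2 < u s" unfolding u2_def using s \<delta> by (intro mono) auto
        then show False using us by simp
      next
        case 2
        then have "u s < u1" unfolding u1_def using s \<delta> by (intro mono) auto
        then show False using us by simp
      qed
    qed
    then show ?thesis unfolding s(2) fc using fu by simp
  qed
  let ?S = "{z. frame_coords \<alpha> \<beta> z \<in> ?B \<and> snd (frame_coords \<alpha> \<beta> z) < f (fst (frame_coords \<alpha> \<beta> z))}"
  have S: "?S \<subseteq> D"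
  proof -
    have fcont: "continuous_on {u1<..<u2} f"
    proof (rule continuous_at_imp_continuous_on, rule ballI)
      fix w assume "w \<in> {u1<..<u2}"
      then obtain t where "\<bar>t - s0\<bar> < \<delta>" "w = u t" using cov' by blast
      then show "isCont f w" using df DERIV_isCont by blast
    qed
    \<comment> \<open>Parametrises the strict subgraph in the box by abscissa and relative height;
      it is thus a continuous image of a product of intervals, hence connected.\<close>
    let ?h = "\<lambda>k::real \<times> real. frame_coords \<alpha> (-\<beta>) (fst k, v1 + snd k * (f (fst k) - v1))"
    have fv: "v1 < f w" "f w < v2" if "w \<in> {u1<..<u2}" for w
      using frange[OF that] \<rho> by (auto simp: c_def d_def v1_def v2_def)
    have eqS: "?S = ?h ` ({u1<..<u2} \<times> {0<..<1})"
    proof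
      show "?S \<subseteq> ?h ` ({u1<..<u2} \<times> {0<..<1})"
      proof
        fix z assume z: "z \<in> ?S"
        obtain w1 w2 where w: "frame_coords \<alpha> \<beta> z = (w1, w2)" by (cases "frame_coords \<alpha> \<beta> z")
        have w': "w1 \<in> {u1<..<u2}" "v1 < w2" "w2 < f w1" using z w by auto
        have "z = frame_coords \<alpha> (-\<beta>) (w1, w2)" using frame_coords_inverse(1)[OF fr, of z] w by simp
        moreover have "w2 = v1 + (w2 - v1) / (f w1 - v1) * (f w1 - v1)" using fv[OF w'(1)] by simp
        moreover have "0 < (w2 - v1) / (f w1 - v1)" "(w2 - v1) / (f w1 - v1) < 1" using w' fv[OF w'(1)] by auto
        ultimately show "z \<in> ?h ` ({u1<..<u2} \<times> {0<..<1})"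
          using w'(1) by (intro image_eqI[of _ _ "(w1, (w2 - v1) / (f w1 - v1))"]) auto
      qed
      show "?h ` ({u1<..<u2} \<times> {0<..<1}) \<subseteq> ?S"
      proof
        fix z assume "z \<in> ?h ` ({u1<..<u2} \<times> {0<..<1})"
        then obtain w t where wt: "w \<in> {u1<..<u2}" "0 < t" "t < 1" "z = ?h (w, t)" by auto
        have e: "frame_coords \<alpha> \<beta> z = (w, v1 + t * (f w - v1))" using wt(4) frame_coords_inverse(2)[OF fr] by simp
        obtain k where k: "t * (f w - v1) = k" by simp
        have k0: "0 < k" unfolding k[symmetric] using wt fv[OF wt(1)] by (intro mult_pos_pos) auto
        have "t * (f w - v1) < 1 * (f w - v1)" using wt fv[OF wt(1)] by (intro mult_strict_right_mono) auto
        then have "k < f w - v1" unfolding k by simp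
        then show "z \<in> ?S" using e[unfolded k] fv[OF wt(1)] wt(1) k0 by simp
      qed
    qed
    have hc: "continuous_on ({u1<..<u2} \<times> {0<..<1}) ?h"
      by (intro continuous_intros continuous_on_compose2[OF fcont]) auto
    have cc: "connected ({u1<..<u2} \<times> {0<..<1::real})" by (intro connected_Times connected_Ioo)
    have con: "connected ?S" unfolding eqS by (rule connected_continuous_image[OF hc cc])
    have dis: "?S \<inter> frontier D = {}"
    proof (rule equals0I)
      fix z assume "z \<in> ?S \<inter> frontier D"
      then have "frame_coords \<alpha> \<beta> z \<in> ?B" "snd (frame_coords \<alpha> \<beta> z) < f (fst (frame_coords \<alpha> \<beta> z))" "z \<in> frontier D"
        unfolding Int_iff mem_Collect_eq by blast+
      then show False using onJ[of z] by simp
    qed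
    \<comment> \<open>For a convex set with interior points the interior is dense, so the box
      contains an interior point of \<open>D\<close>. It is not on the graph, hence lies strictly
      below it.\<close>
    have "closure (interior D) = closure D" by (rule convex_closure_interior[OF convex_D interior_D])
    then have "?G s0 \<in> closure (interior D)" using closure_subset[of D] curve_in_D[of s0] by auto
    moreover have "?G s0 \<in> {z. frame_coords \<alpha> \<beta> z \<in> ?B}" unfolding mem_Collect_eq by (rule uv0)
    ultimately have "{z. frame_coords \<alpha> \<beta> z \<in> ?B} \<inter> closure (interior D) \<noteq> {}" by (intro Int_nonemptyI)
    then have "{z. frame_coords \<alpha> \<beta> z \<in> ?B} \<inter> interior D \<noteq> {}"
      unfolding open_Int_closure_eq_empty[OF oB] .
    then obtain z where "z \<in> {z. frame_coords \<alpha> \<beta> z \<in> ?B}" "z \<in> interior D" by (metis IntE equals0I)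
    then have z: "frame_coords \<alpha> \<beta> z \<in> ?B" "z \<in> interior D" unfolding mem_Collect_eq .
    have zD: "z \<in> D" using z(2) interior_subset by blast
    have "snd (frame_coords \<alpha> \<beta> z) \<noteq> f (fst (frame_coords \<alpha> \<beta> z))"
    proof
      assume e: "snd (frame_coords \<alpha> \<beta> z) = f (fst (frame_coords \<alpha> \<beta> z))"
      have "fst (frame_coords \<alpha> \<beta> z) \<in> {u1<..<u2}" using z(1) by (auto simp: mem_Times_iff)
      then obtain s where s: "\<bar>s - s0\<bar> < \<delta>" "fst (frame_coords \<alpha> \<beta> z) = u s" using cov' by blast
      then have "frame_coords \<alpha> \<beta> z = (u s, v s)" using e fu[of s] by (simp add: prod_eq_iff)
      then have "z = ?G s" using frame_coords_inverse(1)[OF fr, of z] frame_coords_inverse(1)[OF fr, of "?G s"] fc[of s] by simp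
      then have "z \<in> frontier D" unfolding frontier_D by blast
      then show False using z(2) by (simp add: frontier_def)
    qed
    then have "z \<in> ?S" using below[OF z(1) zD] z(1) by simp
    then have ne: "?S \<inter> D \<noteq> {}" using zD by (rule Int_nonemptyI)
    have "?S - D = {}"
    proof (rule ccontr)
      assume "?S - D \<noteq> {}"
      from connected_Int_frontier[OF con ne this] show False using dis by (rule notE)
    qed
    then show ?thesis by (simp only: Diff_eq_empty_iff)
  qed
  show thesis
  proof (rule that[of \<delta> v1 c d v2 u1 u2 f])
    show "\<delta> > 0" "v1 < c" "c \<le> d" "d < v2" using \<delta> \<rho> by (auto simp: v1_def v2_def c_def d_def)
    show "u1 < u2" using inside_u[of s0] \<delta>(1) by simp
    show "f \<in> borel_measurable borel" by (rule fm)
    show "\<forall>s. \<bar>s - s0\<bar> < \<delta> \<longrightarrow> \<alpha> * P s + \<beta> * Q s > 0"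
      unfolding p_def[symmetric] using \<delta>(2) by (intro allI impI p1) linarith
    show "\<forall>s. \<bar>s - s0\<bar> < \<delta> \<longrightarrow> \<alpha> * X s + \<beta> * Y s \<in> {u1<..<u2} \<and> f (\<alpha> * X s + \<beta> * Y s) = - \<beta> * X s + \<alpha> * Y s"
      unfolding u_def[symmetric] v_def[symmetric] by (intro allI impI conjI inside_u fu) simp_all
    show "\<forall>u\<in>{u1<..<u2}. \<exists>s. \<bar>s - s0\<bar> < \<delta> \<and> u = \<alpha> * X s + \<beta> * Y s" 
      unfolding u_def[symmetric] by (intro ballI cov')
    show "\<forall>u\<in>{u1<..<u2}. f u \<in> {c..d}" by (intro ballI frange)
    show "\<forall>s t. \<bar>s - s0\<bar> < \<delta> \<longrightarrow> \<bar>t - s0\<bar> < \<delta> \<longrightarrow> s < t \<longrightarrow> \<alpha> * X s + \<beta> * Y s < \<alpha> * X t + \<beta> * Y t"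
      unfolding u_def[symmetric] using \<delta>(2) by (intro allI impI mono) linarith+
    show "\<forall>s. \<bar>s - s0\<bar> < \<delta> \<longrightarrow> (f has_real_derivative (- \<beta> * P s + \<alpha> * Q s) / (\<alpha> * P s + \<beta> * Q s)) (at (\<alpha> * X s + \<beta> * Y s))"
      unfolding u_def[symmetric] p_def[symmetric] q_def[symmetric] by (intro allI impI df)
    show "\<exists>g. continuous_on {u1<..<u2} g \<and> (\<forall>s. \<bar>s - s0\<bar> < \<delta> \<longrightarrow> g (\<alpha> * X s + \<beta> * Y s) = (- \<beta> * P s + \<alpha> * Q s) / (\<alpha> * P s + \<beta> * Q s))"
      unfolding u_def[symmetric] p_def[symmetric] q_def[symmetric] by (rule cg)
    show "\<forall>z. frame_coords \<alpha> \<beta> z \<in> ?B \<longrightarrow> z \<in> Op \<and> (z \<in> D \<longleftrightarrow> snd (frame_coords \<alpha> \<beta> z) \<le> f (fst (frame_coords \<alpha> \<beta> z)))"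
    proof (intro allI impI conjI iffI)
      fix z assume zB: "frame_coords \<alpha> \<beta> z \<in> ?B"
      show "z \<in> Op" using boxball[OF zB] r(2) by blast
      show "snd (frame_coords \<alpha> \<beta> z) \<le> f (fst (frame_coords \<alpha> \<beta> z))" if "z \<in> D" by (rule below[OF zB that])
      show "z \<in> D" if le: "snd (frame_coords \<alpha> \<beta> z) \<le> f (fst (frame_coords \<alpha> \<beta> z))"
      proof (cases "snd (frame_coords \<alpha> \<beta> z) = f (fst (frame_coords \<alpha> \<beta> z))")
        case False
        then show ?thesis using S zB le by auto
      next
        case True
        have "fst (frame_coords \<alpha> \<beta> z) \<in> {u1<..<u2}" using zB by (auto simp: mem_Times_iff)
        then obtain s where s: "\<bar>s - s0\<bar> < \<delta>" "fst (frame_coords \<alpha> \<beta> z) = u s" using cov' by blast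
        then have "frame_coords \<alpha> \<beta> z = (u s, v s)" using True fu[of s] by (simp add: prod_eq_iff)
        then have "z = ?G s" using frame_coords_inverse(1)[OF fr, of z] frame_coords_inverse(1)[OF fr, of "?G s"] fc[of s] by simp
        then show ?thesis using curve_in_D by simp
      qed
    qed
  qed
qed

end

section \<open>The first integral along the profile of a Cheeger set\<close>

text \<open>Joins the curve to the minimality of the revolved set. Rotational symmetry of
  \<open>\<Omega>\<close> is stated pointwise; the unit vector \<open>e\<close> selects the meridian
  section \<open>slice\<close>, which decides whether a profile point is free.\<close>

locale cheeger_profile = convex_profile D X Y P Q L
  for D :: "(real \<times> real) set" and X Y P Q :: "real \<Rightarrow> real" and L :: real +
  fixes \<Omega> C :: "(real \<times> (real ^ 'm)) set" and h :: real and e :: "real ^ 'm"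
  assumes m2: "CARD('m) \<ge> 2" and C_eq: "C = profile -` D" and e: "norm e = 1"
    and h_pos: "h > 0" and perimeter_C: "perimeter C = ereal (h * measure lborel C)"
    and minimal: "\<forall>E. E \<in> sets borel \<longrightarrow> bounded E \<longrightarrow> negligible (E - \<Omega>) \<longrightarrow> ereal (h * measure lborel E) \<le> perimeter E"
    and C_Omega: "negligible (C - \<Omega>)" and open_Omega: "open \<Omega>"
    and rotation_Omega: "p \<in> \<Omega> \<Longrightarrow> fst p' = fst p \<Longrightarrow> norm (snd p') = norm (snd p) \<Longrightarrow> p' \<in> \<Omega>"
begin

definition slice :: "(real \<times> real) set" where "slice = {q. (fst q, snd q *\<^sub>R e) \<in> \<Omega>}"

lemma open_slice: "open slice"
proof -
  have "open ((\<lambda>q. (fst q, snd q *\<^sub>R e)) -` \<Omega>)" by (intro open_vimage open_Omega continuous_intros)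
  then show ?thesis by (simp add: slice_def vimage_def)
qed

lemma profile_in_slice: "profile p \<in> slice \<longleftrightarrow> p \<in> \<Omega>"
  unfolding slice_def profile_def using rotation_Omega[of p "(fst p, norm (snd p) *\<^sub>R e)"]
    rotation_Omega[of "(fst p, norm (snd p) *\<^sub>R e)" p] e by auto

lemma C_borel: "C \<in> sets borel" "closed C"
proof -
  show "closed C" unfolding C_eq by (intro closed_vimage compact_imp_closed compact_D continuous_on_profile)
  then show "C \<in> sets borel" by (rule borel_closed)
qed

lemma C_bounded: "bounded C"
proof -
  obtain M where M: "\<And>q. q \<in> D \<Longrightarrow> norm q \<le> M" using compact_imp_bounded[OF compact_D] unfolding bounded_iff by blast
  have "norm p \<le> M" if "p \<in> C" for p
  proof -
    have "norm (profile p) = norm p" by (cases p) (simp add: profile_def norm_Pair)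
    then show ?thesis using M[of "profile p"] that by (simp add: C_eq)
  qed
  then show ?thesis unfolding bounded_iff by blast
qed

definition T :: "real \<Rightarrow> real" where
  "T s = Y s ^ (CARD('m) - 1) * P s - h / CARD('m) * Y s ^ CARD('m)"

lemma isCont_T: "isCont T s"
  unfolding T_def[abs_def] by (intro continuous_intros isCont_XY cont_P)

text \<open>In the frame \<open>(0, \<beta>)\<close> the abscissa is \<open>\<beta> * Y s\<close>
  and unit speed gives \<open>f' / sqrt (1 + f'^2) = - \<beta> * P s\<close>, so the
  \<open>M\<close> of \<open>vertical_graph_monotone\<close> equals \<open>- \<beta> * T s\<close>.
  Inward variations give the inequality; at a free point outward ones give its converse.\<close>

lemma T_monotone_local:
  assumes \<beta>: "\<beta> = 1 \<or> \<beta> = -1" and Q0: "\<beta> * Q s0 > 0" and Y0: "Y s0 > 0"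
  shows "\<exists>\<delta>>0. \<forall>s t. \<bar>s - s0\<bar> < \<delta> \<longrightarrow> \<bar>t - s0\<bar> < \<delta> \<longrightarrow> s < t \<longrightarrow>
    \<beta> * T t \<le> \<beta> * T s \<and> ((X s0, Y s0) \<in> slice \<longrightarrow> T t = T s)"
proof -
  let ?m = "CARD('m)"
  \<comment> \<open>Off the axis in all cases, so that the radius is positive in the box; at a free
    point also within \<open>slice\<close>, so that outward variations remain in
    \<open>\<Omega>\<close>.\<close>
  define Op where "Op = (if (X s0, Y s0) \<in> slice then {q. snd q > 0} \<inter> slice else {q. snd q > 0})"
  have "open {q :: real \<times> real. snd q > 0}" by (intro open_Collect_less continuous_intros)
  then have Op: "open Op" "(X s0, Y s0) \<in> Op" using Y0 open_slice by (auto simp: Op_def)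
  have Oppos: "snd q > 0" if "q \<in> Op" for q using that by (auto simp: Op_def split: if_splits)
  have fr: "frame 0 \<beta>" using \<beta> by (auto simp: frame_def)
  have p0: "0 * P s0 + \<beta> * Q s0 > 0" using Q0 by simp
  obtain \<delta> f u1 u2 v1 v2 c d where g: "\<delta> > 0" "v1 < c" "c \<le> d" "d < v2" "u1 < u2" "f \<in> borel_measurable borel"
    "\<forall>s. \<bar>s - s0\<bar> < \<delta> \<longrightarrow> 0 * P s + \<beta> * Q s > 0"
    "\<forall>s. \<bar>s - s0\<bar> < \<delta> \<longrightarrow> 0 * X s + \<beta> * Y s \<in> {u1<..<u2} \<and> f (0 * X s + \<beta> * Y s) = - \<beta> * X s + 0 * Y s"
    "\<forall>u\<in>{u1<..<u2}. \<exists>s. \<bar>s - s0\<bar> < \<delta> \<and> u = 0 * X s + \<beta> * Y s"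
    "\<forall>u\<in>{u1<..<u2}. f u \<in> {c..d}"
    "\<forall>s t. \<bar>s - s0\<bar> < \<delta> \<longrightarrow> \<bar>t - s0\<bar> < \<delta> \<longrightarrow> s < t \<longrightarrow> 0 * X s + \<beta> * Y s < 0 * X t + \<beta> * Y t"
    "\<forall>s. \<bar>s - s0\<bar> < \<delta> \<longrightarrow> (f has_real_derivative (- \<beta> * P s + 0 * Q s) / (0 * P s + \<beta> * Q s)) (at (0 * X s + \<beta> * Y s))"
    "\<exists>g. continuous_on {u1<..<u2} g \<and> (\<forall>s. \<bar>s - s0\<bar> < \<delta> \<longrightarrow> g (0 * X s + \<beta> * Y s) = (- \<beta> * P s + 0 * Q s) / (0 * P s + \<beta> * Q s))"
    "\<forall>q. frame_coords 0 \<beta> q \<in> {u1<..<u2} \<times> {v1<..<v2} \<longrightarrow> q \<in> Op \<and> (q \<in> D \<longleftrightarrow> snd (frame_coords 0 \<beta> q) \<le> f (fst (frame_coords 0 \<beta> q)))"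
    by (rule local_graph[OF fr p0 Op])
  obtain f' where f': "continuous_on {u1<..<u2} f'" "\<forall>s. \<bar>s - s0\<bar> < \<delta> \<longrightarrow> f' (0 * X s + \<beta> * Y s) = (- \<beta> * P s + 0 * Q s) / (0 * P s + \<beta> * Q s)"
    using g(13) by blast
  note gO = g(14)[THEN spec, THEN mp, THEN conjunct1] and gD = g(14)[THEN spec, THEN mp, THEN conjunct2]
  have bb: "\<beta> * \<beta> = 1" using \<beta> by auto
  have df: "(f has_real_derivative f' u) (at u)" if u: "u \<in> {u1<..<u2}" for u
  proof -
    obtain s where s: "\<bar>s - s0\<bar> < \<delta>" "u = 0 * X s + \<beta> * Y s" using g(9) u by blast
    show ?thesis using g(12) f'(2) s(1) unfolding s(2) by metis
  qed
  have upos: "\<beta> * u > 0" if u: "u \<in> {u1<..<u2}" for u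
  proof -
    obtain s where s: "\<bar>s - s0\<bar> < \<delta>" "u = 0 * X s + \<beta> * Y s" using g(9) u by blast
    have "f u \<in> {c..d}" using g(10) u by blast
    moreover have "f u = - \<beta> * X s + 0 * Y s" using g(8) s by blast
    ultimately have "frame_coords 0 \<beta> (X s, Y s) \<in> {u1<..<u2} \<times> {v1<..<v2}"
      using u g(2,4) s(2) by (simp add: frame_coords_def)
    then have "(X s, Y s) \<in> Op" by (rule gO)
    then have "Y s > 0" using Oppos by fastforce
    moreover have "\<beta> * u = (\<beta> * \<beta>) * Y s" unfolding s(2) by simp
    ultimately show ?thesis using bb by simp
  qed
  have CR: "p \<in> C \<longleftrightarrow> snd (cyl_coords 0 \<beta> p) \<le> f (fst (cyl_coords 0 \<beta> p))"
    if "p \<in> cyl_box 0 \<beta> u1 u2 v1 v2" for p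
  proof -
    have "frame_coords 0 \<beta> (profile p) \<in> {u1<..<u2} \<times> {v1<..<v2}"
      using that unfolding cyl_box_def cyl_coords_def mem_Collect_eq .
    then show ?thesis unfolding C_eq vimage_eq cyl_coords_def by (rule gD)
  qed
  have R\<Omega>: "cyl_box 0 \<beta> u1 u2 v1 v2 \<subseteq> \<Omega>" if "(X s0, Y s0) \<in> slice"
  proof
    fix p :: "real \<times> (real ^ 'm)" assume "p \<in> cyl_box 0 \<beta> u1 u2 v1 v2"
    then have "frame_coords 0 \<beta> (profile p) \<in> {u1<..<u2} \<times> {v1<..<v2}"
      unfolding cyl_box_def cyl_coords_def mem_Collect_eq .
    then have "profile p \<in> Op" by (rule gO)
    then have "profile p \<in> slice" using that by (simp add: Op_def)
    then show "p \<in> \<Omega>" by (simp add: profile_in_slice)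
  qed
  have rf: "f u \<in> {c..d}" if "u \<in> {u1<..<u2}" for u by (rule bspec[OF g(10) that])
  define M where "M u = (\<beta> * u) ^ (?m - 1) * (f' u / sqrt (1 + (f' u)\<^sup>2)) + h / ?m * \<beta> * (\<beta> * u) ^ ?m" for u
  have MT: "M (\<beta> * Y s) = - \<beta> * T s" if s: "\<bar>s - s0\<bar> < \<delta>" for s
  proof -
    obtain d where d: "d = \<beta> * Q s" by simp
    obtain n where n: "n = - \<beta> * P s" by simp
    have Qp: "d > 0" using g(7) s unfolding d by simp
    have fs: "f' (\<beta> * Y s) = n / d" using f'(2) s unfolding d n by simp
    have b2: "\<beta>\<^sup>2 = 1" using bb by (simp add: power2_eq_square)
    have "1 + (f' (\<beta> * Y s))\<^sup>2 = (d\<^sup>2 + n\<^sup>2) / d\<^sup>2"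
      unfolding fs using Qp by (simp add: power_divide add_divide_distrib)
    also have "d\<^sup>2 + n\<^sup>2 = \<beta>\<^sup>2 * (P s * P s + Q s * Q s)" unfolding d n by (simp add: power2_eq_square algebra_simps)
    also have "\<dots> = 1" unfolding b2 unit_speed by simp
    finally have "sqrt (1 + (f' (\<beta> * Y s))\<^sup>2) = 1 / d" using Qp by (simp add: real_sqrt_divide)
    then have F: "f' (\<beta> * Y s) / sqrt (1 + (f' (\<beta> * Y s))\<^sup>2) = - \<beta> * P s" unfolding fs using Qp n by simp
    have E: "\<beta> * (\<beta> * Y s) = Y s" using bb by (simp add: mult.assoc[symmetric])
    show ?thesis unfolding M_def E F T_def by (simp add: algebra_simps)
  qed
  show ?thesis
  proof (intro exI[of _ \<delta>] conjI allI impI g(1))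
    fix s t assume st: "\<bar>s - s0\<bar> < \<delta>" "\<bar>t - s0\<bar> < \<delta>" "s < t"
    have xy: "u1 < \<beta> * Y s" "\<beta> * Y s < \<beta> * Y t" "\<beta> * Y t < u2" using g(8) g(11) st by auto
    have mono: "\<epsilon> * M (\<beta> * Y s) \<le> \<epsilon> * M (\<beta> * Y t)" if "\<epsilon> = 1 \<or> \<epsilon> = -1 \<and> cyl_box 0 \<beta> u1 u2 v1 v2 \<subseteq> \<Omega>" for \<epsilon>
      unfolding M_def
      by (rule vertical_graph_monotone[OF m2 \<beta> upos df f'(1) g(6) C_borel(1) C_bounded CR g(2-4) rf less_imp_le[OF h_pos]
          perimeter_C minimal C_Omega that xy])
    have A: "\<beta> * T t \<le> \<beta> * T s" using mono[of 1] MT st by simp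
    then show "\<beta> * T t \<le> \<beta> * T s" .
    show "T t = T s" if "(X s0, Y s0) \<in> slice"
    proof -
      have "\<beta> * T s \<le> \<beta> * T t" using mono[of "-1"] MT st R\<Omega>[OF that] by simp
      then have "\<beta> * T s = \<beta> * T t" using A by (rule antisym)
      then show ?thesis using \<beta> by auto
    qed
  qed
qed

text \<open>If \<open>Q\<close> vanishes near \<open>s0\<close>, then \<open>Y\<close> is constant
  there. Shrinking the box of \<open>local_graph\<close> to the abscissas of this segment turns the
  graph into a constant, the situation of \<open>horizontal_graph_bound\<close>.
  \<open>P s0 = 1\<close> says that the region lies below the segment.\<close>

lemma horizontal_segment_bound:
  assumes Y0: "Y s0 > 0" and sl: "(X s0, Y s0) \<in> slice" and \<eta>: "\<eta> > 0" and Q0: "\<And>s. \<bar>s - s0\<bar> < \<eta> \<Longrightarrow> Q s = 0"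
  shows "P s0 = 1 \<and> h * Y s0 \<le> real CARD('m) - 1"
proof -
  define \<alpha> where "\<alpha> = P s0"
  have "P s0 * P s0 = 1" using unit_speed[of s0] Q0[of s0] \<eta> by simp
  then have \<alpha>: "\<alpha> = 1 \<or> \<alpha> = -1" unfolding \<alpha>_def by (metis square_eq_1_iff)
  have aa: "\<alpha> * \<alpha> = 1" using \<alpha> by auto
  define Op where "Op = {q. snd q > 0} \<inter> slice"
  have "open {q :: real \<times> real. snd q > 0}" by (intro open_Collect_less continuous_intros)
  then have Op: "open Op" "(X s0, Y s0) \<in> Op" using Y0 open_slice sl by (auto simp: Op_def)
  have fr: "frame \<alpha> 0" using \<alpha> by (auto simp: frame_def)
  have p0: "\<alpha> * P s0 + 0 * Q s0 > 0" using aa by (simp add: \<alpha>_def)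
  obtain \<delta> f u1 u2 v1 v2 c d where g: "\<delta> > 0" "v1 < c" "c \<le> d" "d < v2" "u1 < u2" "f \<in> borel_measurable borel"
    "\<forall>s. \<bar>s - s0\<bar> < \<delta> \<longrightarrow> \<alpha> * P s + 0 * Q s > 0"
    "\<forall>s. \<bar>s - s0\<bar> < \<delta> \<longrightarrow> \<alpha> * X s + 0 * Y s \<in> {u1<..<u2} \<and> f (\<alpha> * X s + 0 * Y s) = - 0 * X s + \<alpha> * Y s"
    "\<forall>u\<in>{u1<..<u2}. \<exists>s. \<bar>s - s0\<bar> < \<delta> \<and> u = \<alpha> * X s + 0 * Y s"
    "\<forall>u\<in>{u1<..<u2}. f u \<in> {c..d}"
    "\<forall>s t. \<bar>s - s0\<bar> < \<delta> \<longrightarrow> \<bar>t - s0\<bar> < \<delta> \<longrightarrow> s < t \<longrightarrow> \<alpha> * X s + 0 * Y s < \<alpha> * X t + 0 * Y t"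
    "\<forall>s. \<bar>s - s0\<bar> < \<delta> \<longrightarrow> (f has_real_derivative (- 0 * P s + \<alpha> * Q s) / (\<alpha> * P s + 0 * Q s)) (at (\<alpha> * X s + 0 * Y s))"
    "\<exists>g. continuous_on {u1<..<u2} g \<and> (\<forall>s. \<bar>s - s0\<bar> < \<delta> \<longrightarrow> g (\<alpha> * X s + 0 * Y s) = (- 0 * P s + \<alpha> * Q s) / (\<alpha> * P s + 0 * Q s))"
    "\<forall>q. frame_coords \<alpha> 0 q \<in> {u1<..<u2} \<times> {v1<..<v2} \<longrightarrow> q \<in> Op \<and> (q \<in> D \<longleftrightarrow> snd (frame_coords \<alpha> 0 q) \<le> f (fst (frame_coords \<alpha> 0 q)))"
    by (rule local_graph[OF fr p0 Op])
  define \<epsilon> where "\<epsilon> = min \<delta> \<eta> / 2"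
  have \<epsilon>: "\<epsilon> > 0" "\<epsilon> < \<delta>" "\<epsilon> < \<eta>" using g(1) \<eta> by (auto simp: \<epsilon>_def min_def)
  define w1 where "w1 = \<alpha> * X (s0 - \<epsilon>)" define w2 where "w2 = \<alpha> * X (s0 + \<epsilon>)"
  have mono: "\<alpha> * X s < \<alpha> * X t" if "\<bar>s - s0\<bar> < \<delta>" "\<bar>t - s0\<bar> < \<delta>" "s < t" for s t
    using g(11) that by simp
  have w: "u1 < w1" "w1 < \<alpha> * X s0" "\<alpha> * X s0 < w2" "w2 < u2"
    using g(8) mono[of "s0 - \<epsilon>" s0] mono[of s0 "s0 + \<epsilon>"] \<epsilon> by (auto simp: w1_def w2_def)
  define v0 where "v0 = \<alpha> * Y s0"
  have Yc: "Y s = Y s0" if "\<bar>s - s0\<bar> < \<eta>" for s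
  proof -
    have "(Y has_real_derivative 0) (at x within {s0 - \<eta><..<s0 + \<eta>})" if "x \<in> {s0 - \<eta><..<s0 + \<eta>}" for x
      using deriv_Y[of x] Q0[of x] that by (simp add: abs_less_iff has_field_derivative_at_within)
    from has_field_derivative_zero_constant[OF convex_real_interval(8) this]
    obtain k where "\<forall>x\<in>{s0 - \<eta><..<s0 + \<eta>}. Y x = k" by blast
    moreover have "s \<in> {s0 - \<eta><..<s0 + \<eta>}" "s0 \<in> {s0 - \<eta><..<s0 + \<eta>}" using that \<eta> by (auto simp: abs_less_iff)
    ultimately show ?thesis by simp
  qed
  have fv: "f u = v0" if u: "w1 < u" "u < w2" for u
  proof -
    obtain s where s: "\<bar>s - s0\<bar> < \<delta>" "u = \<alpha> * X s" using g(9) u w by fastforce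
    have "\<not> s \<ge> s0 + \<epsilon>" using mono[of "s0 + \<epsilon>" s] s \<epsilon> u(2) unfolding w2_def by (cases "s = s0 + \<epsilon>") auto
    moreover have "\<not> s \<le> s0 - \<epsilon>" using mono[of s "s0 - \<epsilon>"] s \<epsilon> u(1) unfolding w1_def by (cases "s = s0 - \<epsilon>") auto
    ultimately have "\<bar>s - s0\<bar> < \<eta>" using \<epsilon> by linarith
    then show ?thesis using g(8) s Yc[of s] by (simp add: v0_def)
  qed
  have box: "q \<in> Op \<and> (q \<in> D \<longleftrightarrow> snd (frame_coords \<alpha> 0 q) \<le> v0)" if "frame_coords \<alpha> 0 q \<in> {w1<..<w2} \<times> {v1<..<v2}" for q
  proof -
    have fq: "w1 < fst (frame_coords \<alpha> 0 q)" "fst (frame_coords \<alpha> 0 q) < w2" using that by (auto simp: mem_Times_iff)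
    have "frame_coords \<alpha> 0 q \<in> {u1<..<u2} \<times> {v1<..<v2}" using that w by (auto simp: mem_Times_iff)
    from g(14)[THEN spec, THEN mp, OF this] show ?thesis unfolding fv[OF fq] .
  qed
  have "\<alpha> = 1 \<and> h * v0 \<le> real CARD('m) - 1"
  proof (rule horizontal_graph_bound[OF m2 \<alpha> _ _ _ _ C_borel(1) C_bounded _ less_imp_le[OF h_pos] perimeter_C minimal C_Omega])
    show "\<alpha> * v > 0" if "v \<in> {v1<..<v2}" for v
    proof -
      have "frame_coords \<alpha> 0 (X s0, \<alpha> * v) \<in> {w1<..<w2} \<times> {v1<..<v2}"
        using that w aa by (simp add: frame_coords_def mult.assoc[symmetric])
      then have "(X s0, \<alpha> * v) \<in> Op" by (rule box[THEN conjunct1])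
      then show ?thesis by (simp add: Op_def)
    qed
    have "v0 \<in> {c..d}" using fv[of "\<alpha> * X s0"] g(10) w by force
    then show "v1 < v0" "v0 < v2" using g(2,4) by auto
    show "w1 < w2" using w by simp
    show "p \<in> C \<longleftrightarrow> snd (cyl_coords \<alpha> 0 p) \<le> v0" if "p \<in> cyl_box \<alpha> 0 w1 w2 v1 v2" for p
    proof -
      have "frame_coords \<alpha> 0 (profile p) \<in> {w1<..<w2} \<times> {v1<..<v2}"
        using that unfolding cyl_box_def cyl_coords_def mem_Collect_eq .
      then show ?thesis unfolding C_eq vimage_eq cyl_coords_def by (rule box[THEN conjunct2])
    qed
    show "cyl_box \<alpha> 0 w1 w2 v1 v2 \<subseteq> \<Omega>"
    proof
      fix p :: "real \<times> (real ^ 'm)" assume "p \<in> cyl_box \<alpha> 0 w1 w2 v1 v2"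
      then have "frame_coords \<alpha> 0 (profile p) \<in> {w1<..<w2} \<times> {v1<..<v2}"
        unfolding cyl_box_def cyl_coords_def mem_Collect_eq .
      then have "profile p \<in> Op" by (rule box[THEN conjunct1])
      then have "profile p \<in> slice" by (simp add: Op_def)
      then show "p \<in> \<Omega>" by (simp add: profile_in_slice)
    qed
  qed
  then show ?thesis by (auto simp: \<alpha>_def v0_def)
qed

end

section \<open>Sign of the first integral\<close>

text \<open>Going back from \<open>s\<close> to the last parameter \<open>b\<close> with
  \<open>P b \<le> 0\<close>, the tangent at \<open>b\<close> is vertical and points upward, so
  \<open>T b = - H * Y b^n < 0\<close>. Between \<open>b\<close> and \<open>s\<close> the height
  does not decrease and \<open>T\<close> does not increase. Abstract functions instead of the curve
  allow an application to its mirror image as well.\<close>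

lemma negative_first_integral:
  fixes X Y P Q T :: "real \<Rightarrow> real"
  assumes dX: "\<And>s. (X has_real_derivative P s) (at s)" and dY: "\<And>s. (Y has_real_derivative Q s) (at s)"
    and unit: "\<And>s. P s * P s + Q s * Q s = 1" and cP: "\<And>s. isCont P s" and cQ: "\<And>s. isCont Q s"
    and cT: "\<And>s. isCont T s" and L: "L > 0" and per: "\<And>s. X (s - L) = X s"
    and Y0: "\<And>s. Y s \<ge> 0"
    and slope: "\<And>s t. s \<le> t \<Longrightarrow> (\<And>r. s \<le> r \<Longrightarrow> r \<le> t \<Longrightarrow> P r > 0) \<Longrightarrow> Q t * P s \<le> Q s * P t"
    and T: "\<And>s. T s = Y s ^ k * P s - H * Y s ^ n" and H: "H > 0"
    and loc: "\<And>s. Q s > 0 \<Longrightarrow> Y s > 0 \<Longrightarrow> \<exists>\<delta>>0. \<forall>t. s < t \<longrightarrow> t < s + \<delta> \<longrightarrow> T t \<le> T s"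
    and s: "P s > 0" "Q s \<ge> 0"
  shows "T s < 0"
proof -
  \<comment> \<open>\<open>X\<close> takes the same value one period earlier, so \<open>P\<close>
    vanishes somewhere in between.\<close>
  have "\<exists>z. s - L < z \<and> z < s \<and> X s - X (s - L) = (s - (s - L)) * P z"
    by (rule MVT2) (use L dX in auto)
  then obtain z where z: "z < s" "P z = 0" using per L by auto
  define A where "A = {t. z \<le> t \<and> t \<le> s \<and> P t \<le> 0}"
  have clA: "closed A"
  proof -
    have "continuous_on UNIV P" using cP by (simp add: continuous_at_imp_continuous_on)
    then have "closed {t. P t \<le> 0}" by (intro closed_Collect_le continuous_intros)
    moreover have "A = {z..s} \<inter> {t. P t \<le> 0}" by (auto simp: A_def)
    ultimately show ?thesis by (simp add: closed_Int)
  qed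
  have bA: "bdd_above A" by (auto simp: A_def intro!: bdd_aboveI[of _ s])
  have zA: "z \<in> A" using z by (simp add: A_def)
  define b where "b = Sup A"
  have "A \<noteq> {}" using zA by blast
  then have "b \<in> A" unfolding b_def using clA bA by (intro closed_contains_Sup)
  then have bs: "b < s" "P b \<le> 0" using s(1) by (auto simp: A_def intro: le_neq_trans)
  have Pp: "P t > 0" if "b < t" "t \<le> s" for t
  proof (rule ccontr)
    assume "\<not> P t > 0"
    then have "t \<in> A" using that \<open>b \<in> A\<close> by (auto simp: A_def)
    then have "t \<le> b" unfolding b_def by (rule cSup_upper[OF _ bA])
    then show False using that by simp
  qed
  have Qn: "Q t \<ge> 0" if "b < t" "t \<le> s" for t
  proof -
    have "Q s * P t \<le> Q t * P s" by (rule slope[OF that(2)]) (use Pp that in auto)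
    moreover have "Q s * P t \<ge> 0" using s(2) Pp[OF that] by simp
    ultimately have "Q t * P s \<ge> 0" by linarith
    then show ?thesis using s(1) by (simp add: zero_le_mult_iff)
  qed
  have evr: "\<forall>\<^sub>F t in at_right b. b < t \<and> t \<le> s"
    unfolding eventually_at_right_field using bs(1) by (intro exI[of _ s]) auto
  have limP: "(P \<longlongrightarrow> P b) (at_right b)" and limQ: "(Q \<longlongrightarrow> Q b) (at_right b)"
    using cP[of b] cQ[of b] unfolding isCont_def by (auto intro: tendsto_mono[OF at_le])
  have "P b \<ge> 0" by (rule tendsto_lowerbound[OF limP]) (use evr Pp in \<open>auto elim!: eventually_mono intro: less_imp_le\<close>)
  then have Pb: "P b = 0" using bs(2) by simp
  have Qb0: "Q b \<ge> 0" by (rule tendsto_lowerbound[OF limQ]) (use evr Qn in \<open>auto elim!: eventually_mono\<close>)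
  have "Q b * Q b = 1" using unit[of b] Pb by simp
  then have Qb: "Q b = 1" using Qb0 by (metis abs_of_nonneg abs_square_eq_1 power2_eq_square)
  \<comment> \<open>At height 0 the function \<open>Y\<close> would have a minimum, against
    \<open>Q b = 1\<close>.\<close>
  have Yb: "Y b > 0"
  proof (rule ccontr)
    assume "\<not> Y b > 0"
    then have "Y b = 0" using Y0[of b] by simp
    then have "\<forall>y. \<bar>b - y\<bar> < 1 \<longrightarrow> Y b \<le> Y y" using Y0 by simp
    from DERIV_local_min[OF dY zero_less_one this] Qb show False by simp
  qed
  have Ymono: "Y t \<ge> Y b" if "b \<le> t" "t \<le> s" for t
  proof (rule DERIV_nonneg_imp_nondecreasing[OF that(1)])
    fix x assume "b \<le> x" "x \<le> t"
    then have "Q x \<ge> 0" using Qb0 Qn[of x] that by (cases "x = b") auto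
    then show "\<exists>y. (Y has_real_derivative y) (at x) \<and> 0 \<le> y" using dY by blast
  qed
  have Tb: "T b < 0" using T[of b] Pb H Yb by simp
  \<comment> \<open>Continuation: at the last point \<open>c\<close> of this set either
    \<open>Q c > 0\<close>, and local monotonicity goes further, or \<open>Q c = 0\<close>. In the
    second case monotone slopes force \<open>Q = 0\<close> up to \<open>s\<close>, and
    \<open>T\<close> is constant from \<open>c\<close> on.\<close>
  define B where "B = {t. b \<le> t \<and> t \<le> s \<and> T t \<le> T b}"
  have clB: "closed B"
  proof -
    have "continuous_on UNIV T" using cT by (simp add: continuous_at_imp_continuous_on)
    then have "closed {t. T t \<le> T b}" by (intro closed_Collect_le continuous_intros)
    moreover have "B = {b..s} \<inter> {t. T t \<le> T b}" by (auto simp: B_def)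
    ultimately show ?thesis by (simp add: closed_Int)
  qed
  have bB: "bdd_above B" by (auto simp: B_def intro!: bdd_aboveI[of _ s])
  have "b \<in> B" using bs by (simp add: B_def)
  define c where "c = Sup B"
  have "B \<noteq> {}" using \<open>b \<in> B\<close> by blast
  then have cB: "c \<in> B" unfolding c_def using clB bB by (intro closed_contains_Sup)
  have cmax: "t \<le> c" if "t \<in> B" for t unfolding c_def by (rule cSup_upper[OF that bB])
  have "T s \<le> T b"
  proof (cases "c = s")
    case True then show ?thesis using cB by (simp add: B_def)
  next
    case False
    then have cs: "b \<le> c" "c < s" "T c \<le> T b" using cB by (auto simp: B_def)
    show ?thesis
    proof (cases "Q c > 0")
      case True
      have "Y c > 0" using Ymono[of c] Yb cs by simp
      then obtain \<delta> where \<delta>: "\<delta> > 0" "\<forall>t. c < t \<longrightarrow> t < c + \<delta> \<longrightarrow> T t \<le> T c" using loc[OF True] by blast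
      define t where "t = min (c + \<delta> / 2) s"
      have "c < t" "t < c + \<delta>" "t \<le> s" using \<delta>(1) cs by (auto simp: t_def)
      then have "t \<in> B" using \<delta>(2) cs by (auto simp: B_def)
      then show ?thesis using cmax[of t] \<open>c < t\<close> by simp
    next
      case False
      then have cb: "b < c" using cs Qb by (cases "c = b") auto
      then have Qc: "Q c = 0" using Qn[of c] cs False by simp
      have Q0: "Q t = 0" if "c \<le> t" "t \<le> s" for t
      proof -
        have "Q t * P c \<le> Q c * P t" by (rule slope[OF that(1)]) (use Pp that cb in auto)
        then have "Q t * P c \<le> 0" using Qc by simp
        then have "Q t \<le> 0" using Pp[of c] cb cs by (simp add: mult_le_0_iff)
        then show ?thesis using Qn[of t] that cb by simp
      qed
      have "P t = 1" if "c \<le> t" "t \<le> s" for t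
      proof -
        have "P t * P t = 1" using unit[of t] Q0[OF that] by simp
        then show ?thesis using Pp[of t] that cb by (metis abs_of_pos abs_square_eq_1 less_le_trans power2_eq_square)
      qed
      moreover have "Y s = Y c"
      proof -
        have "\<exists>z. c < z \<and> z < s \<and> Y s - Y c = (s - c) * Q z" by (rule MVT2[OF cs(2)]) (use dY in auto)
        then show ?thesis using Q0 by auto
      qed
      ultimately have "T s = T c" using cs by (simp add: T)
      then show ?thesis using cs by simp
    qed
  qed
  then show ?thesis using Tb by simp
qed

context cheeger_profile
begin

text \<open>The slope \<open>Q / P\<close> does not increase along a clockwise convex curve: the
  support inequalities at \<open>s\<close> and \<open>t\<close> place the slope of the chord between
  those of the two tangents. The cross-multiplied form is the same for both signs of
  \<open>P\<close>.\<close>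

lemma slope_monotone:
  assumes st: "s \<le> t" and sg: "(\<forall>r. s \<le> r \<longrightarrow> r \<le> t \<longrightarrow> P r > 0) \<or> (\<forall>r. s \<le> r \<longrightarrow> r \<le> t \<longrightarrow> P r < 0)"
  shows "Q t * P s \<le> Q s * P t"
proof (cases "s = t")
  case False
  then have st': "s < t" using st by simp
  define dx where "dx = X t - X s" define dy where "dy = Y t - Y s"
  have 1: "P s * dy \<le> Q s * dx" using support[OF curve_in_D[of t], of s] by (simp add: dx_def dy_def)
  have 2: "Q t * dx \<le> P t * dy" using support[OF curve_in_D[of s], of t] by (simp add: dx_def dy_def algebra_simps)
  obtain z where z: "s < z" "z < t" "X t - X s = (t - s) * P z" using MVT2[OF st'] deriv_X by blast
  from sg show ?thesis
  proof
    assume p: "\<forall>r. s \<le> r \<longrightarrow> r \<le> t \<longrightarrow> P r > 0"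
    then have ps: "P s > 0" "P t > 0" "P z > 0" using st z by auto
    have "dx > 0" unfolding dx_def z(3) using z ps by simp
    have "(Q t * dx) * P s \<le> (P t * dy) * P s" using 2 ps by (intro mult_right_mono) auto
    also have "\<dots> = P t * (P s * dy)" by (simp add: mult_ac)
    also have "\<dots> \<le> P t * (Q s * dx)" using 1 ps by (intro mult_left_mono) auto
    finally have "(Q t * P s) * dx \<le> (Q s * P t) * dx" by (simp add: mult_ac)
    then show ?thesis using \<open>dx > 0\<close> by (rule mult_right_le_imp_le)
  next
    assume p: "\<forall>r. s \<le> r \<longrightarrow> r \<le> t \<longrightarrow> P r < 0"
    then have ps: "P s < 0" "P t < 0" "P z < 0" using st z by auto
    have "dx < 0" unfolding dx_def z(3) using z ps by (simp add: mult_pos_neg)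
    have "P t * (Q s * dx) \<le> P t * (P s * dy)" using 1 ps by (intro mult_left_mono_neg) auto
    also have "\<dots> = (P t * dy) * P s" by (simp add: mult_ac)
    also have "\<dots> \<le> (Q t * dx) * P s" using 2 ps by (intro mult_right_mono_neg) auto
    finally have "(Q t * P s) * (- dx) \<le> (Q s * P t) * (- dx)" by (simp add: mult_ac)
    moreover have "- dx > 0" using \<open>dx < 0\<close> by simp
    ultimately show ?thesis by (rule mult_right_le_imp_le)
  qed
qed simp

lemma period_back: "X (s - L) = X s" "Y (s - L) = Y s"
  using period[of "s - L"] by simp_all

text \<open>For \<open>P s \<le> 0\<close> both terms have the right sign. The arcs with
  \<open>P s > 0\<close> are reached from a vertical tangent: ascending ones forward from the left,
  descending ones backward from the right.\<close>

lemma T_negative: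
  assumes Ys: "Y s > 0" shows "T s < 0"
proof -
  let ?m = "CARD('m)"
  have H: "h / ?m > 0" using h_pos m2 by simp
  consider "P s \<le> 0" | "P s > 0" "Q s \<ge> 0" | "P s > 0" "Q s < 0" by linarith
  then show ?thesis
  proof cases
    case 1
    have "Y s ^ (?m - 1) * P s \<le> 0" using 1 Ys by (intro mult_nonneg_nonpos) auto
    moreover have "h / ?m * Y s ^ ?m > 0" using H Ys by (intro mult_pos_pos zero_less_power)
    ultimately show ?thesis unfolding T_def by linarith
  next
    case 2
    show ?thesis
    proof (rule negative_first_integral[OF deriv_X deriv_Y unit_speed cont_P cont_Q isCont_T L_pos period_back(1) Y_nonneg _ T_def H _ 2])
      show "Q v * P u \<le> Q u * P v" if "u \<le> v" "\<And>r. u \<le> r \<Longrightarrow> r \<le> v \<Longrightarrow> P r > 0" for u v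
        using that by (intro slope_monotone) auto
      show "\<exists>\<delta>>0. \<forall>t. r < t \<longrightarrow> t < r + \<delta> \<longrightarrow> T t \<le> T r" if Qr: "Q r > 0" and Yr: "Y r > 0" for r
      proof -
        have "(1::real) = 1 \<or> (1::real) = -1" "1 * Q r > 0" using Qr by simp_all
        from T_monotone_local[OF this Yr] obtain \<delta> where \<delta>: "\<delta> > 0"
          "\<forall>s t. \<bar>s - r\<bar> < \<delta> \<longrightarrow> \<bar>t - r\<bar> < \<delta> \<longrightarrow> s < t \<longrightarrow> 1 * T t \<le> 1 * T s \<and> ((X r, Y r) \<in> slice \<longrightarrow> T t = T s)" by blast
        have "T t \<le> T r" if "r < t" "t < r + \<delta>" for t
          using \<delta>(2)[THEN spec, THEN spec, of r t] that \<delta>(1) by simp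
        then show ?thesis using \<delta>(1) by blast
      qed
    qed
  next
    case 3
    \<comment> \<open>Reflecting \<open>X\<close> and reversing the parameter keeps \<open>P\<close>
      and changes the sign of \<open>Q\<close>; the mirrored curve is again clockwise.\<close>
    have "T (- (- s)) < 0"
    proof (rule negative_first_integral[where X="\<lambda>s. - X (- s)" and P="\<lambda>s. P (- s)" and Y="\<lambda>s. Y (- s)"
          and Q="\<lambda>s. - Q (- s)" and T="\<lambda>s. T (- s)" and L=L and k="?m - 1" and H="h / ?m" and n="?m"])
      show "((\<lambda>s. - X (- s)) has_real_derivative P (- s)) (at s)" for s
        using DERIV_minus[OF DERIV_chain2[OF deriv_X[of "- s"] DERIV_minus[OF DERIV_ident]]] by simp
      show "((\<lambda>s. Y (- s)) has_real_derivative - Q (- s)) (at s)" for s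
        using DERIV_chain2[OF deriv_Y[of "- s"] DERIV_minus[OF DERIV_ident]] by simp
      show "P (- s) * P (- s) + - Q (- s) * - Q (- s) = 1" for s using unit_speed[of "- s"] by simp
      show "isCont (\<lambda>s. P (- s)) s" for s by (rule isCont_o2[OF continuous_minus[OF continuous_ident] cont_P])
      show "isCont (\<lambda>s. - Q (- s)) s" for s
        by (rule continuous_minus[OF isCont_o2[OF continuous_minus[OF continuous_ident] cont_Q]])
      show "isCont (\<lambda>s. T (- s)) s" for s by (rule isCont_o2[OF continuous_minus[OF continuous_ident] isCont_T])
      show "- X (- (s - L)) = - X (- s)" for s
      proof -
        have eq: "- (s - L) = - s + L" by simp
        show ?thesis unfolding eq period by (rule refl)
      qed
      show "0 \<le> Y (- s)" for s by (rule Y_nonneg)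
      show "T (- s) = Y (- s) ^ (?m - 1) * P (- s) - h / ?m * Y (- s) ^ ?m" for s by (rule T_def)
      show "- Q (- v) * P (- u) \<le> - Q (- u) * P (- v)" if uv: "u \<le> v" and pp: "\<And>r. u \<le> r \<Longrightarrow> r \<le> v \<Longrightarrow> P (- r) > 0" for u v
      proof -
        have "P r > 0" if "- v \<le> r" "r \<le> - u" for r using pp[of "- r"] that by simp
        then have "Q (- u) * P (- v) \<le> Q (- v) * P (- u)" using uv by (intro slope_monotone) auto
        then show ?thesis by simp
      qed
      show "\<exists>\<delta>>0. \<forall>t. r < t \<longrightarrow> t < r + \<delta> \<longrightarrow> T (- t) \<le> T (- r)" if Qr: "- Q (- r) > 0" and Yr: "Y (- r) > 0" for r
      proof -
        have "(-1::real) = 1 \<or> (-1::real) = -1" "-1 * Q (- r) > 0" using Qr by simp_all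
        from T_monotone_local[OF this Yr] obtain \<delta> where \<delta>: "\<delta> > 0"
          "\<forall>s t. \<bar>s - - r\<bar> < \<delta> \<longrightarrow> \<bar>t - - r\<bar> < \<delta> \<longrightarrow> s < t \<longrightarrow> -1 * T t \<le> -1 * T s \<and> ((X (- r), Y (- r)) \<in> slice \<longrightarrow> T t = T s)" by blast
        have "T (- t) \<le> T (- r)" if "r < t" "t < r + \<delta>" for t
          using \<delta>(2)[THEN spec, THEN spec, of "- t" "- r"] that \<delta>(1) by simp
        then show ?thesis using \<delta>(1) by blast
      qed
    qed (use L_pos H 3 in simp_all)
    then show ?thesis by simp
  qed
qed

definition free :: "real set" where "free = {s. (X s, Y s) \<in> slice \<and> Y s > 0}"

lemma free_nhds:
  assumes "(X s0, Y s0) \<in> slice"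
  shows "\<exists>\<delta>>0. \<forall>s. \<bar>s - s0\<bar> < \<delta> \<longrightarrow> (X s, Y s) \<in> slice"
proof -
  have "open ((\<lambda>s. (X s, Y s)) -` slice)" by (intro open_vimage open_slice continuous_intros continuous_on_XYPQ)
  then show ?thesis using assms unfolding open_real_def[symmetric] open_dist dist_real_def by auto
qed

lemma open_free: "open free"
proof -
  have "open ((\<lambda>s. (X s, Y s)) -` slice)" by (intro open_vimage open_slice continuous_intros continuous_on_XYPQ)
  moreover have "open {s. 0 < Y s}" by (intro open_Collect_less continuous_intros continuous_on_XYPQ)
  moreover have "free = (\<lambda>s. (X s, Y s)) -` slice \<inter> {s. 0 < Y s}" by (auto simp: free_def)
  ultimately show ?thesis by (simp add: open_Int)
qed

lemma P_sign_nhds: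
  assumes "P s0 \<noteq> 0" shows "\<exists>\<delta>>0. \<forall>s. \<bar>s - s0\<bar> < \<delta> \<longrightarrow> P s * P s0 > 0"
proof -
  have "open {s. 0 < P s * P s0}" by (intro open_Collect_less continuous_intros continuous_on_XYPQ)
  moreover have "s0 \<in> {s. 0 < P s * P s0}" using assms by (simp add: zero_less_mult_iff linorder_neq_iff disj_commute)
  ultimately show ?thesis unfolding open_dist dist_real_def by auto
qed

text \<open>Two zeros of \<open>Q\<close> within a range where \<open>P\<close> keeps its sign force
  \<open>Q = 0\<close> between them, by monotone slopes. The midpoint of this free horizontal
  segment satisfies \<open>P = 1\<close> and \<open>h * Y \<le> CARD('m) - 1\<close>, which makes
  \<open>T\<close> nonnegative, against \<open>T_negative\<close>.\<close>

lemma horizontal_isolated: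
  assumes s0: "s0 \<in> free" "Q s0 = 0"
  shows "\<exists>\<delta>>0. \<forall>s. \<bar>s - s0\<bar> < \<delta> \<longrightarrow> s \<in> free \<and> (s \<noteq> s0 \<longrightarrow> Q s \<noteq> 0)"
proof -
  have "P s0 \<noteq> 0" using unit_speed[of s0] s0(2) by auto
  then obtain d1 where d1: "d1 > 0" "\<forall>s. \<bar>s - s0\<bar> < d1 \<longrightarrow> P s * P s0 > 0" using P_sign_nhds by blast
  obtain d2 where d2: "d2 > 0" "\<forall>s. \<bar>s - s0\<bar> < d2 \<longrightarrow> s \<in> free"
    using open_free s0(1) unfolding open_dist dist_real_def by blast
  define \<delta> where "\<delta> = min d1 d2"
  have \<delta>: "\<delta> > 0" "\<delta> \<le> d1" "\<delta> \<le> d2" using d1 d2 by (auto simp: \<delta>_def)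
  have "Q s1 \<noteq> 0" if s1: "\<bar>s1 - s0\<bar> < \<delta>" "s1 \<noteq> s0" for s1
  proof
    assume Q1: "Q s1 = 0"
    define a where "a = min s0 s1" define b where "b = max s0 s1"
    have ab: "a < b" "Q a = 0" "Q b = 0" using s1(2) Q1 s0(2) by (auto simp: a_def b_def min_def max_def)
    have nb: "\<bar>r - s0\<bar> < \<delta>" if "a \<le> r" "r \<le> b" for r using that s1(1) by (auto simp: a_def b_def min_def max_def split: if_splits)
    have sg: "P r * P s0 > 0" if "a \<le> r" "r \<le> b" for r using d1(2) nb[OF that] \<delta>(2) by simp
    have Qz: "Q r = 0" if r: "a \<le> r" "r \<le> b" for r
    proof (cases "P s0 > 0")
      case True
      have pp: "P t > 0" if "a \<le> t" "t \<le> b" for t using sg[OF that] True by (simp add: zero_less_mult_iff)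
      have "Q r * P a \<le> Q a * P r" using r ab pp by (intro slope_monotone) auto
      then have "Q r \<le> 0" using ab pp[of a] by (simp add: mult_le_0_iff)
      moreover have "Q b * P r \<le> Q r * P b" using r ab pp by (intro slope_monotone) auto
      then have "Q r \<ge> 0" using ab pp[of b] by (simp add: zero_le_mult_iff)
      ultimately show ?thesis by simp
    next
      case False
      have pp: "P t < 0" if "a \<le> t" "t \<le> b" for t using sg[OF that] False by (simp add: zero_less_mult_iff)
      have "Q r * P a \<le> Q a * P r" using r ab pp by (intro slope_monotone) auto
      then have "Q r \<ge> 0" using ab pp[of a] by (simp add: mult_le_0_iff)
      moreover have "Q b * P r \<le> Q r * P b" using r ab pp by (intro slope_monotone) auto
      then have "Q r \<le> 0" using ab pp[of b] by (simp add: zero_le_mult_iff)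
      ultimately show ?thesis by simp
    qed
    define s2 where "s2 = (a + b) / 2" define \<eta> where "\<eta> = (b - a) / 2"
    have "\<bar>s2 - s0\<bar> < \<delta>" using ab by (intro nb) (auto simp: s2_def)
    then have s2: "s2 \<in> free" using d2(2) \<delta>(3) by simp
    have "P s2 = 1 \<and> h * Y s2 \<le> real CARD('m) - 1"
    proof (rule horizontal_segment_bound)
      show "Y s2 > 0" "(X s2, Y s2) \<in> slice" using s2 by (auto simp: free_def)
      show "\<eta> > 0" using ab by (simp add: \<eta>_def)
      show "Q s = 0" if "\<bar>s - s2\<bar> < \<eta>" for s
        using that unfolding s2_def \<eta>_def by (intro Qz) (auto simp: abs_less_iff field_simps)
    qed
    then have P2: "P s2 = 1" and hY: "h * Y s2 \<le> real CARD('m) - 1" by simp_all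
    have Y2: "Y s2 > 0" using s2 by (simp add: free_def)
    have mS: "CARD('m) = Suc (CARD('m) - 1)" using m2 by simp
    have "Y s2 ^ CARD('m) = Y s2 * Y s2 ^ (CARD('m) - 1)" by (rule power_Suc[of "Y s2" "CARD('m) - 1", folded mS])
    then have "T s2 = Y s2 ^ (CARD('m) - 1) * (1 - h * Y s2 / CARD('m))" by (simp add: T_def P2 algebra_simps)
    moreover have "h * Y s2 / CARD('m) \<le> 1" using hY m2 by (simp add: field_simps)
    ultimately have "T s2 \<ge> 0" using Y2 by simp
    then show False using T_negative[OF Y2] by simp
  qed
  then show ?thesis using \<delta> d2(2) by (intro exI[of _ \<delta>]) auto
qed

lemma T_deriv_slanted:
  assumes "s0 \<in> free" "Q s0 \<noteq> 0" shows "(T has_real_derivative 0) (at s0)"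
proof -
  obtain \<beta> :: real where \<beta>: "\<beta> = 1 \<or> \<beta> = -1" "\<beta> * Q s0 > 0"
    using assms(2) that[of 1] that[of "-1"] by (cases "Q s0 > 0") auto
  have Y0: "Y s0 > 0" and sl: "(X s0, Y s0) \<in> slice" using assms(1) by (auto simp: free_def)
  from T_monotone_local[OF \<beta> Y0] obtain \<delta> where \<delta>: "\<delta> > 0"
    "\<forall>s t. \<bar>s - s0\<bar> < \<delta> \<longrightarrow> \<bar>t - s0\<bar> < \<delta> \<longrightarrow> s < t \<longrightarrow> \<beta> * T t \<le> \<beta> * T s \<and> ((X s0, Y s0) \<in> slice \<longrightarrow> T t = T s)" by blast
  have eq: "T s0 = T s" if "s \<in> ball s0 \<delta>" for s
  proof -
    have "\<bar>s - s0\<bar> < \<delta>" "\<bar>s0 - s0\<bar> < \<delta>" using that \<delta>(1) by (auto simp: dist_real_def)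
    then show ?thesis using \<delta>(2) sl by (cases s s0 rule: linorder_cases) metis+
  qed
  show ?thesis
    by (rule has_field_derivative_transform_within_open[of "\<lambda>_. T s0" 0 s0 "ball s0 \<delta>"]) (use eq \<delta>(1) in auto)
qed

text \<open>At a horizontal point \<open>T\<close> is constant on either side, all neighbouring
  points being slanted, and continuity joins the two constants.\<close>

lemma T_deriv:
  assumes "s0 \<in> free" shows "(T has_real_derivative 0) (at s0)"
proof (cases "Q s0 = 0")
  case True
  obtain \<delta> where \<delta>: "\<delta> > 0" "\<forall>s. \<bar>s - s0\<bar> < \<delta> \<longrightarrow> s \<in> free \<and> (s \<noteq> s0 \<longrightarrow> Q s \<noteq> 0)"
    using horizontal_isolated[OF assms True] by blast
  have cT: "continuous_on S T" for S using isCont_T by (simp add: continuous_at_imp_continuous_on)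
  have eq: "T s0 = T s" if "s \<in> ball s0 \<delta>" for s
  proof -
    have sd: "\<bar>s - s0\<bar> < \<delta>" using that by (auto simp: dist_real_def)
    have D: "(T has_real_derivative 0) (at x)" if "\<bar>x - s0\<bar> < \<delta>" "x \<noteq> s0" for x
      using \<delta>(2) that T_deriv_slanted by blast
    show ?thesis
    proof (cases s s0 rule: linorder_cases)
      case less
      show ?thesis by (rule DERIV_isconst_end[OF less cT]) (use D sd in auto)
    next
      case greater
      show ?thesis by (rule sym, rule DERIV_isconst_end[OF greater cT]) (use D sd in auto)
    qed simp
  qed
  show ?thesis
    by (rule has_field_derivative_transform_within_open[of "\<lambda>_. T s0" 0 s0 "ball s0 \<delta>"]) (use eq \<delta>(1) in auto)
qed (rule T_deriv_slanted[OF assms])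

end

section \<open>From the first integral to the curvature equation\<close>

text \<open>Recovers differentiability of a merely continuous \<open>\<sigma>\<close> from that of
  \<open>F\<close> composed with it; used for \<open>F = cos\<close>. Caratheodory's factorisation
  of \<open>F\<close> gives the quotient directly, without a local inverse.\<close>

lemma DERIV_local_inverse:
  fixes F \<sigma> :: "real \<Rightarrow> real"
  assumes F: "(F has_real_derivative F') (at (\<sigma> s))" "F' \<noteq> 0" and c: "isCont \<sigma> s"
    and d: "((\<lambda>t. F (\<sigma> t)) has_real_derivative c') (at s)"
  shows "(\<sigma> has_real_derivative c' / F') (at s)"
proof -
  obtain g where g: "\<forall>z. F z - F (\<sigma> s) = g z * (z - \<sigma> s)" "isCont g (\<sigma> s)" "g (\<sigma> s) = F'"
    using F(1) unfolding CARAT_DERIV by blast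
  have gl: "((\<lambda>t. g (\<sigma> t)) \<longlongrightarrow> F') (at s)"
    using isCont_o2[OF c g(2)] g(3) by (simp add: isCont_def)
  have q: "((\<lambda>t. (F (\<sigma> t) - F (\<sigma> s)) / (t - s)) \<longlongrightarrow> c') (at s)" using d by (simp add: has_field_derivative_iff)
  have l: "((\<lambda>t. (F (\<sigma> t) - F (\<sigma> s)) / (t - s) / g (\<sigma> t)) \<longlongrightarrow> c' / F') (at s)"
    by (rule tendsto_divide[OF q gl F(2)])
  have ev: "\<forall>\<^sub>F t in at s. g (\<sigma> t) \<noteq> 0" using tendsto_imp_eventually_ne[OF gl F(2)] .
  have "((\<lambda>t. (\<sigma> t - \<sigma> s) / (t - s)) \<longlongrightarrow> c' / F') (at s)"
    by (rule Lim_transform_eventually[OF l]) (use ev g(1) in \<open>auto elim!: eventually_mono\<close>)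
  then show ?thesis by (simp add: has_field_derivative_iff)
qed

text \<open>The fundamental theorem of calculus tolerates one exceptional point, so
  \<open>\<sigma>\<close> is an integral of the continuous \<open>R\<close>, hence differentiable
  there too.\<close>

lemma DERIV_across_point:
  fixes \<sigma> R :: "real \<Rightarrow> real"
  assumes d: "\<delta> > 0" and c: "\<And>t. isCont \<sigma> t" and R: "continuous_on {s - \<delta>..s + \<delta>} R"
    and D: "\<And>t. \<bar>t - s\<bar> \<le> \<delta> \<Longrightarrow> t \<noteq> s \<Longrightarrow> (\<sigma> has_real_derivative R t) (at t)"
  shows "(\<sigma> has_real_derivative R s) (at s)"
proof -
  let ?a = "s - \<delta>" let ?b = "s + \<delta>"
  have eq: "integral {?a..t} R = \<sigma> t - \<sigma> ?a" if t: "t \<in> {?a..?b}" for t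
  proof -
    have "(R has_integral \<sigma> t - \<sigma> ?a) {?a..t}"
    proof (rule fundamental_theorem_of_calculus_interior_strong[where S="{s}"])
      show "continuous_on {?a..t} \<sigma>" using c by (simp add: continuous_at_imp_continuous_on)
      fix x assume "x \<in> {?a<..<t} - {s}"
      then have "(\<sigma> has_real_derivative R x) (at x)" using t by (intro D) auto
      then show "(\<sigma> has_vector_derivative R x) (at x)" by (simp add: has_real_derivative_iff_has_vector_derivative)
    qed (use t in auto)
    then show ?thesis by (rule integral_unique)
  qed
  have "((\<lambda>x. integral {?a..x} R) has_real_derivative R s) (at s within {?a..?b})"
    by (rule integral_has_real_derivative[OF R]) (use d in auto)
  then have "((\<lambda>x. integral {?a..x} R) has_real_derivative R s) (at s)"
    using at_within_Icc_at[of ?a s ?b] d by simp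
  then have "((\<lambda>x. integral {?a..x} R + \<sigma> ?a) has_real_derivative R s + 0) (at s)"
    by (intro DERIV_add DERIV_const)
  then have 1: "((\<lambda>x. integral {?a..x} R + \<sigma> ?a) has_real_derivative R s) (at s)" by simp
  show ?thesis
    by (rule has_field_derivative_transform_within_open[OF 1, of "{?a<..<?b}"]) (use d eq in auto)
qed

context cheeger_profile
begin

text \<open>The unit tangent, as a nowhere vanishing complex function on the contractible line, has
  a continuous logarithm. Unit speed makes it purely imaginary.\<close>

lemma tangent_angle: "\<exists>\<sigma>. (\<forall>s. isCont \<sigma> s \<and> P s = cos (\<sigma> s) \<and> Q s = sin (\<sigma> s))"
proof -
  have "continuous_on UNIV (\<lambda>s. Complex (P s) (Q s))"
    unfolding Complex_eq by (intro continuous_intros continuous_on_XYPQ)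
  moreover have "contractible (UNIV :: real set)" by (rule convex_imp_contractible) simp
  moreover have nm: "norm (Complex (P s) (Q s)) = 1" for s
    using unit_speed[of s] by (simp add: cmod_def power2_eq_square)
  then have "Complex (P s) (Q s) \<noteq> 0" for s using nm[of s] by fastforce
  ultimately obtain g where g: "continuous_on UNIV g" "\<And>s. Complex (P s) (Q s) = exp (g s)"
    using continuous_logarithm_on_contractible[of UNIV "\<lambda>s. Complex (P s) (Q s)"] by (metis UNIV_I)
  have r: "Re (g s) = 0" for s
  proof -
    have "exp (Re (g s)) = 1" using nm[of s] unfolding g(2) norm_exp_eq_Re .
    then show ?thesis by simp
  qed
  have gc: "isCont g s" for s using g(1) by (simp add: continuous_on_eq_continuous_at)
  have "isCont (\<lambda>s. Im (g s)) s" for s by (rule continuous_Im[OF gc])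
  moreover have "P s = cos (Im (g s))" "Q s = sin (Im (g s))" for s
    using g(2)[of s] r[of s] by (metis complex.sel(1) Re_exp exp_zero mult_1, metis complex.sel(2) Im_exp exp_zero mult_1)
  ultimately show ?thesis by blast
qed

text \<open>Solving \<open>T\<close> for \<open>P\<close> gives
  \<open>cos \<sigma> = (T + H * Y^m) / Y^(m-1)\<close> with \<open>m = CARD('m)\<close>, and
  \<open>T\<close> has derivative 0 on the free set. This is differentiated and divided by
  \<open>- sin \<sigma> = - Q\<close>, which requires \<open>Q \<noteq> 0\<close>; the isolated
  horizontal points are added by \<open>DERIV_across_point\<close>.\<close>

lemma curvature_equation:
  assumes \<sigma>: "\<forall>s. isCont \<sigma> s \<and> P s = cos (\<sigma> s) \<and> Q s = sin (\<sigma> s)" and s: "s \<in> free"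
  shows "(\<sigma> has_real_derivative - real CARD('m) * (h / CARD('m)) + (real CARD('m) - 1) * (cos (\<sigma> s) / Y s)) (at s)"
proof -
  let ?m = "CARD('m)" define k where "k = ?m - 1"
  have k: "?m = Suc k" "k \<ge> 1" using m2 by (auto simp: k_def)
  define H where "H = h / ?m"
  define R where "R t = - real ?m * H + (real ?m - 1) * (cos (\<sigma> t) / Y t)" for t
  have slanted: "(\<sigma> has_real_derivative R t) (at t)" if t: "t \<in> free" "Q t \<noteq> 0" for t
  proof -
    have Yt: "Y t > 0" using t(1) by (simp add: free_def)
    have Te: "T r = Y r ^ k * P r - H * Y r ^ Suc k" for r by (simp add: T_def k H_def)
    have Pe: "(T r + H * Y r ^ Suc k) * inverse (Y r) ^ k = P r" if "Y r > 0" for r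
      using that by (simp add: Te power_inverse field_simps)
    have di: "((\<lambda>r. inverse (Y r) ^ k) has_real_derivative real k * inverse (Y t) ^ (k - 1) * (- (Q t * inverse (Y t) ^ 2))) (at t)"
      by (rule DERIV_cong[OF DERIV_power[OF DERIV_inverse_fun[OF deriv_Y]]])
        (use Yt in \<open>simp_all add: power2_eq_square\<close>)
    have dn: "((\<lambda>r. T r + H * Y r ^ Suc k) has_real_derivative H * (real (Suc k) * Y t ^ k * Q t)) (at t)"
      by (rule DERIV_cong[OF DERIV_add[OF T_deriv[OF t(1)] DERIV_cmult[OF DERIV_power[OF deriv_Y]]]]) simp
    define y where "y = Y t"
    have y: "y > 0" using Yt by (simp add: y_def)
    obtain j where j: "k = Suc j" using k(2) by (cases k) auto
    have val: "H * (real (Suc k) * y ^ k * Q t) * inverse y ^ k + (real k * inverse y ^ (k - 1) * (- (Q t * inverse y ^ 2))) * (T t + H * y ^ Suc k)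
        = - Q t * (- real ?m * H + (real ?m - 1) * (P t / y))"
    proof -
      have TP: "T t + H * y ^ Suc k = y ^ k * P t" by (simp add: Te y_def)
      have i1: "y ^ k * inverse y ^ k = 1" using y by (simp add: power_inverse)
      have i2: "inverse y ^ (k - 1) * inverse y ^ 2 * y ^ k = inverse y"
        using y unfolding j by (simp add: power_inverse power2_eq_square field_simps)
      have "H * (real (Suc k) * y ^ k * Q t) * inverse y ^ k = H * real (Suc k) * Q t * (y ^ k * inverse y ^ k)" by (simp add: mult_ac)
      moreover have "(real k * inverse y ^ (k - 1) * (- (Q t * inverse y ^ 2))) * (T t + H * y ^ Suc k)
          = - real k * Q t * P t * (inverse y ^ (k - 1) * inverse y ^ 2 * y ^ k)" unfolding TP by (simp add: mult_ac)
      ultimately show ?thesis unfolding i1 i2 by (simp add: k(1) divide_inverse algebra_simps)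
    qed
    have dP0: "((\<lambda>r. (T r + H * Y r ^ Suc k) * inverse (Y r) ^ k) has_real_derivative - Q t * R t) (at t)"
      by (rule DERIV_cong[OF DERIV_mult[OF dn di]]) (use val \<sigma> in \<open>simp add: R_def y_def\<close>)
    have dP: "((\<lambda>r. cos (\<sigma> r)) has_real_derivative - Q t * R t) (at t)"
    proof (rule has_field_derivative_transform_within_open[OF dP0 _ _])
      show "open {r. 0 < Y r}" by (intro open_Collect_less continuous_intros continuous_on_XYPQ)
      show "t \<in> {r. 0 < Y r}" using Yt by simp
      show "(T r + H * Y r ^ Suc k) * inverse (Y r) ^ k = cos (\<sigma> r)" if "r \<in> {r. 0 < Y r}" for r
        using Pe[of r] that \<sigma> by simp
    qed
    have "(cos has_real_derivative - sin (\<sigma> t)) (at (\<sigma> t))" by (rule DERIV_cos)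
    then have "(\<sigma> has_real_derivative (- Q t * R t) / (- sin (\<sigma> t))) (at t)"
      by (rule DERIV_local_inverse) (use \<sigma> t(2) dP in auto)
    moreover have "(- Q t * R t) / (- sin (\<sigma> t)) = R t" using \<sigma> t(2) by simp
    ultimately show ?thesis by simp
  qed
  have "(\<sigma> has_real_derivative R s) (at s)"
  proof (cases "Q s = 0")
    case True
    obtain \<delta> where \<delta>: "\<delta> > 0" "\<forall>t. \<bar>t - s\<bar> < \<delta> \<longrightarrow> t \<in> free \<and> (t \<noteq> s \<longrightarrow> Q t \<noteq> 0)"
      using horizontal_isolated[OF s True] by blast
    show ?thesis
    proof (rule DERIV_across_point[of "\<delta> / 2"])
      show "\<delta> / 2 > 0" using \<delta>(1) by simp
      show "isCont \<sigma> t" for t using \<sigma> by blast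
      have "Y t \<noteq> 0" if "t \<in> {s - \<delta> / 2..s + \<delta> / 2}" for t
        using \<delta>(2)[THEN spec, of t] that \<delta>(1) by (auto simp: free_def abs_less_iff)
      moreover have "continuous_on S \<sigma>" for S using \<sigma> by (simp add: continuous_at_imp_continuous_on)
      ultimately show "continuous_on {s - \<delta> / 2..s + \<delta> / 2} R"
        unfolding R_def[abs_def] by (intro continuous_intros continuous_on_XYPQ) auto
      show "(\<sigma> has_real_derivative R t) (at t)" if "\<bar>t - s\<bar> \<le> \<delta> / 2" "t \<noteq> s" for t
        using \<delta> that by (intro slanted) auto
    qed
  qed (rule slanted[OF s])
  then show ?thesis by (simp add: R_def H_def)
qed

section \<open>Components of the free boundary\<close>

text \<open>The substance is that a free boundary point is off the axis. Suppose its profile point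
  is on the axis. If the curve follows the axis on both sides, the point is interior to
  \<open>C\<close>. Otherwise a free arc with \<open>Y > 0\<close> ends on the axis; there
  \<open>T\<close> is constant and, by continuity, equal to its axis value 0, against
  \<open>T_negative\<close>.\<close>

lemma frontier_point_free:
  assumes p: "p \<in> frontier C" "p \<in> \<Omega>"
  shows "\<exists>s. s \<in> free \<and> profile p = (X s, Y s)"
proof -
  have pC: "p \<in> C" using p(1) C_borel(2) by (simp add: frontier_def closure_closed)
  have "profile p \<notin> interior D"
  proof
    assume "profile p \<in> interior D"
    moreover have "open (profile -` interior D :: (real \<times> (real ^ 'm)) set)" by (intro open_vimage open_interior continuous_on_profile)
    moreover have "profile -` interior D \<subseteq> C" unfolding C_eq using interior_subset by blast
    ultimately have "p \<in> interior C" using interior_maximal by blast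
    then show False using p(1) by (simp add: frontier_def)
  qed
  then have "profile p \<in> frontier D" using pC closure_subset unfolding C_eq frontier_def by blast
  then obtain s0 where s0: "profile p = (X s0, Y s0)" unfolding frontier_D by blast
  have sl: "(X s0, Y s0) \<in> slice" using p(2) profile_in_slice[of p] s0 by simp
  have "Y s0 > 0"
  proof (rule ccontr)
    assume "\<not> Y s0 > 0"
    then have Y0: "Y s0 = 0" using Y_nonneg[of s0] by simp
    then have "\<forall>y. \<bar>s0 - y\<bar> < 1 \<longrightarrow> Y s0 \<le> Y y" using Y_nonneg by simp
    from DERIV_local_min[OF deriv_Y zero_less_one this] have Q0: "Q s0 = 0" .
    have "P s0 \<noteq> 0" using unit_speed[of s0] Q0 by auto
    then obtain d1 where d1: "d1 > 0" "\<forall>s. \<bar>s - s0\<bar> < d1 \<longrightarrow> P s * P s0 > 0" using P_sign_nhds by blast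
    obtain d2 where d2: "d2 > 0" "\<forall>s. \<bar>s - s0\<bar> < d2 \<longrightarrow> (X s, Y s) \<in> slice" using free_nhds[OF sl] by blast
    define \<delta> where "\<delta> = min d1 d2 / 2"
    have \<delta>: "\<delta> > 0" "\<delta> < d1" "\<delta> < d2" using d1 d2 by (auto simp: \<delta>_def)
    have "\<exists>s1. \<bar>s1 - s0\<bar> \<le> \<delta> \<and> Y s1 > 0"
    proof (rule ccontr)
      assume "\<not> ?thesis"
      then have Yz: "Y s = 0" if "\<bar>s - s0\<bar> \<le> \<delta>" for s using that Y_nonneg[of s] by force
      define x1 where "x1 = X (s0 - \<delta>)" define x2 where "x2 = X (s0 + \<delta>)"
      obtain z1 where z1: "s0 - \<delta> < z1" "z1 < s0" "X s0 - x1 = \<delta> * P z1"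
        using MVT2[of "s0 - \<delta>" s0 X P] deriv_X \<delta>(1) by (auto simp: x1_def)
      obtain z2 where z2: "s0 < z2" "z2 < s0 + \<delta>" "x2 - X s0 = \<delta> * P z2"
        using MVT2[of s0 "s0 + \<delta>" X P] deriv_X \<delta>(1) by (auto simp: x2_def)
      have sg: "P z1 * P s0 > 0" "P z2 * P s0 > 0" using d1(2) z1 z2 \<delta> by auto
      define lo where "lo = min x1 x2" define hi where "hi = max x1 x2"
      have lh: "lo < X s0" "X s0 < hi"
      proof -
        have "(P z1 > 0 \<and> P z2 > 0) \<or> (P z1 < 0 \<and> P z2 < 0)" using sg by (auto simp: zero_less_mult_iff)
        then have "(X s0 - x1 > 0 \<and> x2 - X s0 > 0) \<or> (X s0 - x1 < 0 \<and> x2 - X s0 < 0)"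
          unfolding z1(3) z2(3) using \<delta>(1) by (auto simp: zero_less_mult_iff mult_less_0_iff)
        then show "lo < X s0" "X s0 < hi" by (auto simp: lo_def hi_def)
      qed
      have "(x1, 0) \<in> D" "(x2, 0) \<in> D"
        using curve_in_D[of "s0 - \<delta>"] curve_in_D[of "s0 + \<delta>"] Yz[of "s0 - \<delta>"] Yz[of "s0 + \<delta>"] \<delta>(1) by (simp_all add: x1_def x2_def)
      then have lhD: "(lo, 0) \<in> D" "(hi, 0) \<in> D" by (auto simp: lo_def hi_def min_def max_def)
      obtain d0 where d0: "d0 \<in> interior D" using interior_D by blast
      obtain e0 where e0: "e0 > 0" "ball d0 e0 \<subseteq> D" using d0 unfolding mem_interior by blast
      define dx where "dx = fst d0" define dy where "dy = snd d0"
      have "(dx, dy - e0 / 2) \<in> ball d0 e0" using e0(1) by (cases d0) (simp add: dx_def dy_def dist_Pair_Pair dist_real_def)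
      then have "0 \<le> dy - e0 / 2" using e0(2) nonneg_D by blast
      then have dy: "dy > 0" using e0(1) by simp
      have d0D: "(dx, dy) \<in> D" using d0 interior_subset by (auto simp: dx_def dy_def)
      \<comment> \<open>Within the half-plane, \<open>W\<close> is the open triangle with apex
        \<open>d0\<close> and base between \<open>lo\<close> and \<open>hi\<close> on the axis, the
        open base included. It lies in \<open>D\<close> by convexity, and revolved it is a
        neighbourhood of \<open>p\<close> in \<open>C\<close>.\<close>
      define W where "W = {q :: real \<times> real. snd q < dy} \<inter> ({q. lo * (1 - snd q / dy) < fst q - snd q / dy * dx} \<inter>
          {q. fst q - snd q / dy * dx < hi * (1 - snd q / dy)})"
      have oW: "open W" unfolding W_def
        by (intro open_Int open_Collect_less continuous_intros) (use dy in auto)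
      have pW: "profile p \<in> W" unfolding W_def s0 Y0 using lh dy by simp
      have "profile -` W \<subseteq> C"
      proof
        fix q :: "real \<times> (real ^ 'm)" assume q: "q \<in> profile -` W"
        obtain x y where xy: "profile q = (x, y)" by (cases "profile q")
        have y0: "y \<ge> 0" using xy by (auto simp: profile_def)
        define \<tau> where "\<tau> = y / dy"
        have w: "y < dy" "lo * (1 - \<tau>) < x - \<tau> * dx" "x - \<tau> * dx < hi * (1 - \<tau>)"
          using q xy by (auto simp: W_def \<tau>_def)
        have \<tau>: "0 \<le> \<tau>" "\<tau> < 1" using y0 w(1) dy by (auto simp: \<tau>_def)
        define x' where "x' = (x - \<tau> * dx) / (1 - \<tau>)"
        have x': "lo < x'" "x' < hi" using w \<tau> by (auto simp: x'_def field_simps)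
        define \<mu> where "\<mu> = (x' - lo) / (hi - lo)"
        have \<mu>: "0 \<le> \<mu>" "\<mu> \<le> 1" using x' by (auto simp: \<mu>_def)
        have "(1 - \<mu>) *\<^sub>R (lo, 0) + \<mu> *\<^sub>R (hi, 0) \<in> D"
          using convex_D lhD \<mu> unfolding convex_alt by blast
        moreover have "(1 - \<mu>) * lo + \<mu> * hi = x'"
        proof -
          have "(1 - \<mu>) * lo + \<mu> * hi = lo + \<mu> * (hi - lo)" by (simp add: algebra_simps)
          also have "\<dots> = x'" using x' by (simp add: \<mu>_def)
          finally show ?thesis .
        qed
        ultimately have "(x', 0) \<in> D" by simp
        then have "(1 - \<tau>) *\<^sub>R (x', 0) + \<tau> *\<^sub>R (dx, dy) \<in> D"
          using convex_D d0D \<tau> unfolding convex_alt by (metis less_imp_le)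
        moreover have "(1 - \<tau>) * x' + \<tau> * dx = x" using \<tau> by (simp add: x'_def)
        moreover have "\<tau> * dy = y" using dy by (simp add: \<tau>_def)
        ultimately have "(x, y) \<in> D" by simp
        then show "q \<in> C" by (simp add: C_eq xy)
      qed
      moreover have "open (profile -` W :: (real \<times> (real ^ 'm)) set)" by (intro open_vimage oW continuous_on_profile)
      moreover have "p \<in> profile -` W" using pW by simp
      ultimately have "p \<in> interior C" using interior_maximal by blast
      then show False using p(1) by (simp add: frontier_def)
    qed
    then obtain s1 where s1: "\<bar>s1 - s0\<bar> \<le> \<delta>" "Y s1 > 0" by blast
    have cT: "continuous_on S T" for S using isCont_T by (simp add: continuous_at_imp_continuous_on)
    have Tz: "T z = 0" if "Y z = 0" for z using that m2 by (simp add: T_def power_0_left)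
    have clZ: "closed {t. Y t \<le> 0}" by (intro closed_Collect_le continuous_intros continuous_on_XYPQ)
    have fr: "t \<in> free" if "\<bar>t - s0\<bar> \<le> \<delta>" "Y t > 0" for t using d2(2) that \<delta>(3) by (simp add: free_def)
    \<comment> \<open>\<open>z\<close> is the axis point of the curve closest to \<open>s1\<close>
      on the side of \<open>s0\<close>; all points strictly between them are free.\<close>
    have "T s1 = 0"
    proof (cases "s1 < s0")
      case True
      define A where "A = {s1..s0} \<inter> {t. Y t \<le> 0}"
      have "s0 \<in> A" using True Y0 by (simp add: A_def)
      moreover have "closed A" unfolding A_def by (intro closed_Int clZ closed_atLeastAtMost)
      moreover have "bdd_below A" by (rule bdd_belowI[of _ s1]) (simp add: A_def)
      ultimately have A: "closed A" "A \<noteq> {}" "bdd_below A" by blast+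
      define z where "z = Inf A"
      have zA: "z \<in> A" unfolding z_def by (rule closed_contains_Inf[OF A(2,3,1)])
      have Yz: "Y z = 0" using zA Y_nonneg[of z] by (simp add: A_def)
      have sz: "s1 < z" using zA s1(2) Yz by (cases "s1 = z") (auto simp: A_def)
      have pos: "Y t > 0" if "s1 < t" "t < z" for t
      proof (rule ccontr)
        assume "\<not> Y t > 0"
        then have "t \<in> A" using that zA by (auto simp: A_def)
        then have "z \<le> t" unfolding z_def by (rule cInf_lower[OF _ A(3)])
        then show False using that by simp
      qed
      have "T z = T s1"
        by (rule DERIV_isconst_end[OF sz cT]) (use pos zA s1 in \<open>auto intro!: T_deriv fr simp: A_def abs_le_iff\<close>)
      then show ?thesis using Tz[OF Yz] by simp
    next
      case False
      then have s01: "s0 < s1" using s1(2) Y0 by (cases "s0 = s1") auto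
      define A where "A = {s0..s1} \<inter> {t. Y t \<le> 0}"
      have "s0 \<in> A" using s01 Y0 by (simp add: A_def)
      moreover have "closed A" unfolding A_def by (intro closed_Int clZ closed_atLeastAtMost)
      moreover have "bdd_above A" by (rule bdd_aboveI[of _ s1]) (simp add: A_def)
      ultimately have A: "closed A" "A \<noteq> {}" "bdd_above A" by blast+
      define z where "z = Sup A"
      have zA: "z \<in> A" unfolding z_def by (rule closed_contains_Sup[OF A(2,3,1)])
      have Yz: "Y z = 0" using zA Y_nonneg[of z] by (simp add: A_def)
      have sz: "z < s1" using zA s1(2) Yz by (cases "s1 = z") (auto simp: A_def)
      have pos: "Y t > 0" if "z < t" "t < s1" for t
      proof (rule ccontr)
        assume "\<not> Y t > 0"
        then have "t \<in> A" using that zA by (auto simp: A_def)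
        then have "t \<le> z" unfolding z_def by (rule cSup_upper[OF _ A(3)])
        then show False using that by simp
      qed
      have "T s1 = T z"
        by (rule DERIV_isconst_end[OF sz cT]) (use pos zA s1 in \<open>auto intro!: T_deriv fr simp: A_def abs_le_iff\<close>)
      then show ?thesis using Tz[OF Yz] by simp
    qed
    then show False using T_negative[OF s1(2)] by simp
  qed
  then show ?thesis using sl s0 by (auto simp: free_def)
qed

lemma free_periodic: "s + of_int k * L \<in> free \<longleftrightarrow> s \<in> free"
  using period_int[of s k] by (simp add: free_def)

text \<open>The parameter line covers the curve infinitely often, so the arc \<open>I\<close> is
  taken together with its translates by periods. Their union \<open>G1\<close> and the remainder
  \<open>G2\<close> of \<open>free\<close> are open and periodic, so the corresponding parts of
  \<open>K\<close> are disjoint and relatively open, and connectedness leaves only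
  \<open>G1\<close>.\<close>

lemma component_in_arc:
  assumes K: "connected K" "K \<subseteq> frontier C \<inter> \<Omega>" "K \<noteq> {}"
  shows "\<exists>I. is_interval I \<and> open I \<and> I \<noteq> {} \<and> I \<subseteq> free \<and> (\<forall>p\<in>K. \<exists>s\<in>I. profile p = (X s, Y s))"
proof -
  obtain p0 where p0: "p0 \<in> K" using K(3) by blast
  then obtain s0 where s0: "s0 \<in> free" "profile p0 = (X s0, Y s0)" using frontier_point_free K(2) by blast
  define I where "I = connected_component_set free s0"
  have I: "open I" "connected I" "s0 \<in> I" "I \<subseteq> free"
    unfolding I_def using open_connected_component[OF open_free] s0(1) connected_component_subset[of free s0]
    by (auto simp: connected_component_refl)
  define G1 where "G1 = {s. \<exists>k::int. s + of_int k * L \<in> I}"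
  define G2 where "G2 = free - G1"
  have G1f: "G1 \<subseteq> free" using I(4) free_periodic by (auto simp: G1_def)
  have oG1: "open G1"
  proof -
    have "G1 = (\<Union>k::int. (\<lambda>s. s + of_int k * L) -` I)" by (auto simp: G1_def)
    then show ?thesis by (auto intro!: open_vimage I(1) continuous_intros)
  qed
  have oG2: "open G2"
    unfolding open_contains_ball
  proof (rule ballI)
    fix s assume s: "s \<in> G2"
    then obtain r where r: "r > 0" "ball s r \<subseteq> free" using openE[OF open_free] unfolding G2_def by blast
    have "ball s r \<subseteq> G2"
    proof
      fix t assume t: "t \<in> ball s r"
      have "t \<notin> G1"
      proof
        assume "t \<in> G1"
        then obtain k :: int where k: "t + of_int k * L \<in> I" by (auto simp: G1_def)
        let ?B = "(\<lambda>s. s + of_int k * L) ` ball s r"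
        have "connected ?B" by (intro connected_continuous_image continuous_intros connected_ball)
        moreover have "?B \<subseteq> free" using r(2) free_periodic by auto
        moreover have "t + of_int k * L \<in> ?B" using t by blast
        ultimately have "?B \<subseteq> connected_component_set free (t + of_int k * L)" by (intro connected_component_maximal)
        also have "connected_component_set free (t + of_int k * L) = I"
          using k unfolding I_def by (metis connected_component_eq)
        finally have "s + of_int k * L \<in> I" using r(1) by auto
        then show False using s by (auto simp: G1_def G2_def)
      qed
      then show "t \<in> G2" using t r(2) by (auto simp: G2_def)
    qed
    then show "\<exists>e>0. ball s e \<subseteq> G2" using r(1) by blast
  qed
  have per: "s + of_int k * L \<in> G1 \<longleftrightarrow> s \<in> G1" for s and k :: int
  proof
    assume "s + of_int k * L \<in> G1"
    then obtain j :: int where "s + of_int k * L + of_int j * L \<in> I" by (auto simp: G1_def)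
    then have "s + of_int (k + j) * L \<in> I" by (simp add: algebra_simps)
    then show "s \<in> G1" unfolding G1_def by blast
  next
    assume "s \<in> G1"
    then obtain j :: int where "s + of_int j * L \<in> I" by (auto simp: G1_def)
    then have "s + of_int k * L + of_int (j - k) * L \<in> I" by (simp add: algebra_simps)
    then show "s + of_int k * L \<in> G1" unfolding G1_def by blast
  qed
  let ?\<gamma> = "\<lambda>s. (X s, Y s)"
  \<comment> \<open>Open sets in space are obtained as complements of revolved compact arcs. On
    \<open>K\<close> such a set contains only points with a parameter in \<open>G\<close>, since
    each point has a representative in \<open>{0..L}\<close>.\<close>
  define U where "U G = (profile -` (- (?\<gamma> ` ({0..L} - G))) :: (real \<times> (real ^ 'm)) set)" for G
  have oU: "open (U G)" if "open G" for G
  proof -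
    have "compact ({0..L} - G)" using that by (intro compact_diff) auto
    then have "closed (?\<gamma> ` ({0..L} - G))"
      by (intro compact_imp_closed compact_continuous_image continuous_intros continuous_on_XYPQ)
    then show ?thesis unfolding U_def by (intro open_vimage continuous_on_profile) auto
  qed
  have G1U: "p \<in> U G1" if "profile p = ?\<gamma> s" "s \<in> G1" for p :: "real \<times> (real ^ 'm)" and s
  proof -
    have "profile p \<notin> ?\<gamma> ` ({0..L} - G1)"
    proof
      assume "profile p \<in> ?\<gamma> ` ({0..L} - G1)"
      then obtain t where "t \<in> {0..L} - G1" "profile p = ?\<gamma> t" by blast
      then have t: "t \<notin> G1" "X s = X t" "Y s = Y t" using that(1) by simp_all
      then obtain k :: int where "t = s + of_int k * L" using inj_mod by blast
      then show False using t(1) that(2) per by simp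
    qed
    then show ?thesis by (simp add: U_def)
  qed
  have G2U: "p \<in> U G2" if "profile p = ?\<gamma> s" "s \<in> G2" for p :: "real \<times> (real ^ 'm)" and s
  proof -
    have "profile p \<notin> ?\<gamma> ` ({0..L} - G2)"
    proof
      assume "profile p \<in> ?\<gamma> ` ({0..L} - G2)"
      then obtain t where "t \<in> {0..L} - G2" "profile p = ?\<gamma> t" by blast
      then have t: "t \<notin> G2" "X s = X t" "Y s = Y t" using that(1) by simp_all
      then obtain k :: int where "t = s + of_int k * L" using inj_mod by blast
      then show False using t(1) that(2) per free_periodic by (simp add: G2_def)
    qed
    then show ?thesis by (simp add: U_def)
  qed
  have rep: "\<exists>t\<in>{0..L}. t \<in> free \<and> profile p = ?\<gamma> t" if pK: "p \<in> K" for p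
  proof -
    obtain s where s: "s \<in> free" "profile p = ?\<gamma> s" using frontier_point_free K(2) pK by blast
    obtain t where t: "0 \<le> t" "t < 0 + L" "X t = X s" "Y t = Y s" using curve_representative[of 0 s] by blast
    then have "t \<in> free" using s(1) by (simp add: free_def)
    then show ?thesis using t s by (intro bexI[of _ t]) auto
  qed
  have cov: "K \<subseteq> U G1 \<union> U G2"
  proof
    fix p assume "p \<in> K"
    then obtain t where t: "t \<in> free" "profile p = ?\<gamma> t" using rep by blast
    then show "p \<in> U G1 \<union> U G2" using G1U[of p t] G2U[of p t] by (auto simp: G2_def)
  qed
  have inG: "\<exists>t\<in>G. profile p = ?\<gamma> t" if pU: "p \<in> K" "p \<in> U G" for p G
  proof -
    obtain t where t: "t \<in> {0..L}" "profile p = ?\<gamma> t" using rep[OF pU(1)] by blast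
    have "t \<in> G" using pU(2) t by (auto simp: U_def)
    then show ?thesis using t by blast
  qed
  have dis: "U G1 \<inter> U G2 \<inter> K = {}"
  proof (rule equals0I)
    fix p assume "p \<in> U G1 \<inter> U G2 \<inter> K"
    then have p: "p \<in> U G1" "p \<in> U G2" "p \<in> K" by blast+
    obtain t where t: "t \<in> {0..L}" "profile p = ?\<gamma> t" using rep[OF p(3)] by blast
    have "t \<in> G1" "t \<in> G2" using p(1,2) t by (auto simp: U_def)
    then show False by (simp add: G2_def)
  qed
  have s0G: "s0 \<in> G1" unfolding G1_def using I(3) by (intro CollectI exI[of _ 0]) simp
  have "U G1 \<inter> K \<noteq> {}" using G1U[OF s0(2) s0G] p0 by blast
  then have "U G2 \<inter> K = {}" using connectedD[OF K(1) oU[OF oG1] oU[OF oG2] dis cov] by blast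
  then have all: "p \<in> U G1" if "p \<in> K" for p using cov that by blast
  have "\<exists>s\<in>I. profile p = ?\<gamma> s" if pK: "p \<in> K" for p
  proof -
    obtain t where t: "t \<in> G1" "profile p = ?\<gamma> t" using inG[OF pK all[OF pK]] by blast
    then obtain k :: int where k: "t + of_int k * L \<in> I" by (auto simp: G1_def)
    then show ?thesis using t(2) period_int[of t k] by (intro bexI[of _ "t + of_int k * L"]) auto
  qed
  moreover have "is_interval I" using I(2) by (simp add: is_interval_connected_1)
  ultimately show ?thesis using I by blast
qed

end

section \<open>Maximal solutions of the profile equations\<close>

text \<open>Apart from the shape of the domain, being a solution is a local property; this is what
  glues the union of a chain in the Zorn argument.\<close>

lemma cmc_solution_local:
  assumes J: "is_interval J" "J \<noteq> {}"
    and loc: "\<forall>s\<in>J. \<exists>J' u v \<tau>. cmc_solution n H J' u v \<tau> \<and> s \<in> J' \<and> J' \<subseteq> J \<and>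
        (\<forall>t\<in>J'. u t = x t \<and> v t = y t \<and> \<tau> t = \<sigma> t)"
  shows "cmc_solution n H J x y \<sigma>"
proof -
  have "\<exists>e>0. ball s e \<subseteq> J" if "s \<in> J" for s
  proof -
    from bspec[OF loc that] obtain J' u v \<tau> where
      "cmc_solution n H J' u v \<tau>" "s \<in> J'" "J' \<subseteq> J" by blast
    moreover have "open J'" using calculation(1) by (simp add: cmc_solution_def)
    ultimately show ?thesis by (meson open_contains_ball subset_trans)
  qed
  then have "open J" unfolding open_contains_ball by blast
  moreover have "y s > 0 \<and> (x has_real_derivative cos (\<sigma> s)) (at s) \<and>
      (y has_real_derivative sin (\<sigma> s)) (at s) \<and>
      (\<sigma> has_real_derivative (- (real n - 1) * H + (real n - 2) * (cos (\<sigma> s) / y s))) (at s)"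
    if "s \<in> J" for s
  proof -
    from bspec[OF loc that] obtain J' u v \<tau> where c: "cmc_solution n H J' u v \<tau>"
      and s: "s \<in> J'" and eq: "\<forall>t\<in>J'. u t = x t \<and> v t = y t \<and> \<tau> t = \<sigma> t" by blast
    have oJ: "open J'" using c by (simp add: cmc_solution_def)
    have d: "v s > 0" "(u has_real_derivative cos (\<tau> s)) (at s)" "(v has_real_derivative sin (\<tau> s)) (at s)"
      "(\<tau> has_real_derivative (- (real n - 1) * H + (real n - 2) * (cos (\<tau> s) / v s))) (at s)"
      using c s by (simp_all add: cmc_solution_def)
    have e: "v s = y s" "\<tau> s = \<sigma> s" using eq s by auto
    show ?thesis
      using d[unfolded e]
        has_field_derivative_transform_within_open[OF d(2) oJ s, of x]
        has_field_derivative_transform_within_open[OF d(3) oJ s, of y]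
        has_field_derivative_transform_within_open[OF d(4) oJ s, of \<sigma>] eq e by simp
  qed
  ultimately show ?thesis using J by (simp add: cmc_solution_def)
qed

text \<open>Zorn's lemma is applied to graphs rather than functions: inclusion of graphs encodes a
  larger domain together with agreement on the smaller one, and ignores the arbitrary values of
  total functions outside the domain. The union of a chain is single-valued because its members are
  nested, and its domain is an interval because all domains share a point of
  \<open>I\<close>.\<close>

lemma maximal_extension:
  fixes x y \<sigma> :: "real \<Rightarrow> real"
  assumes sol: "cmc_solution n H I x y \<sigma>"
  shows "\<exists>J u v \<tau>. maximal_cmc_solution n H J u v \<tau> \<and> I \<subseteq> J \<and>
    (\<forall>s\<in>I. u s = x s \<and> v s = y s \<and> \<tau> s = \<sigma> s)"
proof -
  define gr :: "real set \<Rightarrow> (real \<Rightarrow> real \<times> real \<times> real) \<Rightarrow> (real \<times> real \<times> real \<times> real) set"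
    where "gr J F = (\<lambda>s. (s, F s)) ` J" for J F
  define solves where "solves J F \<longleftrightarrow>
    cmc_solution n H J (\<lambda>s. fst (F s)) (\<lambda>s. fst (snd (F s))) (\<lambda>s. snd (snd (F s)))" for J F
  define F0 where "F0 s = (x s, y s, \<sigma> s)" for s
  have sol0: "solves I F0" using sol by (simp add: solves_def F0_def)
  have gr_iff: "(s, z) \<in> gr J F \<longleftrightarrow> s \<in> J \<and> z = F s" for s z J F by (auto simp: gr_def)
  have fst_gr: "fst ` gr J F = J" for J F by (force simp: gr_def image_image)
  have gr_sub: "J \<subseteq> J' \<and> (\<forall>s\<in>J. F s = F' s)" if "gr J F \<subseteq> gr J' F'" for J J' F F'
    using that unfolding gr_def by blast
  define \<A> where "\<A> = {g. \<exists>J F. g = gr J F \<and> solves J F \<and> gr I F0 \<subseteq> g}"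
  have A0: "gr I F0 \<in> \<A>" using sol0 unfolding \<A>_def by blast
  have "\<exists>M\<in>\<A>. \<forall>g\<in>\<A>. M \<subseteq> g \<longrightarrow> g = M"
  proof (rule subset_Zorn_nonempty)
    show "\<A> \<noteq> {}" using A0 by blast
  next
    fix \<C> assume ne: "\<C> \<noteq> {}" and ch: "subset.chain \<A> \<C>"
    have CA: "\<C> \<subseteq> \<A>" and lin: "\<And>g g'. g \<in> \<C> \<Longrightarrow> g' \<in> \<C> \<Longrightarrow> g \<subseteq> g' \<or> g' \<subseteq> g"
      using ch unfolding subset_chain_def by blast+
    have sv: "z = w" if sz: "(s, z) \<in> \<Union>\<C>" and sw: "(s, w) \<in> \<Union>\<C>" for s z w
    proof -
      obtain g g' where g: "g \<in> \<C>" "(s, z) \<in> g" "g' \<in> \<C>" "(s, w) \<in> g'" using sz sw by blast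
      then obtain g'' where "g'' \<in> \<C>" "(s, z) \<in> g''" "(s, w) \<in> g''" using lin[of g g'] by blast
      then show ?thesis using CA unfolding \<A>_def gr_def by blast
    qed
    define J where "J = fst ` \<Union>\<C>"
    define F where "F s = (THE z. (s, z) \<in> \<Union>\<C>)" for s
    have F: "F s = z" if "(s, z) \<in> \<Union>\<C>" for s z
      unfolding F_def using that sv by (intro the_equality) blast+
    have U: "\<Union>\<C> = gr J F"
    proof (rule set_eqI)
      fix q :: "real \<times> real \<times> real \<times> real"
      obtain s z where q: "q = (s, z)" by (cases q)
      have "(s, z) \<in> \<Union>\<C> \<longleftrightarrow> s \<in> J \<and> z = F s"
      proof
        assume a: "(s, z) \<in> \<Union>\<C>"
        then have "s \<in> J" unfolding J_def by (rule image_eqI[rotated]) simp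
        then show "s \<in> J \<and> z = F s" using F[OF a] by simp
      next
        assume a: "s \<in> J \<and> z = F s"
        then obtain w where "(s, w) \<in> \<Union>\<C>" unfolding J_def by (metis imageE prod.collapse)
        then show "(s, z) \<in> \<Union>\<C>" using F a by metis
      qed
      then show "q \<in> \<Union>\<C> \<longleftrightarrow> q \<in> gr J F" by (simp only: q gr_iff)
    qed
    have IU: "gr I F0 \<subseteq> g" if "g \<in> \<C>" for g using that CA unfolding \<A>_def by blast
    obtain s0 where s0: "s0 \<in> I" using sol by (auto simp: cmc_solution_def)
    have mem: "\<exists>J' F'. g = gr J' F' \<and> solves J' F' \<and> J' \<subseteq> J \<and> I \<subseteq> J' \<and> (\<forall>s\<in>J'. F' s = F s)" if g: "g \<in> \<C>" for g
    proof -
      obtain J' F' where j: "g = gr J' F'" "solves J' F'" using g CA unfolding \<A>_def by blast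
      have "gr J' F' \<subseteq> gr J F" using g j(1) U by blast
      then show ?thesis using j gr_sub gr_sub[of I F0 J' F'] IU[OF g] by blast
    qed
    have JU: "J = \<Union>((\<lambda>g. fst ` g) ` \<C>)" by (auto simp: J_def)
    have "connected (\<Union>((\<lambda>g. fst ` g) ` \<C>))"
    proof (rule connected_Union)
      fix S assume "S \<in> (\<lambda>g. fst ` g) ` \<C>"
      then obtain g where "g \<in> \<C>" "S = fst ` g" by blast
      then obtain J' F' where "S = J'" "solves J' F'" using mem[of g] fst_gr by blast
      then show "connected S" by (simp add: solves_def cmc_solution_def is_interval_connected_1)
    next
      have "s0 \<in> fst ` g" if "g \<in> \<C>" for g using mem[OF that] fst_gr s0 by blast
      then show "\<Inter>((\<lambda>g. fst ` g) ` \<C>) \<noteq> {}" by blast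
    qed
    then have Ji: "is_interval J" by (simp add: JU is_interval_connected_1)
    obtain g0 where g0: "g0 \<in> \<C>" using ne by blast
    have IJ: "I \<subseteq> J" using mem[OF g0] by blast
    have "solves J F"
      unfolding solves_def
    proof (rule cmc_solution_local[OF Ji])
      show "J \<noteq> {}" using IJ s0 by blast
    next
      show "\<forall>s\<in>J. \<exists>J' u v \<tau>. cmc_solution n H J' u v \<tau> \<and> s \<in> J' \<and> J' \<subseteq> J \<and>
        (\<forall>t\<in>J'. u t = fst (F t) \<and> v t = fst (snd (F t)) \<and> \<tau> t = snd (snd (F t)))"
      proof (rule ballI)
        fix s assume "s \<in> J"
        then obtain g where g: "g \<in> \<C>" "s \<in> fst ` g" unfolding JU by blast
        then obtain J' F' where j: "s \<in> J'" "solves J' F'" "J' \<subseteq> J" "\<forall>s\<in>J'. F' s = F s"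
          using mem[OF g(1)] fst_gr by blast
        show "\<exists>J' u v \<tau>. cmc_solution n H J' u v \<tau> \<and> s \<in> J' \<and> J' \<subseteq> J \<and>
          (\<forall>t\<in>J'. u t = fst (F t) \<and> v t = fst (snd (F t)) \<and> \<tau> t = snd (snd (F t)))"
          by (rule exI[of _ J'], rule exI[of _ "\<lambda>s. fst (F' s)"], rule exI[of _ "\<lambda>s. fst (snd (F' s))"],
              rule exI[of _ "\<lambda>s. snd (snd (F' s))"]) (use j in \<open>simp add: solves_def\<close>)
      qed
    qed
    moreover have "gr I F0 \<subseteq> \<Union>\<C>" using IU[OF g0] g0 by blast
    ultimately show "\<Union>\<C> \<in> \<A>" unfolding \<A>_def using U by blast
  qed
  then obtain M where M: "M \<in> \<A>" and mx: "\<And>g. g \<in> \<A> \<Longrightarrow> M \<subseteq> g \<Longrightarrow> g = M" by blast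
  obtain J F where j: "M = gr J F" "solves J F" "gr I F0 \<subseteq> M" using M unfolding \<A>_def by blast
  define u v \<tau> where "u s = fst (F s)" and "v s = fst (snd (F s))" and "\<tau> s = snd (snd (F s))" for s
  have Feq: "F = (\<lambda>s. (u s, v s, \<tau> s))" by (simp add: u_def v_def \<tau>_def)
  have ex: "I \<subseteq> J" "\<forall>s\<in>I. F0 s = F s" using gr_sub[of I F0 J F] j by blast+
  have "maximal_cmc_solution n H J u v \<tau>"
    unfolding maximal_cmc_solution_def
  proof (intro conjI allI impI)
    show "cmc_solution n H J u v \<tau>" using j(2) by (simp add: solves_def Feq)
  next
    fix J' u' v' \<tau>'
    assume a: "cmc_solution n H J' u' v' \<tau>' \<and> J \<subseteq> J' \<and> (\<forall>s\<in>J. u' s = u s \<and> v' s = v s \<and> \<tau>' s = \<tau> s)"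
    define F' where "F' s = (u' s, v' s, \<tau>' s)" for s
    have s': "solves J' F'" using a by (simp add: solves_def F'_def)
    have sub: "M \<subseteq> gr J' F'" using a by (auto simp: j(1) gr_def Feq F'_def)
    then have "gr J' F' \<in> \<A>" using s' j(3) unfolding \<A>_def by blast
    then have "gr J' F' = M" by (rule mx[OF _ sub])
    then show "J' = J" using fst_gr j(1) by metis
  qed
  moreover have "\<forall>s\<in>I. u s = x s \<and> v s = y s \<and> \<tau> s = \<sigma> s" using ex(2) by (auto simp: F0_def Feq)
  ultimately show ?thesis using ex(1) by blast
qed

text \<open>Carries the inequality \<open>T < 0\<close> from the free arc to the whole maximal
  interval.\<close>

lemma cmc_first_integral:
  assumes n: "n \<ge> 3" and sol: "cmc_solution n H J x y \<sigma>" and st: "s \<in> J" "t \<in> J"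
  shows "y s ^ (n - 2) * cos (\<sigma> s) - H * y s ^ (n - 1) = y t ^ (n - 2) * cos (\<sigma> t) - H * y t ^ (n - 1)"
proof -
  obtain k where k: "n = k + 3" using n le_Suc_ex by (metis add.commute)
  have n2: "n - 2 = Suc k" "n - 1 = Suc (Suc k)" using k by auto
  define T where "T s = y s ^ Suc k * cos (\<sigma> s) - H * y s ^ Suc (Suc k)" for s
  have "(T has_real_derivative 0) (at r)" if "r \<in> J" for r
  proof -
    have y: "y r > 0" and dy: "(y has_real_derivative sin (\<sigma> r)) (at r)"
      and d\<sigma>: "(\<sigma> has_real_derivative (- (real n - 1) * H + (real n - 2) * (cos (\<sigma> r) / y r))) (at r)"
      using sol that by (simp_all add: cmc_solution_def)
    obtain q where q: "q = cos (\<sigma> r) / y r" by simp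
    then have c: "cos (\<sigma> r) = q * y r" using y by simp
    show ?thesis unfolding T_def
      by (rule DERIV_cong[OF DERIV_diff[OF DERIV_mult[OF DERIV_power[OF dy] DERIV_fun_cos[OF d\<sigma>]]
            DERIV_cmult[OF DERIV_power[OF dy]]]])
        (use y in \<open>simp add: q[symmetric] c k algebra_simps\<close>)
  qed
  moreover have "convex J" using sol by (simp add: cmc_solution_def is_interval_convex)
  ultimately obtain c where "\<forall>r\<in>J. T r = c"
    using has_field_derivative_zero_constant[of J T] by (meson has_field_derivative_at_within)
  then have "T s = T t" using st by simp
  then show ?thesis unfolding T_def n2 .
qed

section \<open>Sets of revolution and the conclusion\<close>

lemma revolve_memI: "profile p \<in> S \<Longrightarrow> p \<in> (revolve S :: (real \<times> (real ^ 'm)) set)"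
proof -
  assume p: "profile p \<in> S"
  obtain x z where xz: "p = (x, z)" by (cases p)
  \<comment> \<open>On the axis any unit vector represents the point.\<close>
  define \<omega> :: "real ^ 'm" where "\<omega> = (if z = 0 then axis undefined 1 else sgn z)"
  have "norm \<omega> = 1" by (simp add: \<omega>_def norm_sgn)
  moreover have "z = norm z *\<^sub>R \<omega>" by (simp add: \<omega>_def sgn_div_norm)
  ultimately show ?thesis
    using p unfolding revolve_def by (auto simp: xz profile_def intro!: exI[of _ "norm z"] exI[of _ \<omega>])
qed

lemma revolve_eq_vimage:
  assumes "D \<subseteq> half_plane"
  shows "revolve D = (profile -` D :: (real \<times> (real ^ 'm)) set)"
proof
  show "profile -` D \<subseteq> (revolve D :: (real \<times> (real ^ 'm)) set)" using revolve_memI by blast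
  show "(revolve D :: (real \<times> (real ^ 'm)) set) \<subseteq> profile -` D"
    using assms by (auto simp: revolve_def profile_def half_plane_def)
qed

text \<open>In dimension at least 2 the rotations act transitively on spheres, so invariance reduces
  to dependence on the axial coordinate and the norm.\<close>

lemma rotationally_invariant_mem:
  fixes \<Omega> :: "(real \<times> (real ^ 'm)) set"
  assumes \<Omega>: "rotationally_invariant \<Omega>" and m: "CARD('m) \<ge> 2"
    and p: "p \<in> \<Omega>" "fst p' = fst p" "norm (snd p') = norm (snd p)"
  shows "p' \<in> \<Omega>"
proof -
  obtain f where f: "orthogonal_transformation f" "det (matrix f) = 1" "f (snd p) = snd p'"
    using rotation_exists[OF m] p(3) by metis
  have lin: "linear f" and "orthogonal_matrix (matrix f)"
    using f(1) by (simp_all add: orthogonal_transformation_matrix)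
  then have "rotation_matrix (matrix f)" using f(2) by (simp add: rotation_matrix_def)
  then have "(\<lambda>(x, z). (x, matrix f *v z)) ` \<Omega> = \<Omega>" using \<Omega> by (simp add: rotationally_invariant_def)
  moreover have "p' = (\<lambda>(x, z). (x, matrix f *v z)) p"
    using f(3) p(2) by (simp add: case_prod_beta fun_cong[OF matrix_vector_mul(2)[OF lin]] prod_eq_iff)
  ultimately show ?thesis using p(1) by blast
qed

theorem proposition2p5:
  fixes n :: nat
    and \<Omega> C :: "(real \<times> (real ^ 'm)) set"
    and a b :: real
    and \<gamma> :: "real \<Rightarrow> real \<times> real"
  assumes "n \<ge> 3" and "CARD('m) = n - 1"
    and "open \<Omega>" and "connected \<Omega>" and "bounded \<Omega>"
    and "rotationally_invariant \<Omega>"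
    and "curve_generated_boundary \<Omega>"
    and "cheeger_set \<Omega> C" and "normalized_representative C"
    and "rotationally_invariant C"
    and "generated_by_convex_C11 C a b \<gamma>"
  shows "\<forall>K\<in>components (frontier C \<inter> \<Omega>). \<exists>N. nodoid n N \<and> K \<subseteq> N"
proof
  fix K assume K: "K \<in> components (frontier C \<inter> \<Omega>)"
  have m2: "CARD('m) \<ge> 2" using assms(1,2) by simp
  define D where "D = closed_region (\<gamma> ` {a..b})"
  have gen: "simple_closed_C11 a b \<gamma>" "\<gamma> ` {a..b} \<subseteq> half_plane" "convex D" "C = revolve D"
    using assms(11) by (simp_all add: generated_by_convex_C11_def D_def)
  obtain X Y P Q L where cp: "convex_profile D X Y P Q L"
    using convex_profile_exists[OF gen(1,2)] gen(3) unfolding D_def by blast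
  interpret cp: convex_profile D X Y P Q L by (rule cp)
  have "D \<subseteq> half_plane" using cp.nonneg_D by (auto simp: half_plane_def)
  then have C: "C = profile -` D" unfolding gen(4) by (rule revolve_eq_vimage)
  have clC: "closed C" unfolding C by (intro closed_vimage compact_imp_closed cp.compact_D continuous_on_profile)
  have bC: "bounded C"
  proof -
    obtain B where B: "\<And>q. q \<in> D \<Longrightarrow> norm q \<le> B"
      using compact_imp_bounded[OF cp.compact_D] unfolding bounded_iff by blast
    have "norm p = norm (profile p)" for p :: "real \<times> (real ^ 'm)" by (simp add: profile_def norm_prod_def)
    then show ?thesis using B unfolding C bounded_iff by (metis vimageE)
  qed
  have CB: "C \<in> sets borel" using clC by simp
  obtain h where h: "h > 0" "perimeter C = ereal (h * measure lborel C)"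
      "\<forall>E. E \<in> sets borel \<longrightarrow> bounded E \<longrightarrow> negligible (E - \<Omega>) \<longrightarrow> ereal (h * measure lborel E) \<le> perimeter E"
    by (rule cheeger_set_real[OF assms(8) CB bC assms(3)])
  \<comment> \<open>\<open>axis undefined 1\<close> is an arbitrary coordinate unit vector.\<close>
  interpret cheeger_profile D X Y P Q L \<Omega> C h "axis undefined 1"
  proof (unfold_locales; (rule m2 C h assms(3))?)
    show "norm (axis undefined 1 :: real ^ 'm) = 1" by simp
    show "negligible (C - \<Omega>)" using assms(8) by (simp add: cheeger_set_def)
    show "p' \<in> \<Omega>" if "p \<in> \<Omega>" "fst p' = fst p" "norm (snd p') = norm (snd p)" for p p'
      by (rule rotationally_invariant_mem[OF assms(6) m2 that])
  qed
  obtain I where I: "is_interval I" "open I" "I \<noteq> {}" "I \<subseteq> free" and KI: "\<forall>p\<in>K. \<exists>s\<in>I. profile p = (X s, Y s)"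
    using component_in_arc[OF in_components_connected[OF K] in_components_subset[OF K] in_components_nonempty[OF K]]
    by blast
  obtain \<sigma> where \<sigma>: "\<forall>s. isCont \<sigma> s \<and> P s = cos (\<sigma> s) \<and> Q s = sin (\<sigma> s)" using tangent_angle by blast
  define H where "H = h / CARD('m)"
  have rn: "real CARD('m) = real n - 1" "real CARD('m) - 1 = real n - 2" using assms(1,2) by auto
  have Hpos: "H > 0" using h(1) m2 by (simp add: H_def)
  have sol: "cmc_solution n H I X Y \<sigma>"
    unfolding cmc_solution_def
  proof (intro conjI ballI I(1-3))
    fix s assume s: "s \<in> I"
    then have sf: "s \<in> free" using I(4) by blast
    show "Y s > 0" using sf by (simp add: free_def)
    show "(X has_real_derivative cos (\<sigma> s)) (at s)" "(Y has_real_derivative sin (\<sigma> s)) (at s)"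
      using cp.deriv_X[of s] cp.deriv_Y[of s] \<sigma> by simp_all
    show "(\<sigma> has_real_derivative (- (real n - 1) * H + (real n - 2) * (cos (\<sigma> s) / Y s))) (at s)"
      using curvature_equation[OF \<sigma> sf] unfolding H_def[symmetric] unfolding rn(2) unfolding rn(1) .
  qed
  obtain J u v \<tau> where mx: "maximal_cmc_solution n H J u v \<tau>" and IJ: "I \<subseteq> J"
    and eq: "\<forall>s\<in>I. u s = X s \<and> v s = Y s \<and> \<tau> s = \<sigma> s"
    using maximal_extension[OF sol] by blast
  have solJ: "cmc_solution n H J u v \<tau>" using mx by (simp add: maximal_cmc_solution_def)
  obtain s0 where s0: "s0 \<in> I" using I(3) by blast
  have "T s0 < 0" using s0 I(4) by (intro T_negative) (auto simp: free_def)
  then have "Y s0 ^ (CARD('m) - 1) * P s0 - H * Y s0 ^ CARD('m) < 0" unfolding T_def H_def .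
  moreover have "CARD('m) - 1 = n - 2" using assms(2) by simp
  ultimately have T0: "v s0 ^ (n - 2) * cos (\<tau> s0) - H * v s0 ^ (n - 1) < 0"
    using s0 eq \<sigma> assms(2) by simp
  \<comment> \<open>One point of the free arc suffices, since the first integral is constant on the
    maximal interval.\<close>
  have neg: "\<forall>s\<in>J. v s ^ (n - 2) * cos (\<tau> s) - H * v s ^ (n - 1) < 0"
    using cmc_first_integral[OF assms(1) solJ, of _ s0] T0 s0 IJ by (metis subsetD)
  define N :: "(real \<times> (real ^ 'm)) set" where "N = revolve ((\<lambda>s. (u s, v s)) ` J)"
  have "K \<subseteq> N"
  proof
    fix p assume "p \<in> K"
    then obtain s where s: "s \<in> I" "profile p = (X s, Y s)" using KI by blast
    then have "profile p \<in> (\<lambda>s. (u s, v s)) ` J" using eq IJ by (intro image_eqI[of _ _ s]) auto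
    then show "p \<in> N" unfolding N_def by (rule revolve_memI)
  qed
  moreover have "nodoid n N" unfolding nodoid_def using Hpos mx neg N_def by blast
  ultimately show "\<exists>N. nodoid n N \<and> K \<subseteq> N" by blast
qed

end
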